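(* (i) $\#\Sigma_0^{\mathrm{rel}}\subsetneq$ FO-uniform $\#\mathrm{AC}^0$. (ii) For each $\mathcal{C}\in\{\#\Sigma_1^{\mathrm{rel}},\#\Pi_1^{\mathrm{rel}},\#\Sigma_2^{\mathrm{rel}}\}$: FO-uniform $\#\mathrm{AC}^0\not\subseteq\mathcal{C}$ and $\mathcal{C}\not\subseteq$ FO-uniform $\#\mathrm{AC}^0$.
   Context: Structures: a finite $\sigma$-structure has universe $\{0,\dots,n-1\}$, $n\ge1$; built-in $\le$ (usual order), $\min=0$, $\mathrm{BIT}(i,j)$ iff the $i$-th bit of $j$ is $1$. $\mathrm{enc}_\sigma(\mathcal{A})$ is the standard binary encoding (non-built-in relations as $0/1$ truth values of all tuples in lexicographic order, non-built-in constants in binary of length $\lceil\log_2 n\rceil$; built-ins not encoded). $\#\Phi^{\mathrm{rel}}$ for a class $\Phi$ of first-order formulas: $f:\{0,1\}^*\to\mathbb{N}$ is in $\#\Phi^{\mathrm{rel}}$ if there are a vocabulary $\sigma$ whose only built-in symbol is the linear order $\le$, and a formula $\varphi(R_1,\dots,R_k,x_1,\dots,x_\ell)\in\Phi$ over $\sigma$ with free relation variables $R_i$ and free individual variables $x_j$, such that for every $\sigma$-structure $\mathcal{A}$, $f(\mathrm{enc}_\sigma(\mathcal{A}))$ is the number of tuples $(S_1,\dots,S_k,c_1,\dots,c_\ell)$ of relations on $\mathrm{dom}(\mathcal{A})$ of the appropriate arities and elements with $\mathcal{A}\models\varphi(\bar S,\bar c)$. $\Sigma_0$: quantifier-free formulas;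 $\Sigma_k$ (resp. $\Pi_k$): prenex formulas whose quantifier prefix consists of at most $k$ alternating blocks beginning with an existential (resp. universal) block. FO-uniform $\#\mathrm{AC}^0$: a Boolean circuit is a DAG with $\wedge$-, $\vee$-gates, constants, (possibly negated) input bits and one output gate; viewed as a structure over $\tau_{\mathrm{circ}}=(E^2,G_\wedge^1,G_\vee^1,B^1,r^1)$ ($E(x,y)$: $y$ child of $x$; gate types; $B(x)$: $x$ is a true leaf; $r(x)$: $x$ is the output). A string $w$, $|w|=n$, is the structure $\mathcal{A}_w$ with universe $\{0,\dots,n-1\}$, $\le$, BIT and unary $S$ ($S(x)$ iff bit $x$ of $w$ is $1$). A circuit family $(C_n)$ is FO-uniform if a first-order interpretation (universe defined by a formula with $k$ free variables as a set of $k$-tuples, relations by formulas) maps each $\mathcal{A}_w$ to $C_{|w|}$ (leaves evaluated on $w$). A proof tree of $C$ on $w$: a subtree of the tree-unfolding of $C$ containing the output gate, exactly one child of each included $\vee$-gate, all children of each included $\wedge$-gate, and only true leaves. $f\in$ FO-uniform $\#\mathrm{AC}^0$ iff there is an FO-uniform family of constant depth and polynomial size with $f(w)$ equal to the number of proof trees of $C_{|w|}$ on $w$.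
   Formalization: Functions in the classes #Φ^rel are required to be 0 on nonempty strings encoding no σ-structure; FO-uniformity is demanded only for |w| ≥ 2 (C_1 is an arbitrary circuit); the empty string is disregarded. Without the first two changes the statement is false. *)

theory Defs
  imports Complex_Main
begin

section \<open>Vocabularies, structures and their encodings\<close>

datatype builtin = LE | BIT

text \<open>
  The universe of a structure is \<open>{..<n}\<close>.  The lists give the arity of each relation symbol
  that is not built-in, and the interpretations of the symbols, in the order in which they are
  encoded.  Built-in symbols have a fixed interpretation and are not part of a structure.
\<close>

record vocab =
  builtins :: "builtin set"
  rel_arities :: "nat list"
  nconsts :: nat

record struc =
  size_of :: nat
  rels :: "nat list set list"
  const_vals :: "nat list"

definition tuples :: "nat \<Rightarrow> nat \<Rightarrow> nat list set" where
  "tuples n a = {t. length t = a \<and> set t \<subseteq> {..<n}}"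

definition relation_tuples :: "nat \<Rightarrow> nat list \<Rightarrow> nat list set list set" where
  "relation_tuples n as = {Rs. length Rs = length as \<and> (\<forall>i<length as. Rs ! i \<subseteq> tuples n (as ! i))}"

definition structures :: "vocab \<Rightarrow> struc set" where
  "structures \<sigma> = {\<A>. size_of \<A> \<ge> 1 \<and> rels \<A> \<in> relation_tuples (size_of \<A>) (rel_arities \<sigma>) \<and>
     const_vals \<A> \<in> tuples (size_of \<A>) (nconsts \<sigma>)}"

text \<open>Constants are written in binary with the most significant bit first; \<open>product_lists\<close>
  enumerates the tuples in lexicographic order.\<close>

definition binary :: "nat \<Rightarrow> nat \<Rightarrow> bool list" where
  "binary n c = rev (map (\<lambda>i. bit c i) [0..<nat \<lceil>log 2 (real n)\<rceil>])"

definition encode_rel :: "nat \<Rightarrow> nat \<Rightarrow> nat list set \<Rightarrow> bool list" where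
  "encode_rel n a R = map (\<lambda>t. t \<in> R) (product_lists (replicate a [0..<n]))"

definition enc :: "vocab \<Rightarrow> struc \<Rightarrow> bool list" where
  "enc \<sigma> \<A> = concat (map2 (encode_rel (size_of \<A>)) (rel_arities \<sigma>) (rels \<A>)) @
     concat (map (binary (size_of \<A>)) (const_vals \<A>))"


section \<open>First-order formulas with free relation variables\<close>

datatype tm = Var nat | Cst nat

datatype fm =
    Eq tm tm
  | Builtin builtin tm tm
  | Rel nat "tm list"
  | RVar nat "tm list"
  | Neg fm
  | Conj fm fm
  | Disj fm fm
  | Ex nat fm
  | All nat fm

fun tm_val :: "struc \<Rightarrow> (nat \<Rightarrow> nat) \<Rightarrow> tm \<Rightarrow> nat" where
  "tm_val \<A> e (Var x) = e x"
| "tm_val \<A> e (Cst c) = const_vals \<A> ! c"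

fun builtin_holds :: "builtin \<Rightarrow> nat \<Rightarrow> nat \<Rightarrow> bool" where
  "builtin_holds LE i j \<longleftrightarrow> i \<le> j"
| "builtin_holds BIT i j \<longleftrightarrow> bit j i"

fun sat :: "struc \<Rightarrow> nat list set list \<Rightarrow> (nat \<Rightarrow> nat) \<Rightarrow> fm \<Rightarrow> bool" where
  "sat \<A> Ss e (Eq s t) \<longleftrightarrow> tm_val \<A> e s = tm_val \<A> e t"
| "sat \<A> Ss e (Builtin b s t) \<longleftrightarrow> builtin_holds b (tm_val \<A> e s) (tm_val \<A> e t)"
| "sat \<A> Ss e (Rel i ts) \<longleftrightarrow> map (tm_val \<A> e) ts \<in> rels \<A> ! i"
| "sat \<A> Ss e (RVar i ts) \<longleftrightarrow> map (tm_val \<A> e) ts \<in> Ss ! i"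
| "sat \<A> Ss e (Neg \<phi>) \<longleftrightarrow> \<not> sat \<A> Ss e \<phi>"
| "sat \<A> Ss e (Conj \<phi> \<psi>) \<longleftrightarrow> sat \<A> Ss e \<phi> \<and> sat \<A> Ss e \<psi>"
| "sat \<A> Ss e (Disj \<phi> \<psi>) \<longleftrightarrow> sat \<A> Ss e \<phi> \<or> sat \<A> Ss e \<psi>"
| "sat \<A> Ss e (Ex x \<phi>) \<longleftrightarrow> (\<exists>a<size_of \<A>. sat \<A> Ss (e(x := a)) \<phi>)"
| "sat \<A> Ss e (All x \<phi>) \<longleftrightarrow> (\<forall>a<size_of \<A>. sat \<A> Ss (e(x := a)) \<phi>)"

fun tm_vars :: "tm \<Rightarrow> nat set" where
  "tm_vars (Var x) = {x}"
| "tm_vars (Cst c) = {}"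

fun free_vars :: "fm \<Rightarrow> nat set" where
  "free_vars (Eq s t) = tm_vars s \<union> tm_vars t"
| "free_vars (Builtin b s t) = tm_vars s \<union> tm_vars t"
| "free_vars (Rel i ts) = \<Union> (tm_vars ` set ts)"
| "free_vars (RVar i ts) = \<Union> (tm_vars ` set ts)"
| "free_vars (Neg \<phi>) = free_vars \<phi>"
| "free_vars (Conj \<phi> \<psi>) = free_vars \<phi> \<union> free_vars \<psi>"
| "free_vars (Disj \<phi> \<psi>) = free_vars \<phi> \<union> free_vars \<psi>"
| "free_vars (Ex x \<phi>) = free_vars \<phi> - {x}"
| "free_vars (All x \<phi>) = free_vars \<phi> - {x}"

fun wf_tm :: "vocab \<Rightarrow> tm \<Rightarrow> bool" where
  "wf_tm \<sigma> (Var x) \<longleftrightarrow> True"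
| "wf_tm \<sigma> (Cst c) \<longleftrightarrow> c < nconsts \<sigma>"

text \<open>\<open>wf_fm \<sigma> as \<phi>\<close>: \<open>\<phi>\<close> is a formula over \<open>\<sigma>\<close> whose relation variables are among
  \<open>RVar 0, \<dots>, RVar (length as - 1)\<close>, \<open>RVar i\<close> having arity \<open>as ! i\<close>.\<close>

fun wf_fm :: "vocab \<Rightarrow> nat list \<Rightarrow> fm \<Rightarrow> bool" where
  "wf_fm \<sigma> as (Eq s t) \<longleftrightarrow> wf_tm \<sigma> s \<and> wf_tm \<sigma> t"
| "wf_fm \<sigma> as (Builtin b s t) \<longleftrightarrow> b \<in> builtins \<sigma> \<and> wf_tm \<sigma> s \<and> wf_tm \<sigma> t"
| "wf_fm \<sigma> as (Rel i ts) \<longleftrightarrow>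
     i < length (rel_arities \<sigma>) \<and> length ts = rel_arities \<sigma> ! i \<and> list_all (wf_tm \<sigma>) ts"
| "wf_fm \<sigma> as (RVar i ts) \<longleftrightarrow> i < length as \<and> length ts = as ! i \<and> list_all (wf_tm \<sigma>) ts"
| "wf_fm \<sigma> as (Neg \<phi>) \<longleftrightarrow> wf_fm \<sigma> as \<phi>"
| "wf_fm \<sigma> as (Conj \<phi> \<psi>) \<longleftrightarrow> wf_fm \<sigma> as \<phi> \<and> wf_fm \<sigma> as \<psi>"
| "wf_fm \<sigma> as (Disj \<phi> \<psi>) \<longleftrightarrow> wf_fm \<sigma> as \<phi> \<and> wf_fm \<sigma> as \<psi>"
| "wf_fm \<sigma> as (Ex x \<phi>) \<longleftrightarrow> wf_fm \<sigma> as \<phi>"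
| "wf_fm \<sigma> as (All x \<phi>) \<longleftrightarrow> wf_fm \<sigma> as \<phi>"

fun quantifier_free :: "fm \<Rightarrow> bool" where
  "quantifier_free (Neg \<phi>) \<longleftrightarrow> quantifier_free \<phi>"
| "quantifier_free (Conj \<phi> \<psi>) \<longleftrightarrow> quantifier_free \<phi> \<and> quantifier_free \<psi>"
| "quantifier_free (Disj \<phi> \<psi>) \<longleftrightarrow> quantifier_free \<phi> \<and> quantifier_free \<psi>"
| "quantifier_free (Ex x \<phi>) \<longleftrightarrow> False"
| "quantifier_free (All x \<phi>) \<longleftrightarrow> False"
| "quantifier_free _ \<longleftrightarrow> True"

text \<open>Blocks may be empty, so these are the prenex formulas with at most \<open>k\<close> blocks.\<close>

fun Sigma_fm :: "nat \<Rightarrow> fm set" and Pi_fm :: "nat \<Rightarrow> fm set" where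
  "Sigma_fm 0 = {\<phi>. quantifier_free \<phi>}"
| "Sigma_fm (Suc k) = {foldr Ex xs \<psi> | xs \<psi>. \<psi> \<in> Pi_fm k}"
| "Pi_fm 0 = {\<phi>. quantifier_free \<phi>}"
| "Pi_fm (Suc k) = {foldr All xs \<psi> | xs \<psi>. \<psi> \<in> Sigma_fm k}"


section \<open>Counting classes defined by formulas\<close>

text \<open>The number of tuples \<open>(S\<^sub>1, \<dots>, S\<^sub>k, c\<^sub>1, \<dots>, c\<^sub>l)\<close> satisfying \<open>\<phi>\<close>, where
  \<open>as ! i\<close> is the arity of the relation variable \<open>RVar i\<close> and
  \<open>Var 0, \<dots>, Var (l - 1)\<close> are the free individual variables.\<close>

definition count_sat :: "nat list \<Rightarrow> nat \<Rightarrow> fm \<Rightarrow> struc \<Rightarrow> nat" where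
  "count_sat as l \<phi> \<A> =
     card {(Ss, cs). Ss \<in> relation_tuples (size_of \<A>) as \<and> cs \<in> tuples (size_of \<A>) l \<and>
       sat \<A> Ss (\<lambda>j. cs ! j) \<phi>}"

text \<open>
  Two conventions.  Strings that do not encode any structure over the chosen vocabulary get the
  value 0; if they were left unconstrained, a vocabulary without non-built-in symbols would put
  arbitrary functions on nonempty strings into every such class.  The empty string is disregarded
  throughout (here and for circuits), since universes are nonempty and hence it is not represented
  by a string structure.
\<close>

definition sharp_rel :: "fm set \<Rightarrow> (bool list \<Rightarrow> nat) set" where
  "sharp_rel \<Phi> = {f. \<exists>\<sigma> as l \<phi>.
     builtins \<sigma> = {LE} \<and> \<phi> \<in> \<Phi> \<and> wf_fm \<sigma> as \<phi> \<and> free_vars \<phi> \<subseteq> {..<l} \<and>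
     (\<forall>\<A>\<in>structures \<sigma>. enc \<sigma> \<A> \<noteq> [] \<longrightarrow> f (enc \<sigma> \<A>) = count_sat as l \<phi> \<A>) \<and>
     (\<forall>w. w \<noteq> [] \<and> w \<notin> enc \<sigma> ` structures \<sigma> \<longrightarrow> f w = 0)}"


section \<open>Circuits and proof trees\<close>

datatype gate_label = And_gate | Or_gate | Const bool | Input nat | Neg_input nat

text \<open>\<open>(x, y) \<in> children C\<close> means that \<open>y\<close> is a child of \<open>x\<close>.\<close>

record 'g circuit =
  gates :: "'g set"
  children :: "('g \<times> 'g) set"
  label :: "'g \<Rightarrow> gate_label"
  out_gate :: 'g

definition is_circuit :: "nat \<Rightarrow> 'g circuit \<Rightarrow> bool" where
  "is_circuit n C \<longleftrightarrow> finite (gates C) \<and> children C \<subseteq> gates C \<times> gates C \<and> acyclic (children C) \<and>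
     out_gate C \<in> gates C \<and>
     (\<forall>(x, y)\<in>children C. label C x \<in> {And_gate, Or_gate}) \<and>
     (\<forall>x\<in>gates C. \<forall>i. label C x \<in> {Input i, Neg_input i} \<longrightarrow> i < n)"

fun true_label :: "bool list \<Rightarrow> gate_label \<Rightarrow> bool" where
  "true_label w (Const b) \<longleftrightarrow> b"
| "true_label w (Input i) \<longleftrightarrow> w ! i"
| "true_label w (Neg_input i) \<longleftrightarrow> \<not> w ! i"
| "true_label w And_gate \<longleftrightarrow> False"
| "true_label w Or_gate \<longleftrightarrow> False"

definition paths :: "'g circuit \<Rightarrow> 'g list set" where
  "paths C = {p. p \<noteq> [] \<and> set p \<subseteq> gates C \<and> successively (\<lambda>x y. (x, y) \<in> children C) p}"

definition depth_le :: "'g circuit \<Rightarrow> nat \<Rightarrow> bool" where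
  "depth_le C d \<longleftrightarrow> (\<forall>p\<in>paths C. length p \<le> Suc d)"

text \<open>The nodes of the tree-unfolding are the paths starting in the output gate; the parent of
  \<open>p @ [y]\<close> is \<open>p\<close>.  A subtree containing the root is a prefix-closed set of nodes.\<close>

definition tree_unfolding :: "'g circuit \<Rightarrow> 'g list set" where
  "tree_unfolding C = {p \<in> paths C. hd p = out_gate C}"

definition proof_tree :: "'g circuit \<Rightarrow> bool list \<Rightarrow> 'g list set \<Rightarrow> bool" where
  "proof_tree C w T \<longleftrightarrow> T \<subseteq> tree_unfolding C \<and> [out_gate C] \<in> T \<and>
     (\<forall>p y. p \<noteq> [] \<and> p @ [y] \<in> T \<longrightarrow> p \<in> T) \<and>
     (\<forall>p\<in>T. case label C (last p) of
        And_gate \<Rightarrow> (\<forall>y. (last p, y) \<in> children C \<longrightarrow> p @ [y] \<in> T)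
      | Or_gate \<Rightarrow> (\<exists>!y. (last p, y) \<in> children C \<and> p @ [y] \<in> T)
      | lab \<Rightarrow> true_label w lab)"

definition num_proof_trees :: "'g circuit \<Rightarrow> bool list \<Rightarrow> nat" where
  "num_proof_trees C w = card {T. proof_tree C w T}"


section \<open>First-order uniformity\<close>

text \<open>Structures over \<open>(E\<^sup>2, G\<^sub>\<and>\<^sup>1, G\<^sub>\<or>\<^sup>1, B\<^sup>1, r\<^sup>1)\<close>.\<close>

record 'g circ_struc =
  cs_univ :: "'g set"
  cs_E :: "('g \<times> 'g) set"
  cs_and :: "'g set"
  cs_or :: "'g set"
  cs_B :: "'g set"
  cs_r :: "'g set"

definition circ_struc_of :: "'g circuit \<Rightarrow> bool list \<Rightarrow> 'g circ_struc" where
  "circ_struc_of C w =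
    \<lparr>cs_univ = gates C,
     cs_E = children C,
     cs_and = {x \<in> gates C. label C x = And_gate},
     cs_or = {x \<in> gates C. label C x = Or_gate},
     cs_B = {x \<in> gates C. true_label w (label C x)},
     cs_r = {out_gate C}\<rparr>"

definition string_vocab :: vocab where
  "string_vocab = \<lparr>builtins = {LE, BIT}, rel_arities = [1], nconsts = 0\<rparr>"

definition string_struc :: "bool list \<Rightarrow> struc" where
  "string_struc w = \<lparr>size_of = length w, rels = [{[i] | i. i < length w \<and> w ! i}], const_vals = []\<rparr>"

record fo_interp =
  fi_dim :: nat
  fi_univ :: fm
  fi_E :: fm
  fi_and :: fm
  fi_or :: fm
  fi_B :: fm
  fi_r :: fm

definition wf_interp :: "fo_interp \<Rightarrow> bool" where
  "wf_interp I \<longleftrightarrow>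
     (\<forall>\<phi>\<in>{fi_univ I, fi_and I, fi_or I, fi_B I, fi_r I}.
        wf_fm string_vocab [] \<phi> \<and> free_vars \<phi> \<subseteq> {..<fi_dim I}) \<and>
     wf_fm string_vocab [] (fi_E I) \<and> free_vars (fi_E I) \<subseteq> {..<2 * fi_dim I}"

definition holds :: "struc \<Rightarrow> fm \<Rightarrow> nat list \<Rightarrow> bool" where
  "holds \<A> \<phi> t \<longleftrightarrow> sat \<A> [] (\<lambda>j. t ! j) \<phi>"

definition interp_univ :: "fo_interp \<Rightarrow> struc \<Rightarrow> nat list set" where
  "interp_univ I \<A> = {t \<in> tuples (size_of \<A>) (fi_dim I). holds \<A> (fi_univ I) t}"

definition apply_interp :: "fo_interp \<Rightarrow> struc \<Rightarrow> nat list circ_struc" where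
  "apply_interp I \<A> =
    \<lparr>cs_univ = interp_univ I \<A>,
     cs_E = {(s, t). s \<in> interp_univ I \<A> \<and> t \<in> interp_univ I \<A> \<and> holds \<A> (fi_E I) (s @ t)},
     cs_and = {t \<in> interp_univ I \<A>. holds \<A> (fi_and I) t},
     cs_or = {t \<in> interp_univ I \<A>. holds \<A> (fi_or I) t},
     cs_B = {t \<in> interp_univ I \<A>. holds \<A> (fi_B I) t},
     cs_r = {t \<in> interp_univ I \<A>. holds \<A> (fi_r I) t}\<rparr>"

text \<open>An interpretation maps the one-element structure of a string of length 1 to a circuit with at
  most one gate, which would force all values on such strings to be at most 1.  Therefore
  uniformity is required for lengths at least 2 only, and the circuit for length 1 is arbitrary.\<close>

definition FO_uniform :: "(nat \<Rightarrow> nat list circuit) \<Rightarrow> bool" where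
  "FO_uniform C \<longleftrightarrow> (\<exists>I. wf_interp I \<and>
     (\<forall>w. length w \<ge> 2 \<longrightarrow> apply_interp I (string_struc w) = circ_struc_of (C (length w)) w))"

definition FO_uniform_sharp_AC0 :: "(bool list \<Rightarrow> nat) set" where
  "FO_uniform_sharp_AC0 = {f. \<exists>C. FO_uniform C \<and>
     (\<forall>n\<ge>1. is_circuit n (C n)) \<and>
     (\<exists>d. \<forall>n\<ge>1. depth_le (C n) d) \<and>
     (\<exists>c. \<forall>n\<ge>1. card (gates (C n)) \<le> n ^ c + c) \<and>
     (\<forall>w. w \<noteq> [] \<longrightarrow> f w = num_proof_trees (C (length w)) w)}"

end

theory Submission
  imports Defs "HOL-Library.FuncSet"
begin

text \<open>
  For a quantifier-free formula, the truth values of its atoms can be guessed; given the elements, the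
  relations realizing a guess are then counted by a product over all tuples. So the count is a nested
  sum and product over the universe with a definable summand, and its evaluation tree is a uniform
  circuit. For this, BIT has to define the arithmetic of the positions in the encoding. If no relation
  symbol has positive arity, the encoding is only logarithmic in the size of the structure, and the
  solutions are counted bit by bit instead.

  The function with value 2 on strings of odd length and 1 on the others is in \<open>#AC\<^sup>0\<close>. It is in none of
  the other classes: the \<open>\<Sigma>\<^sub>2\<close> formulas are preserved when passing to a sufficiently large substructure
  containing the witnesses, so two solutions in a large structure persist in a structure of any smaller,
  not too small size, and the length of the encoding would be odd for almost all sizes.

  Conversely, the number of proof trees is a nested sum and product, so its parity is computed by
  \<open>AC\<^sup>0\<close> circuits with parity gates. By the argument of Razborov and Smolensky, this parity cannot be
  majority. However, a relation variable can be forced by universal constraints to contain the partial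
  counts of a set, so that the number of solutions, 0 or 1, is majority; the number of violated assignments
  has the same parity, which gives the existential case.
\<close>

section \<open>Predicates definable over string structures\<close>

text \<open>Proof trees multiply at conjunctions and add at disjunctions, so constant depth provides
  nested sums and products over the positions, but no iteration. This obstacle shapes the upper
  bound twice. Multiplication of positions is defined from BIT by runs of logarithmic length. A
  single position has only logarithmically many bits, enough to store a piece of about square root
  length of such a run; hence two levels of coding. For encodings of logarithmic size the elements
  are too large to be positions. Scanning their bits is again an iteration; it collapses to sums and
  products because the recorded comparisons only grow. For the lower bound the field with two
  elements is the right one: modulo 2 a sum is a parity, which does not raise the degree, and only
  products have to be approximated. The formulas that force majority can spare no quantifiers to
  define a successor or a threshold, so the structure supplies these by edges.\<close>

lemma finite_tm_vars [simp]: "finite (tm_vars t)"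
  by (cases t) auto

lemma finite_free_vars [simp]: "finite (free_vars \<phi>)"
  by (induction \<phi>) auto

lemma tm_val_cong: "(\<And>x. x \<in> tm_vars t \<Longrightarrow> e x = e' x) \<Longrightarrow> tm_val \<A> e t = tm_val \<A> e' t"
  by (cases t) auto

lemma sat_cong: "(\<And>x. x \<in> free_vars \<phi> \<Longrightarrow> e x = e' x) \<Longrightarrow> sat \<A> Ss e \<phi> = sat \<A> Ss e' \<phi>"
proof (induction \<phi> arbitrary: e e')
  case (Eq s t)
  then show ?case using tm_val_cong[of s e e'] tm_val_cong[of t e e'] by auto
next
  case (Builtin b s t)
  then show ?case using tm_val_cong[of s e e'] tm_val_cong[of t e e'] by auto
next
  case (Rel i ts)
  have "map (tm_val \<A> e) ts = map (tm_val \<A> e') ts"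
    using Rel by (intro map_cong refl tm_val_cong) auto
  then show ?case by (metis sat.simps(3))
next
  case (RVar i ts)
  have "map (tm_val \<A> e) ts = map (tm_val \<A> e') ts"
    using RVar by (intro map_cong refl tm_val_cong) auto
  then show ?case by (metis sat.simps(4))
next
  case (Neg \<phi>)
  then show ?case by (metis free_vars.simps(5) sat.simps(5))
next
  case (Conj \<phi> \<psi>)
  have "sat \<A> Ss e \<phi> = sat \<A> Ss e' \<phi>" "sat \<A> Ss e \<psi> = sat \<A> Ss e' \<psi>"
    by (intro Conj.IH; simp add: Conj.prems)+
  then show ?case by simp
next
  case (Disj \<phi> \<psi>)
  have "sat \<A> Ss e \<phi> = sat \<A> Ss e' \<phi>" "sat \<A> Ss e \<psi> = sat \<A> Ss e' \<psi>"
    by (intro Disj.IH; simp add: Disj.prems)+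
  then show ?case by simp
next
  case (Ex x \<phi>)
  have "sat \<A> Ss (e(x := a)) \<phi> = sat \<A> Ss (e'(x := a)) \<phi>" for a
    by (rule Ex.IH) (simp add: Ex.prems)
  then show ?case by simp
next
  case (All x \<phi>)
  have "sat \<A> Ss (e(x := a)) \<phi> = sat \<A> Ss (e'(x := a)) \<phi>" for a
    by (rule All.IH) (simp add: All.prems)
  then show ?case by simp
qed

fun rename_tm :: "(nat \<Rightarrow> nat) \<Rightarrow> tm \<Rightarrow> tm" where
  "rename_tm f (Var x) = Var (f x)"
| "rename_tm f (Cst c) = Cst c"

lemma tm_val_rename_tm [simp]: "tm_val \<A> e (rename_tm f t) = tm_val \<A> (e \<circ> f) t"
  by (cases t) auto

lemma tm_vars_rename_tm [simp]: "tm_vars (rename_tm f t) = f ` tm_vars t"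
  by (cases t) auto

lemma wf_tm_rename_tm [simp]: "wf_tm \<sigma> (rename_tm f t) = wf_tm \<sigma> t"
  by (cases t) auto

text \<open>Bound variables are renamed, since \<open>f\<close> need not be injective.\<close>

lemma ex_rename:
  "\<exists>\<psi>. (\<forall>\<A> Ss e. sat \<A> Ss e \<psi> = sat \<A> Ss (e \<circ> f) \<phi>) \<and> free_vars \<psi> \<subseteq> f ` free_vars \<phi> \<and>
     (\<forall>\<sigma> as. wf_fm \<sigma> as \<phi> \<longrightarrow> wf_fm \<sigma> as \<psi>)"
proof (induction \<phi> arbitrary: f)
  case (Eq s t)
  show ?case by (rule exI[of _ "Eq (rename_tm f s) (rename_tm f t)"]) (auto simp: comp_def)
next
  case (Builtin b s t)
  show ?case by (rule exI[of _ "Builtin b (rename_tm f s) (rename_tm f t)"]) (auto simp: comp_def)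
next
  case (Rel i ts)
  show ?case by (rule exI[of _ "Rel i (map (rename_tm f) ts)"]) (auto simp: list_all_iff comp_def)
next
  case (RVar i ts)
  show ?case by (rule exI[of _ "RVar i (map (rename_tm f) ts)"]) (auto simp: list_all_iff comp_def)
next
  case (Neg \<phi>)
  then obtain \<psi> where "(\<forall>\<A> Ss e. sat \<A> Ss e \<psi> = sat \<A> Ss (e \<circ> f) \<phi>) \<and> free_vars \<psi> \<subseteq> f ` free_vars \<phi> \<and>
     (\<forall>\<sigma> as. wf_fm \<sigma> as \<phi> \<longrightarrow> wf_fm \<sigma> as \<psi>)" by blast
  then show ?case by (intro exI[of _ "Neg \<psi>"]) (auto simp: comp_def)
next
  case (Conj \<phi>1 \<phi>2)
  obtain \<psi>1 where 1: "(\<forall>\<A> Ss e. sat \<A> Ss e \<psi>1 = sat \<A> Ss (e \<circ> f) \<phi>1) \<and> free_vars \<psi>1 \<subseteq> f ` free_vars \<phi>1 \<and>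
     (\<forall>\<sigma> as. wf_fm \<sigma> as \<phi>1 \<longrightarrow> wf_fm \<sigma> as \<psi>1)" using Conj by blast
  obtain \<psi>2 where 2: "(\<forall>\<A> Ss e. sat \<A> Ss e \<psi>2 = sat \<A> Ss (e \<circ> f) \<phi>2) \<and> free_vars \<psi>2 \<subseteq> f ` free_vars \<phi>2 \<and>
     (\<forall>\<sigma> as. wf_fm \<sigma> as \<phi>2 \<longrightarrow> wf_fm \<sigma> as \<psi>2)" using Conj by blast
  from 1 2 show ?case by (intro exI[of _ "Conj \<psi>1 \<psi>2"]) (auto simp: comp_def)
next
  case (Disj \<phi>1 \<phi>2)
  obtain \<psi>1 where 1: "(\<forall>\<A> Ss e. sat \<A> Ss e \<psi>1 = sat \<A> Ss (e \<circ> f) \<phi>1) \<and> free_vars \<psi>1 \<subseteq> f ` free_vars \<phi>1 \<and>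
     (\<forall>\<sigma> as. wf_fm \<sigma> as \<phi>1 \<longrightarrow> wf_fm \<sigma> as \<psi>1)" using Disj by blast
  obtain \<psi>2 where 2: "(\<forall>\<A> Ss e. sat \<A> Ss e \<psi>2 = sat \<A> Ss (e \<circ> f) \<phi>2) \<and> free_vars \<psi>2 \<subseteq> f ` free_vars \<phi>2 \<and>
     (\<forall>\<sigma> as. wf_fm \<sigma> as \<phi>2 \<longrightarrow> wf_fm \<sigma> as \<psi>2)" using Disj by blast
  from 1 2 show ?case by (intro exI[of _ "Disj \<psi>1 \<psi>2"]) (auto simp: comp_def)
next
  case (Ex x \<phi>)
  obtain k where k: "k \<notin> f ` free_vars \<phi>"
    using ex_new_if_finite[OF infinite_UNIV_nat] by (metis finite_free_vars finite_imageI)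
  obtain \<psi> where \<psi>: "\<And>\<A> Ss e. sat \<A> Ss e \<psi> = sat \<A> Ss (e \<circ> f(x := k)) \<phi>"
    "free_vars \<psi> \<subseteq> f(x := k) ` free_vars \<phi>" "\<And>\<sigma> as. wf_fm \<sigma> as \<phi> \<longrightarrow> wf_fm \<sigma> as \<psi>"
    using Ex[of "f(x := k)"] by blast
  have "sat \<A> Ss (e(k := a) \<circ> f(x := k)) \<phi> = sat \<A> Ss ((e \<circ> f)(x := a)) \<phi>" for \<A> Ss e a
    by (rule sat_cong) (use k in auto)
  then have "sat \<A> Ss e (Ex k \<psi>) = sat \<A> Ss (e \<circ> f) (Ex x \<phi>)" for \<A> Ss e
    by (simp only: sat.simps \<psi>(1))
  then show ?case
    using \<psi>(2,3) by (intro exI[of _ "Ex k \<psi>"] conjI) (auto simp: comp_def simp del: sat.simps)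
next
  case (All x \<phi>)
  obtain k where k: "k \<notin> f ` free_vars \<phi>"
    using ex_new_if_finite[OF infinite_UNIV_nat] by (metis finite_free_vars finite_imageI)
  obtain \<psi> where \<psi>: "\<And>\<A> Ss e. sat \<A> Ss e \<psi> = sat \<A> Ss (e \<circ> f(x := k)) \<phi>"
    "free_vars \<psi> \<subseteq> f(x := k) ` free_vars \<phi>" "\<And>\<sigma> as. wf_fm \<sigma> as \<phi> \<longrightarrow> wf_fm \<sigma> as \<psi>"
    using All[of "f(x := k)"] by blast
  have "sat \<A> Ss (e(k := a) \<circ> f(x := k)) \<phi> = sat \<A> Ss ((e \<circ> f)(x := a)) \<phi>" for \<A> Ss e a
    by (rule sat_cong) (use k in auto)
  then have "sat \<A> Ss e (All k \<psi>) = sat \<A> Ss (e \<circ> f) (All x \<phi>)" for \<A> Ss e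
    by (simp only: sat.simps \<psi>(1))
  then show ?case
    using \<psi>(2,3) by (intro exI[of _ "All k \<psi>"] conjI) (auto simp: comp_def simp del: sat.simps)
qed

text \<open>Lengths below 2 are disregarded, so that 0 and 1 are elements of every universe.\<close>

definition ok :: "bool list \<Rightarrow> (nat \<Rightarrow> nat) \<Rightarrow> bool" where
  "ok w e \<longleftrightarrow> length w \<ge> 2 \<and> (\<forall>i. e i < length w)"

text \<open>A semantic notion: HOL predicates of a string and an environment stand for formulas, and
  closure rules replace writing formulas down. Only environments that satisfy \<open>ok\<close> are
  compared.\<close>

definition FO :: "(bool list \<Rightarrow> (nat \<Rightarrow> nat) \<Rightarrow> bool) \<Rightarrow> bool" where
  "FO P \<longleftrightarrow> (\<exists>\<phi>. wf_fm string_vocab [] \<phi> \<and> (\<forall>w e. ok w e \<longrightarrow> sat (string_struc w) [] e \<phi> = P w e))"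

lemma size_string_struc [simp]: "size_of (string_struc w) = length w"
  by (simp add: string_struc_def)

lemma ok_lengthD: "ok w e \<Longrightarrow> length w \<ge> 2"
  by (simp add: ok_def)

lemma ok_lessD: "ok w e \<Longrightarrow> e i < length w"
  by (simp add: ok_def)

lemma ok_push: "ok w e \<Longrightarrow> a < length w \<Longrightarrow> ok w (case_nat a e)"
  by (auto simp: ok_def split: nat.splits)

lemma ok_comp: "ok w e \<Longrightarrow> ok w (\<lambda>i. e (f i))"
  by (auto simp: ok_def)

lemma FO_cong: "FO P \<Longrightarrow> (\<And>w e. ok w e \<Longrightarrow> P w e = Q w e) \<Longrightarrow> FO Q"
  by (auto simp: FO_def)

lemma FO_subst: "FO P \<Longrightarrow> FO (\<lambda>w e. P w (\<lambda>i. e (f i)))"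
  unfolding FO_def
proof (elim exE conjE)
  fix \<phi> assume 1: "wf_fm string_vocab [] \<phi>" "\<forall>w e. ok w e \<longrightarrow> sat (string_struc w) [] e \<phi> = P w e"
  obtain \<psi> where "\<forall>\<A> Ss e. sat \<A> Ss e \<psi> = sat \<A> Ss (e \<circ> f) \<phi>" "\<forall>\<sigma> as. wf_fm \<sigma> as \<phi> \<longrightarrow> wf_fm \<sigma> as \<psi>"
    using ex_rename by blast
  with 1 ok_comp[of _ _ f] show "\<exists>\<psi>. wf_fm string_vocab [] \<psi> \<and>
    (\<forall>w e. ok w e \<longrightarrow> sat (string_struc w) [] e \<psi> = P w (\<lambda>i. e (f i)))"
    by (intro exI[of _ \<psi>]) (simp add: comp_def)
qed

named_theorems FO_intros

lemma FO_eq [FO_intros]: "FO (\<lambda>w e. e i = e j)"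
  unfolding FO_def by (rule exI[of _ "Eq (Var i) (Var j)"]) auto

lemma FO_le [FO_intros]: "FO (\<lambda>w e. e i \<le> e j)"
  unfolding FO_def by (rule exI[of _ "Builtin LE (Var i) (Var j)"]) (auto simp: string_vocab_def)

lemma FO_bit [FO_intros]: "FO (\<lambda>w e. bit (e j) (e i))"
  unfolding FO_def by (rule exI[of _ "Builtin BIT (Var i) (Var j)"]) (auto simp: string_vocab_def)

lemma FO_input: "FO (\<lambda>w e. w ! e i)"
  unfolding FO_def by (rule exI[of _ "Rel 0 [Var i]"]) (auto simp: string_vocab_def string_struc_def ok_def)

lemma FO_not [FO_intros]: "FO P \<Longrightarrow> FO (\<lambda>w e. \<not> P w e)"
  unfolding FO_def by (elim exE, rule exI[of _ "Neg _"]) auto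

lemma FO_conj [FO_intros]:
  assumes "FO P" "FO Q"
  shows "FO (\<lambda>w e. P w e \<and> Q w e)"
proof -
  obtain \<phi> \<psi> where "wf_fm string_vocab [] \<phi>" "\<And>w e. ok w e \<Longrightarrow> sat (string_struc w) [] e \<phi> = P w e"
    "wf_fm string_vocab [] \<psi>" "\<And>w e. ok w e \<Longrightarrow> sat (string_struc w) [] e \<psi> = Q w e"
    using assms unfolding FO_def by blast
  then show ?thesis
    unfolding FO_def by (intro exI[of _ "Conj \<phi> \<psi>"]) simp
qed

lemma FO_disj [FO_intros]:
  assumes "FO P" "FO Q"
  shows "FO (\<lambda>w e. P w e \<or> Q w e)"
proof -
  obtain \<phi> \<psi> where "wf_fm string_vocab [] \<phi>" "\<And>w e. ok w e \<Longrightarrow> sat (string_struc w) [] e \<phi> = P w e"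
    "wf_fm string_vocab [] \<psi>" "\<And>w e. ok w e \<Longrightarrow> sat (string_struc w) [] e \<psi> = Q w e"
    using assms unfolding FO_def by blast
  then show ?thesis
    unfolding FO_def by (intro exI[of _ "Disj \<phi> \<psi>"]) simp
qed

lemma FO_imp [FO_intros]: "FO P \<Longrightarrow> FO Q \<Longrightarrow> FO (\<lambda>w e. P w e \<longrightarrow> Q w e)"
  by (rule FO_cong[OF FO_disj[OF FO_not]]) auto

lemma FO_iff [FO_intros]: "FO P \<Longrightarrow> FO Q \<Longrightarrow> FO (\<lambda>w e. P w e \<longleftrightarrow> Q w e)"
  by (rule FO_cong[OF FO_conj[OF FO_imp[of P Q] FO_imp[of Q P]]]) auto

lemma FO_less [FO_intros]: "FO (\<lambda>w e. e i < e j)"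
  using FO_not[OF FO_le[of j i]] by (simp add: not_le)

lemma FO_const_bool [FO_intros]: "FO (\<lambda>w e. c)"
proof (cases c)
  case True
  then show ?thesis using FO_eq[of 0 0] by simp
next
  case False
  then show ?thesis using FO_not[OF FO_eq[of 0 0]] by simp
qed

text \<open>De Bruijn indices: below the quantifier the bound element is \<open>e 0\<close> and the
  outer variables are shifted. The rule then applies by unification, without the choice of fresh
  names.\<close>

lemma FO_ex [FO_intros]:
  assumes "FO (\<lambda>w e. P w (e 0) (\<lambda>i. e (Suc i)))"
  shows "FO (\<lambda>w e. \<exists>a<length w. P w a e)"
proof -
  obtain \<phi> where \<phi>: "wf_fm string_vocab [] \<phi>"
    "\<And>w e. ok w e \<Longrightarrow> sat (string_struc w) [] e \<phi> = P w (e 0) (\<lambda>i. e (Suc i))"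
    using assms unfolding FO_def by blast
  \<comment> \<open>A name that no outer variable has once the shift is undone, so that it can serve
    as the bound variable.\<close>
  obtain k where k: "k \<notin> (\<lambda>i. i - 1) ` free_vars \<phi>"
    using ex_new_if_finite[OF infinite_UNIV_nat] by (metis finite_free_vars finite_imageI)
  then have k: "Suc k \<notin> free_vars \<phi>"
    by force
  obtain \<psi> where \<psi>: "\<And>\<A> Ss e. sat \<A> Ss e \<psi> = sat \<A> Ss (e \<circ> case_nat k id) \<phi>" "wf_fm string_vocab [] \<psi>"
    using ex_rename \<phi>(1) by blast
  have "sat (string_struc w) [] (e(k := a)) \<psi> = P w a e" if "ok w e" "a < length w" for w e a
  proof -
    have "sat (string_struc w) [] (e(k := a)) \<psi> = sat (string_struc w) [] (case_nat a e) \<phi>"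
      unfolding \<psi>(1) by (rule sat_cong) (use k in \<open>auto split: nat.splits\<close>)
    then show ?thesis using \<phi>(2)[OF ok_push[OF that]] by simp
  qed
  then show ?thesis
    unfolding FO_def using \<psi>(2) by (intro exI[of _ "Ex k \<psi>"]) auto
qed

lemma FO_all [FO_intros]:
  assumes "FO (\<lambda>w e. P w (e 0) (\<lambda>i. e (Suc i)))"
  shows "FO (\<lambda>w e. \<forall>a<length w. P w a e)"
  using FO_not[OF FO_ex[OF FO_not[OF assms]]] by simp

lemma FO_Ball: "finite X \<Longrightarrow> (\<And>x. x \<in> X \<Longrightarrow> FO (P x)) \<Longrightarrow> FO (\<lambda>w e. \<forall>x\<in>X. P x w e)"
  by (induction X rule: finite_induct) (simp_all add: FO_const_bool FO_conj)

lemma FO_Bex: "finite X \<Longrightarrow> (\<And>x. x \<in> X \<Longrightarrow> FO (P x)) \<Longrightarrow> FO (\<lambda>w e. \<exists>x\<in>X. P x w e)"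
  by (induction X rule: finite_induct) (simp_all add: FO_const_bool FO_disj)

lemma FO_all_less: "(\<And>j. j < k \<Longrightarrow> FO (P j)) \<Longrightarrow> FO (\<lambda>w e. \<forall>j<(k::nat). P j w e)"
  by (rule FO_cong[OF FO_Ball[OF finite_lessThan[of k], of P]]) auto

lemma FO_ex_less: "(\<And>j. j < k \<Longrightarrow> FO (P j)) \<Longrightarrow> FO (\<lambda>w e. \<exists>j<(k::nat). P j w e)"
  by (rule FO_cong[OF FO_Bex[OF finite_lessThan[of k], of P]]) auto

lemma FO_if: "FO C \<Longrightarrow> FO P \<Longrightarrow> FO Q \<Longrightarrow> FO (\<lambda>w e. if C w e then P w e else Q w e)"
  by (rule FO_cong[of "\<lambda>w e. (C w e \<and> P w e) \<or> (\<not> C w e \<and> Q w e)"]) (auto intro!: FO_intros)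

lemma FO_eq_const [FO_intros]: "FO (\<lambda>w e. e i = c)"
proof (induction c arbitrary: i)
  case 0
  have "FO (\<lambda>w e. \<forall>y<length w. e i \<le> y)"
    by (intro FO_intros)
  then show ?case
    by (rule FO_cong) (fastforce simp: ok_def)
next
  case (Suc c)
  have "FO (\<lambda>w e. \<exists>y<length w. y = c \<and> y < e i \<and> (\<forall>z<length w. z < e i \<longrightarrow> z \<le> y))"
    by (intro FO_intros Suc)
  then show ?case
  proof (rule FO_cong)
    fix w e assume ok: "ok w e"
    have "e i = Suc c" if "y = c" "y < e i" "\<forall>z<length w. z < e i \<longrightarrow> z \<le> y" for y
      using that(3)[rule_format, of "e i - 1"] ok_lessD[OF ok, of i] that(1,2) by linarith
    moreover have "\<exists>y<length w. y = c \<and> y < e i \<and> (\<forall>z<length w. z < e i \<longrightarrow> z \<le> y)" if "e i = Suc c"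
      using that ok_lessD[OF ok, of i] by (intro exI[of _ c]) auto
    ultimately show "(\<exists>y<length w. y = c \<and> y < e i \<and> (\<forall>z<length w. z < e i \<longrightarrow> z \<le> y)) = (e i = Suc c)"
      by blast
  qed
qed

text \<open>The length itself is not an element of the universe; statements about it are made
  through the last position.\<close>

lemma FO_max [FO_intros]: "FO (\<lambda>w e. e i = length w - Suc 0)"
proof -
  have "FO (\<lambda>w e. \<forall>y<length w. y \<le> e i)"
    by (intro FO_intros)
  then show ?thesis
  proof (rule FO_cong)
    fix w e assume ok: "ok w e"
    show "(\<forall>y<length w. y \<le> e i) = (e i = length w - Suc 0)"
      using ok_lessD[OF ok, of i] ok_lengthD[OF ok] by (auto intro: antisym)
  qed
qed

lemma FO_length_eq: "FO (\<lambda>w e. length w = c)"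
proof -
  have "FO (\<lambda>w e. \<exists>y<length w. y = length w - Suc 0 \<and> y = c - 1 \<and> c \<noteq> 0)"
    by (intro FO_intros)
  then show ?thesis
    by (rule FO_cong) (auto dest: ok_lengthD)
qed

lemma FO_length_le: "FO (\<lambda>w e. length w \<le> c)"
proof -
  have "FO (\<lambda>w e. \<exists>i\<in>{..c}. length w = i)"
    by (rule FO_Bex) (auto intro: FO_length_eq)
  then show ?thesis by (rule FO_cong) auto
qed

text \<open>Interpretations evaluate a formula on a tuple \<open>t\<close>, whose entries beyond its
  length are unspecified. All indices from \<open>k\<close> on are sent to 0, which has to be a
  genuine place of the tuple.\<close>

lemma FO_holds:
  assumes "FO P" "k \<ge> 1"
  shows "\<exists>\<phi>. wf_fm string_vocab [] \<phi> \<and> free_vars \<phi> \<subseteq> {..<k} \<and>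
    (\<forall>w t. length w \<ge> 2 \<longrightarrow> t \<in> tuples (length w) k \<longrightarrow>
       holds (string_struc w) \<phi> t = P w (\<lambda>i. t ! (if i < k then i else 0)))"
proof -
  define f where "f = (\<lambda>i. if i < k then i else (0::nat))"
  obtain \<phi> where \<phi>: "wf_fm string_vocab [] \<phi>" "\<And>w e. ok w e \<Longrightarrow> sat (string_struc w) [] e \<phi> = P w e"
    using assms unfolding FO_def by blast
  obtain \<psi> where \<psi>: "\<And>\<A> Ss e. sat \<A> Ss e \<psi> = sat \<A> Ss (e \<circ> f) \<phi>" "wf_fm string_vocab [] \<psi>"
    "free_vars \<psi> \<subseteq> f ` free_vars \<phi>"
    using ex_rename \<phi>(1) by blast
  have "holds (string_struc w) \<psi> t = P w (\<lambda>i. t ! (if i < k then i else 0))"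
    if "length w \<ge> 2" "t \<in> tuples (length w) k" for w t
  proof -
    have "f i < length t" for i
      using that assms(2) by (auto simp: f_def tuples_def)
    then have "ok w (\<lambda>i. t ! f i)"
      using that nth_mem[of "f _" t] unfolding ok_def tuples_def by blast
    then show ?thesis
      unfolding holds_def \<psi>(1) by (simp add: \<phi>(2) comp_def) (simp add: f_def)
  qed
  then show ?thesis
    using \<psi>(2,3) assms(2) by (intro exI[of _ \<psi>]) (auto simp: f_def split: if_splits)
qed

section \<open>Arithmetic is definable\<close>

lemma bit_imp_power_le: "bit (x::nat) i \<Longrightarrow> 2 ^ i \<le> x"
  by (rule ccontr) (simp add: bit_iff_odd)

lemma bit_imp_less: "bit (x::nat) i \<Longrightarrow> i < x"
  using bit_imp_power_le[of x i] less_exp[of i] by linarith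

lemma less_power_iff_bit: "(x::nat) < 2 ^ n \<longleftrightarrow> (\<forall>i. bit x i \<longrightarrow> i < n)"
proof
  assume "x < 2 ^ n"
  then show "\<forall>i. bit x i \<longrightarrow> i < n"
    using bit_imp_power_le by (metis le_less_trans less_le_not_le nat_power_less_imp_less zero_less_numeral)
next
  assume "\<forall>i. bit x i \<longrightarrow> i < n"
  then have "take_bit n x = x"
    by (intro bit_eqI) (auto simp: bit_take_bit_iff)
  then show "x < 2 ^ n"
    by (metis take_bit_nat_less_exp)
qed

lemma ex_word: "\<exists>u<2 ^ n. \<forall>i. bit (u::nat) i \<longleftrightarrow> i < n \<and> Q i"
  by (rule exI[of _ "horner_sum of_bool 2 (map Q [0..<n])"])
    (use horner_sum_of_bool_2_less[of "map Q [0..<n]"] in \<open>auto simp: bit_horner_sum_bit_iff\<close>)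

text \<open>Carry look-ahead: a carry enters place \<open>k\<close> iff some lower place generates
  one and all places in between pass it on. Unlike the recursive description, this is a first-order
  condition on the bits.\<close>

definition carry :: "nat \<Rightarrow> nat \<Rightarrow> nat \<Rightarrow> bool" where
  "carry x y k \<longleftrightarrow> (\<exists>j<k. bit x j \<and> bit y j \<and> (\<forall>i<k. j < i \<longrightarrow> bit x i \<or> bit y i))"

lemma carry_iff: "carry x y k \<longleftrightarrow> 2 ^ k \<le> x mod 2 ^ k + y mod 2 ^ k"
proof (induction k)
  case 0
  then show ?case by (simp add: carry_def)
next
  case (Suc k)
  have mod: "z mod 2 ^ Suc k = 2 ^ k * of_bool (bit z k) + z mod 2 ^ k" for z :: nat
    using take_bit_Suc_from_most[of k z] by (simp add: take_bit_eq_mod)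
  have less: "x mod 2 ^ k + y mod 2 ^ k < 2 * 2 ^ k"
    using mod_less_divisor[of "2 ^ k" x] mod_less_divisor[of "2 ^ k" y] by (simp del: mod_less_divisor)
  have "carry x y (Suc k) \<longleftrightarrow> (bit x k \<and> bit y k) \<or> ((bit x k \<or> bit y k) \<and> carry x y k)"
    unfolding carry_def by (auto simp: less_Suc_eq)
  then show ?case
    using Suc less unfolding mod by auto
qed

lemma bit_add_iff: "bit (x + y) k \<longleftrightarrow> ((bit x k \<noteq> bit y k) \<noteq> carry x y k)" for x y :: nat
proof -
  have "(x mod 2 ^ k + y mod 2 ^ k) div 2 ^ k = of_bool (carry x y k)"
  proof (cases "carry x y k")
    case True
    have "x mod 2 ^ k + y mod 2 ^ k < 2 * 2 ^ k"
      using mod_less_divisor[of "2 ^ k" x] mod_less_divisor[of "2 ^ k" y] by (simp del: mod_less_divisor)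
    then have "(x mod 2 ^ k + y mod 2 ^ k) div 2 ^ k = 1"
      using True unfolding carry_iff by (intro div_nat_eqI) auto
    then show ?thesis using True by simp
  qed (simp add: carry_iff)
  then show ?thesis
    using div_add1_eq[of x y "2 ^ k"] by (auto simp: bit_iff_odd)
qed

lemma FO_plus [FO_intros]: "FO (\<lambda>w e. e i + e j = e k)"
proof -
  have "FO (\<lambda>w e. \<forall>l<length w. bit (e k) l \<longleftrightarrow> (\<not> (\<not> (bit (e i) l \<longleftrightarrow> bit (e j) l) \<longleftrightarrow> 
     (\<exists>m<length w. m < l \<and> bit (e i) m \<and> bit (e j) m \<and> (\<forall>n<length w. n < l \<longrightarrow> m < n \<longrightarrow> bit (e i) n \<or> bit (e j) n)))))"
    by (intro FO_intros)
  then show ?thesis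
  proof (rule FO_cong)
    fix w e assume ok: "ok w e"
    let ?N = "length w"
    have N: "?N \<ge> 2" "e i < ?N" "e j < ?N" "e k < ?N"
      using ok by (auto simp: ok_def)
    \<comment> \<open>The aim is \<open>2 * ?N \<le> 2 ^ ?N\<close>: the sum of two elements then
      has no bit at or above \<open>?N\<close>, and it is enough to compare the bits whose places
      are elements.\<close>
    have "?N - 1 < 2 ^ (?N - 1)"
      by (rule less_exp)
    then have "2 * ?N \<le> 2 * 2 ^ (?N - 1)"
      by linarith
    also have "2 * 2 ^ (?N - 1) = (2 ^ ?N :: nat)"
      using N(1) by (cases ?N) auto
    finally have "e i + e j < 2 ^ ?N" "e k < 2 ^ ?N"
      using N by auto
    then have big: "\<not> bit (e i + e j) l" "\<not> bit (e k) l" if "l \<ge> ?N" for l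
      using that less_power_iff_bit by (meson not_le)+
    have "e i + e j = e k \<longleftrightarrow> (\<forall>l<?N. bit (e k) l = bit (e i + e j) l)"
      by (metis big bit_eqI not_le_imp_less)
    moreover have "carry (e i) (e j) l \<longleftrightarrow> (\<exists>m<length w. m < l \<and> bit (e i) m \<and> bit (e j) m \<and>
        (\<forall>n<length w. n < l \<longrightarrow> m < n \<longrightarrow> bit (e i) n \<or> bit (e j) n))" if "l < ?N" for l
      using that unfolding carry_def by (meson less_trans)
    ultimately show "(\<forall>l<length w. bit (e k) l \<longleftrightarrow> (\<not> (\<not> (bit (e i) l \<longleftrightarrow> bit (e j) l) \<longleftrightarrow> 
     (\<exists>m<length w. m < l \<and> bit (e i) m \<and> bit (e j) m \<and> (\<forall>n<length w. n < l \<longrightarrow> m < n \<longrightarrow> bit (e i) n \<or> bit (e j) n)))))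
      = (e i + e j = e k)"
      by (simp add: bit_add_iff)
  qed
qed

lemma FO_Suc [FO_intros]: "FO (\<lambda>w e. Suc (e i) = e j)"
proof -
  have "FO (\<lambda>w e. \<exists>y<length w. y = 1 \<and> e i + y = e j)"
    by (intro FO_intros)
  then show ?thesis
    by (rule FO_cong) (auto simp: ok_def)
qed

text \<open>The number of binary digits. Its value at \<open>n - 1\<close> is the rounded-up
  logarithm of \<open>n\<close>, the number of bits used for an encoded constant.\<close>

definition bitlen :: "nat \<Rightarrow> nat" where
  "bitlen m = (LEAST b. m < 2 ^ b)"

lemma bitlen_le_iff: "bitlen m \<le> b \<longleftrightarrow> m < 2 ^ b"
proof
  have "m < 2 ^ bitlen m"
    unfolding bitlen_def by (rule LeastI[of "\<lambda>b. m < 2 ^ b" m]) simp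
  moreover assume "bitlen m \<le> b"
  ultimately show "m < 2 ^ b"
    by (meson less_le_trans one_le_numeral power_increasing)
next
  assume "m < 2 ^ b"
  then show "bitlen m \<le> b"
    unfolding bitlen_def by (rule Least_le)
qed

lemma less_bitlen_iff: "b < bitlen m \<longleftrightarrow> 2 ^ b \<le> m"
  using bitlen_le_iff[of m b] by linarith

lemma less_power_bitlen: "m < 2 ^ bitlen m"
  using bitlen_le_iff by blast

lemma bitlen_le: "bitlen m \<le> m"
  by (simp add: bitlen_le_iff)

lemma bitlen_0 [simp]: "bitlen 0 = 0"
  using bitlen_le[of 0] by simp

lemma bitlen_pos_iff [simp]: "0 < bitlen m \<longleftrightarrow> 0 < m"
  using less_bitlen_iff[of 0 m] by auto

lemma bitlen_eq_Suc_iff: "bitlen m = Suc p \<longleftrightarrow> bit m p \<and> (\<forall>k. bit m k \<longrightarrow> k \<le> p)"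
proof -
  have "bitlen m = Suc p \<longleftrightarrow> m < 2 ^ Suc p \<and> \<not> m < 2 ^ p"
    using bitlen_le_iff[of m p] bitlen_le_iff[of m "Suc p"] by linarith
  also have "\<dots> \<longleftrightarrow> bit m p \<and> (\<forall>k. bit m k \<longrightarrow> k \<le> p)"
  proof -
    have "m < 2 ^ p \<longleftrightarrow> \<not> bit m p" if "m < 2 ^ Suc p"
      using that unfolding less_power_iff_bit by (metis less_Suc_eq less_irrefl)
    then show ?thesis
      unfolding less_power_iff_bit[of m "Suc p"] less_Suc_eq_le by blast
  qed
  finally show ?thesis .
qed

lemma bitlen_eq_0_iff [simp]: "bitlen m = 0 \<longleftrightarrow> m = 0"
  using bitlen_pos_iff[of m] by (metis not_gr_zero)

lemma FO_bitlen [FO_intros]: "FO (\<lambda>w e. bitlen (e i) = e j)"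
proof -
  have "FO (\<lambda>w e. (e i = 0 \<and> e j = 0) \<or> (\<exists>p<length w. Suc p = e j \<and> bit (e i) p \<and> (\<forall>k<length w. bit (e i) k \<longrightarrow> k \<le> p)))"
    by (intro FO_intros)
  then show ?thesis
  proof (rule FO_cong)
    fix w e assume ok: "ok w e"
    have *: "bit (e i) k \<Longrightarrow> k < length w" for k
      using ok_lessD[OF ok, of i] bit_imp_less less_trans by blast
    have "e j < length w"
      using ok by (auto simp: ok_def)
    then have "bitlen (e i) = e j \<longleftrightarrow> (e i = 0 \<and> e j = 0) \<or> (\<exists>p<length w. Suc p = e j \<and> bitlen (e i) = Suc p)"
      by (cases "e j") auto
    then show "((e i = 0 \<and> e j = 0) \<or> (\<exists>p<length w. Suc p = e j \<and> bit (e i) p \<and> (\<forall>k<length w. bit (e i) k \<longrightarrow> k \<le> p)))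
      = (bitlen (e i) = e j)"
      unfolding bitlen_eq_Suc_iff using * by blast
  qed
qed

text \<open>On universes of bounded size every predicate is a finite disjunction over the possible
  values. This takes over where a formula is correct for large universes only.\<close>

lemma FO_small: "FO (\<lambda>w e. length w \<le> M \<and> Q (length w) (e i) (e j) (e k))"
proof -
  define X where "X = {p \<in> {..M} \<times> {..M} \<times> {..M} \<times> {..M}. Q (fst p) (fst (snd p)) (fst (snd (snd p))) (snd (snd (snd p)))}"
  have "FO (\<lambda>w e. \<exists>p\<in>X. length w = fst p \<and> e i = fst (snd p) \<and> e j = fst (snd (snd p)) \<and> e k = snd (snd (snd p)))"
    by (rule FO_Bex) (simp add: X_def, intro FO_intros FO_length_eq)
  then show ?thesis
  proof (rule FO_cong)
    fix w e assume "ok w e"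
    then have "e i < length w" "e j < length w" "e k < length w"
      by (auto simp: ok_def)
    then have "(length w, e i, e j, e k) \<in> X" if "length w \<le> M" "Q (length w) (e i) (e j) (e k)"
      using that by (simp add: X_def)
    then show "(\<exists>p\<in>X. length w = fst p \<and> e i = fst (snd p) \<and> e j = fst (snd (snd p)) \<and> e k = snd (snd (snd p))) =
      (length w \<le> M \<and> Q (length w) (e i) (e j) (e k))"
      by (force simp: X_def)
  qed
qed

section \<open>Paths stored in the bits of single elements\<close>

text \<open>A word \<open>u\<close> stores one number below \<open>2 ^ b\<close> in each of its \<open>b\<close>-bit fields;
  \<open>field b u p v\<close>: the field starting at position \<open>p\<close> contains \<open>v\<close>.\<close>

definition field :: "nat \<Rightarrow> nat \<Rightarrow> nat \<Rightarrow> nat \<Rightarrow> bool" where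
  "field b u p v \<longleftrightarrow> (\<forall>i. bit v i \<longleftrightarrow> i < b \<and> bit u (p + i))"

lemma field_unique: "field b u p v \<Longrightarrow> field b u p v' \<Longrightarrow> v = v'"
  unfolding field_def by (intro bit_eqI) auto

lemma FO_field [FO_intros]: "FO (\<lambda>w e. field (e i) (e j) (e k) (e l))"
proof -
  have "FO (\<lambda>w e. \<forall>m<length w. bit (e l) m \<longleftrightarrow> m < e i \<and> (\<exists>q<length w. e k + m = q \<and> bit (e j) q))"
    by (intro FO_intros)
  then show ?thesis
  proof (rule FO_cong)
    fix w e assume ok: "ok w e"
    have "bit (e x) m \<Longrightarrow> m < length w" for x m
      using ok_lessD[OF ok, of x] bit_imp_less less_trans by blast
    then show "(\<forall>m<length w. bit (e l) m \<longleftrightarrow> m < e i \<and> (\<exists>q<length w. e k + m = q \<and> bit (e j) q))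
      = field (e i) (e j) (e k) (e l)"
      unfolding field_def using ok_lessD[OF ok] by (metis add_lessD1 add.commute)
  qed
qed

text \<open>\<open>short_path n b R k s k' s'\<close>: there are words coding a path from \<open>(k, s)\<close> to \<open>(k', s')\<close>;
  \<open>P\<close> marks the positions of the fields.\<close>

definition field_step :: "nat \<Rightarrow> nat \<Rightarrow> (nat \<Rightarrow> nat \<Rightarrow> nat \<Rightarrow> nat \<Rightarrow> bool) \<Rightarrow> nat \<Rightarrow> nat \<Rightarrow> nat \<Rightarrow> nat \<Rightarrow> bool" where
  "field_step n b R u v p q \<longleftrightarrow> (\<exists>k<n. \<exists>s<n. \<exists>k'<n. \<exists>s'<n.
     field b u p k \<and> field b v p s \<and> field b u q k' \<and> field b v q s' \<and> R k s k' s')"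

text \<open>Every marked position below \<open>l\<close> has a marked successor at distance
  \<open>b\<close> that does not pass \<open>l\<close>. For \<open>b > 0\<close> the chain starting
  at 0 therefore cannot miss \<open>l\<close>.\<close>

definition path_code :: "nat \<Rightarrow> nat \<Rightarrow> (nat \<Rightarrow> nat \<Rightarrow> nat \<Rightarrow> nat \<Rightarrow> bool) \<Rightarrow> nat \<Rightarrow> nat \<Rightarrow> nat \<Rightarrow> nat \<Rightarrow> nat \<Rightarrow> bool" where
  "path_code n b R P u v z l \<longleftrightarrow> bit P z \<and>
     (\<forall>p<n. bit P p \<longrightarrow> p < l \<longrightarrow> (\<exists>q<n. p + b = q \<and> q \<le> l \<and> bit P q \<and> field_step n b R u v p q))"

definition short_path :: "nat \<Rightarrow> nat \<Rightarrow> (nat \<Rightarrow> nat \<Rightarrow> nat \<Rightarrow> nat \<Rightarrow> bool) \<Rightarrow> nat \<Rightarrow> nat \<Rightarrow> nat \<Rightarrow> nat \<Rightarrow> bool" where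
  "short_path n b R k s k' s' \<longleftrightarrow> (\<exists>P<n. \<exists>u<n. \<exists>v<n. \<exists>z<n. \<exists>l<n. z = 0 \<and> path_code n b R P u v z l \<and>
     field b u z k \<and> field b v z s \<and> field b u l k' \<and> field b v l s')"

lemma FO_subst4_env:
  "FO (\<lambda>w e. R w (e 0) (e 1) (e 2) (e 3) (\<lambda>i. e (i + 4))) \<Longrightarrow>
   FO (\<lambda>w e. R w (e a) (e b) (e c) (e d) (\<lambda>i. e (g i)))"
  using FO_subst[of "\<lambda>w e. R w (e 0) (e 1) (e 2) (e 3) (\<lambda>i. e (i + 4))"
      "\<lambda>x. if x = 0 then a else if x = 1 then b else if x = 2 then c else if x = 3 then d else g (x - 4)"] by simp

lemma FO_short_path:
  assumes "FO (\<lambda>w e. R w (e 0) (e 1) (e 2) (e 3) (\<lambda>i. e (i + 4)))"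
  shows "FO (\<lambda>w e. short_path (length w) (e b) (\<lambda>k s k' s'. R w k s k' s' (\<lambda>i. e (g i))) (e i) (e j) (e k) (e l))"
  unfolding short_path_def path_code_def field_step_def by (intro FO_intros FO_subst4_env[OF assms])

definition edges :: "nat \<Rightarrow> (nat \<Rightarrow> nat \<Rightarrow> nat \<Rightarrow> nat \<Rightarrow> bool) \<Rightarrow> ((nat \<times> nat) \<times> (nat \<times> nat)) set" where
  "edges n R = {((k, s), (k', s')). k < n \<and> s < n \<and> k' < n \<and> s' < n \<and> R k s k' s'}"

text \<open>The content of a field is unique, so the steps between consecutive fields chain up; the
  induction is on the distance from the last position \<open>l\<close>. Nothing is claimed about the
  number of steps.\<close>

lemma short_path_sound:
  assumes "short_path n b R k s k' s'" "b > 0"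
  shows "((k, s), (k', s')) \<in> (edges n R)\<^sup>*"
proof -
  obtain P u v l where code: "path_code n b R P u v 0 l" and
    f: "field b u 0 k" "field b v 0 s" "field b u l k'" "field b v l s'" and l: "l < n"
    using assms(1) unfolding short_path_def by auto
  have P: "bit P 0"
    using code by (simp add: path_code_def)
  have step: "p + b \<le> l \<and> p + b < n \<and> bit P (p + b) \<and> field_step n b R u v p (p + b)"
    if "p < n" "bit P p" "p < l" for p
    using code that unfolding path_code_def by auto
  have "((x, y), (k', s')) \<in> (edges n R)\<^sup>*" if "p \<le> l" "p < n" "bit P p" "field b u p x" "field b v p y" for p x y
    using that
  proof (induction "l - p" arbitrary: p x y rule: less_induct)
    case less
    show ?case
    proof (cases "p = l")
      case True
      then show ?thesis using less.prems f field_unique by blast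
    next
      case False
      with less.prems have pl: "p < l" by simp
      obtain k1 s1 k2 s2 where *: "k1 < n" "s1 < n" "k2 < n" "s2 < n" "field b u p k1" "field b v p s1"
        "field b u (p + b) k2" "field b v (p + b) s2" "R k1 s1 k2 s2" and q: "p + b \<le> l" "p + b < n" "bit P (p + b)"
        using step[OF less.prems(2,3) pl] unfolding field_step_def by blast
      have "k1 = x" "s1 = y"
        using * less.prems field_unique by blast+
      with * have "((x, y), (k2, s2)) \<in> edges n R"
        by (simp add: edges_def)
      moreover have "((k2, s2), (k', s')) \<in> (edges n R)\<^sup>*"
        using less.hyps[of "p + b" k2 s2] q * pl assms(2) by simp
      ultimately show ?thesis by (rule converse_rtrancl_into_rtrancl)
    qed
  qed
  then show ?thesis using P f l by (metis le0 le_less_trans)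
qed

lemma field_word:
  assumes "\<And>i. bit u i \<longleftrightarrow> i < Suc t * b \<and> bit (a (i div b)) (i mod b)" "a j < 2 ^ b" "j \<le> t" "b > 0"
  shows "field b u (j * b) (a j)"
  unfolding field_def
proof
  fix i
  show "bit (a j) i \<longleftrightarrow> i < b \<and> bit u (j * b + i)"
  proof (cases "i < b")
    case True
    have "j * b + i < Suc j * b"
      using True by simp
    also have "\<dots> \<le> Suc t * b"
      using assms(3) by (intro mult_right_mono) auto
    finally have "j * b + i < Suc t * b" .
    moreover have "(j * b + i) div b = j" "(j * b + i) mod b = i"
      using True by auto
    ultimately show ?thesis using True assms(1) by simp
  next
    case False
    then show ?thesis using assms(2) less_power_iff_bit by blast
  qed
qed

text \<open>The \<open>Suc t\<close> states of the path, written in fields of \<open>b\<close> bits,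
  form words of at most \<open>W\<close> bits, and these are elements because
  \<open>2 ^ W \<le> n\<close>.\<close>

lemma short_path_complete:
  assumes "\<And>j. j < t \<Longrightarrow> R (a j) (c j) (a (Suc j)) (c (Suc j))"
    and "\<And>j. j \<le> t \<Longrightarrow> a j < 2 ^ b \<and> c j < 2 ^ b"
    and "Suc t * b \<le> W" "2 ^ W \<le> n" "b > 0"
  shows "short_path n b R (a 0) (c 0) (a t) (c t)"
proof -
  obtain P :: nat where P: "P < 2 ^ (Suc t * b)" "\<And>i. bit P i \<longleftrightarrow> i < Suc t * b \<and> b dvd i"
    using ex_word[of "Suc t * b" "\<lambda>i. b dvd i"] by metis
  obtain u :: nat where u: "u < 2 ^ (Suc t * b)" "\<And>i. bit u i \<longleftrightarrow> i < Suc t * b \<and> bit (a (i div b)) (i mod b)"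
    using ex_word[of "Suc t * b" "\<lambda>i. bit (a (i div b)) (i mod b)"] by metis
  obtain v :: nat where v: "v < 2 ^ (Suc t * b)" "\<And>i. bit v i \<longleftrightarrow> i < Suc t * b \<and> bit (c (i div b)) (i mod b)"
    using ex_word[of "Suc t * b" "\<lambda>i. bit (c (i div b)) (i mod b)"] by metis
  have "2 ^ (Suc t * b) \<le> (2::nat) ^ W"
    using assms(3) by (intro power_increasing) auto
  then have n: "2 ^ (Suc t * b) \<le> n"
    using assms(4) by linarith
  have fu: "field b u (j * b) (a j)" and fv: "field b v (j * b) (c j)" if "j \<le> t" for j
    using field_word[OF u(2)] field_word[OF v(2)] assms(2,5) that by auto
  have b1: "Suc t * b < n"
    using n less_exp[of "Suc t * b"] by linarith
  have bn: "a j < n" "c j < n" if "j \<le> t" for j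
  proof -
    have "2 ^ b \<le> (2::nat) ^ (Suc t * b)"
      by (intro power_increasing) auto
    then show "a j < n" "c j < n"
      using n assms(2)[OF that] by linarith+
  qed
  have step: "\<exists>q<n. p + b = q \<and> q \<le> t * b \<and> bit P q \<and> field_step n b R u v p q" if "bit P p" "p < t * b" for p
  proof -
    from that obtain j where j: "p = j * b" "j < t"
      unfolding P(2) by (metis assms(5) dvd_def mult.commute mult_less_cancel2)
    have le: "Suc j * b \<le> t * b"
      using j(2) by (intro mult_right_mono) auto
    have q: "p + b < n" "p + b \<le> t * b" "p + b = Suc j * b"
      using b1 j le by simp_all
    have "bit P (Suc j * b)"
      unfolding P(2) using le_less_trans[OF le, of "Suc t * b"] assms(5) by (simp only: dvd_triv_right) simp
    then have P': "bit P (p + b)"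
      by (simp only: q(3))
    have *: "a j < n" "c j < n" "a (Suc j) < n" "c (Suc j) < n"
      using bn[of j] bn[of "Suc j"] j(2) by auto
    have **: "field b u p (a j)" "field b v p (c j)" "field b u (p + b) (a (Suc j))" "field b v (p + b) (c (Suc j))"
      unfolding q(3) unfolding j(1) using fu[of j] fv[of j] fu[of "Suc j"] fv[of "Suc j"] j(2) by auto
    then have "field_step n b R u v p (p + b)"
      using * assms(1)[OF j(2)] unfolding field_step_def by blast
    then show ?thesis
      using P' q(1,2) by blast
  qed
  have n': "t * b < n" "P < n" "u < n" "v < n" "0 < n"
    using b1 P(1) u(1) v(1) n by auto
  have "bit P 0"
    unfolding P(2) using assms(5) by simp
  then have "path_code n b R P u v 0 (t * b)"
    using step unfolding path_code_def by blast
  moreover have "field b u 0 (a 0)" "field b v 0 (c 0)" "field b u (t * b) (a t)" "field b v (t * b) (c t)"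
    using fu[of 0] fv[of 0] fu[of t] fv[of t] by auto
  ultimately show ?thesis
    unfolding short_path_def using n' by blast
qed

text \<open>Two levels of coded paths reach \<open>q\<^sup>2\<close> steps, which covers all paths of logarithmic length.\<close>

definition log_path :: "nat \<Rightarrow> nat \<Rightarrow> (nat \<Rightarrow> nat \<Rightarrow> nat \<Rightarrow> nat \<Rightarrow> bool) \<Rightarrow> nat \<Rightarrow> nat \<Rightarrow> nat \<Rightarrow> nat \<Rightarrow> bool" where
  "log_path n b R = short_path n b (short_path n b R)"

lemma FO_log_path:
  assumes "FO (\<lambda>w e. R w (e 0) (e 1) (e 2) (e 3) (\<lambda>i. e (i + 4)))"
  shows "FO (\<lambda>w e. log_path (length w) (e b) (\<lambda>k s k' s'. R w k s k' s' (\<lambda>i. e (g i))) (e i) (e j) (e k) (e l))"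
proof -
  have "FO (\<lambda>w e. short_path (length w) (e 4) (\<lambda>k s k' s'. R w k s k' s' (\<lambda>i. e (i + 5))) (e 0) (e 1) (e 2) (e 3))"
    by (rule FO_short_path[OF assms])
  then have "FO (\<lambda>w e. short_path (length w) (e (0 + 4)) (\<lambda>k s k' s'. R w k s k' s' (\<lambda>i. e (Suc i + 4))) (e 0) (e 1) (e 2) (e 3))"
    by (simp add: add.commute)
  from FO_short_path[of "\<lambda>w k s k' s' e. short_path (length w) (e 0) (\<lambda>k s k' s'. R w k s k' s' (\<lambda>i. e (Suc i))) k s k' s'",
      OF this, of b "case_nat b g" i j k l]
  show ?thesis
    unfolding log_path_def by simp
qed

lemma log_path_sound:
  assumes "log_path n b R k s k' s'" "b > 0"
  shows "((k, s), (k', s')) \<in> (edges n R)\<^sup>*"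
proof -
  have "edges n (short_path n b R) \<subseteq> (edges n R)\<^sup>*"
    using short_path_sound assms(2) unfolding edges_def[of n "short_path n b R"] by auto
  then have "(edges n (short_path n b R))\<^sup>* \<subseteq> (edges n R)\<^sup>*"
    by (metis rtrancl_idemp rtrancl_mono)
  then show ?thesis
    using short_path_sound assms unfolding log_path_def by blast
qed

lemma log_path_complete:
  assumes step: "\<And>j. j < t \<Longrightarrow> R (a j) (c j) (a (Suc j)) (c (Suc j))"
    and bound: "\<And>j. j \<le> t \<Longrightarrow> a j < 2 ^ b \<and> c j < 2 ^ b"
    and "t \<le> q * q" "Suc q * b \<le> W" "2 ^ W \<le> n" "b > 0"
  shows "log_path n b R (a 0) (c 0) (a t) (c t)"
proof -
  \<comment> \<open>The path is cut every \<open>q\<close> steps. The minimum lets the pieces beyond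
    its end degenerate to paths of length 0, so that there are always exactly \<open>q\<close>
    pieces.\<close>
  define a' c' where "a' = (\<lambda>j. a (min t (j * q)))" and "c' = (\<lambda>j. c (min t (j * q)))"
  have "short_path n b R (a' j) (c' j) (a' (Suc j)) (c' (Suc j))" for j
  proof -
    define t0 where "t0 = min t (Suc j * q) - min t (j * q)"
    have "t0 \<le> q"
      unfolding t0_def by auto
    then have "Suc t0 * b \<le> W"
      using assms(4) mult_le_mono1[of "Suc t0" "Suc q" b] by linarith
    moreover have "t0 + min t (j * q) = min t (Suc j * q)"
      unfolding t0_def by (simp add: min_def)
    ultimately show ?thesis
      using short_path_complete[of t0 R "\<lambda>i. a (i + min t (j * q))" "\<lambda>i. c (i + min t (j * q))" b W n]
        step bound assms(5,6) unfolding a'_def c'_def by auto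
  qed
  then have "short_path n b (short_path n b R) (a' 0) (c' 0) (a' q) (c' q)"
    by (intro short_path_complete[of q _ a' c' b W n]) (use bound assms in \<open>auto simp: a'_def c'_def\<close>)
  then show ?thesis
    using assms(3) unfolding log_path_def a'_def c'_def by (simp add: min_absorb1)
qed

text \<open>Think of \<open>L\<close> as the number of bits of an element. A state of a run of
  length \<open>L\<close> needs \<open>bitlen L\<close> bits and a word offers \<open>L - 1\<close>;
  hence \<open>Suc q\<close> states fit into a word, while \<open>q * q\<close> steps cover the run.
  The witness is a power of two close to the square root of \<open>L\<close>.\<close>

lemma ex_log_size:
  assumes "(L::nat) \<ge> 2 ^ 12"
  shows "\<exists>q. L \<le> q * q \<and> Suc q * bitlen L \<le> L - 1"
proof -
  define c where "c = (bitlen L + 1) div 2"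
  \<comment> \<open>At \<open>c = 6\<close> the claim reads \<open>65 * 12 + 1 \<le> 2 ^ 10\<close>;
    at 5 it would fail. The assumption on \<open>L\<close> makes \<open>c\<close> at least
    6.\<close>
  have aux: "(2 ^ c + 1) * (2 * c) + 1 \<le> (2::nat) ^ (2 * c - 2)" if "c \<ge> 6" for c
    using that
  proof (induction c rule: dec_induct)
    case (step c)
    have "(2 ^ Suc c + 1) * (2 * Suc c) + 1 \<le> 4 * ((2 ^ c + 1) * (2 * c) + (1::nat))"
    proof -
      have "2 ^ c * 1 \<le> 2 ^ c * (c::nat)"
        using step.hyps by (intro mult_le_mono2) simp
      then have "2 ^ c + 1 \<le> 2 ^ c * c + (c::nat)"
        using step.hyps by linarith
      then show ?thesis by (simp add: algebra_simps)
    qed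
    also have "\<dots> \<le> 4 * 2 ^ (2 * c - 2)"
      using step by simp
    also have "\<dots> = 2 ^ (2 + (2 * c - 2))"
      by (simp only: power_add) simp
    also have "2 + (2 * c - 2) = 2 * Suc c - 2"
      using step.hyps by simp
    finally show ?case .
  qed simp
  have b: "bitlen L > 12"
    using assms by (simp only: less_bitlen_iff)
  then have c6: "c \<ge> 6"
    unfolding c_def by simp
  have b2: "bitlen L \<le> 2 * c" "2 * c - 2 \<le> bitlen L - 1"
    unfolding c_def by auto
  have "L < 2 ^ (2 * c)"
    using b2(1) by (simp add: bitlen_le_iff)
  then have "L \<le> 2 ^ c * 2 ^ c"
    by (simp add: mult_2 power_add)
  moreover have "Suc (2 ^ c) * bitlen L \<le> (2 ^ c + 1) * (2 * c)"
    using mult_le_mono2[OF b2(1), of "Suc (2 ^ c)"] by simp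
  moreover have "2 ^ (2 * c - 2) \<le> L"
    using b2(2) b less_bitlen_iff[of "2 * c - 2" L] by linarith
  ultimately show ?thesis
    using aux[OF c6] by (intro exI[of _ "2 ^ c"]) linarith
qed

text \<open>The threshold from which \<open>ex_log_size\<close> applies to the number of bits of the
  largest element.\<close>

definition large :: "nat \<Rightarrow> bool" where
  "large n \<longleftrightarrow> 2 ^ 12 \<le> bitlen (n - 1)"

text \<open>The first component of a state is the time and bounds the second one, so all states of a
  run of length at most \<open>bitlen (n - 1)\<close> fit into fields of \<open>b\<close> bits. As
  the time grows by one in each step, reaching \<open>(m, s)\<close> at all means reaching it by a
  run \<open>g\<close> of \<open>m\<close> steps.\<close>

lemma log_path_iff:
  assumes large: "large n" and b: "b = bitlen (bitlen (n - 1))" and m: "m \<le> bitlen (n - 1)"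
    and R: "\<And>k s k' s'. R k s k' s' \<Longrightarrow> s \<le> k \<Longrightarrow> k' = Suc k \<and> s' \<le> k'"
  shows "log_path n b R 0 0 m s \<longleftrightarrow> (\<exists>g. g 0 = 0 \<and> g m = s \<and> (\<forall>k<m. R k (g k) (Suc k) (g (Suc k))))"
proof
  have b0: "b > 0"
    using large unfolding b large_def by (simp add: less_bitlen_iff)
  {
    assume "log_path n b R 0 0 m s"
    then have "((0, 0), (m, s)) \<in> (edges n R)\<^sup>*"
      using log_path_sound b0 by blast
    then have "s \<le> m \<and> (\<exists>g. g 0 = 0 \<and> g m = s \<and> (\<forall>k<m. R k (g k) (Suc k) (g (Suc k))))"
    proof (induction "(m, s)" arbitrary: m s rule: rtrancl_induct)
      case base
      then show ?case by auto
    next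
      case (step y)
      obtain k s1 where y: "y = (k, s1)" by (cases y)
      have IH: "s1 \<le> k" "\<exists>g. g 0 = 0 \<and> g k = s1 \<and> (\<forall>j<k. R j (g j) (Suc j) (g (Suc j)))"
        using step.hyps(3)[OF y] by auto
      have r: "R k s1 m s"
        using step.hyps(2) unfolding y edges_def by auto
      then have m: "m = Suc k" "s \<le> m"
        using R IH(1) by blast+
      obtain g where g: "g 0 = 0" "g k = s1" "\<forall>j<k. R j (g j) (Suc j) (g (Suc j))"
        using IH(2) by blast
      have "(g(Suc k := s)) 0 = 0 \<and> (g(Suc k := s)) m = s \<and> (\<forall>j<m. R j ((g(Suc k := s)) j) (Suc j) ((g(Suc k := s)) (Suc j)))"
        using g r m by (auto simp: less_Suc_eq)
      then show ?case using m by blast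
    qed
    then show "\<exists>g. g 0 = 0 \<and> g m = s \<and> (\<forall>k<m. R k (g k) (Suc k) (g (Suc k)))"
      by blast
  }
  {
    assume "\<exists>g. g 0 = 0 \<and> g m = s \<and> (\<forall>k<m. R k (g k) (Suc k) (g (Suc k)))"
    then obtain g where g: "g 0 = 0" "g m = s" "\<And>k. k < m \<Longrightarrow> R k (g k) (Suc k) (g (Suc k))"
      by blast
    have le: "g k \<le> k" if "k \<le> m" for k
      using that
    proof (induction k)
      case (Suc k)
      then show ?case using R[OF g(3)[of k]] by auto
    qed (use g in simp)
    obtain q where q: "bitlen (n - 1) \<le> q * q" "Suc q * b \<le> bitlen (n - 1) - 1"
      using ex_log_size large unfolding large_def b by blast
    have "2 ^ (bitlen (n - 1) - 1) \<le> n - 1"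
      using large unfolding large_def by (subst less_bitlen_iff[symmetric]) simp
    then have w: "2 ^ (bitlen (n - 1) - 1) \<le> n"
      by linarith
    have "k < 2 ^ b" if "k \<le> m" for k
      using less_power_bitlen[of "bitlen (n - 1)"] that m unfolding b by linarith
    then show "log_path n b R 0 0 m s"
      using log_path_complete[of m R "\<lambda>k. k" g b q "bitlen (n - 1) - 1" n] g q w b0 m le
      by (metis le_trans le_less_trans)
  }
qed

section \<open>Multiplication by the schoolbook method\<close>

definition column :: "nat \<Rightarrow> nat \<Rightarrow> nat \<Rightarrow> nat" where
  "column x y k = (\<Sum>i\<le>k. of_bool (bit x i \<and> bit y (k - i)))"

text \<open>Counts the partial products of weight \<open>2 ^ k\<close> one at a time: place
  \<open>i\<close> contributes if bit \<open>i\<close> of \<open>x\<close> and the complementary bit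
  of \<open>y\<close> are set.\<close>

definition column_step :: "nat \<Rightarrow> nat \<Rightarrow> nat \<Rightarrow> nat \<Rightarrow> nat \<Rightarrow> nat \<Rightarrow> nat \<Rightarrow> nat \<Rightarrow> bool" where
  "column_step n x y k i s i' s' \<longleftrightarrow> Suc i = i' \<and>
     (if bit x i \<and> (\<exists>j<n. i + j = k \<and> bit y j) then Suc s = s' else s = s')"

lemma FO_column_step: "FO (\<lambda>w e. column_step (length w) (e x) (e y) (e k) (e i) (e s) (e i') (e s'))"
  unfolding column_step_def by (intro FO_intros FO_if)

lemma column_log_path:
  assumes "large n" "b = bitlen (bitlen (n - 1))" "k < bitlen (n - 1)" "y < n"
  shows "log_path n b (column_step n x y k) 0 0 (Suc k) s \<longleftrightarrow> s = column x y k"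
proof -
  have "log_path n b (column_step n x y k) 0 0 (Suc k) s \<longleftrightarrow>
    (\<exists>g. g 0 = 0 \<and> g (Suc k) = s \<and> (\<forall>i<Suc k. column_step n x y k i (g i) (Suc i) (g (Suc i))))"
    by (rule log_path_iff[OF assms(1,2)]) (use assms(3) in \<open>auto simp: column_step_def split: if_splits\<close>)
  also have "\<dots> \<longleftrightarrow> s = (\<Sum>i<Suc k. of_bool (bit x i \<and> bit y (k - i)))"
  proof -
    have *: "column_step n x y k i u (Suc i) v \<longleftrightarrow> v = u + of_bool (bit x i \<and> bit y (k - i))" if "i < Suc k" for i u v
    proof -
      have "(\<exists>j<n. i + j = k \<and> bit y j) \<longleftrightarrow> bit y (k - i)"
        using that assms(4) bit_imp_less[of y "k - i"] by (metis add_diff_inverse_nat diff_add_inverse less_Suc_eq_le less_trans not_less)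
      then show ?thesis unfolding column_step_def by auto
    qed
    show ?thesis
    proof
      assume "\<exists>g. g 0 = 0 \<and> g (Suc k) = s \<and> (\<forall>i<Suc k. column_step n x y k i (g i) (Suc i) (g (Suc i)))"
      then obtain g where g: "g 0 = 0" "g (Suc k) = s" "\<forall>i<Suc k. g (Suc i) = g i + of_bool (bit x i \<and> bit y (k - i))"
        using * by auto
      have "m \<le> Suc k \<Longrightarrow> g m = (\<Sum>i<m. of_bool (bit x i \<and> bit y (k - i)))" for m
        by (induction m) (use g in auto)
      then show "s = (\<Sum>i<Suc k. of_bool (bit x i \<and> bit y (k - i)))" using g(2) by blast
    next
      assume "s = (\<Sum>i<Suc k. of_bool (bit x i \<and> bit y (k - i)))"
      then show "\<exists>g. g 0 = 0 \<and> g (Suc k) = s \<and> (\<forall>i<Suc k. column_step n x y k i (g i) (Suc i) (g (Suc i)))"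
        by (intro exI[of _ "\<lambda>m. \<Sum>i<m. of_bool (bit x i \<and> bit y (k - i))"]) (auto simp: *)
    qed
  qed
  finally show ?thesis
    by (simp add: column_def lessThan_Suc_atMost)
qed

lemma column_le: "column x y k \<le> Suc k"
  unfolding column_def using sum_bounded_above[of "{..k}" "\<lambda>i. of_bool (bit x i \<and> bit y (k - i))" "1::nat"] by simp

lemma nat_eq_sum_bits: "x < 2 ^ n \<Longrightarrow> x = (\<Sum>i<n. of_bool (bit x i) * 2 ^ i)" for x :: nat
  using take_bit_sum[of n x] by (simp add: take_bit_nat_eq_self push_bit_eq_mult lessThan_atLeast0)

lemma product_columns:
  assumes "\<And>i j. bit x i \<Longrightarrow> bit y j \<Longrightarrow> i + j < n"
  shows "x * y = (\<Sum>k<n. column x y k * 2 ^ k)"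
proof -
  define N where "N = n + bitlen x + bitlen y"
  have "x < 2 ^ N" "y < 2 ^ N"
    by (simp_all add: N_def flip: bitlen_le_iff)
  then have "x * y = (\<Sum>i<N. of_bool (bit x i) * 2 ^ i) * (\<Sum>j<N. of_bool (bit y j) * 2 ^ j)"
    using nat_eq_sum_bits by metis
  also have "\<dots> = (\<Sum>(i, j)\<in>{..<N} \<times> {..<N}. of_bool (bit x i) * 2 ^ i * (of_bool (bit y j) * 2 ^ j))"
    unfolding sum_product by (rule sum.cartesian_product)
  also have "\<dots> = (\<Sum>(i, j)\<in>{(i, j). i + j < n}. of_bool (bit x i) * 2 ^ i * (of_bool (bit y j) * 2 ^ j))"
  proof (rule sum.mono_neutral_right)
    show "{(i, j). i + j < n} \<subseteq> {..<N} \<times> {..<N}"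
      by (auto simp: N_def)
  qed (use assms in auto)
  also have "\<dots> = (\<Sum>k<n. \<Sum>i\<le>k. of_bool (bit x i) * 2 ^ i * (of_bool (bit y (k - i)) * 2 ^ (k - i)))"
    by (rule sum.triangle_reindex)
  also have "\<dots> = (\<Sum>k<n. column x y k * 2 ^ k)"
    unfolding column_def sum_distrib_right
    by (intro sum.cong refl) (auto simp flip: power_add)
  finally show ?thesis .
qed

text \<open>The carries are numbers, not bits: \<open>c k\<close> is the sum of the columns below
  \<open>k\<close>, divided by \<open>2 ^ k\<close>. Only columns below \<open>L\<close> are added
  up, so it must also be said that no partial product lies beyond them; a product below
  \<open>2 ^ L\<close> cannot have one.\<close>

lemma product_iff_carries:
  assumes z: "z < 2 ^ L"
  shows "x * y = z \<longleftrightarrow> (\<forall>i j. bit x i \<longrightarrow> bit y j \<longrightarrow> i + j < L) \<and>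
    (\<exists>c. c 0 = 0 \<and> c L = 0 \<and> (\<forall>k<L. c k + column x y k = 2 * c (Suc k) + of_bool (bit z k)))"
    (is "_ \<longleftrightarrow> ?A \<and> ?B")
proof -
  define S where "S K = (\<Sum>k<K. column x y k * 2 ^ k)" for K
  show ?thesis
  proof (intro iffI conjI)
    assume eq: "x * y = z"
    show A: ?A
    proof (intro allI impI)
      fix i j assume "bit x i" "bit y j"
      then have "2 ^ i * 2 ^ j \<le> x * y"
        by (intro mult_mono bit_imp_power_le) auto
      then have "2 ^ (i + j) < (2::nat) ^ L"
        using z eq by (simp add: power_add)
      then show "i + j < L" by simp
    qed
    then have SL: "S L = z"
      using product_columns eq unfolding S_def by metis
    \<comment> \<open>The columns from \<open>K\<close> on contribute multiples of
      \<open>2 ^ K\<close>, so the lower bits are settled by the columns below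
      \<open>K\<close>.\<close>
    have rem: "S K mod 2 ^ K = z mod 2 ^ K" if "K \<le> L" for K
    proof -
      have "S L = S K + (\<Sum>k\<in>{K..<L}. column x y k * 2 ^ k)"
        unfolding S_def using sum.atLeastLessThan_concat[of 0 K L "\<lambda>k. column x y k * 2 ^ k"] that
        by (simp add: lessThan_atLeast0)
      moreover have "2 ^ K dvd (\<Sum>k\<in>{K..<L}. column x y k * 2 ^ k)"
        by (intro dvd_sum dvd_mult le_imp_power_dvd) auto
      ultimately show ?thesis
        unfolding SL by (metis mod_add_right_eq dvd_imp_mod_0 add_0_right)
    qed
    have dec: "S K = 2 ^ K * (S K div 2 ^ K) + z mod 2 ^ K" if "K \<le> L" for K
      using rem[OF that] by (metis mult_div_mod_eq)
    have "S k div 2 ^ k + column x y k = 2 * (S (Suc k) div 2 ^ Suc k) + of_bool (bit z k)" if "k < L" for k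
    proof -
      have "2 ^ Suc k * (S (Suc k) div 2 ^ Suc k) + z mod 2 ^ Suc k = S k + column x y k * 2 ^ k"
        using dec[of "Suc k"] that by (simp add: S_def)
      moreover have "z mod 2 ^ Suc k = 2 ^ k * of_bool (bit z k) + z mod 2 ^ k"
        using take_bit_Suc_from_most[of k z] by (simp add: take_bit_eq_mod)
      ultimately have "2 ^ k * (S k div 2 ^ k + column x y k) = 2 ^ k * (2 * (S (Suc k) div 2 ^ Suc k) + of_bool (bit z k))"
        using dec[of k] that by (simp add: algebra_simps)
      then show ?thesis by (simp only: mult_cancel1) auto
    qed
    moreover have "S 0 div 2 ^ 0 = 0" "S L div 2 ^ L = 0"
      using SL z by (simp_all add: S_def)
    ultimately show ?B
      by (intro exI[of _ "\<lambda>k. S k div 2 ^ k"]) auto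
  next
    assume "?A \<and> ?B"
    then obtain c where A: ?A and c: "c 0 = 0" "c L = 0"
      "\<And>k. k < L \<Longrightarrow> c k + column x y k = 2 * c (Suc k) + of_bool (bit z k)"
      by blast
    have "S K = 2 ^ K * c K + z mod 2 ^ K" if "K \<le> L" for K
      using that
    proof (induction K)
      case 0
      then show ?case using c by (simp add: S_def)
    next
      case (Suc k)
      have "z mod 2 ^ Suc k = 2 ^ k * of_bool (bit z k) + z mod 2 ^ k"
        using take_bit_Suc_from_most[of k z] by (simp add: take_bit_eq_mod)
      moreover have "S (Suc k) = 2 ^ k * (c k + column x y k) + z mod 2 ^ k"
        using Suc by (simp add: S_def algebra_simps)
      ultimately show ?case
        using c(3)[of k] Suc by (simp add: algebra_simps)
    qed
    then have "S L = z"
      using c(2) z by simp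
    then show "x * y = z"
      using product_columns A unfolding S_def by metis
  qed
qed

text \<open>The state of this outer run is the carry, and the column sum that it needs is the result
  of an inner run. Every intermediate number is named by a quantifier, since formulas can only
  mention elements.\<close>

definition carry_step :: "nat \<Rightarrow> nat \<Rightarrow> nat \<Rightarrow> nat \<Rightarrow> nat \<Rightarrow> nat \<Rightarrow> nat \<Rightarrow> nat \<Rightarrow> nat \<Rightarrow> nat \<Rightarrow> bool" where
  "carry_step n L b x y z k c k' c' \<longleftrightarrow> Suc k = k' \<and> k < L \<and>
     (\<exists>r<n. r = 0 \<and> (\<exists>s<n. log_path n b (column_step n x y k) r r k' s \<and>
        (\<exists>t<n. c + s = t \<and> (\<exists>d<n. c' + c' = d \<and> (if bit z k then Suc d = t else d = t)))))"

lemma FO_column_log_path: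
  "FO (\<lambda>w e. log_path (length w) (e b) (column_step (length w) (e x) (e y) (e k)) (e i) (e j) (e l) (e m))"
proof -
  have "FO (\<lambda>w e. column_step (length w) (e (0 + 4)) (e (1 + 4)) (e (2 + 4)) (e 0) (e 1) (e 2) (e 3))"
    by (rule FO_column_step)
  from FO_log_path[of "\<lambda>w k s k' s' e. column_step (length w) (e 0) (e 1) (e 2) k s k' s'", OF this,
      of b "\<lambda>v. if v = 0 then x else if v = 1 then y else k" i j l m]
  show ?thesis by simp
qed

lemma FO_carry_step:
  "FO (\<lambda>w e. carry_step (length w) (e L) (e b) (e x) (e y) (e z) (e k) (e c) (e k') (e c'))"
  unfolding carry_step_def by (intro FO_intros FO_if FO_column_log_path)

lemma FO_carry_log_path:
  "FO (\<lambda>w e. log_path (length w) (e b) (carry_step (length w) (e L) (e b') (e x) (e y) (e z)) (e i) (e j) (e l) (e m))"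
proof -
  have "FO (\<lambda>w e. carry_step (length w) (e (0 + 4)) (e (1 + 4)) (e (2 + 4)) (e (3 + 4)) (e (4 + 4)) (e 0) (e 1) (e 2) (e 3))"
    by (rule FO_carry_step)
  from FO_log_path[of "\<lambda>w k s k' s' e. carry_step (length w) (e 0) (e 1) (e 2) (e 3) (e 4) k s k' s'", OF this,
      of b "\<lambda>v. if v = 0 then L else if v = 1 then b' else if v = 2 then x else if v = 3 then y else z" i j l m]
  show ?thesis by simp
qed

definition times_formula :: "nat \<Rightarrow> nat \<Rightarrow> nat \<Rightarrow> nat \<Rightarrow> bool" where
  "times_formula n x y z \<longleftrightarrow> (\<exists>m<n. m = n - Suc 0 \<and> (\<exists>L<n. bitlen m = L \<and> (\<exists>b<n. bitlen L = b \<and>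
     (\<forall>i<n. bit x i \<longrightarrow> (\<forall>j<n. bit y j \<longrightarrow> (\<exists>k<n. i + j = k \<and> k < L))) \<and>
     (\<exists>r<n. r = 0 \<and> log_path n b (carry_step n L b x y z) r r L r))))"

lemma FO_times_formula: "FO (\<lambda>w e. times_formula (length w) (e x) (e y) (e z))"
  unfolding times_formula_def by (intro FO_intros FO_carry_log_path)

lemma four_mult_le_power: "4 \<le> m \<Longrightarrow> 4 * m \<le> (2::nat) ^ m"
  by (induction m rule: dec_induct) auto

lemma times_formula_iff:
  assumes "large n" "x < n" "y < n" "z < n"
  shows "times_formula n x y z \<longleftrightarrow> x * y = z"
proof -
  define L where "L = bitlen (n - 1)"
  define b where "b = bitlen L"
  have L12: "2 ^ 12 \<le> L"
    using assms(1) by (simp add: large_def L_def)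
  have "2 ^ (L - 1) \<le> n - 1"
    using L12 unfolding L_def by (subst less_bitlen_iff[symmetric]) simp
  moreover have "4 * (L - 1) \<le> 2 ^ (L - 1)"
    using L12 by (intro four_mult_le_power) auto
  moreover have "4096 \<le> L"
    using L12 by simp
  \<comment> \<open>For \<open>k < L\<close>, carries are at most \<open>k\<close> and column sums
    at most \<open>Suc k\<close>; hence all numbers that the formula has to name are
    elements.\<close>
  ultimately have Ln: "3 * L < n"
    by linarith
  have bL: "b \<le> L"
    unfolding b_def by (rule bitlen_le)
  have z: "z < 2 ^ L"
    using less_power_bitlen[of "n - 1"] assms(4) unfolding L_def by linarith
  have bits: "i < n" if "bit x i \<or> bit y i" for i
    using that bit_imp_less assms(2,3) less_trans by blast
  have step: "carry_step n L b x y z k c k' c' \<longleftrightarrow> k' = Suc k \<and> k < L \<and> c + column x y k = 2 * c' + of_bool (bit z k)"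
    if "c \<le> k" for k c k' c'
  proof (cases "k' = Suc k \<and> k < L")
    case True
    have col: "log_path n b (column_step n x y k) 0 0 (Suc k) s \<longleftrightarrow> s = column x y k" for s
      by (rule column_log_path) (use True assms in \<open>auto simp: b_def L_def\<close>)
    have "column x y k < n" "c + column x y k < n"
      using column_le[of x y k] that True Ln by auto
    then have "carry_step n L b x y z k c k' c' \<longleftrightarrow>
      (\<exists>d<n. c' + c' = d \<and> (if bit z k then Suc d = c + column x y k else d = c + column x y k))"
      using True unfolding carry_step_def by (auto simp: col)
    also have "\<dots> \<longleftrightarrow> c + column x y k = 2 * c' + of_bool (bit z k)"
      using \<open>c + column x y k < n\<close> by auto
    finally show ?thesis using True by simp
  qed (auto simp: carry_step_def)
  have "log_path n b (carry_step n L b x y z) 0 0 L 0 \<longleftrightarrow>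
    (\<exists>c. c 0 = 0 \<and> c L = 0 \<and> (\<forall>k<L. carry_step n L b x y z k (c k) (Suc k) (c (Suc k))))"
  proof (rule log_path_iff)
    fix k s k' s' assume *: "carry_step n L b x y z k s k' s'" "s \<le> k"
    then show "k' = Suc k \<and> s' \<le> k'"
      using step[OF *(2), of k' s'] column_le[of x y k] by auto
  qed (use assms in \<open>auto simp: b_def L_def\<close>)
  also have "\<dots> \<longleftrightarrow> (\<exists>c. c 0 = 0 \<and> c L = 0 \<and> (\<forall>k<L. c k + column x y k = 2 * c (Suc k) + of_bool (bit z k)))"
  proof (intro iffI; elim exE conjE)
    fix c assume c: "c 0 = (0::nat)" "c L = 0" "\<forall>k<L. carry_step n L b x y z k (c k) (Suc k) (c (Suc k))"
    have "k \<le> L \<Longrightarrow> c k \<le> k" for k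
    proof (induction k)
      case (Suc k)
      then have "c k \<le> k" "carry_step n L b x y z k (c k) (Suc k) (c (Suc k))"
        using c(3) by simp_all
      then have "c k + column x y k = 2 * c (Suc k) + of_bool (bit z k)"
        using step by blast
      then show ?case
        using column_le[of x y k] \<open>c k \<le> k\<close> by linarith
    qed (use c in auto)
    then show "\<exists>c. c 0 = 0 \<and> c L = 0 \<and> (\<forall>k<L. c k + column x y k = 2 * c (Suc k) + of_bool (bit z k))"
      using c step by (intro exI[of _ c]) auto
  next
    fix c assume c: "c 0 = (0::nat)" "c L = 0" "\<forall>k<L. c k + column x y k = 2 * c (Suc k) + of_bool (bit z k)"
    have "k \<le> L \<Longrightarrow> c k \<le> k" for k
    proof (induction k)
      case (Suc k)
      then show ?case using c(3)[rule_format, of k] column_le[of x y k] by auto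
    qed (use c in auto)
    then show "\<exists>c. c 0 = 0 \<and> c L = 0 \<and> (\<forall>k<L. carry_step n L b x y z k (c k) (Suc k) (c (Suc k)))"
      using c step by (intro exI[of _ c]) auto
  qed
  finally have "log_path n b (carry_step n L b x y z) 0 0 L 0 \<longleftrightarrow> \<dots>" .
  moreover have "(\<forall>i<n. bit x i \<longrightarrow> (\<forall>j<n. bit y j \<longrightarrow> (\<exists>k<n. i + j = k \<and> k < L))) \<longleftrightarrow>
    (\<forall>i j. bit x i \<longrightarrow> bit y j \<longrightarrow> i + j < L)"
    using bits Ln by fastforce
  moreover have "times_formula n x y z \<longleftrightarrow> (\<forall>i<n. bit x i \<longrightarrow> (\<forall>j<n. bit y j \<longrightarrow> (\<exists>k<n. i + j = k \<and> k < L))) \<and>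
    log_path n b (carry_step n L b x y z) 0 0 L 0"
  proof -
    have "(\<exists>m<n. m = n - Suc 0 \<and> P m) \<longleftrightarrow> P (n - Suc 0)" "(\<exists>k<n. bitlen (n - Suc 0) = k \<and> P k) \<longleftrightarrow> P L"
      "(\<exists>k<n. bitlen L = k \<and> P k) \<longleftrightarrow> P b" "(\<exists>k<n. k = 0 \<and> P k) \<longleftrightarrow> P 0" for P
      using Ln bL assms(2) by (auto simp: L_def b_def)
    then show ?thesis
      unfolding times_formula_def by (simp only:)
  qed
  ultimately show ?thesis
    unfolding product_iff_carries[OF z, of x y] by blast
qed

lemma FO_times [FO_intros]: "FO (\<lambda>w e. e i * e j = e k)"
proof -
  \<comment> \<open>For longer strings the last position has more than \<open>2 ^ 12\<close> bits,
    as \<open>large\<close> demands.\<close>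
  define M :: nat where "M = 2 ^ (2 ^ 12)"
  have large: "large n" if "n > M" for n
  proof -
    have "2 ^ (2 ^ 12) \<le> n - 1"
      using that unfolding M_def by linarith
    then have "2 ^ 12 < bitlen (n - 1)"
      by (simp only: less_bitlen_iff)
    then show ?thesis
      unfolding large_def by linarith
  qed
  have "FO (\<lambda>w e. (length w \<le> M \<and> e i * e j = e k) \<or> (\<not> length w \<le> M \<and> times_formula (length w) (e i) (e j) (e k)))"
    by (rule FO_disj[OF FO_small[of M "\<lambda>n a b c. a * b = c" i j k]]) (intro FO_intros FO_times_formula FO_length_le)
  then show ?thesis
  proof (rule FO_cong)
    fix w e assume "ok w e"
    then show "((length w \<le> M \<and> e i * e j = e k) \<or> (\<not> length w \<le> M \<and> times_formula (length w) (e i) (e j) (e k))) =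
      (e i * e j = e k)"
      using times_formula_iff[OF large, of "length w" "e i" "e j" "e k"]
      by (cases "length w \<le> M") (simp_all add: ok_def)
  qed
qed

text \<open>Only the part of the graph inside the universe has to be definable; the values may exceed it.\<close>

definition DT :: "(bool list \<Rightarrow> (nat \<Rightarrow> nat) \<Rightarrow> nat) \<Rightarrow> bool" where
  "DT T \<longleftrightarrow> FO (\<lambda>w e. T w (\<lambda>i. e (Suc i)) = e 0)"

lemma FO_DT: "DT T \<Longrightarrow> FO (\<lambda>w e. T w (\<lambda>i. e (f i)) = e k)"
  using FO_subst[of "\<lambda>w e. T w (\<lambda>i. e (Suc i)) = e 0" "case_nat k f"] by (simp add: DT_def)

lemma FO_DT_env: "DT T \<Longrightarrow> FO (\<lambda>w e. T w e = e k)"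
  using FO_DT[of T "\<lambda>i. i"] by simp

named_theorems DT_intros

lemma DT_var [DT_intros]: "DT (\<lambda>w e. e i)"
  unfolding DT_def by (intro FO_intros)

lemma DT_const [DT_intros]: "DT (\<lambda>w e. c)"
  unfolding DT_def by (rule FO_cong[OF FO_eq_const[of 0 c]]) auto

lemma DT_add [DT_intros]: "DT S \<Longrightarrow> DT T \<Longrightarrow> DT (\<lambda>w e. S w e + T w e)"
proof -
  assume "DT S" "DT T"
  then have "FO (\<lambda>w e. \<exists>a<length w. \<exists>b<length w. S w (\<lambda>i. e (Suc i)) = a \<and> T w (\<lambda>i. e (Suc i)) = b \<and> a + b = e 0)"
    by (intro FO_intros FO_DT)
  then show ?thesis
    unfolding DT_def by (rule FO_cong) (auto dest: ok_lessD[of _ _ 0])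
qed

text \<open>A nonzero product bounds both factors, so they are elements if the product is. A product
  0 is treated apart, because the other factor may then lie outside the universe.\<close>

lemma DT_mult [DT_intros]: "DT S \<Longrightarrow> DT T \<Longrightarrow> DT (\<lambda>w e. S w e * T w e)"
proof -
  assume "DT S" "DT T"
  then have "FO (\<lambda>w e. (\<exists>z<length w. z = 0 \<and> e 0 = 0 \<and> (S w (\<lambda>i. e (Suc i)) = z \<or> T w (\<lambda>i. e (Suc i)) = z)) \<or> 
    (\<exists>a<length w. \<exists>b<length w. S w (\<lambda>i. e (Suc i)) = a \<and> T w (\<lambda>i. e (Suc i)) = b \<and> a * b = e 0))"
    by (intro FO_intros FO_DT)
  then show ?thesis
    unfolding DT_def
  proof (rule FO_cong)
    fix w e assume ok: "ok w e"
    let ?S = "S w (\<lambda>i. e (Suc i))" and ?T = "T w (\<lambda>i. e (Suc i))"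
    have "?S < length w \<and> ?T < length w" if "?S * ?T = e 0" "e 0 \<noteq> 0"
    proof -
      have "?S > 0" "?T > 0"
        using that by (metis mult_is_0 not_gr_zero)+
      then have "?S \<le> ?S * ?T" "?T \<le> ?S * ?T"
        by simp_all
      then show ?thesis
        using that ok_lessD[OF ok, of 0] by linarith
    qed
    then show "((\<exists>z<length w. z = 0 \<and> e 0 = 0 \<and> (?S = z \<or> ?T = z)) \<or> (\<exists>a<length w. \<exists>b<length w. ?S = a \<and> ?T = b \<and> a * b = e 0))
      = (?S * ?T = e 0)"
      using ok_lengthD[OF ok] by (cases "e 0 = 0") auto
  qed
qed

lemma DT_bitlen [DT_intros]: "DT (\<lambda>w e. bitlen (e i))"
  unfolding DT_def by (intro FO_intros)

lemma DT_power_const [DT_intros]: "DT T \<Longrightarrow> DT (\<lambda>w e. T w e ^ k)"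
  by (induction k) (auto intro: DT_intros)

lemma DT_sum [DT_intros]: "finite X \<Longrightarrow> (\<And>x. x \<in> X \<Longrightarrow> DT (T x)) \<Longrightarrow> DT (\<lambda>w e. \<Sum>x\<in>X. T x w e)"
  by (induction X rule: finite_induct) (auto intro: DT_intros)

lemma DT_subst: "DT T \<Longrightarrow> DT (\<lambda>w e. T w (\<lambda>i. e (f i)))"
  unfolding DT_def using FO_subst[of "\<lambda>w e. T w (\<lambda>i. e (Suc i)) = e 0" "case_nat 0 (\<lambda>i. Suc (f i))"] by simp

section \<open>Counting proof trees\<close>

definition child_gates :: "'g circuit \<Rightarrow> 'g \<Rightarrow> 'g set" where
  "child_gates C g = {y. (g, y) \<in> children C}"

text \<open>Moving the output gate makes the definition of proof trees available at every gate, as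
  the recursion over the circuit requires.\<close>

definition trees_at :: "'g circuit \<Rightarrow> bool list \<Rightarrow> 'g \<Rightarrow> 'g list set set" where
  "trees_at C w g = {T. proof_tree (C\<lparr>out_gate := g\<rparr>) w T}"

definition node_ok :: "'g circuit \<Rightarrow> bool list \<Rightarrow> 'g list set \<Rightarrow> 'g list \<Rightarrow> bool" where
  "node_ok C w T p \<longleftrightarrow> (case label C (last p) of
        And_gate \<Rightarrow> (\<forall>y. (last p, y) \<in> children C \<longrightarrow> p @ [y] \<in> T)
      | Or_gate \<Rightarrow> (\<exists>!y. (last p, y) \<in> children C \<and> p @ [y] \<in> T)
      | lab \<Rightarrow> true_label w lab)"

text \<open>The subtree at the child \<open>y\<close> of the root. Its nodes are again addressed by
  paths that start at its own root, hence the removal of \<open>g\<close>.\<close>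

definition branch :: "'g list set \<Rightarrow> 'g \<Rightarrow> 'g \<Rightarrow> 'g list set" where
  "branch T g y = {p. p \<noteq> [] \<and> hd p = y \<and> g # p \<in> T}"

definition join :: "'g \<Rightarrow> 'g set \<Rightarrow> ('g \<Rightarrow> 'g list set) \<Rightarrow> 'g list set" where
  "join g Y F = insert [g] (\<Union>y\<in>Y. (#) g ` F y)"

lemma num_proof_trees_eq: "num_proof_trees C w = card (trees_at C w (out_gate C))"
  by (simp add: num_proof_trees_def trees_at_def)

lemma trees_at_iff:
  "T \<in> trees_at C w g \<longleftrightarrow> (\<forall>p\<in>T. p \<in> paths C \<and> hd p = g) \<and> [g] \<in> T \<and>
     (\<forall>p y. p \<noteq> [] \<and> p @ [y] \<in> T \<longrightarrow> p \<in> T) \<and> (\<forall>p\<in>T. node_ok C w T p)"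
proof -
  have upd: "paths (C\<lparr>out_gate := g\<rparr>) = paths C" "label (C\<lparr>out_gate := g\<rparr>) = label C" "children (C\<lparr>out_gate := g\<rparr>) = children C"
    by (simp_all add: paths_def)
  then show ?thesis
    unfolding trees_at_def proof_tree_def tree_unfolding_def node_ok_def upd by (simp add: subset_iff Ball_def)
qed

lemma trees_at_root: "T \<in> trees_at C w g \<Longrightarrow> [g] \<in> T"
  unfolding trees_at_iff by (elim conjE)

lemma trees_at_pathD: "T \<in> trees_at C w g \<Longrightarrow> p \<in> T \<Longrightarrow> p \<noteq> [] \<and> p \<in> paths C \<and> hd p = g"
proof -
  assume T: "T \<in> trees_at C w g" and p: "p \<in> T"
  have "p \<in> paths C \<and> hd p = g"
    using conjunct1[OF T[unfolded trees_at_iff]] p by (rule bspec)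
  then show ?thesis
    by (simp add: paths_def)
qed

lemma paths_Cons: "p \<noteq> [] \<Longrightarrow> g # p \<in> paths C \<longleftrightarrow> g \<in> gates C \<and> (g, hd p) \<in> children C \<and> p \<in> paths C"
  by (auto simp: paths_def successively_Cons)

lemma trees_at_prefix:
  assumes "T \<in> trees_at C w g" "p @ q \<in> T" "p \<noteq> []"
  shows "p \<in> T"
  using assms(2)
proof (induction q rule: rev_induct)
  case (snoc y q)
  then have "(p @ q) @ [y] \<in> T" by simp
  then show ?case
    using snoc.IH assms(1,3) unfolding trees_at_iff by (metis append_is_Nil_conv)
qed simp

lemma node_ok_branch: "p \<noteq> [] \<Longrightarrow> node_ok C w (branch T g (hd p)) p = node_ok C w T (g # p)"
  unfolding node_ok_def branch_def by (cases "label C (last p)") (simp_all add: hd_append)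

lemma branch_in_trees_at:
  assumes "T \<in> trees_at C w g" "[g, y] \<in> T"
  shows "branch T g y \<in> trees_at C w y" "y \<in> child_gates C g"
proof -
  note T = assms(1)[unfolded trees_at_iff]
  have "p \<in> paths C" if "g # p \<in> T" "p \<noteq> []" for p
    using trees_at_pathD[OF assms(1) that(1)] paths_Cons[OF that(2), of g C] by simp
  moreover have "[y] \<in> branch T g y"
    using assms(2) by (simp add: branch_def)
  moreover have "p \<in> branch T g y" if "p \<noteq> []" "p @ [z] \<in> branch T g y" for p z
  proof -
    have "(g # p) @ [z] \<in> T"
      using that by (simp add: branch_def)
    then have "g # p \<in> T"
      using T by blast
    then show ?thesis
      using that by (simp add: branch_def hd_append)
  qed
  moreover have "node_ok C w (branch T g y) p" if "p \<in> branch T g y" for p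
  proof -
    from that have "p \<noteq> []" "hd p = y" "g # p \<in> T"
      by (auto simp: branch_def)
    then show ?thesis
      using T node_ok_branch[of p C w T g] by blast
  qed
  ultimately show "branch T g y \<in> trees_at C w y"
    unfolding trees_at_iff by (auto simp: branch_def)
  show "y \<in> child_gates C g"
    using trees_at_pathD[OF assms] paths_Cons[of "[y]" g C] by (simp add: child_gates_def)
qed

lemma join_branches:
  assumes "T \<in> trees_at C w g"
  shows "join g {y. [g, y] \<in> T} (branch T g) = T"
proof (intro equalityI subsetI)
  fix p assume "p \<in> join g {y. [g, y] \<in> T} (branch T g)"
  then show "p \<in> T"
    using trees_at_root[OF assms] by (auto simp: join_def branch_def)
next
  fix p assume p: "p \<in> T"
  then have "p \<noteq> []" "hd p = g"
    using trees_at_pathD[OF assms] by auto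
  then obtain q where q: "p = g # q"
    by (cases p) auto
  show "p \<in> join g {y. [g, y] \<in> T} (branch T g)"
  proof (cases q)
    case Nil
    then show ?thesis by (simp add: q join_def)
  next
    case (Cons y r)
    have "[g, y] \<in> T"
      by (rule trees_at_prefix[OF assms, of _ r]) (use p q Cons in auto)
    moreover have "q \<in> branch T g y"
      using p by (simp add: q Cons branch_def)
    ultimately show ?thesis
      by (auto simp: join_def q)
  qed
qed

text \<open>What a proof tree has to satisfy at its root, in terms of the set \<open>Y\<close> of
  those children of the root that it contains.\<close>

definition root_ok :: "'g circuit \<Rightarrow> bool list \<Rightarrow> 'g \<Rightarrow> 'g set \<Rightarrow> bool" where
  "root_ok C w g Y \<longleftrightarrow> Y \<subseteq> child_gates C g \<and> (case label C g of
        And_gate \<Rightarrow> Y = child_gates C g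
      | Or_gate \<Rightarrow> \<exists>!y. y \<in> Y
      | lab \<Rightarrow> true_label w lab)"

lemma root_ok_iff:
  assumes "Y = {y. [g, y] \<in> T}" "Y \<subseteq> child_gates C g"
  shows "node_ok C w T [g] \<longleftrightarrow> root_ok C w g Y"
proof -
  have "(g, y) \<in> children C \<and> [g, y] \<in> T \<longleftrightarrow> y \<in> Y" for y
    using assms by (auto simp: child_gates_def)
  then show ?thesis
    using assms unfolding node_ok_def root_ok_def by (auto split: gate_label.splits simp: child_gates_def)
qed

lemma root_ok_children:
  assumes "T \<in> trees_at C w g"
  shows "root_ok C w g {y. [g, y] \<in> T}"
proof -
  have "node_ok C w T [g]"
    using assms by (simp add: trees_at_iff)
  then show ?thesis
    using root_ok_iff[of _ g T C w] branch_in_trees_at(2)[OF assms] by auto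
qed

context
  fixes C :: "'g circuit" and w :: "bool list" and g :: 'g and Y :: "'g set" and F :: "'g \<Rightarrow> 'g list set"
  assumes F: "\<And>y. y \<in> Y \<Longrightarrow> F y \<in> trees_at C w y"
begin

lemma branch_join: "y \<in> Y \<Longrightarrow> branch (join g Y F) g y = F y"
  using trees_at_pathD[OF F] unfolding branch_def join_def by fastforce

lemma children_join: "{y. [g, y] \<in> join g Y F} = Y"
  using trees_at_root[OF F] trees_at_pathD[OF F] unfolding join_def by fastforce

lemma join_in_trees_at:
  assumes g: "g \<in> gates C" and root: "root_ok C w g Y"
  shows "join g Y F \<in> trees_at C w g"
proof -
  let ?T = "join g Y F"
  have Y: "Y \<subseteq> child_gates C g"
    using root by (simp add: root_ok_def)
  have cases: "p = [g] \<or> (\<exists>q y. p = g # q \<and> y \<in> Y \<and> q \<in> F y \<and> q \<noteq> [] \<and> hd q = y)" if "p \<in> ?T" for p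
    using that trees_at_pathD[OF F] unfolding join_def by auto
  have "p \<in> paths C \<and> hd p = g" if "p \<in> ?T" for p
    using cases[OF that]
  proof (elim disjE exE conjE)
    fix q y assume p: "p = g # q" "y \<in> Y" "q \<in> F y" "q \<noteq> []" "hd q = y"
    then show ?thesis
      using trees_at_pathD[OF F[OF p(2)] p(3)] Y g by (auto simp: paths_Cons child_gates_def)
  qed (use g in \<open>simp add: paths_def\<close>)
  moreover have "p \<in> ?T" if "p \<noteq> []" "p @ [z] \<in> ?T" for p z
    using cases[OF that(2)]
  proof (elim disjE exE conjE)
    note nonempty = that(1)
    fix q y assume p: "p @ [z] = g # q" "y \<in> Y" "q \<in> F y" "q \<noteq> []" "hd q = y"
    obtain p' where p': "p = g # p'" "q = p' @ [z]"
      using p(1) nonempty by (cases p) auto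
    show ?thesis
    proof (cases "p' = []")
      case False
      then have "p' \<in> F y"
        using F[OF p(2)] p(3) p'(2) unfolding trees_at_iff by blast
      then show ?thesis using p(2) p'(1) by (auto simp: join_def)
    qed (simp add: p' join_def)
  qed (use that(1) in \<open>simp add: Cons_eq_append_conv append_eq_Cons_conv\<close>)
  moreover have "node_ok C w ?T p" if "p \<in> ?T" for p
    using cases[OF that]
  proof (elim disjE exE conjE)
    assume "p = [g]"
    then show ?thesis
      using root_ok_iff[of Y g ?T C w] children_join Y root by simp
  next
    fix q y assume p: "p = g # q" "y \<in> Y" "q \<in> F y" "q \<noteq> []" "hd q = y"
    have "node_ok C w (F y) q"
      using F[OF p(2)] p(3) unfolding trees_at_iff by blast
    then show ?thesis
      using node_ok_branch[of q C w ?T g] branch_join[OF p(2)] p by simp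
  qed
  moreover have "[g] \<in> ?T"
    by (simp add: join_def)
  ultimately show ?thesis
    unfolding trees_at_iff by blast
qed

end

text \<open>At a conjunction a proof tree is a choice of one proof tree for every child, at a
  disjunction a child together with one of its proof trees; \<open>branch\<close> and
  \<open>join\<close> translate back and forth. Nodes are paths of the unfolding, so a shared gate
  may get different subtrees at its different occurrences.\<close>

lemma card_trees_at:
  assumes C: "is_circuit n C" and g: "g \<in> gates C"
  shows "finite (trees_at C w g) \<and> card (trees_at C w g) = (case label C g of
      And_gate \<Rightarrow> \<Prod>y\<in>child_gates C g. card (trees_at C w y)
    | Or_gate \<Rightarrow> \<Sum>y\<in>child_gates C g. card (trees_at C w y)
    | lab \<Rightarrow> of_bool (true_label w lab))"
proof -
  have fin: "finite (children C)" "children C \<subseteq> gates C \<times> gates C"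
    using C finite_subset unfolding is_circuit_def by blast+
  then have "wf ((children C)\<inverse>)"
    using C unfolding is_circuit_def by (intro finite_acyclic_wf_converse) auto
  then show ?thesis
    using g
  proof (induction g rule: wf_induct_rule)
    case (less g)
    let ?Y = "child_gates C g"
    have finY: "finite ?Y"
      using fin(1) finite_subset[of ?Y "snd ` children C"] by (force simp: child_gates_def)
    have IH: "finite (trees_at C w y)" if "y \<in> ?Y" for y
      using less.IH[of y] that fin(2) by (auto simp: child_gates_def)
    note rk = root_ok_children[of _ C w g]
    show ?case
    proof (cases "label C g = And_gate"; cases "label C g = Or_gate")
      assume And_gate: "label C g = And_gate" and "label C g \<noteq> Or_gate"
      have root: "root_ok C w g Y \<longleftrightarrow> Y = ?Y" for Y
        using And_gate by (auto simp: root_ok_def)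
      have "bij_betw (join g ?Y) (PiE ?Y (trees_at C w)) (trees_at C w g)"
      proof (rule bij_betw_byWitness[where f' = "\<lambda>T. restrict (branch T g) ?Y"])
        show "\<forall>F\<in>PiE ?Y (trees_at C w). restrict (branch (join g ?Y F) g) ?Y = F"
        proof
          fix F assume F: "F \<in> PiE ?Y (trees_at C w)"
          then have "\<And>y. y \<in> ?Y \<Longrightarrow> F y \<in> trees_at C w y"
            by auto
          then have "branch (join g ?Y F) g y = F y" if "y \<in> ?Y" for y
            using that by (rule branch_join)
          then show "restrict (branch (join g ?Y F) g) ?Y = F"
            using F by (auto simp: restrict_def PiE_def extensional_def fun_eq_iff)
        qed
        show "\<forall>T\<in>trees_at C w g. join g ?Y (restrict (branch T g) ?Y) = T"
        proof
          fix T assume T: "T \<in> trees_at C w g"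
          have "join g ?Y (restrict (branch T g) ?Y) = join g ?Y (branch T g)"
            by (auto simp: join_def)
          then show "join g ?Y (restrict (branch T g) ?Y) = T"
            using join_branches[OF T] rk[OF T] root by simp
        qed
        show "join g ?Y ` PiE ?Y (trees_at C w) \<subseteq> trees_at C w g"
          using join_in_trees_at[of ?Y _ C w g] less.prems root by (auto simp: PiE_def Pi_def)
        show "(\<lambda>T. restrict (branch T g) ?Y) ` trees_at C w g \<subseteq> PiE ?Y (trees_at C w)"
        proof (intro image_subsetI)
          fix T assume T: "T \<in> trees_at C w g"
          have "[g, y] \<in> T" if "y \<in> ?Y" for y
            using rk[OF T] that unfolding root by blast
          then show "restrict (branch T g) ?Y \<in> PiE ?Y (trees_at C w)"
            using branch_in_trees_at(1)[OF T] by auto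
        qed
      qed
      from bij_betw_same_card[OF this] bij_betw_finite[OF this] show ?thesis
        using And_gate finY IH by (simp add: card_PiE finite_PiE)
    next
      assume Or_gate: "label C g = Or_gate" and "label C g \<noteq> And_gate"
      have root: "root_ok C w g Y \<longleftrightarrow> (\<exists>y\<in>?Y. Y = {y})" for Y
        using Or_gate by (auto simp: root_ok_def)
      let ?j = "\<lambda>(y, T). join g {y} (\<lambda>_. T)"
      have "bij_betw ?j (Sigma ?Y (trees_at C w)) (trees_at C w g)"
        unfolding bij_betw_def
      proof (intro conjI inj_onI equalityI subsetI)
        fix p q assume p: "p \<in> Sigma ?Y (trees_at C w)" and q: "q \<in> Sigma ?Y (trees_at C w)" and eq: "?j p = ?j q"
        obtain y T y' T' where pq: "p = (y, T)" "q = (y', T')" by (cases p, cases q)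
        have T: "T \<in> trees_at C w y" "T' \<in> trees_at C w y'" and eq': "join g {y} (\<lambda>_. T) = join g {y'} (\<lambda>_. T')"
          using p q eq by (simp_all add: pq)
        have "{z. [g, z] \<in> join g {y} (\<lambda>_. T)} = {y}" "branch (join g {y} (\<lambda>_. T)) g y = T"
          by (rule children_join branch_join; use T in simp)+
        moreover have "{z. [g, z] \<in> join g {y'} (\<lambda>_. T')} = {y'}" "branch (join g {y'} (\<lambda>_. T')) g y' = T'"
          by (rule children_join branch_join; use T in simp)+
        ultimately have "{y} = {y'}" "y = y' \<Longrightarrow> T = T'"
          unfolding eq' by simp_all
        then have "y = y'" "T = T'"
          by simp_all
        then show "p = q" by (simp add: pq)
      next
        fix T assume "T \<in> ?j ` Sigma ?Y (trees_at C w)"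
        then obtain y S where "y \<in> ?Y" "S \<in> trees_at C w y" "T = join g {y} (\<lambda>_. S)"
          by auto
        then show "T \<in> trees_at C w g"
          using join_in_trees_at[of "{y}" "\<lambda>_. S" C w g] less.prems root by auto
      next
        fix T assume T: "T \<in> trees_at C w g"
        then obtain y where y: "y \<in> ?Y" "{z. [g, z] \<in> T} = {y}"
          using rk root by blast
        then have "T = join g {y} (branch T g)"
          using join_branches[OF T] by simp
        also have "\<dots> = ?j (y, branch T g y)"
          by (simp add: join_def)
        finally show "T \<in> ?j ` Sigma ?Y (trees_at C w)"
          using y branch_in_trees_at(1)[OF T, of y] by (intro image_eqI[of _ _ "(y, branch T g y)"]) auto
      qed
      then have "card (trees_at C w g) = card (Sigma ?Y (trees_at C w))" "finite (trees_at C w g) = finite (Sigma ?Y (trees_at C w))"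
        using bij_betw_same_card bij_betw_finite by metis+
      then show ?thesis
        using Or_gate finY IH by simp
    next
      assume leaf: "label C g \<noteq> And_gate" "label C g \<noteq> Or_gate"
      then have Y: "?Y = {}"
        using C unfolding is_circuit_def child_gates_def by fastforce
      have root: "root_ok C w g Y \<longleftrightarrow> Y = {} \<and> true_label w (label C g)" for Y
        using leaf by (cases "label C g") (auto simp: root_ok_def Y)
      have "trees_at C w g = (if true_label w (label C g) then {{[g]}} else {})"
      proof (intro equalityI subsetI)
        fix T assume T: "T \<in> trees_at C w g"
        then show "T \<in> (if true_label w (label C g) then {{[g]}} else {})"
        proof -
          have "{y. [g, y] \<in> T} = {} \<and> true_label w (label C g)"
            using rk[OF T] by (simp only: root)
          moreover from this have "T = join g {} (branch T g)"
            using join_branches[OF T] by simp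
          ultimately show ?thesis
            by (simp add: join_def)
        qed
      next
        fix T assume "T \<in> (if true_label w (label C g) then {{[g]}} else {})"
        then show "T \<in> trees_at C w g"
          using join_in_trees_at[of "{}" "\<lambda>_. {}" C w g] less.prems unfolding root by (simp add: join_def split: if_splits)
      qed
      then show ?thesis
        using leaf by (cases "label C g") auto
    qed simp
  qed
qed

section \<open>Functions given by nested sums and products over the universe\<close>

definition leaf_label :: "nat \<Rightarrow> gate_label \<Rightarrow> bool" where
  "leaf_label n l \<longleftrightarrow> (case l of Const b \<Rightarrow> True | Input i \<Rightarrow> i < n | Neg_input i \<Rightarrow> i < n | _ \<Rightarrow> False)"

text \<open>Two demands meet here. The circuit depends on the length alone, so the label may depend
  on the length and the chosen elements but not on the string; and uniformity requires the value of
  the leaf to be definable over the string.\<close>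

definition leaf :: "(bool list \<Rightarrow> (nat \<Rightarrow> nat) \<Rightarrow> bool) \<Rightarrow> bool" where
  "leaf B \<longleftrightarrow> FO B \<and> (\<exists>lab. \<forall>w e. ok w e \<longrightarrow>
     leaf_label (length w) (lab (length w) e) \<and> B w e = true_label w (lab (length w) e))"

text \<open>Conditions independent of the bits of the string: these may decide which gates a circuit
  has.\<close>

definition NUM :: "(bool list \<Rightarrow> (nat \<Rightarrow> nat) \<Rightarrow> bool) \<Rightarrow> bool" where
  "NUM P \<longleftrightarrow> FO P \<and> (\<exists>Q. P = (\<lambda>w. Q (length w)))"

lemma NUM_I:
  assumes "FO P" "\<And>w w' e. length w = length w' \<Longrightarrow> P w e = P w' e"
  shows "NUM P"
proof -
  have "P w = P (replicate (length w) False)" for w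
    by (rule ext, rule assms(2)) simp
  then have "P = (\<lambda>w. P (replicate (length w) False))"
    by (rule ext)
  then show ?thesis
    unfolding NUM_def using assms(1) by (intro conjI exI[of _ "\<lambda>n. P (replicate n False)"])
qed

lemma NUM_subst:
  assumes "NUM P"
  shows "NUM (\<lambda>w e. P w (\<lambda>i. e (f i)))"
proof -
  obtain Q where "P = (\<lambda>w. Q (length w))" and FO: "FO P"
    using assms unfolding NUM_def by blast
  then show ?thesis
    using FO_subst[OF FO, of f] by (intro NUM_I) auto
qed

lemma NUM_eq_const: "NUM (\<lambda>w e. e i = c)"
  by (rule NUM_I[OF FO_eq_const]) simp

lemma NUM_const: "NUM (\<lambda>w e. c)"
  by (rule NUM_I[OF FO_const_bool]) simp

lemma leaf_NUM:
  assumes "NUM P"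
  shows "leaf P"
proof -
  obtain Q where "P = (\<lambda>w. Q (length w))" "FO P"
    using assms unfolding NUM_def by blast
  then show ?thesis
    unfolding leaf_def leaf_label_def by (intro conjI exI[of _ "\<lambda>n e. Const (Q n e)"]) auto
qed

lemma leaf_input: "leaf (\<lambda>w e. w ! e i)"
  unfolding leaf_def leaf_label_def
  by (intro conjI FO_input exI[of _ "\<lambda>n e. Input (e i)"]) (simp add: ok_lessD)

lemma leaf_neg_input: "leaf (\<lambda>w e. \<not> w ! e i)"
  unfolding leaf_def leaf_label_def
  by (intro conjI FO_not FO_input exI[of _ "\<lambda>n e. Neg_input (e i)"]) (simp add: ok_lessD)

lemma leaf_if:
  assumes "NUM P" "leaf A" "leaf B"
  shows "leaf (\<lambda>w e. if P w e then A w e else B w e)"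
proof -
  obtain Q where Q: "P = (\<lambda>w. Q (length w))" "FO P"
    using assms(1) unfolding NUM_def by blast
  obtain la where la: "\<And>w e. ok w e \<Longrightarrow> leaf_label (length w) (la (length w) e) \<and> A w e = true_label w (la (length w) e)"
    using assms(2) unfolding leaf_def by blast
  obtain lb where lb: "\<And>w e. ok w e \<Longrightarrow> leaf_label (length w) (lb (length w) e) \<and> B w e = true_label w (lb (length w) e)"
    using assms(3) unfolding leaf_def by blast
  have "FO (\<lambda>w e. if P w e then A w e else B w e)"
    using assms Q(2) unfolding leaf_def by (intro FO_if) auto
  then show ?thesis
    unfolding leaf_def using la lb
    by (intro conjI exI[of _ "\<lambda>n e. if Q n e then la n e else lb n e"]) (auto simp: Q(1))
qed

lemma leaf_subst:
  assumes "leaf A"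
  shows "leaf (\<lambda>w e. A w (\<lambda>i. e (f i)))"
proof -
  obtain la where la: "\<And>w e. ok w e \<Longrightarrow> leaf_label (length w) (la (length w) e) \<and> A w e = true_label w (la (length w) e)"
    using assms unfolding leaf_def by blast
  then show ?thesis
    using assms ok_comp[of _ _ f] FO_subst[of A f] unfolding leaf_def
    by (intro conjI exI[of _ "\<lambda>n e. la n (\<lambda>i. e (f i))"]) auto
qed

text \<open>\<open>True\<close> stands for a sum and \<open>False\<close> for a product; the innermost bound variable is variable 0.\<close>

fun nest :: "bool list \<Rightarrow> (bool list \<Rightarrow> (nat \<Rightarrow> nat) \<Rightarrow> bool) \<Rightarrow> bool list \<Rightarrow> (nat \<Rightarrow> nat) \<Rightarrow> nat" where
  "nest [] B w e = of_bool (B w e)"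
| "nest (q # qs) B w e = (if q then \<Sum>a<length w. nest qs B w (case_nat a e) else \<Prod>a<length w. nest qs B w (case_nat a e))"

definition KL :: "bool list \<Rightarrow> (bool list \<Rightarrow> (nat \<Rightarrow> nat) \<Rightarrow> nat) \<Rightarrow> bool" where
  "KL qs F \<longleftrightarrow> (\<exists>B. leaf B \<and> (\<forall>w e. ok w e \<longrightarrow> F w e = nest qs B w e))"

lemma KL_cong: "KL qs F \<Longrightarrow> (\<And>w e. ok w e \<Longrightarrow> F w e = G w e) \<Longrightarrow> KL qs G"
  unfolding KL_def by metis

lemma KL_Nil: "leaf B \<Longrightarrow> KL [] (\<lambda>w e. of_bool (B w e))"
  unfolding KL_def by auto

lemma KL_Cons_iff:
  "KL (q # qs) F \<longleftrightarrow> (\<exists>G. KL qs G \<and> (\<forall>w e. ok w e \<longrightarrow> F w e =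
     (if q then \<Sum>a<length w. G w (case_nat a e) else \<Prod>a<length w. G w (case_nat a e))))"
proof
  assume "KL (q # qs) F"
  then obtain B where B: "leaf B" "\<And>w e. ok w e \<Longrightarrow> F w e = nest (q # qs) B w e"
    unfolding KL_def by blast
  have "KL qs (nest qs B)"
    unfolding KL_def using B(1) by blast
  then show "\<exists>G. KL qs G \<and> (\<forall>w e. ok w e \<longrightarrow> F w e =
     (if q then \<Sum>a<length w. G w (case_nat a e) else \<Prod>a<length w. G w (case_nat a e)))"
    using B(2) by (intro exI[of _ "nest qs B"]) simp
next
  assume "\<exists>G. KL qs G \<and> (\<forall>w e. ok w e \<longrightarrow> F w e =
     (if q then \<Sum>a<length w. G w (case_nat a e) else \<Prod>a<length w. G w (case_nat a e)))"
  then obtain G B where G: "\<And>w e. ok w e \<Longrightarrow> F w e =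
     (if q then \<Sum>a<length w. G w (case_nat a e) else \<Prod>a<length w. G w (case_nat a e))"
    and B: "leaf B" "\<And>w e. ok w e \<Longrightarrow> G w e = nest qs B w e"
    unfolding KL_def by blast
  have "F w e = nest (q # qs) B w e" if "ok w e" for w e
    using G[OF that] B(2)[OF ok_push[OF that]] by simp
  then show "KL (q # qs) F"
    unfolding KL_def using B(1) by blast
qed

lemma KL_sum: "KL qs (\<lambda>w e. F w (e 0) (\<lambda>i. e (Suc i))) \<Longrightarrow> KL (True # qs) (\<lambda>w e. \<Sum>a<length w. F w a e)"
  unfolding KL_Cons_iff by (intro exI[of _ "\<lambda>w e. F w (e 0) (\<lambda>i. e (Suc i))"] conjI) simp_all

lemma KL_prod: "KL qs (\<lambda>w e. F w (e 0) (\<lambda>i. e (Suc i))) \<Longrightarrow> KL (False # qs) (\<lambda>w e. \<Prod>a<length w. F w a e)"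
  unfolding KL_Cons_iff by (intro exI[of _ "\<lambda>w e. F w (e 0) (\<lambda>i. e (Suc i))"] conjI) simp_all

lemma KL_subst: "KL qs F \<Longrightarrow> KL qs (\<lambda>w e. F w (\<lambda>i. e (f i)))"
proof (induction qs arbitrary: F f)
  case Nil
  then obtain B where "leaf B" "\<And>w e. ok w e \<Longrightarrow> F w e = of_bool (B w e)"
    unfolding KL_def by auto
  then show ?case
    using leaf_subst[of B f] ok_comp[of _ _ f] unfolding KL_def by (intro exI[of _ "\<lambda>w e. B w (\<lambda>i. e (f i))"]) auto
next
  case (Cons q qs)
  then obtain G where G: "KL qs G" "\<And>w e. ok w e \<Longrightarrow> F w e =
     (if q then \<Sum>a<length w. G w (case_nat a e) else \<Prod>a<length w. G w (case_nat a e))"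
    unfolding KL_Cons_iff by blast
  have "KL qs (\<lambda>w e. G w (\<lambda>i. e (case_nat 0 (\<lambda>i. Suc (f i)) i)))"
    by (rule Cons.IH[OF G(1)])
  moreover have "(\<lambda>i. case_nat a e (case_nat 0 (\<lambda>i. Suc (f i)) i)) = case_nat a (\<lambda>i. e (f i))" for a :: nat and e
    by (auto split: nat.splits)
  ultimately show ?case
    unfolding KL_Cons_iff using G(2) ok_comp[of _ _ f]
    by (intro exI[of _ "\<lambda>w e. G w (\<lambda>i. e (case_nat 0 (\<lambda>i. Suc (f i)) i))"] conjI) simp_all
qed

text \<open>For a common prefix the case distinction can be pushed down to the leaves, where it
  merely selects a label.\<close>

lemma KL_if:
  "NUM P \<Longrightarrow> KL qs F \<Longrightarrow> KL qs G \<Longrightarrow> KL qs (\<lambda>w e. if P w e then F w e else G w e)"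
proof (induction qs arbitrary: P F G)
  case Nil
  then obtain A B where "leaf A" "leaf B" "\<And>w e. ok w e \<Longrightarrow> F w e = of_bool (A w e)" "\<And>w e. ok w e \<Longrightarrow> G w e = of_bool (B w e)"
    unfolding KL_def by auto
  then show ?case
    using leaf_if[OF Nil(1)] unfolding KL_def by (intro exI[of _ "\<lambda>w e. if P w e then A w e else B w e"]) auto
next
  case (Cons q qs)
  obtain F' where F: "KL qs F'" "\<And>w e. ok w e \<Longrightarrow> F w e =
     (if q then \<Sum>a<length w. F' w (case_nat a e) else \<Prod>a<length w. F' w (case_nat a e))"
    using Cons.prems(2) unfolding KL_Cons_iff by blast
  obtain G' where G: "KL qs G'" "\<And>w e. ok w e \<Longrightarrow> G w e =
     (if q then \<Sum>a<length w. G' w (case_nat a e) else \<Prod>a<length w. G' w (case_nat a e))"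
    using Cons.prems(3) unfolding KL_Cons_iff by blast
  have "KL qs (\<lambda>w e. if P w (\<lambda>i. e (Suc i)) then F' w e else G' w e)"
    by (intro Cons.IH F(1) G(1) NUM_subst[OF Cons.prems(1)])
  then show ?case
    unfolding KL_Cons_iff using F(2) G(2)
    by (intro exI[of _ "\<lambda>w e. if P w (\<lambda>i. e (Suc i)) then F' w e else G' w e"] conjI) auto
qed

lemma KL_zero: "KL qs (\<lambda>w e. 0)"
proof (induction qs)
  case Nil
  then show ?case using KL_Nil[OF leaf_NUM[OF NUM_const[of False]]] by simp
next
  case (Cons q qs)
  then show ?case
    unfolding KL_Cons_iff by (intro exI[of _ "\<lambda>w e. 0"]) (auto dest: ok_lengthD)
qed

lemma KL_single:
  assumes "KL qs F"
  shows "KL (True # qs) F"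
proof -
  have "KL qs (\<lambda>w e. if e 0 = 0 then F w (\<lambda>i. e (Suc i)) else 0)"
    by (intro KL_if KL_subst[OF assms] KL_zero NUM_eq_const)
  then have "KL (True # qs) (\<lambda>w e. \<Sum>a<length w. if a = 0 then F w e else 0)"
    by (rule KL_sum)
  then show ?thesis
    by (rule KL_cong) (auto dest: ok_lengthD)
qed

lemma KL_one: "KL qs (\<lambda>w e. 1)"
proof (induction qs)
  case Nil
  then show ?case using KL_Nil[OF leaf_NUM[OF NUM_const[of True]]] by simp
next
  case (Cons q qs)
  then show ?case
    using KL_single[OF Cons] KL_prod[OF Cons] by (cases q) auto
qed

text \<open>A vacuous sum or product, in which only the element 0 contributes more than the neutral
  value. It serves to bring functions to a common prefix.\<close>

lemma KL_dummy:
  assumes "KL qs F"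
  shows "KL (q # qs) F"
proof (cases q)
  case False
  have "KL qs (\<lambda>w e. if e 0 = 0 then F w (\<lambda>i. e (Suc i)) else 1)"
    by (intro KL_if KL_subst[OF assms] KL_one NUM_eq_const)
  then have "KL (False # qs) (\<lambda>w e. \<Prod>a<length w. if a = 0 then F w e else 1)"
    by (rule KL_prod)
  then have "KL (False # qs) F"
    by (rule KL_cong) (auto dest: ok_lengthD)
  then show ?thesis using False by simp
qed (use KL_single[OF assms] in simp)

lemma KL_prepend: "KL qs F \<Longrightarrow> KL (ps @ qs) F"
  by (induction ps) (auto intro: KL_dummy)

lemma KL_append: "KL ps F \<Longrightarrow> KL (ps @ qs) F"
proof (induction ps arbitrary: F)
  case Nil
  then show ?case using KL_prepend[of "[]" F qs] by simp
next
  case (Cons p ps)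
  then obtain G where "KL ps G" "\<And>w e. ok w e \<Longrightarrow> F w e =
     (if p then \<Sum>a<length w. G w (case_nat a e) else \<Prod>a<length w. G w (case_nat a e))"
    unfolding KL_Cons_iff by blast
  then show ?case
    using Cons.IH[of G] unfolding append_Cons KL_Cons_iff by blast
qed

section \<open>Closure properties of nested sums and products\<close>

definition K :: "(bool list \<Rightarrow> (nat \<Rightarrow> nat) \<Rightarrow> nat) \<Rightarrow> bool" where
  "K F \<longleftrightarrow> (\<exists>qs. KL qs F)"

lemma K_cong: "K F \<Longrightarrow> (\<And>w e. ok w e \<Longrightarrow> F w e = G w e) \<Longrightarrow> K G"
  unfolding K_def using KL_cong by blast

named_theorems K_intros

lemma K_NUM: "NUM P \<Longrightarrow> K (\<lambda>w e. of_bool (P w e))"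
  unfolding K_def using KL_Nil leaf_NUM by blast

lemma K_input: "NUM P \<Longrightarrow> K (\<lambda>w e. of_bool (w ! e i = P w e))"
proof -
  assume "NUM P"
  then have "leaf (\<lambda>w e. if P w e then w ! e i else \<not> w ! e i)"
    by (intro leaf_if leaf_input leaf_neg_input)
  then have "K (\<lambda>w e. of_bool (if P w e then w ! e i else \<not> w ! e i))"
    unfolding K_def using KL_Nil by blast
  then show ?thesis
    by (rule K_cong) auto
qed

lemma K_subst: "K F \<Longrightarrow> K (\<lambda>w e. F w (\<lambda>i. e (f i)))"
  unfolding K_def using KL_subst by blast

lemma K_sum [K_intros]: "K (\<lambda>w e. F w (e 0) (\<lambda>i. e (Suc i))) \<Longrightarrow> K (\<lambda>w e. \<Sum>a<length w. F w a e)"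
  unfolding K_def using KL_sum by blast

lemma K_prod [K_intros]: "K (\<lambda>w e. F w (e 0) (\<lambda>i. e (Suc i))) \<Longrightarrow> K (\<lambda>w e. \<Prod>a<length w. F w a e)"
  unfolding K_def using KL_prod by blast

text \<open>If the two prefixes are \<open>ps\<close> and \<open>qs\<close>, both functions are
  padded to \<open>ps @ qs\<close>, one by appending and the other by prepending; then
  \<open>KL_if\<close> applies.\<close>

lemma K_if: "NUM P \<Longrightarrow> K F \<Longrightarrow> K G \<Longrightarrow> K (\<lambda>w e. if P w e then F w e else G w e)"
  unfolding K_def using KL_if KL_prepend KL_append by blast

lemma K_zero [K_intros]: "K (\<lambda>w e. 0)"
  unfolding K_def using KL_zero by blast

lemma K_one [K_intros]: "K (\<lambda>w e. 1)"
  unfolding K_def using KL_one by blast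

lemma two_elements:
  assumes "(n::nat) \<ge> 2"
  shows "{..<n} = insert 0 (insert 1 {2..<n})"
  using assms by auto

text \<open>The two summands are placed at the elements 0 and 1 of a sum over the universe, which
  exist because lengths below 2 are excluded.\<close>

lemma K_add [K_intros]:
  assumes "K F" "K G"
  shows "K (\<lambda>w e. F w e + G w e)"
proof -
  have "K (\<lambda>w e. \<Sum>a<length w. if a = 0 then F w e else if a = 1 then G w e else 0)"
    by (intro K_sum K_if NUM_eq_const K_subst[OF assms(1)] K_subst[OF assms(2)] K_zero)
  then show ?thesis
    by (rule K_cong) (simp add: two_elements ok_lengthD)
qed

lemma K_mult [K_intros]:
  assumes "K F" "K G"
  shows "K (\<lambda>w e. F w e * G w e)"
proof -
  have "K (\<lambda>w e. \<Prod>a<length w. if a = 0 then F w e else if a = 1 then G w e else 1)"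
    by (intro K_prod K_if NUM_eq_const K_subst[OF assms(1)] K_subst[OF assms(2)] K_one)
  then show ?thesis
    by (rule K_cong) (simp add: two_elements ok_lengthD)
qed

lemma K_const [K_intros]: "K (\<lambda>w e. c)"
proof (induction c)
  case (Suc c)
  then show ?case using K_add[OF K_one Suc] by simp
qed (rule K_zero)

lemma K_finite_sum [K_intros]: "(\<And>x. x \<in> X \<Longrightarrow> K (F x)) \<Longrightarrow> K (\<lambda>w e. \<Sum>x\<in>X. F x w e)"
  by (induction X rule: infinite_finite_induct) (simp_all add: K_zero K_add)

lemma K_finite_prod [K_intros]: "(\<And>x. x \<in> X \<Longrightarrow> K (F x)) \<Longrightarrow> K (\<lambda>w e. \<Prod>x\<in>X. F x w e)"
  by (induction X rule: infinite_finite_induct) (simp_all add: K_one[simplified] K_mult)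

lemma finite_tuples [simp]: "finite (tuples n k)"
  using finite_lists_length_eq[of "{..<n}" k] by (simp add: tuples_def conj_commute)

lemma tuples_0 [simp]: "tuples n 0 = {[]}"
  by (auto simp: tuples_def)

lemma tuples_Suc: "tuples n (Suc k) = (\<lambda>(a, t). a # t) ` ({..<n} \<times> tuples n k)"
  by (auto simp: tuples_def length_Suc_conv image_iff)

lemma sum_tuples_Suc: "(\<Sum>t\<in>tuples n (Suc k). F t) = (\<Sum>t\<in>tuples n k. \<Sum>a<n. F (a # t))"
proof -
  have "(\<Sum>t\<in>tuples n (Suc k). F t) = (\<Sum>(a, t)\<in>{..<n} \<times> tuples n k. F (a # t))"
    unfolding tuples_Suc by (subst sum.reindex) (auto simp: inj_on_def case_prod_beta)
  then show ?thesis
    by (simp add: sum.cartesian_product[symmetric] sum.swap[of _ "{..<n}"])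
qed

lemma prod_tuples_Suc: "(\<Prod>t\<in>tuples n (Suc k). F t) = (\<Prod>t\<in>tuples n k. \<Prod>a<n. F (a # t))"
proof -
  have "(\<Prod>t\<in>tuples n (Suc k). F t) = (\<Prod>(a, t)\<in>{..<n} \<times> tuples n k. F (a # t))"
    unfolding tuples_Suc by (subst prod.reindex) (auto simp: inj_on_def case_prod_beta)
  then show ?thesis
    by (simp add: prod.cartesian_product[symmetric] prod.swap[of _ "{..<n}"])
qed

lemma map_upt_Suc_env: "map e [0..<Suc k] = e 0 # map (\<lambda>i. e (Suc i)) [0..<k]"
  by (simp add: upt_conv_Cons map_Suc_upt[symmetric] del: upt_Suc)

lemma K_sum_tuples:
  "K (\<lambda>w e. F w (map e [0..<k]) (\<lambda>i. e (i + k))) \<Longrightarrow> K (\<lambda>w e. \<Sum>t\<in>tuples (length w) k. F w t e)"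
proof (induction k arbitrary: F)
  case (Suc k)
  have "K (\<lambda>w e. \<Sum>a<length w. F w (a # map e [0..<k]) (\<lambda>i. e (i + k)))"
    using Suc.prems by (intro K_sum) (simp add: map_upt_Suc_env del: upt_Suc)
  from Suc.IH[OF this] show ?case
    by (simp add: sum_tuples_Suc)
qed simp

lemma K_prod_tuples:
  "K (\<lambda>w e. F w (map e [0..<k]) (\<lambda>i. e (i + k))) \<Longrightarrow> K (\<lambda>w e. \<Prod>t\<in>tuples (length w) k. F w t e)"
proof (induction k arbitrary: F)
  case (Suc k)
  have "K (\<lambda>w e. \<Prod>a<length w. F w (a # map e [0..<k]) (\<lambda>i. e (i + k)))"
    using Suc.prems by (intro K_prod) (simp add: map_upt_Suc_env del: upt_Suc)
  from Suc.IH[OF this] show ?case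
    by (simp add: prod_tuples_Suc)
qed simp

section \<open>Circuits for nested sums and products\<close>

text \<open>The gate reached by choosing \<open>as\<close>, as a tuple of length \<open>2 * D\<close>: \<open>as\<close> padded with zeros,
  followed by the number of choices in unary.\<close>

definition gate :: "nat \<Rightarrow> nat list \<Rightarrow> nat list" where
  "gate D as = as @ replicate (D - length as) 0 @ replicate (length as) 1 @ replicate (D - length as) 0"

definition gate_depth :: "nat \<Rightarrow> nat list \<Rightarrow> nat" where
  "gate_depth D t = length (filter (\<lambda>x. x = 1) (drop D t))"

definition choices :: "nat \<Rightarrow> nat \<Rightarrow> nat list set" where
  "choices n D = {as. length as \<le> D \<and> set as \<subseteq> {..<n}}"

text \<open>The order is reversed because the most recent choice belongs to the innermost bound
  variable, which has index 0.\<close>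

definition pad_env :: "nat list \<Rightarrow> nat \<Rightarrow> nat" where
  "pad_env as = (\<lambda>i. if i < length as then as ! (length as - 1 - i) else 0)"

definition nest_circuit :: "bool list \<Rightarrow> (nat \<Rightarrow> (nat \<Rightarrow> nat) \<Rightarrow> gate_label) \<Rightarrow> nat \<Rightarrow> nat list circuit" where
  "nest_circuit qs lab n = (let D = length qs in
    \<lparr>gates = gate D ` choices n D,
     children = {(gate D as, gate D (as @ [a])) | as a. as @ [a] \<in> choices n D},
     label = (\<lambda>t. if gate_depth D t = D then lab n (pad_env (take D t))
       else if qs ! gate_depth D t then Or_gate else And_gate),
     out_gate = gate D []\<rparr>)"

lemma length_gate [simp]: "length as \<le> D \<Longrightarrow> length (gate D as) = 2 * D"
  by (simp add: gate_def)

lemma gate_depth_gate [simp]: "length as \<le> D \<Longrightarrow> gate_depth D (gate D as) = length as"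
  by (simp add: gate_def gate_depth_def)

lemma take_gate [simp]: "length as \<le> D \<Longrightarrow> take (length as) (gate D as) = as"
  by (simp add: gate_def)

lemma gate_inject: "length as \<le> D \<Longrightarrow> length bs \<le> D \<Longrightarrow> gate D as = gate D bs \<longleftrightarrow> as = bs"
  by (metis gate_depth_gate take_gate)

lemma pad_env_snoc: "pad_env (as @ [a]) = case_nat a (pad_env as)"
  by (rule ext) (auto simp: pad_env_def nth_append split: nat.splits)

lemma choices_snoc: "as @ [a] \<in> choices n D \<longleftrightarrow> as \<in> choices n D \<and> length as < D \<and> a < n"
  by (auto simp: choices_def)

lemma Nil_choices: "[] \<in> choices n D"
  by (simp add: choices_def)

lemma choices_length: "as \<in> choices n D \<Longrightarrow> length as \<le> D"
  by (simp add: choices_def)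

lemma finite_choices: "finite (choices n D)"
  unfolding choices_def using finite_lists_length_le[of "{..<n}" D] by (simp add: conj_commute)

lemma gate_tuples: "as \<in> choices n D \<Longrightarrow> 2 \<le> n \<Longrightarrow> gate D as \<in> tuples n (2 * D)"
  by (auto simp: tuples_def choices_def gate_def dest: in_set_takeD)

context
  fixes qs :: "bool list" and lab :: "nat \<Rightarrow> (nat \<Rightarrow> nat) \<Rightarrow> gate_label" and n :: nat and D
  assumes n: "2 \<le> n" and D_def: "D = length qs"
    and lab: "\<And>e. (\<And>i. e i < n) \<Longrightarrow> leaf_label n (lab n e)"
begin

lemma nest_circuit_simps:
  "gates (nest_circuit qs lab n) = gate D ` choices n D"
  "children (nest_circuit qs lab n) = {(gate D as, gate D (as @ [a])) | as a. as @ [a] \<in> choices n D}"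
  "label (nest_circuit qs lab n) = (\<lambda>t. if gate_depth D t = D then lab n (pad_env (take D t))
       else if qs ! gate_depth D t then Or_gate else And_gate)"
  "out_gate (nest_circuit qs lab n) = gate D []"
  by (simp_all add: nest_circuit_def Let_def flip: D_def)

lemma pad_env_less: "as \<in> choices n D \<Longrightarrow> pad_env as i < n"
  using n nth_mem[of "length as - 1 - i" as] unfolding pad_env_def choices_def by (auto simp: subset_iff)

lemma label_gate:
  "as \<in> choices n D \<Longrightarrow> label (nest_circuit qs lab n) (gate D as) =
     (if length as = D then lab n (pad_env as) else if qs ! length as then Or_gate else And_gate)"
  using choices_length[of as n D] take_gate[of as D] by (cases "length as = D") (simp_all add: nest_circuit_simps)

lemma children_depth: "children (nest_circuit qs lab n) \<subseteq> measure (gate_depth D)"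
  by (auto simp: nest_circuit_simps choices_snoc choices_length)

lemma is_circuit_nest: "is_circuit n (nest_circuit qs lab n)"
  unfolding is_circuit_def
proof (intro conjI)
  show "finite (gates (nest_circuit qs lab n))"
    by (simp add: nest_circuit_simps finite_choices)
  show "children (nest_circuit qs lab n) \<subseteq> gates (nest_circuit qs lab n) \<times> gates (nest_circuit qs lab n)"
    by (auto simp: nest_circuit_simps choices_snoc)
  show "acyclic (children (nest_circuit qs lab n))"
    using children_depth wf_acyclic[OF wf_measure] acyclic_subset by blast
  show "out_gate (nest_circuit qs lab n) \<in> gates (nest_circuit qs lab n)"
    by (simp add: nest_circuit_simps Nil_choices)
  show "\<forall>(x, y)\<in>children (nest_circuit qs lab n). label (nest_circuit qs lab n) x \<in> {And_gate, Or_gate}"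
    by (auto simp: nest_circuit_simps(2) choices_snoc label_gate)
  show "\<forall>x\<in>gates (nest_circuit qs lab n). \<forall>i. label (nest_circuit qs lab n) x \<in> {Input i, Neg_input i} \<longrightarrow> i < n"
  proof (intro ballI allI impI)
    fix x i assume x: "x \<in> gates (nest_circuit qs lab n)" and i: "label (nest_circuit qs lab n) x \<in> {Input i, Neg_input i}"
    then obtain as where as: "x = gate D as" "as \<in> choices n D"
      by (auto simp: nest_circuit_simps)
    then have "lab n (pad_env as) \<in> {Input i, Neg_input i}"
      using i label_gate[OF as(2)] by (auto split: if_splits)
    then show "i < n"
      using lab[of "pad_env as"] pad_env_less[OF as(2)] by (auto simp: leaf_label_def)
  qed
qed

lemma depth_le_nest: "depth_le (nest_circuit qs lab n) D"
  unfolding depth_le_def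
proof
  fix p assume "p \<in> paths (nest_circuit qs lab n)"
  then have p: "p \<noteq> []" "set p \<subseteq> gates (nest_circuit qs lab n)"
    "successively (\<lambda>x y. (x, y) \<in> children (nest_circuit qs lab n)) p"
    by (auto simp: paths_def)
  have "successively (\<lambda>x y. (x, y) \<in> children (nest_circuit qs lab n)) p \<Longrightarrow> p \<noteq> [] \<Longrightarrow>
    length p + gate_depth D (hd p) \<le> Suc (gate_depth D (last p))" for p
  proof (induction p rule: induct_list012)
    case (3 x y zs)
    then have "(x, y) \<in> children (nest_circuit qs lab n)"
      by simp
    then have "gate_depth D x < gate_depth D y"
      using children_depth by auto
    then show ?case using 3 by simp
  qed auto
  from this[OF p(3,1)] have "length p \<le> Suc (gate_depth D (last p))"
    by simp
  moreover have "last p \<in> gates (nest_circuit qs lab n)"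
    using p by auto
  then have "gate_depth D (last p) \<le> D"
    by (auto simp: nest_circuit_simps choices_length)
  ultimately show "length p \<le> Suc D"
    by simp
qed

lemma card_gates_nest: "card (gates (nest_circuit qs lab n)) \<le> n ^ (2 * D)"
proof -
  have "gates (nest_circuit qs lab n) \<subseteq> tuples n (2 * D)"
    using gate_tuples n by (auto simp: nest_circuit_simps)
  then have "card (gates (nest_circuit qs lab n)) \<le> card (tuples n (2 * D))"
    by (intro card_mono) auto
  also have "tuples n (2 * D) = {xs. set xs \<subseteq> {..<n} \<and> length xs = 2 * D}"
    by (auto simp: tuples_def)
  also have "card \<dots> = n ^ (2 * D)"
    by (simp add: card_lists_length_eq)
  finally show ?thesis .
qed

text \<open>Induction on the number of choices still open, from the leaves upwards: the children of
  a gate are its extensions by one element, so sums and products over children are those of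
  \<open>nest\<close>.\<close>

lemma card_trees_nest:
  assumes w: "length w = n" and B: "\<And>e. ok w e \<Longrightarrow> B w e = true_label w (lab n e)"
    and as: "as \<in> choices n D"
  shows "card (trees_at (nest_circuit qs lab n) w (gate D as)) = nest (drop (length as) qs) B w (pad_env as)"
  using as
proof (induction "D - length as" arbitrary: as)
  case 0
  let ?C = "nest_circuit qs lab n"
  have len: "length as = D"
    using 0 choices_length by fastforce
  have ok: "ok w (pad_env as)"
    using pad_env_less[OF 0(2)] n w by (simp add: ok_def)
  have "leaf_label n (lab n (pad_env as))"
    using lab pad_env_less[OF 0(2)] by blast
  moreover have "label ?C (gate D as) = lab n (pad_env as)"
    using label_gate[OF 0(2)] len by simp
  ultimately have "card (trees_at ?C w (gate D as)) = of_bool (true_label w (lab n (pad_env as)))"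
    using card_trees_at[OF is_circuit_nest, of "gate D as" w] 0(2)
    by (auto simp: nest_circuit_simps(1) leaf_label_def split: gate_label.splits)
  then show ?case
    using len B[OF ok] by (simp add: D_def)
next
  case (Suc d)
  let ?C = "nest_circuit qs lab n"
  have len: "length as < D"
    using Suc by simp
  have choice: "as @ [a] \<in> choices n D \<longleftrightarrow> a < n" for a
    using Suc.prems len by (simp add: choices_snoc)
  have ch: "child_gates ?C (gate D as) = (\<lambda>a. gate D (as @ [a])) ` {..<n}"
  proof (intro equalityI subsetI)
    fix y assume "y \<in> child_gates ?C (gate D as)"
    then obtain bs a where "gate D as = gate D bs" "y = gate D (bs @ [a])" "bs @ [a] \<in> choices n D"
      by (auto simp: child_gates_def nest_circuit_simps)
    moreover from this have "as = bs"
      using gate_inject[of as D bs] len choices_length[of bs n D] by (simp add: choices_snoc)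
    ultimately show "y \<in> (\<lambda>a. gate D (as @ [a])) ` {..<n}"
      using choice by auto
  next
    fix y assume "y \<in> (\<lambda>a. gate D (as @ [a])) ` {..<n}"
    then obtain a where "y = gate D (as @ [a])" "as @ [a] \<in> choices n D"
      using choice by auto
    then show "y \<in> child_gates ?C (gate D as)"
      unfolding child_gates_def nest_circuit_simps by blast
  qed
  have inj: "inj_on (\<lambda>a. gate D (as @ [a])) {..<n}"
    using len by (auto simp: inj_on_def gate_inject)
  have IH: "card (trees_at ?C w (gate D (as @ [a]))) = nest (drop (Suc (length as)) qs) B w (case_nat a (pad_env as))" if "a < n" for a
    using Suc.hyps(1)[of "as @ [a]"] Suc.hyps(2) that by (simp add: choice pad_env_snoc)
  have drop: "drop (length as) qs = qs ! length as # drop (Suc (length as)) qs"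
    using len by (simp add: Cons_nth_drop_Suc D_def)
  have lab': "label ?C (gate D as) = (if qs ! length as then Or_gate else And_gate)"
    using label_gate[OF Suc.prems] len by simp
  have g: "gate D as \<in> gates ?C"
    using Suc.prems by (simp add: nest_circuit_simps)
  show ?case
    using card_trees_at[OF is_circuit_nest g, of w] IH
    by (simp add: lab' ch drop w sum.reindex[OF inj] prod.reindex[OF inj])
qed

end

section \<open>The interpretation that defines these circuits\<close>

definition depth_fm :: "nat \<Rightarrow> nat \<Rightarrow> nat \<Rightarrow> (nat \<Rightarrow> nat) \<Rightarrow> bool" where
  "depth_fm D i s e \<longleftrightarrow> (\<forall>j<D. if j < i then e (s + D + j) = 1 else e (s + D + j) = 0 \<and> e (s + j) = 0)"

lemma FO_depth_fm: "FO (\<lambda>w e. depth_fm D i s e)"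
  unfolding depth_fm_def by (intro FO_all_less FO_if FO_conj FO_eq_const FO_const_bool)

lemma depth_fm_iff:
  assumes "t \<in> tuples n (2 * D)" "\<And>j. j < 2 * D \<Longrightarrow> e (s + j) = t ! j" "i \<le> D"
  shows "depth_fm D i s e \<longleftrightarrow> (\<exists>as\<in>choices n D. length as = i \<and> t = gate D as)"
proof
  have len: "length t = 2 * D"
    using assms(1) by (simp add: tuples_def)
  assume d: "depth_fm D i s e"
  have "t = gate D (take i t)"
  proof (rule nth_equalityI)
    show "length t = length (gate D (take i t))"
      using len assms(3) by simp
    fix j assume j: "j < length t"
    show "t ! j = gate D (take i t) ! j"
    proof (cases "j < D")
      case True
      then show ?thesis
        using d len assms(2)[of j] assms(3) unfolding depth_fm_def by (auto simp: gate_def nth_append)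
    next
      case False
      then have "t ! j = (if j - D < i then 1 else 0)"
        using d len j assms(2)[of j] unfolding depth_fm_def by (auto dest!: spec[of _ "j - D"] split: if_splits)
      then show ?thesis
        using False len j assms(3) by (auto simp: gate_def nth_append)
    qed
  qed
  moreover have "take i t \<in> choices n D" "length (take i t) = i"
    using assms(1,3) len by (auto simp: choices_def tuples_def dest: in_set_takeD)
  ultimately show "\<exists>as\<in>choices n D. length as = i \<and> t = gate D as"
    by metis
next
  assume "\<exists>as\<in>choices n D. length as = i \<and> t = gate D as"
  then obtain as where as: "length as = i" "t = gate D as" by blast
  show "depth_fm D i s e"
    unfolding depth_fm_def
  proof (intro allI impI)
    fix j assume "j < D"
    then have "e (s + D + j) = gate D as ! (D + j)" "e (s + j) = gate D as ! j"
      using assms(2)[of "D + j"] assms(2)[of j] as by (simp_all add: add.assoc)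
    then show "if j < i then e (s + D + j) = 1 else e (s + D + j) = 0 \<and> e (s + j) = 0"
      using as(1) assms(3) \<open>j < D\<close> by (auto simp: gate_def nth_append)
  qed
qed

text \<open>The variables not represented in the tuple of a gate have the value 0; a quantified
  least element stands in for them.\<close>

lemma FO_pad:
  assumes "FO P"
  shows "FO (\<lambda>w e. P w (\<lambda>i. if i < D then e (g i) else 0))"
proof -
  have "FO (\<lambda>w e. \<exists>z<length w. z = 0 \<and> P w (\<lambda>i. if i < D then e (g i) else z))"
  proof (intro FO_ex FO_conj FO_eq_const)
    show "FO (\<lambda>w e. P w (\<lambda>i. if i < D then e (Suc (g i)) else e 0))"
      using FO_subst[OF assms, of "\<lambda>i. if i < D then Suc (g i) else 0"] by (simp add: if_distrib)
  qed
  then show ?thesis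
    by (rule FO_cong) (auto dest: ok_lengthD)
qed

lemma FO_uniform_nest:
  assumes D: "D = length qs" "D > 0" and B: "FO B"
    and lab: "\<And>w e. ok w e \<Longrightarrow> leaf_label (length w) (lab (length w) e) \<and> B w e = true_label w (lab (length w) e)"
    and C: "\<And>n. n \<ge> 2 \<Longrightarrow> C n = nest_circuit qs lab n"
  shows "FO_uniform C"
proof -
  define P where "P S = (\<lambda>(w::bool list) e. \<exists>i<Suc D. i \<in> S \<and> depth_fm D i 0 e)" for S
  have FO_P: "FO (P S)" for S
    unfolding P_def by (intro FO_ex_less FO_conj FO_const_bool FO_depth_fm)
  \<comment> \<open>A child has one more choice than its parent and agrees with it at all other
    places; at place \<open>i\<close> the parent has the padding and the child an arbitrary
    element.\<close>
  define PE where "PE = (\<lambda>(w::bool list) e. \<exists>i<D. depth_fm D i 0 e \<and> depth_fm D (Suc i) (2 * D) e \<and>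
    (\<forall>j<D. j \<noteq> i \<longrightarrow> e j = e (2 * D + j)))"
  have FO_PE: "FO PE"
    unfolding PE_def by (intro FO_ex_less FO_all_less FO_conj FO_imp FO_const_bool FO_depth_fm FO_eq)
  \<comment> \<open>Only gates with all \<open>D\<close> choices are leaves. Reversing the indices
    turns the tuple into the environment \<open>pad_env\<close>.\<close>
  define PB where "PB = (\<lambda>w e. depth_fm D D 0 e \<and> B w (\<lambda>i. if i < D then e (D - 1 - i) else 0))"
  have FO_PB: "FO PB"
    unfolding PB_def by (intro FO_conj FO_depth_fm FO_pad[OF B])
  have D2: "2 * D \<ge> 1" "2 * (2 * D) \<ge> 1"
    using D(2) by simp_all
  have "\<forall>S. \<exists>\<phi>. wf_fm string_vocab [] \<phi> \<and> free_vars \<phi> \<subseteq> {..<2 * D} \<and>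
    (\<forall>w t. length w \<ge> 2 \<longrightarrow> t \<in> tuples (length w) (2 * D) \<longrightarrow>
       holds (string_struc w) \<phi> t = P S w (\<lambda>i. t ! (if i < 2 * D then i else 0)))"
    using FO_holds[OF FO_P D2(1)] by blast
  from choice[OF this] obtain \<phi> where \<phi>0: "\<forall>S. wf_fm string_vocab [] (\<phi> S) \<and> free_vars (\<phi> S) \<subseteq> {..<2 * D} \<and>
    (\<forall>w t. length w \<ge> 2 \<longrightarrow> t \<in> tuples (length w) (2 * D) \<longrightarrow>
       holds (string_struc w) (\<phi> S) t = P S w (\<lambda>i. t ! (if i < 2 * D then i else 0)))" ..
  have \<phi>: "\<And>S. wf_fm string_vocab [] (\<phi> S) \<and> free_vars (\<phi> S) \<subseteq> {..<2 * D}"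
    "\<And>S w t. length w \<ge> 2 \<Longrightarrow> t \<in> tuples (length w) (2 * D) \<Longrightarrow>
       holds (string_struc w) (\<phi> S) t = P S w (\<lambda>i. t ! (if i < 2 * D then i else 0))"
    using \<phi>0 by simp_all
  obtain \<phi>E where \<phi>E: "wf_fm string_vocab [] \<phi>E" "free_vars \<phi>E \<subseteq> {..<2 * (2 * D)}"
    "\<And>w t. length w \<ge> 2 \<Longrightarrow> t \<in> tuples (length w) (2 * (2 * D)) \<Longrightarrow>
       holds (string_struc w) \<phi>E t = PE w (\<lambda>i. t ! (if i < 2 * (2 * D) then i else 0))"
    using FO_holds[OF FO_PE D2(2)] by blast
  obtain \<phi>B where \<phi>B: "wf_fm string_vocab [] \<phi>B" "free_vars \<phi>B \<subseteq> {..<2 * D}"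
    "\<And>w t. length w \<ge> 2 \<Longrightarrow> t \<in> tuples (length w) (2 * D) \<Longrightarrow>
       holds (string_struc w) \<phi>B t = PB w (\<lambda>i. t ! (if i < 2 * D then i else 0))"
    using FO_holds[OF FO_PB D2(1)] by blast
  define I where "I = \<lparr>fi_dim = 2 * D, fi_univ = \<phi> UNIV, fi_E = \<phi>E, fi_and = \<phi> {i. i < D \<and> \<not> qs ! i},
    fi_or = \<phi> {i. i < D \<and> qs ! i}, fi_B = \<phi>B, fi_r = \<phi> {0}\<rparr>"
  have "wf_interp I"
    unfolding wf_interp_def I_def using \<phi>(1) \<phi>E(1,2) \<phi>B(1,2) by simp
  moreover have "apply_interp I (string_struc w) = circ_struc_of (C (length w)) w" if w: "length w \<ge> 2" for w
  proof -
    define n where "n = length w"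
    have n: "2 \<le> n" using w by (simp add: n_def)
    have lab1: "leaf_label n (lab n e)" if "\<And>i. e i < n" for e
      using lab[of w e] that w by (simp add: ok_def n_def)
    have simps: "gates (nest_circuit qs lab n) = gate D ` choices n D"
      "children (nest_circuit qs lab n) = {(gate D as, gate D (as @ [a])) | as a. as @ [a] \<in> choices n D}"
      "out_gate (nest_circuit qs lab n) = gate D []"
      by (simp_all add: nest_circuit_def Let_def flip: D(1))
    have lg: "label (nest_circuit qs lab n) (gate D as) =
     (if length as = D then lab n (pad_env as) else if qs ! length as then Or_gate else And_gate)" if "as \<in> choices n D" for as
      using label_gate[where n = n and D = D and qs = qs and lab = lab, OF n D(1) lab1 that] .
    have dep: "depth_fm D i 0 (\<lambda>i. t ! (if i < 2 * D then i else 0)) \<longleftrightarrow> (\<exists>as\<in>choices n D. length as = i \<and> t = gate D as)"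
      if "t \<in> tuples n (2 * D)" "i \<le> D" for t i
      by (rule depth_fm_iff[OF that(1) _ that(2)]) simp
    have P: "holds (string_struc w) (\<phi> S) t \<longleftrightarrow> (\<exists>as\<in>choices n D. length as \<in> S \<and> t = gate D as)" if "t \<in> tuples n (2 * D)" for S t
    proof -
      have "holds (string_struc w) (\<phi> S) t \<longleftrightarrow> (\<exists>i<Suc D. i \<in> S \<and> (\<exists>as\<in>choices n D. length as = i \<and> t = gate D as))"
        using \<phi>(2)[OF w, of t S] dep[OF that] that unfolding P_def n_def by (auto simp: less_Suc_eq_le)
      then show ?thesis
        using choices_length by (auto simp: less_Suc_eq_le)
    qed
    have univ: "interp_univ I (string_struc w) = gate D ` choices n D"
    proof (intro equalityI subsetI)
      fix t assume "t \<in> interp_univ I (string_struc w)"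
      then show "t \<in> gate D ` choices n D"
        using P[of t UNIV] by (auto simp: interp_univ_def I_def n_def)
    next
      fix t assume "t \<in> gate D ` choices n D"
      then show "t \<in> interp_univ I (string_struc w)"
        using P[of t UNIV] gate_tuples[OF _ n] by (auto simp: interp_univ_def I_def n_def)
    qed
    have inj: "gate D as = gate D bs \<longleftrightarrow> as = bs" if "as \<in> choices n D" "bs \<in> choices n D" for as bs
      using that choices_length gate_inject by blast
    have one: "(\<exists>bs\<in>choices n D. Q bs \<and> gate D as = gate D bs) \<longleftrightarrow> Q as" if "as \<in> choices n D" for Q as
      using inj[OF that] that by auto
    have PG: "holds (string_struc w) (\<phi> S) (gate D as) \<longleftrightarrow> length as \<in> S" if "as \<in> choices n D" for S as
      unfolding P[OF gate_tuples[OF that n]] by (rule one[OF that])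
    have E: "holds (string_struc w) \<phi>E (gate D as @ gate D bs) \<longleftrightarrow> (\<exists>a. bs = as @ [a])"
      if as: "as \<in> choices n D" and bs: "bs \<in> choices n D" for as bs
    proof -
      let ?t = "gate D as @ gate D bs"
      let ?e = "\<lambda>i. ?t ! (if i < 2 * (2 * D) then i else 0)"
      have la: "length as \<le> D" "length bs \<le> D"
        using as bs by (simp_all add: choices_length)
      have t: "?t \<in> tuples n (2 * (2 * D))"
        using gate_tuples[OF as n] gate_tuples[OF bs n] by (auto simp: tuples_def)
      have 1: "depth_fm D i 0 ?e \<longleftrightarrow> length as = i" if "i \<le> D" for i
        by (subst depth_fm_iff[OF gate_tuples[OF as n] _ that]) (use la in \<open>auto simp: nth_append one[OF as]\<close>)
      have 2: "depth_fm D i (2 * D) ?e \<longleftrightarrow> length bs = i" if "i \<le> D" for i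
        by (subst depth_fm_iff[OF gate_tuples[OF bs n] _ that]) (use la in \<open>auto simp: nth_append one[OF bs]\<close>)
      have "holds (string_struc w) \<phi>E ?t \<longleftrightarrow> PE w ?e"
        using \<phi>E(3)[OF w] t by (simp add: n_def)
      also have "\<dots> \<longleftrightarrow> length as < D \<and> length bs = Suc (length as) \<and> (\<forall>j<D. j \<noteq> length as \<longrightarrow> ?e j = ?e (2 * D + j))"
        unfolding PE_def using 1 2 by (auto simp: Suc_le_eq)
      also have "(\<forall>j<D. j \<noteq> length as \<longrightarrow> ?e j = ?e (2 * D + j)) \<longleftrightarrow> (\<forall>j<D. j \<noteq> length as \<longrightarrow> gate D as ! j = gate D bs ! j)"
        using la by (simp add: nth_append)
      also have "length as < D \<and> length bs = Suc (length as) \<and> \<dots> \<longleftrightarrow> (\<exists>a. bs = as @ [a])"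
      proof
        assume *: "length as < D \<and> length bs = Suc (length as) \<and> (\<forall>j<D. j \<noteq> length as \<longrightarrow> gate D as ! j = gate D bs ! j)"
        have "as = take (length as) bs"
        proof (rule nth_equalityI)
          fix j assume j: "j < length as"
          then have "gate D as ! j = gate D bs ! j"
            using * la by simp
          then show "as ! j = take (length as) bs ! j"
            using j * by (simp add: gate_def nth_append)
        qed (use * in simp)
        moreover have "bs = take (length as) bs @ [bs ! length as]"
          using * by (metis lessI take_Suc_conv_app_nth take_all_iff order_refl)
        ultimately show "\<exists>a. bs = as @ [a]" by metis
      qed (use la in \<open>auto simp: gate_def nth_append\<close>)
      finally show ?thesis .
    qed
    have Bq: "holds (string_struc w) \<phi>B (gate D as) \<longleftrightarrow> length as = D \<and> true_label w (lab n (pad_env as))"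
      if as: "as \<in> choices n D" for as
    proof -
      let ?e = "\<lambda>i. gate D as ! (if i < 2 * D then i else 0)"
      have "holds (string_struc w) \<phi>B (gate D as) \<longleftrightarrow> PB w ?e"
        using \<phi>B(3)[OF w] gate_tuples[OF as n] by (simp add: n_def)
      also have "\<dots> \<longleftrightarrow> length as = D \<and> B w (\<lambda>i. if i < D then ?e (D - 1 - i) else 0)"
        unfolding PB_def dep[OF gate_tuples[OF as n] order_refl] one[OF as] by (rule refl)
      also have "\<dots> \<longleftrightarrow> length as = D \<and> B w (pad_env as)"
      proof -
        have "length as = D \<Longrightarrow> (\<lambda>i. if i < D then ?e (D - 1 - i) else 0) = pad_env as"
          by (rule ext) (auto simp: pad_env_def gate_def nth_append)
        then show ?thesis by metis
      qed
      also have "ok w (pad_env as)"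
        using pad_env_less[where n = n and D = D and qs = qs and lab = lab, OF n D(1) lab1 as] w by (simp add: ok_def n_def)
      then have "length as = D \<and> B w (pad_env as) \<longleftrightarrow> length as = D \<and> true_label w (lab n (pad_env as))"
        using lab[of w "pad_env as"] by (auto simp: n_def)
      finally show ?thesis .
    qed
    have leaf_neq: "lab n (pad_env as) \<noteq> And_gate" "lab n (pad_env as) \<noteq> Or_gate" if "as \<in> choices n D" for as
      using lab1[of "pad_env as"] pad_env_less[where n = n and D = D and qs = qs and lab = lab, OF n D(1) lab1 that]
      by (auto simp: leaf_label_def)
    have "cs_E (apply_interp I (string_struc w)) = children (nest_circuit qs lab n)"
    proof (intro equalityI subrelI)
      fix s t assume "(s, t) \<in> cs_E (apply_interp I (string_struc w))"
      then obtain as bs where "s = gate D as" "t = gate D bs" "as \<in> choices n D" "bs \<in> choices n D"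
        "holds (string_struc w) \<phi>E (s @ t)"
        unfolding apply_interp_def univ by (auto simp: I_def)
      moreover from this obtain a where "bs = as @ [a]"
        using E by blast
      ultimately show "(s, t) \<in> children (nest_circuit qs lab n)"
        unfolding simps by blast
    next
      fix s t assume "(s, t) \<in> children (nest_circuit qs lab n)"
      then obtain as a where "s = gate D as" "t = gate D (as @ [a])" "as @ [a] \<in> choices n D"
        unfolding simps by blast
      moreover from this have "as \<in> choices n D"
        by (simp add: choices_snoc)
      ultimately show "(s, t) \<in> cs_E (apply_interp I (string_struc w))"
        using E[of as "as @ [a]"] unfolding apply_interp_def univ by (simp add: I_def)
    qed
    moreover have "cs_r (apply_interp I (string_struc w)) = {gate D []}"
      unfolding apply_interp_def univ using Nil_choices by (auto simp: I_def PG)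
    moreover have "cs_and (apply_interp I (string_struc w)) =
        {x \<in> gate D ` choices n D. label (nest_circuit qs lab n) x = And_gate}"
      "cs_or (apply_interp I (string_struc w)) = {x \<in> gate D ` choices n D. label (nest_circuit qs lab n) x = Or_gate}"
      unfolding apply_interp_def univ using leaf_neq
      by (auto simp: I_def PG lg le_neq_implies_less choices_length split: if_splits gate_label.splits)
    moreover have "cs_B (apply_interp I (string_struc w)) =
        {x \<in> gate D ` choices n D. true_label w (label (nest_circuit qs lab n) x)}"
      unfolding apply_interp_def univ by (auto simp: I_def Bq lg split: if_splits)
    moreover have "cs_univ (apply_interp I (string_struc w)) = gate D ` choices n D"
      unfolding apply_interp_def univ by simp
    ultimately show ?thesis
      using C[OF n] unfolding circ_struc_of_def n_def[symmetric] simps(1,3)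
      by (intro circ_struc.equality) (simp_all add: simps)
  qed
  ultimately show ?thesis
    unfolding FO_uniform_def by blast
qed

text \<open>Uniformity does not constrain inputs of length 1, where every function is computed by such a circuit.\<close>

definition bit_circuit :: "nat \<Rightarrow> nat \<Rightarrow> nat list circuit" where
  "bit_circuit a b = (let L = (\<lambda>i. [0, i]) ` {..<a} \<union> (\<lambda>i. [1, i]) ` {..<b} in
    \<lparr>gates = insert [] L, children = {[]} \<times> L,
     label = (\<lambda>x. if x = [] then Or_gate else if hd x = 0 then Neg_input 0 else Input 0), out_gate = []\<rparr>)"

lemma is_circuit_bit: "is_circuit 1 (bit_circuit a b)"
proof -
  have "children (bit_circuit a b) \<subseteq> measure length"
    by (auto simp: bit_circuit_def Let_def)
  then have "acyclic (children (bit_circuit a b))"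
    using wf_acyclic[OF wf_measure] acyclic_subset by blast
  then show ?thesis
    unfolding is_circuit_def by (auto simp: bit_circuit_def Let_def split: if_splits)
qed

lemma depth_le_bit: "depth_le (bit_circuit a b) 1"
  unfolding depth_le_def
proof
  fix p assume "p \<in> paths (bit_circuit a b)"
  then have "successively (\<lambda>x y. (x, y) \<in> children (bit_circuit a b)) p"
    by (simp add: paths_def)
  then show "length p \<le> Suc 1"
    by (cases p; cases "tl p"; cases "tl (tl p)") (auto simp: bit_circuit_def Let_def)
qed

lemma num_proof_trees_bit:
  assumes "length w = 1"
  shows "num_proof_trees (bit_circuit a b) w = (if w ! 0 then b else a)"
proof -
  let ?C = "bit_circuit a b"
  have card: "card (trees_at ?C w x) = of_bool (w ! 0 = (hd x \<noteq> 0))" if "x \<in> child_gates ?C []" for x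
    using card_trees_at[OF is_circuit_bit, of x a b w] that
    by (auto simp: bit_circuit_def Let_def child_gates_def split: if_splits)
  have ch: "child_gates ?C [] = (\<lambda>i. [0, i]) ` {..<a} \<union> (\<lambda>i. [1, i]) ` {..<b}"
    by (auto simp: bit_circuit_def Let_def child_gates_def)
  have "num_proof_trees ?C w = (\<Sum>x\<in>child_gates ?C []. card (trees_at ?C w x))"
    using card_trees_at[OF is_circuit_bit, of "[]" a b w]
    unfolding num_proof_trees_eq by (auto simp: bit_circuit_def Let_def)
  also have "\<dots> = (\<Sum>x\<in>child_gates ?C []. of_bool (w ! 0 = (hd x \<noteq> 0)))"
    by (intro sum.cong refl card)
  also have "\<dots> = (\<Sum>i<a. of_bool (\<not> w ! 0)) + (\<Sum>i<b. of_bool (w ! 0))"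
  proof -
    have "(\<Sum>x\<in>(\<lambda>i. [0, i]) ` {..<a}. of_bool (w ! 0 = (hd x \<noteq> 0))) = (\<Sum>i<a. of_bool (\<not> w ! 0) :: nat)"
      by (subst sum.reindex) (auto simp: inj_on_def)
    moreover have "(\<Sum>x\<in>(\<lambda>i. [1, i]) ` {..<b}. of_bool (w ! 0 = (hd x \<noteq> 0))) = (\<Sum>i<b. of_bool (w ! 0) :: nat)"
      by (subst sum.reindex) (auto simp: inj_on_def)
    ultimately show ?thesis
      unfolding ch by (subst sum.union_disjoint) auto
  qed
  finally show ?thesis
    by simp
qed

text \<open>Serves to tabulate a function on finitely many strings, so that constructions need only
  be right for long ones.\<close>

lemma K_string_indicator: "K (\<lambda>w e. of_bool (w = v))"
proof -
  have num: "NUM (\<lambda>w e. \<exists>j\<in>{j. j < length v \<and> v ! j}. e 0 = j)"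
    by (intro NUM_I FO_Bex FO_eq_const) auto
  have "NUM (\<lambda>w e. length w = length v)"
    by (intro NUM_I FO_length_eq) auto
  then have "K (\<lambda>w e. if length w = length v
      then \<Prod>a<length w. of_bool (w ! a = (\<exists>j\<in>{j. j < length v \<and> v ! j}. a = j)) else 0)"
    by (intro K_if K_prod K_zero K_input num)
  then show ?thesis
  proof (rule K_cong)
    fix w e
    have "(\<Prod>a<length w. of_bool (w ! a = (\<exists>j\<in>{j. j < length v \<and> v ! j}. a = j))) = (of_bool (w = v) :: nat)" if len: "length w = length v"
    proof (cases "w = v")
      case False
      then obtain i where i: "i < length w" "w ! i \<noteq> v ! i"
        using len by (auto simp: list_eq_iff_nth_eq)
      then have "(\<Prod>a<length w. of_bool (w ! a = (\<exists>j\<in>{j. j < length v \<and> v ! j}. a = j))) = (0 :: nat)"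
        using len by (intro prod_zero bexI[of _ i]) auto
      then show ?thesis
        using False by simp
    qed auto
    then show "(if length w = length v
      then \<Prod>a<length w. of_bool (w ! a = (\<exists>j\<in>{j. j < length v \<and> v ! j}. a = j)) else 0) = (of_bool (w = v) :: nat)"
      by auto
  qed
qed

theorem K_imp_sharp_AC0:
  assumes F: "K F" and f: "\<And>w. length w > M \<Longrightarrow> length w \<ge> 2 \<Longrightarrow> f w = F w (\<lambda>_. 0)"
  shows "f \<in> FO_uniform_sharp_AC0"
proof -
  define V where "V = {v :: bool list. length v \<le> M}"
  have finV: "finite V"
    using finite_lists_length_le[of "UNIV :: bool set" M] by (simp add: V_def)
  \<comment> \<open>The finitely many strings of length at most \<open>M\<close> are tabulated, and
    \<open>F\<close> is used beyond.\<close>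
  define G where "G = (\<lambda>w e. (\<Sum>v\<in>V. of_bool (w = v) * f v) + (if length w \<le> M then 0 else F w e))"
  have "NUM (\<lambda>w e. length w \<le> M)"
    by (intro NUM_I FO_length_le) auto
  then have "K G"
    unfolding G_def by (intro K_intros K_if F K_string_indicator)
  then obtain qs0 where "KL qs0 G"
    unfolding K_def by blast
  \<comment> \<open>The additional vacuous sum guarantees a nonempty prefix and thus an
    interpretation of positive dimension.\<close>
  then have "KL (True # qs0) G"
    by (rule KL_dummy)
  then obtain B where B: "leaf B" "\<And>w e. ok w e \<Longrightarrow> G w e = nest (True # qs0) B w e"
    unfolding KL_def by blast
  define qs where "qs = True # qs0"
  define D where "D = length qs"
  obtain lab where lab: "\<And>w e. ok w e \<Longrightarrow> leaf_label (length w) (lab (length w) e) \<and> B w e = true_label w (lab (length w) e)"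
    and FO: "FO B"
    using B(1) unfolding leaf_def by blast
  have lab1: "leaf_label n (lab n e)" if "\<And>i. e i < n" "2 \<le> n" for n e
    using lab[of "replicate n False" e] that by (simp add: ok_def)
  have Gf: "G w (\<lambda>_. 0) = f w" if "length w \<ge> 2" for w
  proof (cases "length w \<le> M")
    case True
    then have "(\<Sum>v\<in>V. of_bool (w = v) * f v) = (\<Sum>v\<in>{w}. of_bool (w = v) * f v)"
      by (intro sum.mono_neutral_right finV) (auto simp: V_def)
    then show ?thesis using True by (simp add: G_def)
  next
    case False
    then have "(\<Sum>v\<in>V. of_bool (w = v) * f v) = 0"
      by (intro sum.neutral) (auto simp: V_def)
    then show ?thesis using False f that by (simp add: G_def)
  qed
  define C where "C n = (if n = 1 then bit_circuit (f [False]) (f [True]) else nest_circuit qs lab n)" for n :: nat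
  have "FO_uniform C"
    by (rule FO_uniform_nest[of D qs B lab]) (use FO lab in \<open>auto simp: C_def D_def qs_def\<close>)
  moreover have "is_circuit n (C n)" if "n \<ge> 1" for n
    using is_circuit_bit is_circuit_nest[of n D qs lab] lab1[of _ n] that
    by (cases "n = 1") (auto simp: C_def D_def)
  moreover have "depth_le (C n) (D + 1)" if "n \<ge> 1" for n
  proof (cases "n = 1")
    case True
    then show ?thesis
      using depth_le_bit unfolding C_def depth_le_def by fastforce
  next
    case False
    then show ?thesis
      using depth_le_nest[of n D qs lab] lab1[of _ n] that unfolding C_def depth_le_def D_def by fastforce
  qed
  moreover have "\<exists>c. \<forall>n\<ge>1. card (gates (C n)) \<le> n ^ c + c"
  proof (intro exI allI impI)
    fix n :: nat assume n: "n \<ge> 1"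
    let ?c = "2 * D + card (gates (C 1))"
    show "card (gates (C n)) \<le> n ^ ?c + ?c"
    proof (cases "n = 1")
      case False
      then have "card (gates (C n)) \<le> n ^ (2 * D)"
        using card_gates_nest[of n D qs lab] lab1[of _ n] n by (simp add: C_def D_def)
      also have "\<dots> \<le> n ^ ?c"
        using n by (intro power_increasing) auto
      finally show ?thesis by simp
    qed simp
  qed
  moreover have "f w = num_proof_trees (C (length w)) w" if "w \<noteq> []" for w
  proof (cases "length w = 1")
    case True
    then obtain b where "w = [b]"
      by (cases w) auto
    then show ?thesis
      using num_proof_trees_bit[of w "f [False]" "f [True]"] by (cases b) (simp_all add: C_def)
  next
    case False
    define n where "n = length w"
    have n: "n \<ge> 2"
      using False that by (cases w; cases "tl w") (auto simp: n_def)
    have "num_proof_trees (C n) w = card (trees_at (nest_circuit qs lab n) w (gate D []))"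
      using n by (simp add: num_proof_trees_eq C_def nest_circuit_def D_def Let_def)
    also have "\<dots> = nest qs B w (pad_env [])"
      by (subst card_trees_nest[where n = n and B = B])
        (use n lab1 lab n_def in \<open>auto simp: D_def Nil_choices\<close>)
    also have "pad_env [] = (\<lambda>_. 0)"
      by (simp add: pad_env_def)
    also have "nest qs B w (\<lambda>_. 0) = f w"
    proof -
      have "ok w (\<lambda>_. 0)"
        using n that by (simp add: ok_def n_def)
      then show ?thesis
        using B(2)[OF \<open>ok w (\<lambda>_. 0)\<close>] Gf[of w] n that unfolding qs_def n_def by (simp del: nest.simps)
    qed
    finally show ?thesis by (simp add: n_def)
  qed
  ultimately show ?thesis
    unfolding FO_uniform_sharp_AC0_def by blast
qed

section \<open>Encodings of structures\<close>

lemma concat_nth: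
  assumes "i < length xss" "p < length (xss ! i)"
  shows "(\<Sum>j<i. length (xss ! j)) + p < length (concat xss)"
    "concat xss ! ((\<Sum>j<i. length (xss ! j)) + p) = xss ! i ! p"
proof -
  have "(\<Sum>j<i. length (xss ! j)) + p < length (concat xss) \<and>
    concat xss ! ((\<Sum>j<i. length (xss ! j)) + p) = xss ! i ! p"
    using assms
  proof (induction xss arbitrary: i)
    case (Cons xs xss)
    show ?case
    proof (cases i)
      case 0
      then show ?thesis using Cons.prems by (simp add: nth_append)
    next
      case (Suc k)
      have "(\<Sum>j<k. length (xss ! j)) + p < length (concat xss)"
        "concat xss ! ((\<Sum>j<k. length (xss ! j)) + p) = xss ! k ! p"
        using Cons.IH[of k] Cons.prems Suc by auto
      then show ?thesis
        unfolding Suc sum.lessThan_Suc_shift by (simp add: nth_append add.assoc)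
    qed
  qed simp
  then show "(\<Sum>j<i. length (xss ! j)) + p < length (concat xss)"
    "concat xss ! ((\<Sum>j<i. length (xss ! j)) + p) = xss ! i ! p" by auto
qed

lemma length_concat_sum: "length (concat xss) = (\<Sum>j<length xss. length (xss ! j))"
  by (simp add: length_concat sum_list_sum_nth lessThan_atLeast0)

section \<open>Positions of truth values and constants in an encoding\<close>

fun lex_index :: "nat \<Rightarrow> nat list \<Rightarrow> nat" where
  "lex_index n [] = 0"
| "lex_index n (x # t) = x * n ^ length t + lex_index n t"

lemma length_product_lists_replicate: "length (product_lists (replicate a [0..<n])) = n ^ a"
  by (induction a) (simp_all add: length_concat comp_def sum_list_triv)

lemma lex_index_nth:
  "t \<in> tuples n a \<Longrightarrow> lex_index n t < n ^ a \<and> product_lists (replicate a [0..<n]) ! lex_index n t = t"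
proof (induction a arbitrary: t)
  case (Suc a)
  then obtain x s where t: "t = x # s" "x < n" "s \<in> tuples n a"
    by (auto simp: tuples_Suc)
  note IH = Suc.IH[OF t(3)]
  define xss where "xss = map (\<lambda>x. map (Cons x) (product_lists (replicate a [0..<n]))) [0..<n]"
  have len: "length (xss ! j) = n ^ a" if "j < n" for j
    using that by (simp add: xss_def length_product_lists_replicate)
  have s: "length s = a"
    using t(3) by (simp add: tuples_def)
  have "(\<Sum>j<x. length (xss ! j)) + lex_index n s = lex_index n t"
    using len t(2) s by (simp add: t(1))
  moreover have "xss ! x ! lex_index n s = t"
    using IH t(1,2) by (simp add: xss_def length_product_lists_replicate)
  moreover have "product_lists (replicate (Suc a) [0..<n]) = concat xss"
    by (simp add: xss_def)
  moreover have "x < length xss" "lex_index n s < length (xss ! x)"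
    using t(2) IH len by (simp_all add: xss_def)
  ultimately have "product_lists (replicate (Suc a) [0..<n]) ! lex_index n t = t"
    "lex_index n t < length (product_lists (replicate (Suc a) [0..<n]))"
    using concat_nth[of x xss "lex_index n s"] by (simp_all only:)
  then show ?case
    by (simp only: length_product_lists_replicate)
qed simp

lemma lex_index_surj: "p < n ^ a \<Longrightarrow> \<exists>t\<in>tuples n a. lex_index n t = p"
proof (induction a arbitrary: p)
  case (Suc a)
  then have n: "n > 0"
    by (cases n) auto
  obtain s where s: "s \<in> tuples n a" "lex_index n s = p mod n ^ a"
    using Suc.IH[of "p mod n ^ a"] n by auto
  have "p div n ^ a < n"
    using Suc.prems by (simp add: less_mult_imp_div_less)
  then have "p div n ^ a # s \<in> tuples n (Suc a)"
    using s(1) by (auto simp: tuples_Suc)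
  moreover have "lex_index n (p div n ^ a # s) = p"
    using s div_mult_mod_eq[of p "n ^ a"] by (simp add: tuples_def)
  ultimately show ?case by blast
qed simp

lemma length_encode_rel [simp]: "length (encode_rel n a R) = n ^ a"
  by (simp add: encode_rel_def length_product_lists_replicate)

lemma encode_rel_nth: "t \<in> tuples n a \<Longrightarrow> encode_rel n a R ! lex_index n t \<longleftrightarrow> t \<in> R"
  using lex_index_nth[of t n a] by (simp add: encode_rel_def length_product_lists_replicate)

lemma ceiling_log_eq_bitlen:
  assumes "n \<ge> 1"
  shows "nat \<lceil>log 2 (real n)\<rceil> = bitlen (n - 1)"
proof -
  have "nat \<lceil>log 2 (real n)\<rceil> \<le> k \<longleftrightarrow> bitlen (n - 1) \<le> k" for k
  proof -
    have "nat \<lceil>log 2 (real n)\<rceil> \<le> k \<longleftrightarrow> log 2 (real n) \<le> real k"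
      by (simp add: nat_le_iff ceiling_le_iff)
    also have "\<dots> \<longleftrightarrow> real n \<le> 2 powr real k"
      using assms by (intro log_le_iff) auto
    also have "\<dots> \<longleftrightarrow> n \<le> 2 ^ k"
    proof -
      have "2 powr real k = real (2 ^ k)"
        by (simp add: powr_realpow)
      then show ?thesis
        by (simp only: of_nat_le_iff)
    qed
    also have "\<dots> \<longleftrightarrow> bitlen (n - 1) \<le> k"
      using assms by (auto simp: bitlen_le_iff)
    finally show ?thesis .
  qed
  then show ?thesis
    by (metis order_antisym order_refl)
qed

lemma length_binary: "n \<ge> 1 \<Longrightarrow> length (binary n c) = bitlen (n - 1)"
  by (simp add: binary_def ceiling_log_eq_bitlen)

lemma binary_nth: "n \<ge> 1 \<Longrightarrow> q < bitlen (n - 1) \<Longrightarrow> binary n c ! q \<longleftrightarrow> bit c (bitlen (n - 1) - Suc q)"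
  by (simp add: binary_def ceiling_log_eq_bitlen rev_nth)

definition rel_offset :: "vocab \<Rightarrow> nat \<Rightarrow> nat \<Rightarrow> nat" where
  "rel_offset \<sigma> n i = (\<Sum>j<i. n ^ (rel_arities \<sigma> ! j))"

definition const_offset :: "vocab \<Rightarrow> nat \<Rightarrow> nat" where
  "const_offset \<sigma> n = rel_offset \<sigma> n (length (rel_arities \<sigma>))"

definition enc_len :: "vocab \<Rightarrow> nat \<Rightarrow> nat" where
  "enc_len \<sigma> n = const_offset \<sigma> n + nconsts \<sigma> * bitlen (n - 1)"

lemma enc_facts:
  assumes "\<A> \<in> structures \<sigma>" and n_def: "n = size_of \<A>"
  shows length_enc: "length (enc \<sigma> \<A>) = enc_len \<sigma> n"
    and enc_rel_nth: "\<And>i t. i < length (rel_arities \<sigma>) \<Longrightarrow> t \<in> tuples n (rel_arities \<sigma> ! i) \<Longrightarrow>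
      rel_offset \<sigma> n i + lex_index n t < const_offset \<sigma> n \<and>
      enc \<sigma> \<A> ! (rel_offset \<sigma> n i + lex_index n t) = (t \<in> rels \<A> ! i)"
    and enc_const_nth: "\<And>j q. j < nconsts \<sigma> \<Longrightarrow> q < bitlen (n - 1) \<Longrightarrow>
      const_offset \<sigma> n + j * bitlen (n - 1) + q < enc_len \<sigma> n \<and>
      enc \<sigma> \<A> ! (const_offset \<sigma> n + j * bitlen (n - 1) + q) = bit (const_vals \<A> ! j) (bitlen (n - 1) - Suc q)"
proof -
  define rs where "rs = map2 (encode_rel n) (rel_arities \<sigma>) (rels \<A>)"
  define cs where "cs = map (binary n) (const_vals \<A>)"
  have enc: "enc \<sigma> \<A> = concat rs @ concat cs"
    by (simp add: enc_def rs_def cs_def n_def)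
  have n: "n \<ge> 1" and lr: "length (rels \<A>) = length (rel_arities \<sigma>)" and lc: "length (const_vals \<A>) = nconsts \<sigma>"
    using assms by (auto simp: structures_def relation_tuples_def tuples_def)
  have lrs: "length rs = length (rel_arities \<sigma>)" "\<And>i. i < length (rel_arities \<sigma>) \<Longrightarrow> length (rs ! i) = n ^ (rel_arities \<sigma> ! i)"
    using lr by (simp_all add: rs_def)
  have lcs: "length cs = nconsts \<sigma>" "\<And>i. i < nconsts \<sigma> \<Longrightarrow> length (cs ! i) = bitlen (n - 1)"
    using lc n by (simp_all add: cs_def length_binary)
  have off: "(\<Sum>j<i. length (rs ! j)) = rel_offset \<sigma> n i" if "i \<le> length (rel_arities \<sigma>)" for i
    unfolding rel_offset_def using that lrs by (intro sum.cong) auto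
  have offc: "(\<Sum>j<i. length (cs ! j)) = i * bitlen (n - 1)" if "i \<le> nconsts \<sigma>" for i
  proof -
    have "(\<Sum>j<i. length (cs ! j)) = (\<Sum>j<i. bitlen (n - 1))"
      using that lcs by (intro sum.cong) auto
    then show ?thesis by simp
  qed
  have lenr: "length (concat rs) = const_offset \<sigma> n"
    using off[of "length rs"] lrs(1) by (simp add: length_concat_sum const_offset_def)
  have lenc: "length (concat cs) = nconsts \<sigma> * bitlen (n - 1)"
    using offc[of "length cs"] lcs(1) by (simp add: length_concat_sum)
  show "length (enc \<sigma> \<A>) = enc_len \<sigma> n"
    by (simp add: enc enc_len_def lenr lenc)
  show "rel_offset \<sigma> n i + lex_index n t < const_offset \<sigma> n \<and>
      enc \<sigma> \<A> ! (rel_offset \<sigma> n i + lex_index n t) = (t \<in> rels \<A> ! i)"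
    if i: "i < length (rel_arities \<sigma>)" and t: "t \<in> tuples n (rel_arities \<sigma> ! i)" for i t
  proof -
    have "lex_index n t < length (rs ! i)"
      using lex_index_nth[OF t] lrs(2)[OF i] by simp
    from concat_nth[of i rs, OF _ this] have
      "rel_offset \<sigma> n i + lex_index n t < const_offset \<sigma> n"
      "concat rs ! (rel_offset \<sigma> n i + lex_index n t) = rs ! i ! lex_index n t"
      using i lrs(1) off[of i] lenr by simp_all
    moreover have "rs ! i ! lex_index n t = (t \<in> rels \<A> ! i)"
      using encode_rel_nth[OF t] i lr by (simp add: rs_def)
    ultimately show ?thesis
      by (simp add: enc nth_append lenr)
  qed
  show "const_offset \<sigma> n + j * bitlen (n - 1) + q < enc_len \<sigma> n \<and>
      enc \<sigma> \<A> ! (const_offset \<sigma> n + j * bitlen (n - 1) + q) = bit (const_vals \<A> ! j) (bitlen (n - 1) - Suc q)"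
    if j: "j < nconsts \<sigma>" and q: "q < bitlen (n - 1)" for j q
  proof -
    have "q < length (cs ! j)"
      using lcs(2)[OF j] q by simp
    from concat_nth[of j cs, OF _ this] have
      "j * bitlen (n - 1) + q < nconsts \<sigma> * bitlen (n - 1)"
      "concat cs ! (j * bitlen (n - 1) + q) = cs ! j ! q"
      using j lcs(1) offc[of j] lenc by simp_all
    moreover have "cs ! j ! q = bit (const_vals \<A> ! j) (bitlen (n - 1) - Suc q)"
      using binary_nth[OF n q] j lc by (simp add: cs_def)
    ultimately show ?thesis
      by (simp add: enc nth_append lenr enc_len_def add.assoc)
  qed
qed

lemma enc_position:
  assumes "q < enc_len \<sigma> n"
  shows "(\<exists>i<length (rel_arities \<sigma>). \<exists>t\<in>tuples n (rel_arities \<sigma> ! i). q = rel_offset \<sigma> n i + lex_index n t) \<or>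
    (\<exists>j<nconsts \<sigma>. \<exists>p<bitlen (n - 1). q = const_offset \<sigma> n + j * bitlen (n - 1) + p)"
proof (cases "q < const_offset \<sigma> n")
  case True
  have "\<exists>i<k. \<exists>p<n ^ (rel_arities \<sigma> ! i). q = rel_offset \<sigma> n i + p" if "q < rel_offset \<sigma> n k" for k
    using that
  proof (induction k)
    case (Suc k)
    show ?case
    proof (cases "q < rel_offset \<sigma> n k")
      case True
      then show ?thesis using Suc.IH less_SucI by blast
    next
      case False
      then show ?thesis
        using Suc.prems by (intro exI[of _ k] conjI exI[of _ "q - rel_offset \<sigma> n k"]) (auto simp: rel_offset_def)
    qed
  qed (simp add: rel_offset_def)
  then show ?thesis
    using True lex_index_surj unfolding const_offset_def by metis
next
  case False
  let ?l = "bitlen (n - 1)"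
  define p where "p = q - const_offset \<sigma> n"
  have p: "p < nconsts \<sigma> * ?l"
    using assms False by (simp add: p_def enc_len_def)
  then have "?l > 0"
    by (cases ?l) auto
  then have "p div ?l < nconsts \<sigma>" "p mod ?l < ?l" "q = const_offset \<sigma> n + p div ?l * ?l + p mod ?l"
    using p False by (simp_all add: less_mult_imp_div_less p_def)
  then show ?thesis by blast
qed

text \<open>The constants are not read off the string but given as a guess \<open>cv\<close>, which
  \<open>consts_match\<close> compares with the string. A correct guess is unique by
  \<open>consts_match_unique\<close>, and it exists at size \<open>n\<close> only if the string
  encodes a structure of that size.\<close>

definition decode :: "vocab \<Rightarrow> nat \<Rightarrow> bool list \<Rightarrow> nat list \<Rightarrow> struc" where
  "decode \<sigma> n w cv = \<lparr>size_of = n,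
     rels = map (\<lambda>i. {t \<in> tuples n (rel_arities \<sigma> ! i). w ! (rel_offset \<sigma> n i + lex_index n t)}) [0..<length (rel_arities \<sigma>)],
     const_vals = cv\<rparr>"

definition consts_match :: "vocab \<Rightarrow> nat \<Rightarrow> bool list \<Rightarrow> nat list \<Rightarrow> bool" where
  "consts_match \<sigma> n w cv \<longleftrightarrow> (\<forall>j<nconsts \<sigma>. \<forall>q<bitlen (n - 1).
     w ! (const_offset \<sigma> n + j * bitlen (n - 1) + q) = bit (cv ! j) (bitlen (n - 1) - Suc q))"

lemma decode_in_structures: "n \<ge> 1 \<Longrightarrow> cv \<in> tuples n (nconsts \<sigma>) \<Longrightarrow> decode \<sigma> n w cv \<in> structures \<sigma>"
  by (auto simp: structures_def decode_def relation_tuples_def)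

lemma enc_decode:
  assumes "n \<ge> 1" "cv \<in> tuples n (nconsts \<sigma>)" "length w = enc_len \<sigma> n" "consts_match \<sigma> n w cv"
  shows "enc \<sigma> (decode \<sigma> n w cv) = w"
proof (rule nth_equalityI)
  have A: "decode \<sigma> n w cv \<in> structures \<sigma>" "n = size_of (decode \<sigma> n w cv)"
    using assms decode_in_structures by (auto simp: decode_def)
  note facts = enc_facts[OF A]
  show "length (enc \<sigma> (decode \<sigma> n w cv)) = length w"
    using facts(1) assms(3) by simp
  fix q assume "q < length (enc \<sigma> (decode \<sigma> n w cv))"
  then have "q < enc_len \<sigma> n"
    using facts(1) by simp
  from enc_position[OF this] show "enc \<sigma> (decode \<sigma> n w cv) ! q = w ! q"
  proof (elim disjE exE conjE bexE)
    fix i t assume *: "i < length (rel_arities \<sigma>)" "t \<in> tuples n (rel_arities \<sigma> ! i)" "q = rel_offset \<sigma> n i + lex_index n t"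
    then show ?thesis
      using facts(2)[of i t] by (simp add: decode_def)
  next
    fix j p assume *: "j < nconsts \<sigma>" "p < bitlen (n - 1)" "q = const_offset \<sigma> n + j * bitlen (n - 1) + p"
    then show ?thesis
      using facts(3)[of j p] assms(4) by (simp add: decode_def consts_match_def)
  qed
qed

lemma structure_unfold:
  assumes "\<A> \<in> structures \<sigma>"
  shows "size_of \<A> \<ge> 1" "length (rels \<A>) = length (rel_arities \<sigma>)"
    "\<And>i. i < length (rel_arities \<sigma>) \<Longrightarrow> rels \<A> ! i \<subseteq> tuples (size_of \<A>) (rel_arities \<sigma> ! i)"
    "const_vals \<A> \<in> tuples (size_of \<A>) (nconsts \<sigma>)"
  using assms by (auto simp: structures_def relation_tuples_def)

lemma decode_enc:
  assumes A: "\<A> \<in> structures \<sigma>"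
  shows "consts_match \<sigma> (size_of \<A>) (enc \<sigma> \<A>) (const_vals \<A>)"
    "decode \<sigma> (size_of \<A>) (enc \<sigma> \<A>) (const_vals \<A>) = \<A>"
proof -
  note facts = enc_facts[OF A refl]
  show "consts_match \<sigma> (size_of \<A>) (enc \<sigma> \<A>) (const_vals \<A>)"
    using facts(3) by (simp add: consts_match_def)
  have "rels (decode \<sigma> (size_of \<A>) (enc \<sigma> \<A>) (const_vals \<A>)) = rels \<A>"
  proof (rule nth_equalityI)
    fix i assume "i < length (rels (decode \<sigma> (size_of \<A>) (enc \<sigma> \<A>) (const_vals \<A>)))"
    then have "i < length (rel_arities \<sigma>)"
      by (simp add: decode_def)
    then show "rels (decode \<sigma> (size_of \<A>) (enc \<sigma> \<A>) (const_vals \<A>)) ! i = rels \<A> ! i"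
      using facts(2) structure_unfold(3)[OF A] by (auto simp: decode_def)
  qed (simp add: decode_def structure_unfold(2)[OF A])
  then show "decode \<sigma> (size_of \<A>) (enc \<sigma> \<A>) (const_vals \<A>) = \<A>"
    by (intro struc.equality) (simp_all add: decode_def)
qed

lemma tuples_nth: "t \<in> tuples n k \<Longrightarrow> j < k \<Longrightarrow> t ! j < n"
  using nth_mem[of j t] unfolding tuples_def by blast

lemma consts_match_unique:
  assumes "consts_match \<sigma> n w cv" "consts_match \<sigma> n w cv'"
    "cv \<in> tuples n (nconsts \<sigma>)" "cv' \<in> tuples n (nconsts \<sigma>)"
  shows "cv = cv'"
proof (rule nth_equalityI)
  show "length cv = length cv'"
    using assms by (simp add: tuples_def)
  fix j assume j: "j < length cv"
  let ?l = "bitlen (n - 1)"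
  have "j < nconsts \<sigma>"
    using assms(3) j by (simp add: tuples_def)
  then have "cv ! j < n" "cv' ! j < n"
    using assms(3,4) tuples_nth by blast+
  then have "cv ! j < 2 ^ ?l" "cv' ! j < 2 ^ ?l"
    using less_power_bitlen[of "n - 1"] by linarith+
  moreover have "bit (cv ! j) b = bit (cv' ! j) b" if "b < ?l" for b
  proof -
    have "?l - Suc b < ?l" "?l - Suc (?l - Suc b) = b"
      using that by auto
    then show ?thesis
      using assms(1,2) \<open>j < nconsts \<sigma>\<close> unfolding consts_match_def by metis
  qed
  ultimately show "cv ! j = cv' ! j"
    by (intro bit_eqI) (meson less_power_iff_bit)
qed

section \<open>Counting solutions of quantifier-free formulas\<close>

fun atoms :: "fm \<Rightarrow> fm set" where
  "atoms (Neg \<phi>) = atoms \<phi>"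
| "atoms (Conj \<phi> \<psi>) = atoms \<phi> \<union> atoms \<psi>"
| "atoms (Disj \<phi> \<psi>) = atoms \<phi> \<union> atoms \<psi>"
| "atoms (Ex x \<phi>) = {}"
| "atoms (All x \<phi>) = {}"
| "atoms \<phi> = {\<phi>}"

fun eval_atoms :: "(fm \<Rightarrow> bool) \<Rightarrow> fm \<Rightarrow> bool" where
  "eval_atoms \<tau> (Neg \<phi>) \<longleftrightarrow> \<not> eval_atoms \<tau> \<phi>"
| "eval_atoms \<tau> (Conj \<phi> \<psi>) \<longleftrightarrow> eval_atoms \<tau> \<phi> \<and> eval_atoms \<tau> \<psi>"
| "eval_atoms \<tau> (Disj \<phi> \<psi>) \<longleftrightarrow> eval_atoms \<tau> \<phi> \<or> eval_atoms \<tau> \<psi>"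
| "eval_atoms \<tau> \<phi> \<longleftrightarrow> \<tau> \<phi>"

lemma finite_atoms [simp]: "finite (atoms \<phi>)"
  by (induction \<phi>) auto

lemma sat_eval_atoms: "quantifier_free \<phi> \<Longrightarrow> sat \<A> Ss e \<phi> \<longleftrightarrow> eval_atoms (sat \<A> Ss e) \<phi>"
  by (induction \<phi>) auto

lemma eval_atoms_cong:
  "quantifier_free \<phi> \<Longrightarrow> (\<And>a. a \<in> atoms \<phi> \<Longrightarrow> \<tau> a = \<tau>' a) \<Longrightarrow> eval_atoms \<tau> \<phi> \<longleftrightarrow> eval_atoms \<tau>' \<phi>"
  by (induction \<phi>) auto

lemma atoms_wf:
  "a \<in> atoms \<phi> \<Longrightarrow> wf_fm \<sigma> as \<phi> \<Longrightarrow> wf_fm \<sigma> as a \<and> free_vars a \<subseteq> free_vars \<phi> \<and>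
     (case a of Eq s t \<Rightarrow> True | Builtin b s t \<Rightarrow> True | Rel i ts \<Rightarrow> True | RVar i ts \<Rightarrow> True | _ \<Rightarrow> False)"
  by (induction \<phi>) auto

definition is_rvar :: "fm \<Rightarrow> bool" where
  "is_rvar a \<longleftrightarrow> (case a of RVar i ts \<Rightarrow> True | _ \<Rightarrow> False)"

lemma card_lists_nth:
  assumes "\<And>i. i < k \<Longrightarrow> finite (X i)"
  shows "finite {Ss. length Ss = k \<and> (\<forall>i<k. Ss ! i \<in> X i)}"
    "card {Ss. length Ss = k \<and> (\<forall>i<k. Ss ! i \<in> X i)} = (\<Prod>i<k. card (X i))"
proof -
  let ?L = "{Ss. length Ss = k \<and> (\<forall>i<k. Ss ! i \<in> X i)}"
  have bij: "bij_betw (\<lambda>F. map F [0..<k]) (PiE {..<k} X) ?L"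
  proof (rule bij_betw_byWitness[where f' = "\<lambda>Ss. restrict ((!) Ss) {..<k}"])
    show "\<forall>F\<in>PiE {..<k} X. restrict ((!) (map F [0..<k])) {..<k} = F"
      by (auto simp: restrict_def PiE_def extensional_def fun_eq_iff)
    show "\<forall>Ss\<in>?L. map (restrict ((!) Ss) {..<k}) [0..<k] = Ss"
      by (auto intro: nth_equalityI)
  qed (auto simp: PiE_def Pi_def)
  show "finite ?L"
    using bij_betw_finite[OF bij] assms finite_PiE[of "{..<k}" X] by auto
  show "card ?L = (\<Prod>i<k. card (X i))"
    using bij_betw_same_card[OF bij] by (simp add: card_PiE)
qed

lemma relation_tuples_eq:
  "relation_tuples n as = {Ss. length Ss = length as \<and> (\<forall>i<length as. Ss ! i \<in> Pow (tuples n (as ! i)))}"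
  by (auto simp: relation_tuples_def)

lemma finite_relation_tuples [simp]: "finite (relation_tuples n as)"
  unfolding relation_tuples_eq by (rule card_lists_nth(1)) simp

text \<open>The elements of \<open>T\<close> decide independently: \<open>t\<close> may belong to
  \<open>S\<close> unless \<open>Q\<close> forbids it, and may be omitted unless \<open>P\<close>
  demands it. Each factor is 0, 1 or 2.\<close>

lemma card_constrained_subsets:
  assumes "finite T"
  shows "card {S. S \<subseteq> T \<and> (\<forall>t\<in>T. (t \<in> P \<longrightarrow> t \<in> S) \<and> (t \<in> Q \<longrightarrow> t \<notin> S))} =
    (\<Prod>t\<in>T. of_bool (t \<notin> Q) + of_bool (t \<notin> P))"
  using assms
proof (induction T)
  case (insert x T)
  let ?X = "\<lambda>T. {S. S \<subseteq> T \<and> (\<forall>t\<in>T. (t \<in> P \<longrightarrow> t \<in> S) \<and> (t \<in> Q \<longrightarrow> t \<notin> S))}"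
  have fin: "finite (?X T)"
    using insert.hyps(1) by simp
  have split: "?X (insert x T) = (if x \<in> Q then {} else insert x ` ?X T) \<union> (if x \<in> P then {} else ?X T)"
  proof (intro equalityI subsetI)
    fix S assume S: "S \<in> ?X (insert x T)"
    show "S \<in> (if x \<in> Q then {} else insert x ` ?X T) \<union> (if x \<in> P then {} else ?X T)"
    proof (cases "x \<in> S")
      case True
      have "S - {x} \<in> ?X T"
        using S insert.hyps(2) by auto
      then have "S \<in> insert x ` ?X T"
        using insert_Diff[OF True, symmetric] by (rule image_eqI[rotated])
      moreover have "x \<notin> Q"
        using S True by auto
      ultimately show ?thesis by simp
    next
      case False
      then have "S \<in> ?X T" "x \<notin> P"
        using S by auto
      then show ?thesis by auto
    qed
  next
    fix S assume "S \<in> (if x \<in> Q then {} else insert x ` ?X T) \<union> (if x \<in> P then {} else ?X T)"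
    then consider S' where "x \<notin> Q" "S = insert x S'" "S' \<in> ?X T" | "x \<notin> P" "S \<in> ?X T"
      by (auto split: if_splits)
    then show "S \<in> ?X (insert x T)"
      using insert.hyps(2) by cases auto
  qed
  have inj: "inj_on (insert x) (?X T)"
  proof (rule inj_onI)
    fix S S' assume "S \<in> ?X T" "S' \<in> ?X T" and eq: "insert x S = insert x S'"
    then have "x \<notin> S" "x \<notin> S'"
      using insert.hyps(2) by auto
    then show "S = S'"
      using eq by (metis Diff_insert_absorb)
  qed
  have disj: "insert x ` ?X T \<inter> ?X T = {}"
    using insert.hyps(2) by auto
  have "card (?X (insert x T)) = (of_bool (x \<notin> Q) + of_bool (x \<notin> P)) * card (?X T)"
    unfolding split using fin disj card_image[OF inj] by (auto simp: card_Un_disjoint)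
  then show ?case
    using insert by simp
qed simp

text \<open>A relation variable may contain \<open>t\<close> unless an atom that is to be false says so, and may omit
  \<open>t\<close> unless an atom that is to be true says the contrary; this makes the count a product.\<close>

definition claims :: "fm set \<Rightarrow> (tm \<Rightarrow> nat) \<Rightarrow> nat \<Rightarrow> nat list \<Rightarrow> bool" where
  "claims T v i t \<longleftrightarrow> (\<exists>ts. RVar i ts \<in> T \<and> map v ts = t)"

text \<open>The solutions are sorted by the set \<open>\<tau>\<close> of atoms that they make true.
  Distinct atoms may name the same tuple; if \<open>\<tau>\<close> treats such atoms differently,
  the factor of that tuple is 0, so contradictory guesses contribute nothing.\<close>

lemma card_solutions:
  assumes qf: "quantifier_free \<phi>" and wf: "wf_fm \<sigma> as \<phi>"
    and vals: "\<And>a t ts i. RVar i ts \<in> atoms \<phi> \<Longrightarrow> map (tm_val \<A> e) ts \<in> tuples n (as ! i)"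
  shows "card {Ss \<in> relation_tuples n as. sat \<A> Ss e \<phi>} =
    (\<Sum>\<tau>\<in>{\<tau> \<in> Pow (atoms \<phi>). eval_atoms (\<lambda>a. a \<in> \<tau>) \<phi>}.
      (\<Prod>a\<in>{a \<in> atoms \<phi>. \<not> is_rvar a}. of_bool (sat \<A> [] e a = (a \<in> \<tau>))) *
      (\<Prod>i<length as. \<Prod>t\<in>tuples n (as ! i).
        of_bool (\<not> claims (atoms \<phi> - \<tau>) (tm_val \<A> e) i t) + of_bool (\<not> claims \<tau> (tm_val \<A> e) i t)))"
    (is "_ = (\<Sum>\<tau>\<in>?T. ?f \<tau> * ?g \<tau>)")
proof -
  define At where "At = atoms \<phi>"
  have wfa: "wf_fm \<sigma> as a" "(case a of Eq s t \<Rightarrow> True | Builtin b s t \<Rightarrow> True | Rel i ts \<Rightarrow> True | RVar i ts \<Rightarrow> True | _ \<Rightarrow> False)"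
    if "a \<in> At" for a
    using atoms_wf that wf unfolding At_def by blast+
  define Z where "Z \<tau> = {Ss \<in> relation_tuples n as. \<forall>a\<in>At. sat \<A> Ss e a = (a \<in> \<tau>)}" for \<tau>
  have "{Ss \<in> relation_tuples n as. sat \<A> Ss e \<phi>} = (\<Union>\<tau>\<in>?T. Z \<tau>)"
  proof (intro equalityI subsetI)
    fix Ss assume Ss: "Ss \<in> {Ss \<in> relation_tuples n as. sat \<A> Ss e \<phi>}"
    define \<tau> where "\<tau> = {a \<in> At. sat \<A> Ss e a}"
    have "eval_atoms (\<lambda>a. a \<in> \<tau>) \<phi> \<longleftrightarrow> eval_atoms (sat \<A> Ss e) \<phi>"
      by (rule eval_atoms_cong[OF qf]) (simp add: \<tau>_def At_def)
    then have "\<tau> \<in> ?T" "Ss \<in> Z \<tau>"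
      using Ss sat_eval_atoms[OF qf] by (auto simp: Z_def \<tau>_def At_def)
    then show "Ss \<in> (\<Union>\<tau>\<in>?T. Z \<tau>)" by blast
  next
    fix Ss assume "Ss \<in> (\<Union>\<tau>\<in>?T. Z \<tau>)"
    then obtain \<tau> where "\<tau> \<in> ?T" "Ss \<in> Z \<tau>" by blast
    moreover from this have "eval_atoms (\<lambda>a. a \<in> \<tau>) \<phi> \<longleftrightarrow> eval_atoms (sat \<A> Ss e) \<phi>"
      by (intro eval_atoms_cong[OF qf]) (auto simp: Z_def At_def)
    ultimately show "Ss \<in> {Ss \<in> relation_tuples n as. sat \<A> Ss e \<phi>}"
      using sat_eval_atoms[OF qf] by (auto simp: Z_def)
  qed
  also have "card \<dots> = (\<Sum>\<tau>\<in>?T. card (Z \<tau>))"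
  proof (rule card_UN_disjoint)
    show "\<forall>\<tau>\<in>?T. \<forall>\<tau>'\<in>?T. \<tau> \<noteq> \<tau>' \<longrightarrow> Z \<tau> \<inter> Z \<tau>' = {}"
    proof (intro ballI impI)
      fix \<tau> \<tau>' assume *: "\<tau> \<in> ?T" "\<tau>' \<in> ?T" "\<tau> \<noteq> \<tau>'"
      then obtain a where "a \<in> At" "(a \<in> \<tau>) \<noteq> (a \<in> \<tau>')"
        unfolding At_def by blast
      then show "Z \<tau> \<inter> Z \<tau>' = {}"
        by (auto simp: Z_def)
    qed
  qed (simp_all add: Z_def)
  also have "\<dots> = (\<Sum>\<tau>\<in>?T. ?f \<tau> * ?g \<tau>)"
  proof (rule sum.cong[OF refl])
    fix \<tau> assume \<tau>: "\<tau> \<in> ?T"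
    have fixed: "sat \<A> Ss e a = sat \<A> [] e a" if "a \<in> At" "\<not> is_rvar a" for Ss a
      using wfa[OF that(1)] that(2) by (cases a) (auto simp: is_rvar_def)
    have f: "?f \<tau> = of_bool (\<forall>a\<in>At. \<not> is_rvar a \<longrightarrow> sat \<A> [] e a = (a \<in> \<tau>))"
    proof (cases "\<forall>a\<in>At. \<not> is_rvar a \<longrightarrow> sat \<A> [] e a = (a \<in> \<tau>)")
      case False
      then obtain a where "a \<in> At" "\<not> is_rvar a" "sat \<A> [] e a \<noteq> (a \<in> \<tau>)" by blast
      then have "?f \<tau> = 0"
        by (intro prod_zero bexI[of _ a]) (auto simp: At_def)
      moreover have "of_bool (\<forall>a\<in>At. \<not> is_rvar a \<longrightarrow> sat \<A> [] e a = (a \<in> \<tau>)) = (0 :: nat)"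
        using False by (simp only: of_bool_eq simp_thms)
      ultimately show ?thesis by (simp only:)
    qed (simp add: At_def)
    define X where "X i = {S. S \<subseteq> tuples n (as ! i) \<and> (\<forall>t\<in>tuples n (as ! i).
      (t \<in> {t. claims \<tau> (tm_val \<A> e) i t} \<longrightarrow> t \<in> S) \<and> (t \<in> {t. claims (At - \<tau>) (tm_val \<A> e) i t} \<longrightarrow> t \<notin> S))}" for i
    have cardX: "card (X i) = (\<Prod>t\<in>tuples n (as ! i).
        of_bool (\<not> claims (At - \<tau>) (tm_val \<A> e) i t) + of_bool (\<not> claims \<tau> (tm_val \<A> e) i t))" for i
      unfolding X_def by (subst card_constrained_subsets) simp_all
    have rv: "(\<forall>a\<in>At. is_rvar a \<longrightarrow> sat \<A> Ss e a = (a \<in> \<tau>)) \<longleftrightarrow> (\<forall>i<length as. Ss ! i \<in> X i)"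
      if "Ss \<in> relation_tuples n as" for Ss
    proof
      assume *: "\<forall>a\<in>At. is_rvar a \<longrightarrow> sat \<A> Ss e a = (a \<in> \<tau>)"
      have "claims \<tau> (tm_val \<A> e) i t \<Longrightarrow> t \<in> Ss ! i" "claims (At - \<tau>) (tm_val \<A> e) i t \<Longrightarrow> t \<notin> Ss ! i" for i t
      proof -
        assume "claims \<tau> (tm_val \<A> e) i t"
        then obtain ts where "RVar i ts \<in> \<tau>" "map (tm_val \<A> e) ts = t"
          unfolding claims_def by blast
        moreover from this have "RVar i ts \<in> At"
          using \<tau> by (auto simp: At_def)
        ultimately show "t \<in> Ss ! i"
          using *[rule_format, of "RVar i ts"] by (simp add: is_rvar_def)
      next
        assume "claims (At - \<tau>) (tm_val \<A> e) i t"
        then obtain ts where "RVar i ts \<in> At - \<tau>" "map (tm_val \<A> e) ts = t"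
          unfolding claims_def by blast
        then show "t \<notin> Ss ! i"
          using *[rule_format, of "RVar i ts"] by (simp add: is_rvar_def)
      qed
      then show "\<forall>i<length as. Ss ! i \<in> X i"
        using that by (simp add: X_def relation_tuples_def)
    next
      assume *: "\<forall>i<length as. Ss ! i \<in> X i"
      show "\<forall>a\<in>At. is_rvar a \<longrightarrow> sat \<A> Ss e a = (a \<in> \<tau>)"
      proof (intro ballI impI)
        fix a assume a: "a \<in> At" "is_rvar a"
        then obtain i ts where ai: "a = RVar i ts"
          by (cases a) (auto simp: is_rvar_def)
        have i: "i < length as"
          using wfa(1)[OF a(1)] by (simp add: ai)
        define t where "t = map (tm_val \<A> e) ts"
        have t: "t \<in> tuples n (as ! i)"
          using vals a(1) unfolding ai t_def At_def by blast
        have "a \<in> \<tau> \<Longrightarrow> claims \<tau> (tm_val \<A> e) i t" "a \<notin> \<tau> \<Longrightarrow> claims (At - \<tau>) (tm_val \<A> e) i t"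
          using a(1) unfolding claims_def ai t_def by blast+
        then have "t \<in> Ss ! i \<longleftrightarrow> a \<in> \<tau>"
          using *[rule_format, OF i] t unfolding X_def by blast
        then show "sat \<A> Ss e a = (a \<in> \<tau>)"
          by (simp add: ai t_def)
      qed
    qed
    have "Z \<tau> = (if \<forall>a\<in>At. \<not> is_rvar a \<longrightarrow> sat \<A> [] e a = (a \<in> \<tau>)
      then {Ss. length Ss = length as \<and> (\<forall>i<length as. Ss ! i \<in> X i)} else {})"
    proof -
      have 1: "length Ss = length as \<and> (\<forall>i<length as. Ss ! i \<in> X i) \<longleftrightarrow>
        Ss \<in> relation_tuples n as \<and> (\<forall>a\<in>At. is_rvar a \<longrightarrow> sat \<A> Ss e a = (a \<in> \<tau>))" for Ss
      proof
        assume *: "length Ss = length as \<and> (\<forall>i<length as. Ss ! i \<in> X i)"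
        then have "Ss \<in> relation_tuples n as"
          by (simp add: X_def relation_tuples_def)
        then show "Ss \<in> relation_tuples n as \<and> (\<forall>a\<in>At. is_rvar a \<longrightarrow> sat \<A> Ss e a = (a \<in> \<tau>))"
          using rv * by blast
      next
        assume *: "Ss \<in> relation_tuples n as \<and> (\<forall>a\<in>At. is_rvar a \<longrightarrow> sat \<A> Ss e a = (a \<in> \<tau>))"
        then have "length Ss = length as"
          by (simp add: relation_tuples_def)
        then show "length Ss = length as \<and> (\<forall>i<length as. Ss ! i \<in> X i)"
          using rv * by blast
      qed
      have 2: "(\<forall>a\<in>At. sat \<A> Ss e a = (a \<in> \<tau>)) \<longleftrightarrow>
        (\<forall>a\<in>At. \<not> is_rvar a \<longrightarrow> sat \<A> [] e a = (a \<in> \<tau>)) \<and> (\<forall>a\<in>At. is_rvar a \<longrightarrow> sat \<A> Ss e a = (a \<in> \<tau>))" for Ss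
        using fixed by blast
      show ?thesis
        unfolding Z_def 1 2 by (simp split: if_splits)
    qed
    moreover have "card {Ss. length Ss = length as \<and> (\<forall>i<length as. Ss ! i \<in> X i)} = ?g \<tau>"
      by (subst card_lists_nth(2)) (simp_all add: cardX At_def, simp add: X_def)
    ultimately show "card (Z \<tau>) = ?f \<tau> * ?g \<tau>"
      unfolding f by simp
  qed
  finally show ?thesis .
qed

lemma count_sat_eq:
  "count_sat as l \<phi> \<A> = (\<Sum>cs\<in>tuples (size_of \<A>) l. card {Ss \<in> relation_tuples (size_of \<A>) as. sat \<A> Ss (\<lambda>j. cs ! j) \<phi>})"
proof -
  let ?S = "Sigma (tuples (size_of \<A>) l) (\<lambda>cs. {Ss \<in> relation_tuples (size_of \<A>) as. sat \<A> Ss (\<lambda>j. cs ! j) \<phi>})"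
  have "{(Ss, cs). Ss \<in> relation_tuples (size_of \<A>) as \<and> cs \<in> tuples (size_of \<A>) l \<and>
       sat \<A> Ss (\<lambda>j. cs ! j) \<phi>} = prod.swap ` ?S"
    by (auto simp: image_iff)
  then have "count_sat as l \<phi> \<A> = card ?S"
    unfolding count_sat_def by (simp add: card_image)
  then show ?thesis by simp
qed

section \<open>Quantifier-free counting over vocabularies with a relation of positive arity\<close>

lemma bitlen_mono: "m \<le> n \<Longrightarrow> bitlen m \<le> bitlen n"
  using less_power_bitlen[of n] by (simp add: bitlen_le_iff)

context
  fixes \<sigma> :: vocab and a0 :: nat
  assumes pos: "a0 \<in> set (rel_arities \<sigma>)" "a0 \<ge> 1"
begin

lemma const_offset_less: "n < n' \<Longrightarrow> const_offset \<sigma> n < const_offset \<sigma> n'"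
proof -
  assume n: "n < n'"
  obtain j where "j < length (rel_arities \<sigma>)" "rel_arities \<sigma> ! j = a0"
    using pos(1) by (auto simp: in_set_conv_nth)
  then have "\<exists>j\<in>{..<length (rel_arities \<sigma>)}. n ^ (rel_arities \<sigma> ! j) < n' ^ (rel_arities \<sigma> ! j)"
    using n pos(2) by (auto intro!: bexI[of _ j] power_strict_mono)
  then show ?thesis
    unfolding const_offset_def rel_offset_def using n
    by (intro sum_strict_mono_ex1) (auto intro: power_mono)
qed

text \<open>With a relation of positive arity the length of a string determines the size of the
  structure that it may encode. The size is also at most the length, so the elements of that
  structure are positions of the string.\<close>

lemma enc_len_less: "n < n' \<Longrightarrow> enc_len \<sigma> n < enc_len \<sigma> n'"
  unfolding enc_len_def using const_offset_less[of n n'] bitlen_mono[of "n - 1" "n' - 1"]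
  by (intro add_less_le_mono mult_le_mono2) auto

lemma enc_len_eq_iff: "enc_len \<sigma> n = enc_len \<sigma> n' \<longleftrightarrow> n = n'"
  using enc_len_less[of n n'] enc_len_less[of n' n] by (metis linorder_neqE_nat less_irrefl)

lemma le_enc_len: "n \<le> enc_len \<sigma> n"
proof (induction n)
  case (Suc n)
  then show ?case using enc_len_less[of n "Suc n"] by simp
qed simp

end

text \<open>The number \<open>Suc m ^ a - 1\<close>, computed without subtraction. It is used
  because the length of a string is not an element, whereas the length minus one is.\<close>

fun pred_power :: "nat \<Rightarrow> nat \<Rightarrow> nat" where
  "pred_power 0 m = 0"
| "pred_power (Suc a) m = Suc m * pred_power a m + m"

lemma Suc_pred_power: "Suc (pred_power a m) = Suc m ^ a"
proof (induction a)
  case (Suc a)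
  have "Suc m ^ Suc a = Suc m * Suc (pred_power a m)"
    by (simp only: Suc power_Suc)
  then show ?case by simp
qed simp

lemma DT_Suc [DT_intros]: "DT T \<Longrightarrow> DT (\<lambda>w e. Suc (T w e))"
  using DT_add[OF DT_const[of 1], of T] by simp

lemma DT_pred_power: "DT (\<lambda>w e. pred_power a (e i))"
  by (induction a) (auto intro!: DT_intros simp del: mult_Suc)

lemma DT_rel_offset: "DT (\<lambda>w e. rel_offset \<sigma> (Suc (e m)) i)"
  unfolding rel_offset_def by (intro DT_sum DT_power_const DT_Suc DT_var) simp

lemma DT_lex_index: "DT (\<lambda>w e. lex_index (Suc (e m)) (map (\<lambda>t. e (v t)) ts))"
  by (induction ts) (auto intro!: DT_intros simp del: power_Suc mult_Suc)

lemma NUM_enc_len: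
  assumes "rel_arities \<sigma> \<noteq> []"
  shows "NUM (\<lambda>w e. enc_len \<sigma> (Suc (e i)) = length w)"
proof (rule NUM_I)
  \<comment> \<open>The length of the encoding minus one: one truth value of the first relation is
    left out, and the rest is compared with the last position.\<close>
  define T where "T = (\<lambda>(w::bool list) e. pred_power (rel_arities \<sigma> ! 0) (e i) +
    (\<Sum>j\<in>{1..<length (rel_arities \<sigma>)}. Suc (e i) ^ (rel_arities \<sigma> ! j)) + nconsts \<sigma> * bitlen (e i))"
  have eq: "enc_len \<sigma> (Suc (e i)) = Suc (T w e)" for w and e :: "nat \<Rightarrow> nat"
  proof -
    have "{..<length (rel_arities \<sigma>)} = insert 0 {1..<length (rel_arities \<sigma>)}"
      using assms by (cases "rel_arities \<sigma>") auto
    then show ?thesis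
      unfolding enc_len_def const_offset_def rel_offset_def T_def
      by (simp add: Suc_pred_power[symmetric] del: power_Suc)
  qed
  have "DT T"
    unfolding T_def by (intro DT_intros DT_pred_power) auto
  then have "DT (\<lambda>w e. T w (\<lambda>i. e (Suc i)))"
    by (rule DT_subst)
  then have "FO (\<lambda>w e. \<exists>y<length w. y = length w - Suc 0 \<and> T w e = y)"
    by (intro FO_ex FO_conj FO_max FO_DT_env)
  then show "FO (\<lambda>w e. enc_len \<sigma> (Suc (e i)) = length w)"
  proof (rule FO_cong)
    fix w e assume "ok w e"
    then show "(\<exists>y<length w. y = length w - Suc 0 \<and> T w e = y) = (enc_len \<sigma> (Suc (e i)) = length w)"
      using eq[of e w] by (auto simp: ok_def)
  qed
qed simp

text \<open>The sums available range over the positions of the string; those over the smaller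
  decoded structure are recovered by a condition on the summands.\<close>

lemma sum_restrict_tuples:
  "Suc m \<le> n \<Longrightarrow> (\<Sum>t\<in>tuples (Suc m) k. X t) = (\<Sum>t\<in>tuples n k. if \<forall>x\<in>set t. x \<le> m then X t else (0::nat))"
  by (subst sum.inter_filter[OF finite_tuples, symmetric]) (auto simp: tuples_def subset_iff less_Suc_eq_le intro!: sum.cong)

lemma prod_restrict_tuples:
  "Suc m \<le> n \<Longrightarrow> (\<Prod>t\<in>tuples (Suc m) k. X t) = (\<Prod>t\<in>tuples n k. if \<forall>x\<in>set t. x \<le> m then X t else (1::nat))"
  by (subst prod.inter_filter[OF finite_tuples, symmetric]) (auto simp: tuples_def subset_iff less_Suc_eq_le intro!: prod.cong)

text \<open>An input leaf can only look up a position that is the value of a variable. A computed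
  position is looked up by a sum over all \<open>p\<close>, of which the condition leaves a single
  term.\<close>

definition const_test :: "vocab \<Rightarrow> bool list \<Rightarrow> nat \<Rightarrow> nat list \<Rightarrow> nat" where
  "const_test \<sigma> w m cv = (\<Prod>j<nconsts \<sigma>. \<Prod>q<length w. if q < bitlen m then
     (\<Sum>p<length w. if const_offset \<sigma> (Suc m) + j * bitlen m + q = p
       then of_bool (w ! p = (\<exists>b<length w. Suc (q + b) = bitlen m \<and> bit (cv ! j) b)) else 0) else 1)"

lemma prod_of_bool: "finite A \<Longrightarrow> (\<Prod>x\<in>A. of_bool (P x)) = (of_bool (\<forall>x\<in>A. P x) :: nat)"
  by (induction A rule: finite_induct) auto

lemma const_test_eq:
  assumes "length w = enc_len \<sigma> (Suc m)" "m < length w"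
  shows "const_test \<sigma> w m cv = of_bool (consts_match \<sigma> (Suc m) w cv)"
proof -
  have "(\<Prod>q<length w. if q < bitlen m then
     (\<Sum>p<length w. if const_offset \<sigma> (Suc m) + j * bitlen m + q = p
       then of_bool (w ! p = (\<exists>b<length w. Suc (q + b) = bitlen m \<and> bit (cv ! j) b)) else 0) else 1) =
     (of_bool (\<forall>q\<in>{..<length w}. q < bitlen m \<longrightarrow>
       w ! (const_offset \<sigma> (Suc m) + j * bitlen m + q) = bit (cv ! j) (bitlen m - Suc q)) :: nat)"
    if j: "j < nconsts \<sigma>" for j
    unfolding prod_of_bool[OF finite_lessThan, symmetric]
  proof (intro prod.cong refl)
    fix q assume "q \<in> {..<length w}"
    show "(if q < bitlen m then
     (\<Sum>p<length w. if const_offset \<sigma> (Suc m) + j * bitlen m + q = p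
       then of_bool (w ! p = (\<exists>b<length w. Suc (q + b) = bitlen m \<and> bit (cv ! j) b)) else 0) else 1) =
     (of_bool (q < bitlen m \<longrightarrow>
       w ! (const_offset \<sigma> (Suc m) + j * bitlen m + q) = bit (cv ! j) (bitlen m - Suc q)) :: nat)"
    proof (cases "q < bitlen m")
      case True
      have "j * bitlen m + q < Suc j * bitlen m"
        using True by simp
      also have "\<dots> \<le> nconsts \<sigma> * bitlen m"
        using j by (intro mult_le_mono1) simp
      finally have p: "const_offset \<sigma> (Suc m) + j * bitlen m + q < length w"
        by (simp add: assms(1) enc_len_def)
      have "bitlen m < length w"
        using bitlen_le[of m] assms(2) by simp
      then have "(\<exists>b<length w. Suc (q + b) = bitlen m \<and> bit (cv ! j) b) \<longleftrightarrow> bit (cv ! j) (bitlen m - Suc q)"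
      proof -
        have "Suc (q + b) = bitlen m \<longleftrightarrow> b = bitlen m - Suc q" "bitlen m - Suc q < length w" for b
          using True \<open>bitlen m < length w\<close> by auto
        then show ?thesis by auto
      qed
      then show ?thesis
        using True p by simp
    qed simp
  qed
  then have "const_test \<sigma> w m cv = (\<Prod>j<nconsts \<sigma>. of_bool (\<forall>q\<in>{..<length w}. q < bitlen m \<longrightarrow>
       w ! (const_offset \<sigma> (Suc m) + j * bitlen m + q) = bit (cv ! j) (bitlen m - Suc q)))"
    unfolding const_test_def by (intro prod.cong refl) simp
  moreover have "q < length w" if "q < bitlen m" for q
    using that bitlen_le[of m] assms(2) by simp
  ultimately show ?thesis
    by (auto simp: prod_of_bool consts_match_def)
qed

lemma K_const_test: "K (\<lambda>w e. const_test \<sigma> w (e m) (map (\<lambda>i. e (g i)) [0..<nconsts \<sigma>]))"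
proof -
  have 1: "NUM (\<lambda>w e. \<exists>b<length w. Suc (e i + b) = bitlen (e k) \<and> bit (e j) b)" for i j k
  proof (rule NUM_I)
    have "FO (\<lambda>w e. \<exists>b<length w. \<exists>l<length w. bitlen (e k) = l \<and> Suc (e i + b) = l \<and> bit (e j) b)"
      by (intro FO_ex FO_conj FO_bitlen FO_bit FO_DT_env DT_intros)
    then show "FO (\<lambda>w e. \<exists>b<length w. Suc (e i + b) = bitlen (e k) \<and> bit (e j) b)"
      by (rule FO_cong) (auto simp: ok_def intro: le_less_trans[OF bitlen_le])
  qed auto
  have 2: "NUM (\<lambda>w e. e i < bitlen (e j))" for i j
  proof (rule NUM_I)
    have "FO (\<lambda>w e. \<exists>l<length w. bitlen (e j) = l \<and> e i < l)"
      by (intro FO_intros)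
    then show "FO (\<lambda>w e. e i < bitlen (e j))"
      by (rule FO_cong) (auto simp: ok_def intro: le_less_trans[OF bitlen_le])
  qed auto
  have 3: "NUM (\<lambda>w e. const_offset \<sigma> (Suc (e k)) + j * bitlen (e k) + e i = e l)" for i j k l
    unfolding const_offset_def by (intro NUM_I FO_DT_env DT_add DT_rel_offset DT_mult DT_const DT_bitlen DT_var) simp
  have "K (\<lambda>w e. \<Prod>j<nconsts \<sigma>. \<Prod>q<length w. if q < bitlen (e m) then
     (\<Sum>p<length w. if const_offset \<sigma> (Suc (e m)) + j * bitlen (e m) + q = p
       then of_bool (w ! p = (\<exists>b<length w. Suc (q + b) = bitlen (e m) \<and> bit (e (g j)) b)) else 0) else 1)"
    by (intro K_finite_prod K_prod K_if K_sum K_input K_zero K_one 1 2 3)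
  then show ?thesis
    unfolding const_test_def by (rule K_cong) (auto intro!: prod.cong)
qed

definition atom_factor :: "vocab \<Rightarrow> bool list \<Rightarrow> nat \<Rightarrow> (tm \<Rightarrow> nat) \<Rightarrow> fm set \<Rightarrow> fm \<Rightarrow> nat" where
  "atom_factor \<sigma> w m v \<tau> a = (case a of
     Eq s t \<Rightarrow> of_bool ((v s = v t) = (a \<in> \<tau>))
   | Builtin b s t \<Rightarrow> of_bool ((v s \<le> v t) = (a \<in> \<tau>))
   | Rel i ts \<Rightarrow> (\<Sum>p<length w. if rel_offset \<sigma> (Suc m) i + lex_index (Suc m) (map v ts) = p
       then of_bool (w ! p = (a \<in> \<tau>)) else 0)
   | _ \<Rightarrow> 1)"

definition solution_sum :: "vocab \<Rightarrow> nat list \<Rightarrow> fm \<Rightarrow> bool list \<Rightarrow> nat \<Rightarrow> (tm \<Rightarrow> nat) \<Rightarrow> nat" where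
  "solution_sum \<sigma> as \<phi> w m v = (\<Sum>\<tau>\<in>{\<tau> \<in> Pow (atoms \<phi>). eval_atoms (\<lambda>a. a \<in> \<tau>) \<phi>}.
      (\<Prod>a\<in>{a \<in> atoms \<phi>. \<not> is_rvar a}. atom_factor \<sigma> w m v \<tau> a) *
      (\<Prod>i<length as. \<Prod>t\<in>tuples (length w) (as ! i). if \<forall>x\<in>set t. x \<le> m
        then of_bool (\<not> claims (atoms \<phi> - \<tau>) v i t) + of_bool (\<not> claims \<tau> v i t) else 1))"

fun atom_terms :: "fm \<Rightarrow> tm set" where
  "atom_terms (Eq s t) = {s, t}"
| "atom_terms (Builtin b s t) = {s, t}"
| "atom_terms (Rel i ts) = set ts"
| "atom_terms (RVar i ts) = set ts"
| "atom_terms _ = {}"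

lemma solution_sum_cong:
  assumes "\<And>a t. a \<in> atoms \<phi> \<Longrightarrow> t \<in> atom_terms a \<Longrightarrow> v t = v' t"
  shows "solution_sum \<sigma> as \<phi> w m v = solution_sum \<sigma> as \<phi> w m v'"
proof -
  have 1: "atom_factor \<sigma> w m v \<tau> a = atom_factor \<sigma> w m v' \<tau> a" if "a \<in> atoms \<phi>" for a \<tau>
  proof (cases a)
    case (Rel i ts)
    have "map v ts = map v' ts"
      using assms[OF that] by (simp add: Rel)
    then show ?thesis
      unfolding atom_factor_def Rel by (simp only: fm.case)
  qed (use assms[OF that] in \<open>auto simp: atom_factor_def\<close>)
  have 2: "claims T v i t = claims T v' i t" if "T \<subseteq> atoms \<phi>" for T i t
  proof -
    have "map v ts = map v' ts" if "RVar i ts \<in> T" for ts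
      using assms[of "RVar i ts"] that \<open>T \<subseteq> atoms \<phi>\<close> by auto
    then show ?thesis
      unfolding claims_def by metis
  qed
  show ?thesis
    unfolding solution_sum_def
  proof (intro sum.cong refl arg_cong2[where f = "(*)"] prod.cong)
    fix \<tau> i t assume "\<tau> \<in> {\<tau> \<in> Pow (atoms \<phi>). eval_atoms (\<lambda>a. a \<in> \<tau>) \<phi>}"
    then have "\<tau> \<subseteq> atoms \<phi>" by simp
    then show "(if \<forall>x\<in>set t. x \<le> m then of_bool (\<not> claims (atoms \<phi> - \<tau>) v i t) + of_bool (\<not> claims \<tau> v i t) else 1) =
      (if \<forall>x\<in>set t. x \<le> m then of_bool (\<not> claims (atoms \<phi> - \<tau>) v' i t) + of_bool (\<not> claims \<tau> v' i t) else (1::nat))"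
      using 2[of \<tau> i t] 2[of "atoms \<phi> - \<tau>" i t] by simp
  qed (simp add: 1)
qed

lemma NUM_bounded: "NUM (\<lambda>w e. \<forall>x\<in>set (map (\<lambda>i. e (g i)) [0..<k]). x \<le> e j)"
proof (rule NUM_I)
  have "FO (\<lambda>w e. \<forall>i<k. e (g i) \<le> e j)"
    by (intro FO_all_less FO_le)
  then show "FO (\<lambda>w e. \<forall>x\<in>set (map (\<lambda>i. e (g i)) [0..<k]). x \<le> e j)"
    by (rule FO_cong) auto
qed simp

lemma NUM_claims:
  assumes "finite T"
  shows "NUM (\<lambda>w e. \<not> claims T (\<lambda>t. e (v t)) i (map e [0..<k]))"
proof (intro NUM_I FO_not)
  have "finite {ts. RVar i ts \<in> T}"
    using finite_vimageI[OF assms, of "RVar i"] by (simp add: inj_on_def vimage_def)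
  then have "FO (\<lambda>w e. \<exists>ts\<in>{ts. RVar i ts \<in> T}. length ts = k \<and> (\<forall>q<k. e (v (ts ! q)) = e q))"
    by (intro FO_Bex FO_conj FO_const_bool FO_all_less FO_eq)
  then show "FO (\<lambda>w e. claims T (\<lambda>t. e (v t)) i (map e [0..<k]))"
  proof (rule FO_cong)
    fix w :: "bool list" and e :: "nat \<Rightarrow> nat"
    have "map (\<lambda>t. e (v t)) ts = map e [0..<k] \<longleftrightarrow> length ts = k \<and> (\<forall>q<k. e (v (ts ! q)) = e q)" for ts
      unfolding list_eq_iff_nth_eq by auto
    then show "(\<exists>ts\<in>{ts. RVar i ts \<in> T}. length ts = k \<and> (\<forall>q<k. e (v (ts ! q)) = e q)) =
      claims T (\<lambda>t. e (v t)) i (map e [0..<k])"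
      unfolding claims_def by simp
  qed
qed simp

lemma K_solution_sum: "K (\<lambda>w e. solution_sum \<sigma> as \<phi> w (e m) (\<lambda>t. e (v t)))"
proof -
  have 1: "K (\<lambda>w e. atom_factor \<sigma> w (e m) (\<lambda>t. e (v t)) \<tau> a)" for \<tau> a
  proof (cases a)
    case (Eq s t)
    have "NUM (\<lambda>w e. (e (v s) = e (v t)) = (a \<in> \<tau>))"
      by (intro NUM_I FO_iff FO_eq FO_const_bool) simp
    then show ?thesis
      unfolding Eq atom_factor_def fm.case by (rule K_NUM)
  next
    case (Builtin b s t)
    have "NUM (\<lambda>w e. (e (v s) \<le> e (v t)) = (a \<in> \<tau>))"
      by (intro NUM_I FO_iff FO_le FO_const_bool) simp
    then show ?thesis
      unfolding Builtin atom_factor_def fm.case by (rule K_NUM)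
  next
    case (Rel i ts)
    have "NUM (\<lambda>w e. rel_offset \<sigma> (Suc (e k)) i + lex_index (Suc (e k)) (map (\<lambda>t. e (u t)) ts) = e l)" for k l u
      by (intro NUM_I FO_DT_env DT_add DT_rel_offset DT_lex_index) simp
    then show ?thesis
      unfolding Rel atom_factor_def fm.case by (intro K_sum K_if K_input NUM_const K_zero)
  qed (simp_all add: atom_factor_def K_one[simplified])
  show ?thesis
    unfolding solution_sum_def
  proof (intro K_finite_sum K_mult K_finite_prod 1 K_prod_tuples K_if K_add K_NUM K_one)
    fix \<tau> i assume "\<tau> \<in> {\<tau> \<in> Pow (atoms \<phi>). eval_atoms (\<lambda>a. a \<in> \<tau>) \<phi>}"
    then have fin: "finite \<tau>" "finite (atoms \<phi> - \<tau>)"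
      using finite_subset[OF _ finite_atoms] by auto
    show "NUM (\<lambda>w e. \<forall>x\<in>set (map e [0..<as ! i]). x \<le> e (m + as ! i))"
      using NUM_bounded[of "\<lambda>i. i"] .
    show "NUM (\<lambda>w e. \<not> claims (atoms \<phi> - \<tau>) (\<lambda>t. e (v t + as ! i)) i (map e [0..<as ! i]))"
      by (rule NUM_claims[OF fin(2)])
    show "NUM (\<lambda>w e. \<not> claims \<tau> (\<lambda>t. e (v t + as ! i)) i (map e [0..<as ! i]))"
      by (rule NUM_claims[OF fin(1)])
  qed
qed

definition tm_value :: "nat list \<Rightarrow> nat list \<Rightarrow> tm \<Rightarrow> nat" where
  "tm_value xs cv t = (case t of Var x \<Rightarrow> xs ! x | Cst j \<Rightarrow> cv ! j)"

lemma tm_val_decode: "tm_val (decode \<sigma> n w cv) (\<lambda>j. xs ! j) = tm_value xs cv"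
  by (rule ext) (auto simp: tm_value_def decode_def split: tm.splits)

lemma atom_terms_wf:
  assumes "a \<in> atoms \<phi>" "t \<in> atom_terms a" "wf_fm \<sigma> as \<phi>" "free_vars \<phi> \<subseteq> {..<l}"
  shows "wf_tm \<sigma> t \<and> tm_vars t \<subseteq> {..<l}"
proof -
  have "wf_fm \<sigma> as a" "free_vars a \<subseteq> {..<l}"
    using atoms_wf[OF assms(1,3)] assms(4) by blast+
  then show ?thesis
    using assms(2) by (cases a) (auto simp: list_all_iff)
qed

lemma tm_value_less:
  assumes "xs \<in> tuples n l" "cv \<in> tuples n (nconsts \<sigma>)" "wf_tm \<sigma> t" "tm_vars t \<subseteq> {..<l}"
  shows "tm_value xs cv t < n"
  using assms tuples_nth by (cases t) (auto simp: tm_value_def)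

lemma solution_sum_eq:
  assumes qf: "quantifier_free \<phi>" and wf: "wf_fm \<sigma> as \<phi>" and fv: "free_vars \<phi> \<subseteq> {..<l}" and LE: "builtins \<sigma> = {LE}"
    and w: "length w = enc_len \<sigma> (Suc m)" "Suc m \<le> length w"
    and xs: "xs \<in> tuples (Suc m) l" and cv: "cv \<in> tuples (Suc m) (nconsts \<sigma>)"
  shows "card {Ss \<in> relation_tuples (Suc m) as. sat (decode \<sigma> (Suc m) w cv) Ss (\<lambda>j. xs ! j) \<phi>} =
    solution_sum \<sigma> as \<phi> w m (tm_value xs cv)"
proof -
  let ?A = "decode \<sigma> (Suc m) w cv" and ?v = "tm_value xs cv"
  have val: "?v t < Suc m" if "a \<in> atoms \<phi>" "t \<in> atom_terms a" for a t
    using tm_value_less[OF xs cv] atom_terms_wf[OF that wf fv] by blast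
  have wfa: "wf_fm \<sigma> as a" if "a \<in> atoms \<phi>" for a
    using atoms_wf[OF that wf] by blast
  have "map ?v ts \<in> tuples (Suc m) (as ! i)" if "RVar i ts \<in> atoms \<phi>" for i ts
    using val[OF that] wfa[OF that] by (auto simp: tuples_def)
  then have "card {Ss \<in> relation_tuples (Suc m) as. sat ?A Ss (\<lambda>j. xs ! j) \<phi>} =
    (\<Sum>\<tau>\<in>{\<tau> \<in> Pow (atoms \<phi>). eval_atoms (\<lambda>a. a \<in> \<tau>) \<phi>}.
      (\<Prod>a\<in>{a \<in> atoms \<phi>. \<not> is_rvar a}. of_bool (sat ?A [] (\<lambda>j. xs ! j) a = (a \<in> \<tau>))) *
      (\<Prod>i<length as. \<Prod>t\<in>tuples (Suc m) (as ! i).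
        of_bool (\<not> claims (atoms \<phi> - \<tau>) ?v i t) + of_bool (\<not> claims \<tau> ?v i t)))"
    by (subst card_solutions[OF qf wf]) (simp_all only: tm_val_decode)
  also have "\<dots> = solution_sum \<sigma> as \<phi> w m ?v"
  proof -
    have 1: "of_bool (sat ?A [] (\<lambda>j. xs ! j) a = (a \<in> \<tau>)) = atom_factor \<sigma> w m ?v \<tau> a"
      if "a \<in> {a \<in> atoms \<phi>. \<not> is_rvar a}" for a \<tau>
    proof -
    from that have a: "a \<in> atoms \<phi>" "\<not> is_rvar a" by auto
    show ?thesis
    proof (cases a)
      case (Eq s t)
      show ?thesis unfolding Eq atom_factor_def by (simp add: tm_val_decode)
    next
      case (Builtin b s t)
      then have "b = LE"
        using wfa[OF a(1)] LE by simp
      then show ?thesis unfolding Builtin atom_factor_def by (simp add: tm_val_decode)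
    next
      case (Rel i ts)
      have i: "i < length (rel_arities \<sigma>)" "length ts = rel_arities \<sigma> ! i"
        using wfa[OF a(1)] by (simp_all add: Rel)
      have t: "map ?v ts \<in> tuples (Suc m) (rel_arities \<sigma> ! i)"
        using val[OF a(1)] i(2) by (auto simp: Rel tuples_def)
      let ?p = "rel_offset \<sigma> (Suc m) i + lex_index (Suc m) (map ?v ts)"
      have "?A \<in> structures \<sigma>" "Suc m = size_of ?A"
        using decode_in_structures[OF _ cv] by (simp_all add: decode_def)
      then have "?p < const_offset \<sigma> (Suc m)"
        using enc_rel_nth[of ?A \<sigma> "Suc m" i] i(1) t by blast
      then have "?p < length w"
        by (simp add: w enc_len_def)
      then have "atom_factor \<sigma> w m ?v \<tau> a = of_bool (w ! ?p = (a \<in> \<tau>))"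
        unfolding Rel atom_factor_def by simp
      moreover have "sat ?A [] (\<lambda>j. xs ! j) a \<longleftrightarrow> w ! ?p"
        using i(1) t by (simp add: Rel tm_val_decode) (simp add: decode_def)
      ultimately show ?thesis by simp
    qed (use atoms_wf[OF a(1) wf] a(2) in \<open>auto simp: is_rvar_def\<close>)
    qed
    show ?thesis
      unfolding solution_sum_def prod_restrict_tuples[OF w(2)]
      by (intro sum.cong refl arg_cong2[where f = "(*)"]) (rule prod.cong[OF refl 1])
  qed
  finally show ?thesis .
qed

text \<open>The sums over \<open>m\<close> and \<open>cv\<close> guess the structure; at most one
  pair passes both tests, and none does if the string is not an encoding.\<close>

definition structure_sum :: "vocab \<Rightarrow> nat list \<Rightarrow> nat \<Rightarrow> fm \<Rightarrow> bool list \<Rightarrow> nat" where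
  "structure_sum \<sigma> as l \<phi> w = (\<Sum>m<length w. if enc_len \<sigma> (Suc m) = length w then
     (\<Sum>cv\<in>tuples (length w) (nconsts \<sigma>). if \<forall>x\<in>set cv. x \<le> m then const_test \<sigma> w m cv *
       (\<Sum>xs\<in>tuples (length w) l. if \<forall>x\<in>set xs. x \<le> m then solution_sum \<sigma> as \<phi> w m (tm_value xs cv) else 0) else 0) else 0)"

lemma K_structure_sum:
  assumes ne: "rel_arities \<sigma> \<noteq> []" and wf: "wf_fm \<sigma> as \<phi>" and fv: "free_vars \<phi> \<subseteq> {..<l}"
  shows "K (\<lambda>w e. structure_sum \<sigma> as l \<phi> w)"
  unfolding structure_sum_def
proof (intro K_sum K_sum_tuples K_if K_mult K_zero NUM_enc_len[OF ne])
  let ?c = "nconsts \<sigma>"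
  show "NUM (\<lambda>w e. \<forall>x\<in>set (map e [0..<?c]). x \<le> e (0 + ?c))"
    using NUM_bounded[of "\<lambda>i. i"] .
  show "K (\<lambda>w e. const_test \<sigma> w (e (0 + ?c)) (map e [0..<?c]))"
    using K_const_test[of \<sigma> "0 + ?c" "\<lambda>i. i"] .
  show "NUM (\<lambda>w e. \<forall>x\<in>set (map e [0..<l]). x \<le> e (0 + ?c + l))"
    using NUM_bounded[of "\<lambda>i. i"] .
  \<comment> \<open>The innermost \<open>l\<close> variables hold the tuple of elements; they are
    followed by the constants and then by \<open>m\<close>.\<close>
  define v where "v = (\<lambda>t. case t of Var x \<Rightarrow> x | Cst j \<Rightarrow> j + l)"
  have "K (\<lambda>w e. solution_sum \<sigma> as \<phi> w (e (0 + ?c + l)) (\<lambda>t. e (v t)))"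
    by (rule K_solution_sum)
  then show "K (\<lambda>w e. solution_sum \<sigma> as \<phi> w (e (0 + ?c + l)) (tm_value (map e [0..<l]) (map (\<lambda>i. e (i + l)) [0..<?c])))"
  proof (rule K_cong, intro solution_sum_cong)
    fix e :: "nat \<Rightarrow> nat" and a t assume "a \<in> atoms \<phi>" "t \<in> atom_terms a"
    then have "wf_tm \<sigma> t" "tm_vars t \<subseteq> {..<l}"
      using atom_terms_wf wf fv by blast+
    then show "e (v t) = tm_value (map e [0..<l]) (map (\<lambda>i. e (i + l)) [0..<?c]) t"
      by (cases t) (simp_all add: v_def tm_value_def)
  qed
qed

lemma structure_sum_eq:
  assumes a0: "a0 \<in> set (rel_arities \<sigma>)" "a0 \<ge> 1"
    and qf: "quantifier_free \<phi>" and wf: "wf_fm \<sigma> as \<phi>" and fv: "free_vars \<phi> \<subseteq> {..<l}" and LE: "builtins \<sigma> = {LE}"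
    and f: "\<And>\<A>. \<A> \<in> structures \<sigma> \<Longrightarrow> enc \<sigma> \<A> \<noteq> [] \<Longrightarrow> f (enc \<sigma> \<A>) = count_sat as l \<phi> \<A>"
      "\<And>w. w \<noteq> [] \<Longrightarrow> w \<notin> enc \<sigma> ` structures \<sigma> \<Longrightarrow> f w = 0"
    and w: "w \<noteq> []"
  shows "f w = structure_sum \<sigma> as l \<phi> w"
proof -
  let ?N = "length w"
  have inner: "(\<Sum>cv\<in>tuples ?N (nconsts \<sigma>). if \<forall>x\<in>set cv. x \<le> m then const_test \<sigma> w m cv *
       (\<Sum>xs\<in>tuples ?N l. if \<forall>x\<in>set xs. x \<le> m then solution_sum \<sigma> as \<phi> w m (tm_value xs cv) else 0) else 0) =
     (\<Sum>cv\<in>tuples (Suc m) (nconsts \<sigma>). of_bool (consts_match \<sigma> (Suc m) w cv) * f w)"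
    if m: "enc_len \<sigma> (Suc m) = ?N" for m
  proof -
    have m': "Suc m \<le> ?N"
      using le_enc_len[OF a0, of "Suc m"] m by simp
    have "const_test \<sigma> w m cv * (\<Sum>xs\<in>tuples (Suc m) l. solution_sum \<sigma> as \<phi> w m (tm_value xs cv)) =
      of_bool (consts_match \<sigma> (Suc m) w cv) * f w" if cv: "cv \<in> tuples (Suc m) (nconsts \<sigma>)" for cv
    proof (cases "consts_match \<sigma> (Suc m) w cv")
      case True
      have "f w = count_sat as l \<phi> (decode \<sigma> (Suc m) w cv)"
        using f(1)[OF decode_in_structures[OF _ cv], of w] enc_decode[OF _ cv m[symmetric] True] w by simp
      also have "\<dots> = (\<Sum>xs\<in>tuples (Suc m) l. solution_sum \<sigma> as \<phi> w m (tm_value xs cv))"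
        unfolding count_sat_eq using solution_sum_eq[OF qf wf fv LE m[symmetric] m' _ cv]
        by (simp add: decode_def)
      finally show ?thesis
        using const_test_eq[of w \<sigma> m cv] m m' True by simp
    next
      case False
      then show ?thesis
        using const_test_eq[of w \<sigma> m cv] m m' by simp
    qed
    then show ?thesis
      unfolding sum_restrict_tuples[OF m', symmetric] by (intro sum.cong refl)
  qed
  then have S: "structure_sum \<sigma> as l \<phi> w = (\<Sum>m<?N. if enc_len \<sigma> (Suc m) = ?N then
     (\<Sum>cv\<in>tuples (Suc m) (nconsts \<sigma>). of_bool (consts_match \<sigma> (Suc m) w cv) * f w) else 0)"
    unfolding structure_sum_def by (intro sum.cong refl) simp
  show ?thesis
  proof (cases "w \<in> enc \<sigma> ` structures \<sigma>")
    case False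
    then show ?thesis
      unfolding S using f(2)[OF w] by simp
  next
    case True
    then obtain \<A> where A: "\<A> \<in> structures \<sigma>" "w = enc \<sigma> \<A>" by blast
    define m where "m = size_of \<A> - 1"
    have n: "size_of \<A> = Suc m"
      using structure_unfold(1)[OF A(1)] by (simp add: m_def)
    have N: "?N = enc_len \<sigma> (Suc m)"
      using length_enc[OF A(1) refl] A(2) n by simp
    have match: "consts_match \<sigma> (Suc m) w (const_vals \<A>)" "const_vals \<A> \<in> tuples (Suc m) (nconsts \<sigma>)"
      using decode_enc(1)[OF A(1)] structure_unfold(4)[OF A(1)] A(2) n by simp_all
    have "(\<Sum>cv\<in>tuples (Suc m) (nconsts \<sigma>). of_bool (consts_match \<sigma> (Suc m) w cv) * f w) =
      (\<Sum>cv\<in>{const_vals \<A>}. of_bool (consts_match \<sigma> (Suc m) w cv) * f w)"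
    proof (rule sum.mono_neutral_right)
      show "\<forall>cv\<in>tuples (Suc m) (nconsts \<sigma>) - {const_vals \<A>}. of_bool (consts_match \<sigma> (Suc m) w cv) * f w = 0"
      proof
        fix cv assume "cv \<in> tuples (Suc m) (nconsts \<sigma>) - {const_vals \<A>}"
        then have "\<not> consts_match \<sigma> (Suc m) w cv"
          using consts_match_unique[OF _ match(1) _ match(2), of cv] by blast
        then show "of_bool (consts_match \<sigma> (Suc m) w cv) * f w = 0" by simp
      qed
    qed (use match in simp_all)
    then have one: "(\<Sum>cv\<in>tuples (Suc m) (nconsts \<sigma>). of_bool (consts_match \<sigma> (Suc m) w cv) * f w) = f w"
      using match by simp
    have "m < ?N"
      using le_enc_len[OF a0, of "Suc m"] N by simp
    moreover have "enc_len \<sigma> (Suc k) = ?N \<longleftrightarrow> k = m" for k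
      unfolding N by (simp add: enc_len_eq_iff[OF a0])
    ultimately show ?thesis
      unfolding S by (simp add: one)
  qed
qed

theorem sigma0_positive_arity:
  assumes "a0 \<in> set (rel_arities \<sigma>)" "a0 \<ge> 1"
    "quantifier_free \<phi>" "wf_fm \<sigma> as \<phi>" "free_vars \<phi> \<subseteq> {..<l}" "builtins \<sigma> = {LE}"
    "\<And>\<A>. \<A> \<in> structures \<sigma> \<Longrightarrow> enc \<sigma> \<A> \<noteq> [] \<Longrightarrow> f (enc \<sigma> \<A>) = count_sat as l \<phi> \<A>"
    "\<And>w. w \<noteq> [] \<Longrightarrow> w \<notin> enc \<sigma> ` structures \<sigma> \<Longrightarrow> f w = 0"
  shows "f \<in> FO_uniform_sharp_AC0"
proof (rule K_imp_sharp_AC0)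
  show "K (\<lambda>w e. structure_sum \<sigma> as l \<phi> w)"
    using assms(1) by (intro K_structure_sum[OF _ assms(4,5)]) auto
  show "f w = structure_sum \<sigma> as l \<phi> w" if "length w \<ge> 2" for w
    by (rule structure_sum_eq[OF assms]) (use that in auto)
qed

section \<open>Substructures\<close>

text \<open>The substructure induced on the range of \<open>h\<close>, renumbered by
  \<open>{..<n}\<close>.\<close>

definition pull :: "vocab \<Rightarrow> (nat \<Rightarrow> nat) \<Rightarrow> nat \<Rightarrow> struc \<Rightarrow> struc" where
  "pull \<sigma> h n \<A> = \<lparr>size_of = n,
     rels = map (\<lambda>i. {t \<in> tuples n (rel_arities \<sigma> ! i). map h t \<in> rels \<A> ! i}) [0..<length (rel_arities \<sigma>)],
     const_vals = map (\<lambda>c. SOME k. k < n \<and> h k = c) (const_vals \<A>)\<rparr>"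

definition pull_rels :: "nat list \<Rightarrow> (nat \<Rightarrow> nat) \<Rightarrow> nat \<Rightarrow> nat list set list \<Rightarrow> nat list set list" where
  "pull_rels as h n Ss = map (\<lambda>i. {t \<in> tuples n (as ! i). map h t \<in> Ss ! i}) [0..<length as]"

lemma pull_rels_in: "pull_rels as h n Ss \<in> relation_tuples n as"
  by (auto simp: pull_rels_def relation_tuples_def)

context
  fixes \<sigma> :: vocab and h :: "nat \<Rightarrow> nat" and n :: nat and \<A> :: struc
  assumes A: "\<A> \<in> structures \<sigma>" and h: "strict_mono_on {..<n} h" "h ` {..<n} \<subseteq> {..<size_of \<A>}"
    and cimg: "set (const_vals \<A>) \<subseteq> h ` {..<n}" and LE: "builtins \<sigma> = {LE}"
begin

lemma pull_const:
  assumes "c \<in> set (const_vals \<A>)"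
  shows "(SOME k. k < n \<and> h k = c) < n \<and> h (SOME k. k < n \<and> h k = c) = c"
  by (rule someI_ex) (use assms cimg in auto)

lemma pull_in_structures: "n \<ge> 1 \<Longrightarrow> pull \<sigma> h n \<A> \<in> structures \<sigma>"
  using structure_unfold[OF A] pull_const
  by (auto simp: structures_def relation_tuples_def pull_def tuples_def)

lemma pull_tm_val:
  assumes "wf_tm \<sigma> t" "\<And>x. e x < n"
  shows "tm_val (pull \<sigma> h n \<A>) e t < n" "h (tm_val (pull \<sigma> h n \<A>) e t) = tm_val \<A> (\<lambda>x. h (e x)) t"
proof -
  have "c < length (const_vals \<A>)" if "t = Cst c" for c
    using assms(1) that structure_unfold(4)[OF A] by (simp add: tuples_def)
  then show "tm_val (pull \<sigma> h n \<A>) e t < n" "h (tm_val (pull \<sigma> h n \<A>) e t) = tm_val \<A> (\<lambda>x. h (e x)) t"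
    using assms(2) pull_const by (cases t; simp add: pull_def)+
qed

text \<open>An order embedding whose range contains the constants preserves and reflects all atoms.
  The order is the only built-in symbol that has to be respected; BIT would not survive the
  renumbering.\<close>

lemma pull_sat:
  assumes "\<And>x. e x < n" "quantifier_free \<phi>" "wf_fm \<sigma> as \<phi>"
  shows "sat (pull \<sigma> h n \<A>) (pull_rels as h n Ss) e \<phi> \<longleftrightarrow> sat \<A> Ss (\<lambda>x. h (e x)) \<phi>"
  using assms(2,3)
proof (induction \<phi>)
  case (Eq s t)
  note s = pull_tm_val[of s e] and t = pull_tm_val[of t e]
  have "inj_on h {..<n}"
    using h(1) by (rule strict_mono_on_imp_inj_on)
  then show ?case
    using s t Eq assms(1) by (simp add: inj_on_eq_iff[symmetric, of h "{..<n}"])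
next
  case (Builtin b s t)
  then have b: "b = LE" "wf_tm \<sigma> s" "wf_tm \<sigma> t"
    using LE by simp_all
  then show ?case
    using pull_tm_val[of s e] pull_tm_val[of t e] assms(1)
      strict_mono_on_less_eq[OF h(1), of "tm_val (pull \<sigma> h n \<A>) e s" "tm_val (pull \<sigma> h n \<A>) e t"] by simp
next
  case (Rel i ts)
  have 1: "tm_val (pull \<sigma> h n \<A>) e t < n \<and> h (tm_val (pull \<sigma> h n \<A>) e t) = tm_val \<A> (\<lambda>x. h (e x)) t" if "t \<in> set ts" for t
    using pull_tm_val[of t e] assms(1) Rel that by (auto simp: list_all_iff)
  then have "map h (map (tm_val (pull \<sigma> h n \<A>) e) ts) = map (tm_val \<A> (\<lambda>x. h (e x))) ts"
    by simp
  moreover have "map (tm_val (pull \<sigma> h n \<A>) e) ts \<in> tuples n (rel_arities \<sigma> ! i)"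
    using 1 Rel by (auto simp: tuples_def)
  moreover have "rels (pull \<sigma> h n \<A>) ! i = {t \<in> tuples n (rel_arities \<sigma> ! i). map h t \<in> rels \<A> ! i}"
    using Rel by (simp add: pull_def)
  ultimately show ?case
    by (simp only: sat.simps mem_Collect_eq simp_thms)
next
  case (RVar i ts)
  have 1: "tm_val (pull \<sigma> h n \<A>) e t < n \<and> h (tm_val (pull \<sigma> h n \<A>) e t) = tm_val \<A> (\<lambda>x. h (e x)) t" if "t \<in> set ts" for t
    using pull_tm_val[of t e] assms(1) RVar that by (auto simp: list_all_iff)
  then have "map h (map (tm_val (pull \<sigma> h n \<A>) e) ts) = map (tm_val \<A> (\<lambda>x. h (e x))) ts"
    by simp
  moreover have "map (tm_val (pull \<sigma> h n \<A>) e) ts \<in> tuples n (as ! i)"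
    using 1 RVar by (auto simp: tuples_def)
  moreover have "pull_rels as h n Ss ! i = {t \<in> tuples n (as ! i). map h t \<in> Ss ! i}"
    using RVar by (simp add: pull_rels_def)
  ultimately show ?case
    by (simp only: sat.simps mem_Collect_eq simp_thms)
qed simp_all

end

lemma ex_order_embedding:
  assumes "V \<subseteq> {..<N}" "card V \<le> n" "n \<le> N"
  shows "\<exists>h. strict_mono_on {..<n} h \<and> h ` {..<n} \<subseteq> {..<N} \<and> V \<subseteq> h ` {..<n}"
proof -
  obtain X where X: "V \<subseteq> X" "X \<subseteq> {..<N}" "card X = n"
    using exists_subset_between[of V n "{..<N}"] assms by auto
  have fin: "finite X"
    using X(2) finite_subset by blast
  let ?h = "(!) (sorted_list_of_set X)"
  have "length (sorted_list_of_set X) = n"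
    using X(3) by simp
  then have "?h ` {..<n} = set (sorted_list_of_set X)"
    by (metis lessThan_atLeast0 nth_image take_all_iff order_refl set_upt)
  then have "?h ` {..<n} = X"
    using fin by simp
  moreover have "strict_mono_on {..<n} ?h"
    using strict_sorted_list_of_set[of X] X(3) by (auto simp: strict_mono_on_def sorted_wrt_iff_nth_less)
  ultimately show ?thesis
    using X by (intro exI[of _ ?h]) auto
qed

section \<open>Vocabularies with nullary relations only: relation variables of positive arity\<close>

text \<open>Here the encoding does not determine the size \<open>n\<close> of a structure, but only \<open>\<lceil>log\<^sub>2 n\<rceil>\<close>; a formula
  with a relation variable of positive arity has more solutions in larger structures, so it has none.\<close>

context
  fixes \<sigma> :: vocab and as :: "nat list" and l :: nat and \<phi> :: fm and f :: "bool list \<Rightarrow> nat"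
  assumes nullary: "\<And>a. a \<in> set (rel_arities \<sigma>) \<Longrightarrow> a = 0"
    and qf: "quantifier_free \<phi>" and wf: "wf_fm \<sigma> as \<phi>" and fv: "free_vars \<phi> \<subseteq> {..<l}" and LE: "builtins \<sigma> = {LE}"
    and f: "\<And>\<A>. \<A> \<in> structures \<sigma> \<Longrightarrow> enc \<sigma> \<A> \<noteq> [] \<Longrightarrow> f (enc \<sigma> \<A>) = count_sat as l \<phi> \<A>"
      "\<And>w. w \<noteq> [] \<Longrightarrow> w \<notin> enc \<sigma> ` structures \<sigma> \<Longrightarrow> f w = 0"
begin

lemma nullary_nth: "i < length (rel_arities \<sigma>) \<Longrightarrow> rel_arities \<sigma> ! i = 0"
  using nullary by simp

lemma const_offset_nullary: "const_offset \<sigma> n = length (rel_arities \<sigma>)"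
  by (simp add: const_offset_def rel_offset_def nullary_nth)

lemma enc_len_nullary: "enc_len \<sigma> n = length (rel_arities \<sigma>) + nconsts \<sigma> * bitlen (n - 1)"
  by (simp add: enc_len_def const_offset_nullary)

text \<open>Truth values of nullary relations do not depend on the size, and constants depend on it
  only through their number of bits.\<close>

lemma enc_resize:
  assumes "\<A> \<in> structures \<sigma>" "n \<ge> 1" "bitlen (n - 1) = bitlen (size_of \<A> - 1)"
  shows "enc \<sigma> (\<A>\<lparr>size_of := n\<rparr>) = enc \<sigma> \<A>"
proof -
  have "map2 (encode_rel n) (rel_arities \<sigma>) (rels \<A>) = map2 (encode_rel (size_of \<A>)) (rel_arities \<sigma>) (rels \<A>)"
    by (intro map_cong refl) (auto simp: encode_rel_def dest!: set_zip_leftD nullary)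
  moreover have "binary n = binary (size_of \<A>)"
    using assms structure_unfold(1)[OF assms(1)] by (simp add: binary_def ceiling_log_eq_bitlen fun_eq_iff)
  moreover have "enc \<sigma> (\<A>\<lparr>size_of := n\<rparr>) =
      concat (map2 (encode_rel n) (rel_arities \<sigma>) (rels \<A>)) @ concat (map (binary n) (const_vals \<A>))"
    by (simp add: enc_def)
  ultimately show ?thesis
    unfolding enc_def by (simp only:)
qed

lemma resize_in_structures:
  assumes "\<A> \<in> structures \<sigma>" "n \<ge> 1" "set (const_vals \<A>) \<subseteq> {..<n}"
  shows "\<A>\<lparr>size_of := n\<rparr> \<in> structures \<sigma>"
proof -
  have "rels \<A> ! i \<subseteq> tuples n (rel_arities \<sigma> ! i)" if "i < length (rel_arities \<sigma>)" for i
    using structure_unfold(3)[OF assms(1) that] by (simp add: nullary_nth[OF that])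
  then show ?thesis
    using structure_unfold(2,4)[OF assms(1)] assms(2,3) by (simp add: structures_def relation_tuples_def tuples_def)
qed

text \<open>If \<open>n\<close> and \<open>n + 1\<close> have the same encoded constants, enlarging
  the structure by one element keeps the encoding and hence the count. All solutions persist, and
  adding to a relation a tuple \<open>t0\<close> of the new element gives a further one: the formula
  only inspects tuples of old elements. So there cannot have been a solution.\<close>

lemma no_solutions:
  assumes A: "\<A> \<in> structures \<sigma>" "enc \<sigma> \<A> \<noteq> []" and bl: "bitlen (size_of \<A>) = bitlen (size_of \<A> - 1)"
    and i0: "i0 < length as" "as ! i0 \<ge> 1"
  shows "count_sat as l \<phi> \<A> = 0"
proof (rule ccontr)
  define n where "n = size_of \<A>"
  define \<B> where "\<B> = \<A>\<lparr>size_of := Suc n\<rparr>"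
  define sol where "sol \<C> = {(Ss, cs). Ss \<in> relation_tuples (size_of \<C>) as \<and> cs \<in> tuples (size_of \<C>) l \<and>
       sat \<C> Ss (\<lambda>j. cs ! j) \<phi>}" for \<C>
  have n1: "n \<ge> 1"
    using structure_unfold(1)[OF A(1)] by (simp add: n_def)
  have cA: "set (const_vals \<A>) \<subseteq> {..<n}"
    using structure_unfold(4)[OF A(1)] by (simp add: tuples_def n_def)
  then have B: "\<B> \<in> structures \<sigma>"
    unfolding \<B>_def by (intro resize_in_structures A(1)) auto
  have "enc \<sigma> \<B> = enc \<sigma> \<A>"
    unfolding \<B>_def using bl by (intro enc_resize A(1)) (auto simp: n_def)
  then have eq: "card (sol \<A>) = card (sol \<B>)"
    using f(1)[OF A] f(1)[OF B] A(2) by (simp add: count_sat_def sol_def)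
  have sub: "tuples n k \<subseteq> tuples (Suc n) k" for k
    by (auto simp: tuples_def subset_iff less_SucI)
  have pullA: "pull \<sigma> (\<lambda>x. x) n \<B> = \<A>"
  proof -
    have "map (\<lambda>i. {t \<in> tuples n (rel_arities \<sigma> ! i). map (\<lambda>x. x) t \<in> rels \<A> ! i}) [0..<length (rel_arities \<sigma>)] = rels \<A>"
      using structure_unfold(2,3)[OF A(1)] by (intro nth_equalityI) (auto simp: n_def)
    moreover have "map (\<lambda>c. SOME k. k < n \<and> k = c) (const_vals \<A>) = const_vals \<A>"
      using cA by (intro map_idI some_equality) auto
    ultimately show ?thesis
      by (intro struc.equality) (simp_all add: pull_def \<B>_def n_def)
  qed
  have sat: "sat \<A> (pull_rels as (\<lambda>x. x) n Ss) (\<lambda>j. cs ! j) \<phi> \<longleftrightarrow> sat \<B> Ss (\<lambda>j. cs ! j) \<phi>" if cs: "cs \<in> tuples n l" for Ss cs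
  proof -
    let ?e = "\<lambda>j. if j < l then cs ! j else 0"
    have e: "?e x < n" for x
      using tuples_nth[OF cs, of x] n1 by auto
    have cong: "sat \<C> T (\<lambda>j. cs ! j) \<phi> \<longleftrightarrow> sat \<C> T ?e \<phi>" for \<C> T
      by (rule sat_cong) (use fv in auto)
    have "sat (pull \<sigma> (\<lambda>x. x) n \<B>) (pull_rels as (\<lambda>x. x) n Ss) ?e \<phi> \<longleftrightarrow> sat \<B> Ss ?e \<phi>"
      by (rule pull_sat[where h = "\<lambda>x. x", OF B _ _ _ LE e qf wf])
        (use cA in \<open>auto simp: strict_mono_on_def \<B>_def\<close>)
    then show ?thesis
      unfolding cong pullA .
  qed
  have pull_id: "pull_rels as (\<lambda>x. x) n Ss = Ss" if "Ss \<in> relation_tuples n as" for Ss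
    using that by (intro nth_equalityI) (auto simp: pull_rels_def relation_tuples_def)
  have rt: "Ss \<in> relation_tuples (Suc n) as" if "Ss \<in> relation_tuples n as" for Ss
    using that sub by (auto simp: relation_tuples_def)
  assume "count_sat as l \<phi> \<A> \<noteq> 0"
  then have "card (sol \<A>) \<noteq> 0"
    unfolding count_sat_def sol_def .
  then have "sol \<A> \<noteq> {}"
    by (metis card.empty)
  then obtain Ss cs where s: "Ss \<in> relation_tuples n as" "cs \<in> tuples n l" "sat \<A> Ss (\<lambda>j. cs ! j) \<phi>"
    unfolding sol_def n_def by auto
  define t0 where "t0 = replicate (as ! i0) n"
  have t0: "t0 \<notin> tuples n (as ! i0)" "t0 \<in> tuples (Suc n) (as ! i0)"
    using i0(2) by (auto simp: t0_def tuples_def)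
  define Ss' where "Ss' = Ss[i0 := insert t0 (Ss ! i0)]"
  have len: "length Ss = length as"
    using s(1) by (simp add: relation_tuples_def)
  have Ss': "Ss' \<in> relation_tuples (Suc n) as"
    using rt[OF s(1)] t0(2) i0(1) by (auto simp: Ss'_def relation_tuples_def nth_list_update)
  have "pull_rels as (\<lambda>x. x) n Ss' = pull_rels as (\<lambda>x. x) n Ss"
    unfolding pull_rels_def Ss'_def using t0(1) i0(1) len by (auto simp: nth_list_update)
  then have "sat \<B> Ss' (\<lambda>j. cs ! j) \<phi>"
    using sat[OF s(2), of Ss'] s(1,3) by (simp add: pull_id)
  then have in_B: "(Ss', cs) \<in> sol \<B>"
    using Ss' s(2) sub by (auto simp: sol_def \<B>_def)
  have "t0 \<in> Ss' ! i0"
    using i0(1) len by (simp add: Ss'_def)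
  then have not_A: "(Ss', cs) \<notin> sol \<A>"
    using t0(1) i0(1) by (auto simp: sol_def relation_tuples_def n_def)
  have "sol \<A> \<subseteq> sol \<B>"
  proof
    fix p assume "p \<in> sol \<A>"
    then obtain T d where p: "p = (T, d)" "T \<in> relation_tuples n as" "d \<in> tuples n l" "sat \<A> T (\<lambda>j. d ! j) \<phi>"
      by (auto simp: sol_def n_def)
    then show "p \<in> sol \<B>"
      using rt[OF p(2)] sub[of l] sat[OF p(3), of T] by (auto simp: sol_def \<B>_def pull_id)
  qed
  moreover have "finite (sol \<B>)"
    unfolding sol_def by (rule finite_subset[of _ "relation_tuples (size_of \<B>) as \<times> tuples (size_of \<B>) l"]) auto
  ultimately have "card (sol \<A>) < card (sol \<B>)"
    using in_B not_A by (intro psubset_card_mono) auto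
  then show False
    using eq by simp
qed

text \<open>Enlarging by one element changes the encoding if the size \<open>n\<close> is a power of
  two. In that case a solution is carried over to a substructure of size \<open>n - 1\<close> that
  contains the elements and constants involved; enlarging that one is harmless, so it has no
  solution either.\<close>

lemma bounded_support:
  assumes i0: "i0 < length as" "as ! i0 \<ge> 1" and w: "length w > enc_len \<sigma> (l + nconsts \<sigma> + 5)"
  shows "f w = 0"
proof (rule ccontr)
  assume fw: "f w \<noteq> 0"
  have "w \<noteq> []"
    using w by auto
  then have "w \<in> enc \<sigma> ` structures \<sigma>"
    using f(2)[of w] fw by linarith
  then obtain \<A> where A: "\<A> \<in> structures \<sigma>" "enc \<sigma> \<A> = w"
    by auto
  define n where "n = size_of \<A>"
  have "enc_len \<sigma> (l + nconsts \<sigma> + 5) < enc_len \<sigma> n"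
    using w length_enc[OF A(1) refl] A(2) by (simp add: n_def)
  then have "bitlen (l + nconsts \<sigma> + 4) < bitlen (n - 1)"
    by (simp add: enc_len_nullary add_ac)
  then have n: "l + nconsts \<sigma> + 4 < n - 1"
    using bitlen_mono[of "n - 1" "l + nconsts \<sigma> + 4"] by (meson not_less)
  have cnt: "count_sat as l \<phi> \<A> \<noteq> 0"
    using f(1)[OF A(1)] A(2) fw \<open>w \<noteq> []\<close> by simp
  have "bitlen n \<noteq> bitlen (n - 1)"
    using no_solutions[OF A(1) _ _ i0] A(2) \<open>w \<noteq> []\<close> cnt by (auto simp: n_def)
  then have bn: "bitlen (n - 1) < bitlen n"
    using bitlen_mono[of "n - 1" n] by simp
  define k where "k = bitlen (n - 1)"
  have nk: "n = 2 ^ k"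
    using bn less_power_bitlen[of "n - 1"] unfolding less_bitlen_iff k_def[symmetric] by linarith
  have "k \<noteq> 0" "k \<noteq> 1"
    using n nk by (intro notI; simp)+
  then have k2: "2 * 2 ^ (k - 1) = n" "2 ^ (k - 1) \<ge> (2::nat)"
    using nk by (cases k; cases "k - 1"; simp)+
  have "k - 1 < bitlen (n - 1 - 1)"
    using k2 by (simp add: less_bitlen_iff)
  moreover have "bitlen (n - 1 - 1) \<le> k"
    unfolding k_def by (rule bitlen_mono) simp
  ultimately have bl: "bitlen (n - 1) = bitlen (n - 1 - 1)"
    unfolding k_def[symmetric] by linarith
  obtain Ss cs where s: "Ss \<in> relation_tuples n as" "cs \<in> tuples n l" "sat \<A> Ss (\<lambda>j. cs ! j) \<phi>"
  proof -
    have "{(Ss, cs). Ss \<in> relation_tuples (size_of \<A>) as \<and> cs \<in> tuples (size_of \<A>) l \<and>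
       sat \<A> Ss (\<lambda>j. cs ! j) \<phi>} \<noteq> {}"
      using cnt unfolding count_sat_def by (metis (no_types, lifting) card.empty)
    then show ?thesis
      using that by (auto simp: n_def)
  qed
  \<comment> \<open>The element 0 is included because it is the default value in the environment
    \<open>?e\<close>.\<close>
  define V where "V = insert 0 (set cs \<union> set (const_vals \<A>))"
  have cA: "const_vals \<A> \<in> tuples n (nconsts \<sigma>)"
    using structure_unfold(4)[OF A(1)] by (simp add: n_def)
  have "V \<subseteq> {..<n}"
    using s(2) cA n by (auto simp: V_def tuples_def)
  moreover have "card V \<le> n - 1"
  proof -
    have "card V \<le> Suc (card (set cs) + card (set (const_vals \<A>)))"
    proof -
      have "card V \<le> Suc (card (set cs \<union> set (const_vals \<A>)))"
        unfolding V_def by (simp add: card_insert_if)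
      then show ?thesis
        using card_Un_le[of "set cs" "set (const_vals \<A>)"] by linarith
    qed
    also have "\<dots> \<le> Suc (l + nconsts \<sigma>)"
      using card_length[of cs] card_length[of "const_vals \<A>"] s(2) cA by (simp add: tuples_def add_mono)
    finally show ?thesis using n by simp
  qed
  ultimately obtain h where h: "strict_mono_on {..<n - 1} h" "h ` {..<n - 1} \<subseteq> {..<n}" "V \<subseteq> h ` {..<n - 1}"
    using ex_order_embedding[of V n "n - 1"] by auto
  let ?e = "\<lambda>j. if j < l then cs ! j else 0"
  have "?e j \<in> V" for j
    using s(2) by (auto simp: V_def tuples_def)
  then have "?e j \<in> h ` {..<n - 1}" for j
    using h(3) by (rule subsetD[rotated])
  then have "\<forall>j. \<exists>x. x < n - 1 \<and> h x = ?e j"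
    unfolding image_iff Bex_def lessThan_iff by metis
  from choice[OF this] obtain e where e0: "\<forall>j. e j < n - 1 \<and> h (e j) = ?e j" ..
  then have e: "\<And>j. e j < n - 1" "\<And>j. h (e j) = ?e j"
    by blast+
  let ?B = "pull \<sigma> h (n - 1) \<A>"
  have cimg: "set (const_vals \<A>) \<subseteq> h ` {..<n - 1}"
    using h(3) by (auto simp: V_def)
  note pull_facts = A(1) h(1) h(2)[unfolded n_def] cimg LE
  have B: "?B \<in> structures \<sigma>"
    using pull_in_structures[OF A(1) h(1) _ cimg LE] h(2) n by (simp add: n_def)
  have "sat ?B (pull_rels as h (n - 1) Ss) e \<phi> \<longleftrightarrow> sat \<A> Ss (\<lambda>x. h (e x)) \<phi>"
    by (rule pull_sat[OF A(1) h(1) _ cimg LE e(1) qf wf]) (use h(2) in \<open>simp add: n_def\<close>)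
  also have "\<dots> \<longleftrightarrow> sat \<A> Ss (\<lambda>j. cs ! j) \<phi>"
    by (rule sat_cong) (use fv in \<open>auto simp: e(2)\<close>)
  finally have sB: "sat ?B (pull_rels as h (n - 1) Ss) e \<phi>"
    using s(3) by simp
  have "sat ?B (pull_rels as h (n - 1) Ss) (\<lambda>j. map e [0..<l] ! j) \<phi> \<longleftrightarrow> sat ?B (pull_rels as h (n - 1) Ss) e \<phi>"
    by (rule sat_cong) (use fv in auto)
  moreover have "size_of ?B = n - 1" "map e [0..<l] \<in> tuples (n - 1) l"
    using e(1) by (auto simp: pull_def tuples_def)
  ultimately have "(pull_rels as h (n - 1) Ss, map e [0..<l]) \<in> {(Ss, cs). Ss \<in> relation_tuples (size_of ?B) as \<and>
      cs \<in> tuples (size_of ?B) l \<and> sat ?B Ss (\<lambda>j. cs ! j) \<phi>}" (is "_ \<in> ?S")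
    using pull_rels_in[of as h "n - 1" Ss] sB by simp
  moreover have "finite ?S"
    by (rule finite_subset[of _ "relation_tuples (size_of ?B) as \<times> tuples (size_of ?B) l"]) auto
  ultimately have "count_sat as l \<phi> ?B \<noteq> 0"
    unfolding count_sat_def by auto
  moreover have "count_sat as l \<phi> ?B = 0"
  proof (rule no_solutions[OF B _ _ i0])
    have "length (enc \<sigma> ?B) = enc_len \<sigma> (n - 1)"
      by (rule length_enc[OF B]) (simp add: pull_def)
    also have "\<dots> = length w"
      using length_enc[OF A(1) refl] A(2) bl by (simp add: enc_len_nullary n_def)
    finally show "enc \<sigma> ?B \<noteq> []"
      using \<open>w \<noteq> []\<close> by auto
  qed (use bl in \<open>simp add: pull_def\<close>)
  ultimately show False by simp
qed

end

section \<open>Vocabularies with nullary relations only: nullary relation variables\<close>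

text \<open>The elements, given in binary, are compared bit by bit, starting with the most significant one.
  A state is the set of pairs \<open>(i, j)\<close> for which it is already known that the \<open>i\<close>-th number is
  smaller than the \<open>j\<close>-th one; along a run it changes a bounded number of times.\<close>

definition less_step :: "nat \<Rightarrow> (nat \<times> nat) set \<Rightarrow> nat set \<Rightarrow> (nat \<times> nat) set" where
  "less_step d s X = s \<union> {(i, j). i < d \<and> j < d \<and> (i, j) \<notin> s \<and> (j, i) \<notin> s \<and> i \<notin> X \<and> j \<in> X}"

definition less_pairs :: "nat \<Rightarrow> (nat \<Rightarrow> nat) \<Rightarrow> (nat \<times> nat) set" where
  "less_pairs d v = {(i, j). i < d \<and> j < d \<and> v i < v j}"

text \<open>Comparison of numbers whose upper bits have been compared in \<open>s\<close> and whose
  lower bits compare as in \<open>L\<close>: the lower bits matter only where the upper ones left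
  the matter open.\<close>

definition refine :: "(nat \<times> nat) set \<Rightarrow> (nat \<times> nat) set \<Rightarrow> (nat \<times> nat) set" where
  "refine s L = s \<union> {(i, j). (i, j) \<in> L \<and> (j, i) \<notin> s}"

lemma mod_power_Suc: "x mod 2 ^ Suc b = 2 ^ b * of_bool (bit x b) + x mod 2 ^ b" for x :: nat
  using take_bit_Suc_from_most[of b x] by (simp add: take_bit_eq_mod)

lemma refine_less_step:
  "refine s (less_pairs d (\<lambda>i. v i mod 2 ^ Suc b)) =
   refine (less_step d s {i. bit (v i) b}) (less_pairs d (\<lambda>i. v i mod 2 ^ b))"
proof -
  have less: "v i mod 2 ^ Suc b < v j mod 2 ^ Suc b \<longleftrightarrow>
    (\<not> bit (v i) b \<and> bit (v j) b) \<or> (bit (v i) b = bit (v j) b \<and> v i mod 2 ^ b < v j mod 2 ^ b)" for i j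
    using mod_less_divisor[of "2 ^ b" "v i"] mod_less_divisor[of "2 ^ b" "v j"]
    unfolding mod_power_Suc by (cases "bit (v i) b"; cases "bit (v j) b") (simp_all del: mod_less_divisor)
  show ?thesis
    unfolding refine_def less_step_def less_pairs_def less by auto
qed

text \<open>Counts the ways to choose bits \<open>b - 1\<close> down to 0 of \<open>l\<close>
  numbers such that the run ends in an accepting state. The set \<open>Y\<close> is the choice for
  one bit place, and \<open>C\<close> supplies the bits of the constants, which are fixed.\<close>

fun count_runs :: "((nat \<times> nat) set \<Rightarrow> bool) \<Rightarrow> nat \<Rightarrow> nat \<Rightarrow> (nat \<Rightarrow> nat set) \<Rightarrow> (nat \<times> nat) set \<Rightarrow> nat \<Rightarrow> nat" where
  "count_runs acc l d C s 0 = of_bool (acc s)"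
| "count_runs acc l d C s (Suc b) = (\<Sum>Y\<in>Pow {..<l}. count_runs acc l d C (less_step d s (Y \<union> C b)) b)"

definition bits_at :: "nat \<Rightarrow> nat list \<Rightarrow> nat \<Rightarrow> nat set" where
  "bits_at l cs b = {i. i < l \<and> bit (cs ! i) b}"

lemma tuples_split_bit:
  "bij_betw (\<lambda>cs. (bits_at l cs b, map (\<lambda>x. x mod 2 ^ b) cs)) (tuples (2 ^ Suc b) l) (Pow {..<l} \<times> tuples (2 ^ b) l)"
proof (rule bij_betw_byWitness[where f' = "\<lambda>(Y, cs). map (\<lambda>i. 2 ^ b * of_bool (i \<in> Y) + cs ! i) [0..<l]"])
  show "\<forall>cs\<in>tuples (2 ^ Suc b) l. (\<lambda>(Y, cs). map (\<lambda>i. 2 ^ b * of_bool (i \<in> Y) + cs ! i) [0..<l])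
      (bits_at l cs b, map (\<lambda>x. x mod 2 ^ b) cs) = cs"
  proof
    fix cs assume cs: "cs \<in> tuples (2 ^ Suc b) l"
    then have len: "length cs = l"
      by (simp add: tuples_def)
    have "cs ! i = 2 ^ b * of_bool (bit (cs ! i) b) + cs ! i mod 2 ^ b" if "i < l" for i
      using tuples_nth[OF cs that] mod_power_Suc[of "cs ! i" b] by (simp del: power_Suc)
    then show "(\<lambda>(Y, cs). map (\<lambda>i. 2 ^ b * of_bool (i \<in> Y) + cs ! i) [0..<l])
      (bits_at l cs b, map (\<lambda>x. x mod 2 ^ b) cs) = cs"
      using len by (intro nth_equalityI) (auto simp: bits_at_def)
  qed
  show "\<forall>p\<in>Pow {..<l} \<times> tuples (2 ^ b) l. (\<lambda>cs. (bits_at l cs b, map (\<lambda>x. x mod 2 ^ b) cs))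
      ((\<lambda>(Y, cs). map (\<lambda>i. 2 ^ b * of_bool (i \<in> Y) + cs ! i) [0..<l]) p) = p"
  proof
    fix p assume "p \<in> Pow {..<l} \<times> tuples (2 ^ b) l"
    then obtain Y cs where p: "p = (Y, cs)" "Y \<subseteq> {..<l}" "cs \<in> tuples (2 ^ b) l"
      by auto
    have len: "length cs = l"
      using p(3) by (simp add: tuples_def)
    have small: "cs ! i < 2 ^ b" "\<not> bit (cs ! i) b" if "i < l" for i
      using tuples_nth[OF p(3) that] less_power_iff_bit[of "cs ! i" b] by auto
    have "bit (2 ^ b * of_bool (i \<in> Y) + cs ! i) b \<longleftrightarrow> i \<in> Y" "(2 ^ b * of_bool (i \<in> Y) + cs ! i) mod 2 ^ b = cs ! i" if "i < l" for i
      using small[OF that] by (auto simp: bit_iff_odd)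
    moreover from this(1) have "bits_at l (map (\<lambda>i. 2 ^ b * of_bool (i \<in> Y) + cs ! i) [0..<l]) b = Y"
      using p(2) by (force simp: bits_at_def)
    ultimately show "(\<lambda>cs. (bits_at l cs b, map (\<lambda>x. x mod 2 ^ b) cs))
      ((\<lambda>(Y, cs). map (\<lambda>i. 2 ^ b * of_bool (i \<in> Y) + cs ! i) [0..<l]) p) = p"
      using len by (auto simp: p(1) comp_def intro!: nth_equalityI)
  qed
  show "(\<lambda>cs. (bits_at l cs b, map (\<lambda>x. x mod 2 ^ b) cs)) ` tuples (2 ^ Suc b) l \<subseteq> Pow {..<l} \<times> tuples (2 ^ b) l"
    by (auto simp: bits_at_def tuples_def)
  show "(\<lambda>(Y, cs). map (\<lambda>i. 2 ^ b * of_bool (i \<in> Y) + cs ! i) [0..<l]) ` (Pow {..<l} \<times> tuples (2 ^ b) l) \<subseteq> tuples (2 ^ Suc b) l"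
  proof (clarify)
    fix Y cs assume cs: "cs \<in> tuples (2 ^ b) l"
    have "2 ^ b * of_bool (i \<in> Y) + cs ! i < 2 ^ Suc b" if "i < l" for i
      using tuples_nth[OF cs that] by auto
    then show "map (\<lambda>i. 2 ^ b * of_bool (i \<in> Y) + cs ! i) [0..<l] \<in> tuples (2 ^ Suc b) l"
      by (auto simp: tuples_def)
  qed
qed

definition joint_value :: "nat \<Rightarrow> nat list \<Rightarrow> nat list \<Rightarrow> nat \<Rightarrow> nat" where
  "joint_value l cs cv i = (if i < l then cs ! i else cv ! (i - l))"

text \<open>Splitting off the leading bits is a bijection from the tuples below
  \<open>2 ^ Suc b\<close> to the pairs of a bit choice and a tuple below \<open>2 ^ b\<close>; so
  runs correspond to all tuples of \<open>b\<close>-bit numbers.\<close>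

lemma count_runs_eq:
  assumes "\<And>i. i < b \<Longrightarrow> C i = {l + j | j. j < c \<and> bit (cv ! j) i}"
  shows "count_runs acc l (l + c) C s b =
    (\<Sum>cs\<in>tuples (2 ^ b) l. of_bool (acc (refine s (less_pairs (l + c) (\<lambda>i. joint_value l cs cv i mod 2 ^ b)))))"
  using assms
proof (induction b arbitrary: s)
  case 0
  have "tuples 1 l = {replicate l 0}"
    by (auto simp: tuples_def intro!: replicate_length_same[symmetric])
  then show ?case
    by (simp add: less_pairs_def refine_def)
next
  case (Suc b)
  let ?d = "l + c"
  have step: "acc (refine s (less_pairs ?d (\<lambda>i. joint_value l cs cv i mod 2 ^ Suc b))) =
    acc (refine (less_step ?d s (bits_at l cs b \<union> C b)) (less_pairs ?d (\<lambda>i. joint_value l (map (\<lambda>x. x mod 2 ^ b) cs) cv i mod 2 ^ b)))"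
    if cs: "cs \<in> tuples (2 ^ Suc b) l" for cs
  proof -
    have len: "length cs = l"
      using cs by (simp add: tuples_def)
    have "less_step ?d s {i. bit (joint_value l cs cv i) b} = less_step ?d s (bits_at l cs b \<union> C b)"
    proof -
      have "i \<in> {i. bit (joint_value l cs cv i) b} \<longleftrightarrow> i \<in> bits_at l cs b \<union> C b" if "i < ?d" for i
        using that Suc.prems[of b] by (cases "i < l") (auto simp: joint_value_def bits_at_def intro: exI[of _ "i - l"])
      then show ?thesis
        unfolding less_step_def by blast
    qed
    moreover have "less_pairs ?d (\<lambda>i. joint_value l cs cv i mod 2 ^ b) =
      less_pairs ?d (\<lambda>i. joint_value l (map (\<lambda>x. x mod 2 ^ b) cs) cv i mod 2 ^ b)"
      using len by (auto simp: less_pairs_def joint_value_def)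
    ultimately show ?thesis
      unfolding refine_less_step by simp
  qed
  have "(\<Sum>cs\<in>tuples (2 ^ Suc b) l. of_bool (acc (refine s (less_pairs ?d (\<lambda>i. joint_value l cs cv i mod 2 ^ Suc b))))) =
    (\<Sum>cs\<in>tuples (2 ^ Suc b) l. case (bits_at l cs b, map (\<lambda>x. x mod 2 ^ b) cs) of (Y, cs') \<Rightarrow>
      of_bool (acc (refine (less_step ?d s (Y \<union> C b)) (less_pairs ?d (\<lambda>i. joint_value l cs' cv i mod 2 ^ b)))))"
    using step by (intro sum.cong refl) simp
  also have "\<dots> = (\<Sum>p\<in>Pow {..<l} \<times> tuples (2 ^ b) l. case p of (Y, cs') \<Rightarrow>
      of_bool (acc (refine (less_step ?d s (Y \<union> C b)) (less_pairs ?d (\<lambda>i. joint_value l cs' cv i mod 2 ^ b)))))"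
    by (rule sum.reindex_bij_betw[OF tuples_split_bit])
  also have "\<dots> = (\<Sum>Y\<in>Pow {..<l}. count_runs acc l ?d C (less_step ?d s (Y \<union> C b)) b)"
  proof -
    have "count_runs acc l ?d C t b =
      (\<Sum>cs\<in>tuples (2 ^ b) l. of_bool (acc (refine t (less_pairs ?d (\<lambda>i. joint_value l cs cv i mod 2 ^ b)))))" for t
      by (rule Suc.IH) (simp add: Suc.prems)
    then show ?thesis
      by (simp only: sum.cartesian_product)
  qed
  finally show ?case by simp
qed

section \<open>Counting runs by sums and products\<close>

lemma linear_recurrence:
  fixes g a d :: "nat \<Rightarrow> nat"
  assumes "\<And>b. g (Suc b) = a b * g b + d b"
  shows "g b = g 0 * (\<Prod>i<b. a i) + (\<Sum>j<b. (\<Prod>i\<in>{j<..<b}. a i) * d j)"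
proof (induction b)
  case (Suc b)
  have "(\<Prod>i\<in>{j<..<Suc b}. a i) = (\<Prod>i\<in>{j<..<b}. a i) * a b" if "j < b" for j
  proof -
    have "{j<..<Suc b} = insert b {j<..<b}"
      using that by auto
    then show ?thesis by simp
  qed
  then have "(\<Sum>j<b. (\<Prod>i\<in>{j<..<Suc b}. a i) * d j) = a b * (\<Sum>j<b. (\<Prod>i\<in>{j<..<b}. a i) * d j)"
    unfolding sum_distrib_left by (intro sum.cong refl) simp
  moreover have "{b<..<Suc b} = {}"
    by auto
  ultimately show ?case
    using assms[of b] Suc by (simp add: algebra_simps)
qed simp

definition moves :: "nat \<Rightarrow> nat \<Rightarrow> (nat \<Rightarrow> nat set) \<Rightarrow> (nat \<times> nat) set \<Rightarrow> (nat \<times> nat) set \<Rightarrow> nat \<Rightarrow> nat" where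
  "moves l d C s s' b = (\<Sum>Y\<in>Pow {..<l}. of_bool (less_step d s (Y \<union> C b) = s'))"

lemma count_runs_Suc_moves:
  assumes "s \<subseteq> {..<d} \<times> {..<d}"
  shows "count_runs acc l d C s (Suc b) =
    (\<Sum>s'\<in>Pow ({..<d} \<times> {..<d}). moves l d C s s' b * count_runs acc l d C s' b)"
proof -
  have sub: "less_step d s X \<in> Pow ({..<d} \<times> {..<d})" for X
    using assms by (auto simp: less_step_def)
  have "count_runs acc l d C s (Suc b) = (\<Sum>Y\<in>Pow {..<l}. \<Sum>s'\<in>Pow ({..<d} \<times> {..<d}).
      of_bool (less_step d s (Y \<union> C b) = s') * count_runs acc l d C s' b)"
  proof -
    have "(\<Sum>s'\<in>Pow ({..<d} \<times> {..<d}). of_bool (t = s') * count_runs acc l d C s' b) = count_runs acc l d C t b"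
      if "t \<in> Pow ({..<d} \<times> {..<d})" for t
    proof -
      have "(\<Sum>s'\<in>Pow ({..<d} \<times> {..<d}). of_bool (t = s') * count_runs acc l d C s' b) =
        (\<Sum>s'\<in>{t}. of_bool (t = s') * count_runs acc l d C s' b)"
        using that by (intro sum.mono_neutral_right) auto
      then show ?thesis by simp
    qed
    then show ?thesis
      using sub by simp
  qed
  also have "\<dots> = (\<Sum>s'\<in>Pow ({..<d} \<times> {..<d}). moves l d C s s' b * count_runs acc l d C s' b)"
    unfolding moves_def sum_distrib_right by (rule sum.swap)
  finally show ?thesis .
qed

text \<open>States only grow, so a run stays in \<open>s\<close> for some bits and then leaves it
  for good. This is a linear recurrence with larger states as the inhomogeneity. Its solution is a
  sum over the bit \<open>j\<close> at which \<open>s\<close> is left, with a product over the bits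
  read before in state \<open>s\<close>.\<close>

lemma count_runs_closed_form:
  assumes s: "s \<subseteq> {..<d} \<times> {..<d}"
  shows "count_runs acc l d C s b = of_bool (acc s) * (\<Prod>i<b. moves l d C s s i) +
    (\<Sum>j<b. (\<Prod>i\<in>{j<..<b}. moves l d C s s i) *
      (\<Sum>s'\<in>{s'. s \<subset> s' \<and> s' \<subseteq> {..<d} \<times> {..<d}}. moves l d C s s' j * count_runs acc l d C s' j))"
proof -
  let ?S = "{s'. s \<subset> s' \<and> s' \<subseteq> {..<d} \<times> {..<d}}"
  have fin: "finite ?S"
    by (rule finite_subset[of _ "Pow ({..<d} \<times> {..<d})"]) auto
  have "count_runs acc l d C s (Suc b) = moves l d C s s b * count_runs acc l d C s b +
      (\<Sum>s'\<in>?S. moves l d C s s' b * count_runs acc l d C s' b)" for b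
  proof -
    have zero: "moves l d C s s' b = 0" if "\<not> s \<subseteq> s'" for s'
      unfolding moves_def using that by (intro sum.neutral) (auto simp: less_step_def)
    have "(\<Sum>s'\<in>Pow ({..<d} \<times> {..<d}). moves l d C s s' b * count_runs acc l d C s' b) =
      (\<Sum>s'\<in>insert s ?S. moves l d C s s' b * count_runs acc l d C s' b)"
    proof (rule sum.mono_neutral_right)
      show "\<forall>s'\<in>Pow ({..<d} \<times> {..<d}) - insert s ?S. moves l d C s s' b * count_runs acc l d C s' b = 0"
      proof
        fix s' assume "s' \<in> Pow ({..<d} \<times> {..<d}) - insert s ?S"
        then have "\<not> s \<subseteq> s'"
          by blast
        then show "moves l d C s s' b * count_runs acc l d C s' b = 0"
          by (simp add: zero)
      qed
    qed (use s in auto)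
    then show ?thesis
      using fin count_runs_Suc_moves[OF s, of acc l C b] by simp
  qed
  from linear_recurrence[of "count_runs acc l d C s", OF this, of b] show ?thesis
    by simp
qed

text \<open>Bit \<open>b\<close> of the \<open>j\<close>-th of \<open>c\<close> constants with \<open>k + 1\<close> bits, encoded after \<open>r\<close> truth values.\<close>

definition const_bits :: "nat \<Rightarrow> nat \<Rightarrow> nat \<Rightarrow> bool list \<Rightarrow> nat \<Rightarrow> nat \<Rightarrow> nat set" where
  "const_bits l r c w k b = {l + j | j. j < c \<and> w ! (r + j * Suc k + (k - b))}"

context
  fixes l r c d :: nat
  assumes d_def: "d = l + c"
begin

text \<open>A version of \<open>moves\<close> that looks up the string. The bits of the constants
  are guessed as \<open>Z\<close>, and the product over \<open>j\<close> compares the guess with the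
  string, locating each bit by sums over positions.\<close>

definition moves_sum :: "bool list \<Rightarrow> nat \<Rightarrow> (nat \<times> nat) set \<Rightarrow> (nat \<times> nat) set \<Rightarrow> nat \<Rightarrow> nat" where
  "moves_sum w k s s' b = (\<Sum>Y\<in>Pow {..<l}. \<Sum>Z\<in>Pow {..<c}. of_bool (less_step d s (Y \<union> (+) l ` Z) = s') *
     (\<Prod>j<c. \<Sum>p<length w. \<Sum>q<length w. if q + b = k \<and> r + j * Suc k + q = p then of_bool (w ! p = (j \<in> Z)) else 0))"

lemma moves_sum_eq:
  assumes w: "length w = r + c * Suc k" and b: "b \<le> k" "k < length w"
  shows "moves_sum w k s s' b = moves l d (const_bits l r c w k) s s' b"
proof -
  define Z0 where "Z0 = {j. j < c \<and> w ! (r + j * Suc k + (k - b))}"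
  have one: "(\<Sum>p<length w. \<Sum>q<length w. if q + b = k \<and> r + j * Suc k + q = p then of_bool (w ! p = (j \<in> Z)) else 0) =
    (of_bool (w ! (r + j * Suc k + (k - b)) = (j \<in> Z)) :: nat)" if "j < c" for j Z
  proof -
    have "j * Suc k + (k - b) < Suc j * Suc k"
      by simp
    also have "\<dots> \<le> c * Suc k"
      using that by (intro mult_le_mono1) simp
    finally have p: "r + j * Suc k + (k - b) < length w"
      by (simp add: w)
    have "(\<Sum>q<length w. if q + b = k \<and> r + j * Suc k + q = p then of_bool (w ! p = (j \<in> Z)) else 0) =
      (if r + j * Suc k + (k - b) = p then of_bool (w ! p = (j \<in> Z)) else (0::nat))" for p
    proof -
      have "(q + b = k \<and> r + j * Suc k + q = p) \<longleftrightarrow> (q = k - b \<and> r + j * Suc k + (k - b) = p)" for q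
        using b by auto
      moreover have "k - b < length w"
        using b by simp
      ultimately show ?thesis
        by (auto simp: sum.neutral)
    qed
    then show ?thesis
      using p by simp
  qed
  have "(\<Sum>Z\<in>Pow {..<c}. of_bool (less_step d s (Y \<union> (+) l ` Z) = s') *
     (\<Prod>j<c. \<Sum>p<length w. \<Sum>q<length w. if q + b = k \<and> r + j * Suc k + q = p then of_bool (w ! p = (j \<in> Z)) else 0)) =
     (of_bool (less_step d s (Y \<union> const_bits l r c w k b) = s') :: nat)" for Y
  proof -
    have prod: "(\<Prod>j<c. \<Sum>p<length w. \<Sum>q<length w. if q + b = k \<and> r + j * Suc k + q = p then of_bool (w ! p = (j \<in> Z)) else 0) =
      (of_bool (Z = Z0) :: nat)" if "Z \<in> Pow {..<c}" for Z
    proof -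
      have "(\<Prod>j<c. \<Sum>p<length w. \<Sum>q<length w. if q + b = k \<and> r + j * Suc k + q = p then of_bool (w ! p = (j \<in> Z)) else 0) =
        (\<Prod>j<c. of_bool (w ! (r + j * Suc k + (k - b)) = (j \<in> Z)) :: nat)"
        by (intro prod.cong refl one) simp
      also have "\<dots> = of_bool (\<forall>j\<in>{..<c}. w ! (r + j * Suc k + (k - b)) = (j \<in> Z))"
        by (rule prod_of_bool) simp
      also have "(\<forall>j\<in>{..<c}. w ! (r + j * Suc k + (k - b)) = (j \<in> Z)) \<longleftrightarrow> Z = Z0"
        using that unfolding Z0_def by auto
      finally show ?thesis .
    qed
    have "(\<Sum>Z\<in>Pow {..<c}. of_bool (less_step d s (Y \<union> (+) l ` Z) = s') *
     (\<Prod>j<c. \<Sum>p<length w. \<Sum>q<length w. if q + b = k \<and> r + j * Suc k + q = p then of_bool (w ! p = (j \<in> Z)) else 0)) =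
     (\<Sum>Z\<in>Pow {..<c}. of_bool (less_step d s (Y \<union> (+) l ` Z) = s') * of_bool (Z = Z0) :: nat)"
      by (intro sum.cong refl arg_cong2[where f = "(*)"] prod)
    also have "\<dots> = (\<Sum>Z\<in>{Z0}. of_bool (less_step d s (Y \<union> (+) l ` Z) = s') * of_bool (Z = Z0))"
      by (intro sum.mono_neutral_right) (auto simp: Z0_def)
    also have "(+) l ` Z0 = const_bits l r c w k b"
      by (auto simp: Z0_def const_bits_def)
    then have "(\<Sum>Z\<in>{Z0}. of_bool (less_step d s (Y \<union> (+) l ` Z) = s') * of_bool (Z = Z0)) =
      (of_bool (less_step d s (Y \<union> const_bits l r c w k b) = s') :: nat)"
      by simp
    finally show ?thesis .
  qed
  then show ?thesis
    unfolding moves_sum_def moves_def by simp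
qed

lemma K_moves_sum: "K (\<lambda>w e. moves_sum w (e k) s s' (e b))"
proof -
  have "NUM (\<lambda>w e. e q + e b = e k \<and> r + j * Suc (e k) + e q = e p)" for q b k p j
    by (intro NUM_I FO_conj FO_plus FO_DT_env DT_add DT_mult DT_const DT_Suc DT_var) simp
  then show ?thesis
    unfolding moves_sum_def
    by (intro K_finite_sum K_mult K_NUM NUM_const K_finite_prod K_sum K_if K_input K_zero)
qed

lemma NUM_size: "NUM (\<lambda>w e. length w = r + c * Suc (e i))"
proof (rule NUM_I)
  have "FO (\<lambda>w e. (c = 0 \<and> length w = r) \<or> (\<exists>y<length w. y = length w - Suc 0 \<and> c \<noteq> 0 \<and> r + c * e i + (c - 1) = y))"
    by (intro FO_disj FO_conj FO_ex FO_const_bool FO_length_eq FO_max FO_DT_env DT_add DT_mult DT_const DT_var)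
  then show "FO (\<lambda>w e. length w = r + c * Suc (e i))"
    by (rule FO_cong) (cases c; auto dest: ok_lengthD)
qed simp

lemma NUM_less: "NUM (\<lambda>w e. e i < e j)"
  by (rule NUM_I[OF FO_less]) simp

text \<open>Induction on the number of pairs not yet in \<open>s\<close>: the closed form refers to
  strictly larger states only, so the nesting stays bounded independently of the string. The guard
  makes all bit places and positions involved lie inside the string.\<close>

lemma K_count_runs:
  assumes "s \<subseteq> {..<d} \<times> {..<d}"
  shows "K (\<lambda>w e. if length w = r + c * Suc (e 1) \<and> \<not> e 1 < e 0
    then count_runs acc l d (const_bits l r c w (e 1)) s (e 0) else 0)"
  using assms
proof (induction "card ({..<d} \<times> {..<d} - s)" arbitrary: s rule: less_induct)
  case less
  let ?S = "{s'. s \<subset> s' \<and> s' \<subseteq> {..<d} \<times> {..<d}}"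
  let ?G = "\<lambda>w k. length w = r + c * Suc k"
  let ?n = "\<lambda>s w b k. if ?G w k \<and> \<not> k < b then count_runs acc l d (const_bits l r c w k) s b else 0"
  have IH: "K (\<lambda>w e. ?n s' w (e b) (e k))" if "s' \<in> ?S" for s' b k
  proof -
    have "card ({..<d} \<times> {..<d} - s') < card ({..<d} \<times> {..<d} - s)"
      using that by (intro psubset_card_mono) auto
    then have "K (\<lambda>w e. ?n s' w (e 0) (e 1))"
      using less.hyps[of s'] that by blast
    then show ?thesis
      using K_subst[of "\<lambda>w e. ?n s' w (e 0) (e 1)" "\<lambda>i. if i = 0 then b else k"] by (simp cong: if_cong)
  qed
  have "K (\<lambda>w e. if ?G w (e 1) then if e 1 < e 0 then 0 else
      of_bool (acc s) * (\<Prod>i<length w. if i < e 0 then moves_sum w (e 1) s s i else 1) +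
      (\<Sum>j<length w. if j < e 0 then
        (\<Prod>i<length w. if j < i then if i < e 0 then moves_sum w (e 1) s s i else 1 else 1) *
        (\<Sum>s'\<in>?S. moves_sum w (e 1) s s' j * ?n s' w j (e 1)) else 0) else 0)"
    by (intro K_if K_add K_mult K_prod K_sum K_finite_sum IH K_moves_sum NUM_less NUM_size K_NUM NUM_const K_one K_zero)
  then show ?case
  proof (rule K_cong)
    fix w e assume ok: "ok w e"
    let ?C = "const_bits l r c w (e 1)"
    show "(if ?G w (e 1) then if e 1 < e 0 then 0 else
      of_bool (acc s) * (\<Prod>i<length w. if i < e 0 then moves_sum w (e 1) s s i else 1) +
      (\<Sum>j<length w. if j < e 0 then
        (\<Prod>i<length w. if j < i then if i < e 0 then moves_sum w (e 1) s s i else 1 else 1) *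
        (\<Sum>s'\<in>?S. moves_sum w (e 1) s s' j * ?n s' w j (e 1)) else 0) else 0) =
      (if ?G w (e 1) \<and> \<not> e 1 < e 0 then count_runs acc l d ?C s (e 0) else 0)"
    proof (cases "?G w (e 1) \<and> \<not> e 1 < e 0")
      case True
      have e: "e 0 < length w" "e 1 < length w"
        using ok by (simp_all add: ok_def)
      have mv: "moves_sum w (e 1) s s' i = moves l d ?C s s' i" if "i \<le> e 0" for s' i
        using moves_sum_eq[of w "e 1" i s s'] True that e by simp
      have 1: "(\<Prod>i<length w. if i < e 0 then moves_sum w (e 1) s s i else 1) = (\<Prod>i<e 0. moves l d ?C s s i)"
        using e(1) by (intro prod.mono_neutral_cong_right) (auto simp: mv simp del: One_nat_def)
      have 2: "(\<Prod>i<length w. if j < i then if i < e 0 then moves_sum w (e 1) s s i else 1 else 1) =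
        (\<Prod>i\<in>{j<..<e 0}. moves l d ?C s s i)" for j
        using e(1) by (intro prod.mono_neutral_cong_right) (auto simp: mv simp del: One_nat_def)
      have 3: "(\<Sum>j<length w. if j < e 0 then
        (\<Prod>i<length w. if j < i then if i < e 0 then moves_sum w (e 1) s s i else 1 else 1) *
        (\<Sum>s'\<in>?S. moves_sum w (e 1) s s' j * ?n s' w j (e 1)) else 0) =
        (\<Sum>j<e 0. (\<Prod>i\<in>{j<..<e 0}. moves l d ?C s s i) *
          (\<Sum>s'\<in>?S. moves l d ?C s s' j * count_runs acc l d ?C s' j))"
        unfolding 2 using e(1) True by (intro sum.mono_neutral_cong_right) (auto simp: mv simp del: One_nat_def)
      show ?thesis
        using True unfolding 1 3 by (subst count_runs_closed_form[OF less.prems]) simp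
    qed auto
  qed
qed

end

section \<open>Evaluating the formula from the comparisons of its terms\<close>

definition tm_index :: "nat \<Rightarrow> tm \<Rightarrow> nat" where
  "tm_index l t = (case t of Var x \<Rightarrow> x | Cst j \<Rightarrow> l + j)"

definition accepts :: "nat \<Rightarrow> fm \<Rightarrow> nat set \<Rightarrow> nat list set list \<Rightarrow> (nat \<times> nat) set \<Rightarrow> bool" where
  "accepts l \<phi> \<rho> Ss s \<longleftrightarrow> eval_atoms (\<lambda>a. case a of
      Eq t u \<Rightarrow> (tm_index l t, tm_index l u) \<notin> s \<and> (tm_index l u, tm_index l t) \<notin> s
    | Builtin b t u \<Rightarrow> (tm_index l u, tm_index l t) \<notin> s
    | Rel i ts \<Rightarrow> i \<in> \<rho>
    | RVar i ts \<Rightarrow> [] \<in> Ss ! i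
    | _ \<Rightarrow> False) \<phi>"

text \<open>With only nullary relations and relation variables, the truth of a quantifier-free
  formula depends on the elements through the order of the values of its terms alone.\<close>

lemma sat_iff_accepts:
  assumes A: "\<A> \<in> structures \<sigma>" and nullary: "\<And>a. a \<in> set (rel_arities \<sigma>) \<Longrightarrow> a = 0" "\<And>a. a \<in> set as \<Longrightarrow> a = 0"
    and qf: "quantifier_free \<phi>" and wf: "wf_fm \<sigma> as \<phi>" and fv: "free_vars \<phi> \<subseteq> {..<l}" and LE: "builtins \<sigma> = {LE}"
    and \<rho>: "\<rho> = {i. i < length (rel_arities \<sigma>) \<and> [] \<in> rels \<A> ! i}"
  shows "sat \<A> Ss (\<lambda>j. cs ! j) \<phi> \<longleftrightarrow>
    accepts l \<phi> \<rho> Ss (less_pairs (l + nconsts \<sigma>) (joint_value l cs (const_vals \<A>)))"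
  unfolding sat_eval_atoms[OF qf] accepts_def
proof (rule eval_atoms_cong[OF qf])
  let ?v = "joint_value l cs (const_vals \<A>)" and ?d = "l + nconsts \<sigma>"
  fix a assume a: "a \<in> atoms \<phi>"
  have wfa: "wf_fm \<sigma> as a" "(case a of Eq s t \<Rightarrow> True | Builtin b s t \<Rightarrow> True | Rel i ts \<Rightarrow> True | RVar i ts \<Rightarrow> True | _ \<Rightarrow> False)"
    using atoms_wf[OF a wf] by simp_all
  have v: "tm_val \<A> (\<lambda>j. cs ! j) t = ?v (tm_index l t) \<and> tm_index l t < ?d" if "t \<in> atom_terms a" for t
    using atom_terms_wf[OF a that wf fv] by (cases t) (auto simp: joint_value_def tm_index_def)
  show "sat \<A> Ss (\<lambda>j. cs ! j) a \<longleftrightarrow> (case a of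
      Eq t u \<Rightarrow> (tm_index l t, tm_index l u) \<notin> less_pairs ?d ?v \<and> (tm_index l u, tm_index l t) \<notin> less_pairs ?d ?v
    | Builtin b t u \<Rightarrow> (tm_index l u, tm_index l t) \<notin> less_pairs ?d ?v
    | Rel i ts \<Rightarrow> i \<in> \<rho>
    | RVar i ts \<Rightarrow> [] \<in> Ss ! i
    | _ \<Rightarrow> False)"
  proof (cases a)
    case (Eq t u)
    then show ?thesis using v[of t] v[of u] by (auto simp: less_pairs_def)
  next
    case (Builtin b t u)
    then have "b = LE"
      using wfa(1) LE by simp
    then show ?thesis using v[of t] v[of u] by (auto simp: Builtin less_pairs_def)
  next
    case (Rel i ts)
    then have "i < length (rel_arities \<sigma>)" "ts = []"
      using wfa(1) nullary(1)[of "rel_arities \<sigma> ! i"] by auto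
    then show ?thesis by (simp add: Rel \<rho>)
  next
    case (RVar i ts)
    then have "ts = []"
      using wfa(1) nullary(2)[of "as ! i"] by auto
    then show ?thesis by (simp add: RVar)
  qed (use wfa(2) in auto)
qed

text \<open>The constants have \<open>Suc k\<close> bits. Since \<open>Suc k\<close> may equal the
  length of the string, the most significant bit \<open>k\<close> is treated by a separate step from
  the empty state, and the remaining run is indexed by the element \<open>k\<close>.\<close>

definition bitwise_sum :: "nat \<Rightarrow> nat \<Rightarrow> nat \<Rightarrow> nat list \<Rightarrow> fm \<Rightarrow> bool list \<Rightarrow> nat" where
  "bitwise_sum l r c as \<phi> w = (\<Sum>k<length w. if length w = r + c * Suc k then
     \<Sum>\<rho>\<in>Pow {..<r}. (\<Prod>i<r. \<Sum>p<length w. if p = i then of_bool (w ! p = (i \<in> \<rho>)) else 0) *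
       (\<Sum>Ss\<in>relation_tuples 1 as. \<Sum>s\<in>Pow ({..<l + c} \<times> {..<l + c}).
          moves_sum l r c (l + c) w k {} s k *
          (if length w = r + c * Suc k \<and> \<not> k < k
           then count_runs (accepts l \<phi> \<rho> Ss) l (l + c) (const_bits l r c w k) s k else 0)) else 0)"

lemma K_bitwise_sum: "K (\<lambda>w e. bitwise_sum l r c as \<phi> w)"
proof -
  have runs: "K (\<lambda>w e. if length w = r + c * Suc (e 0) \<and> \<not> e 0 < e 0
    then count_runs acc l (l + c) (const_bits l r c w (e 0)) s (e 0) else 0)"
    if "s \<subseteq> {..<l + c} \<times> {..<l + c}" for acc s
    using K_subst[OF K_count_runs[OF refl that, of r acc], of "\<lambda>_. 0"] by simp
  show ?thesis
    unfolding bitwise_sum_def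
    by (intro K_sum K_if K_finite_sum K_mult K_finite_prod K_input NUM_const NUM_eq_const K_zero
        NUM_size[OF refl] K_moves_sum[OF refl] runs) auto
qed

lemma bitlen_power_minus_1: "bitlen (2 ^ k - 1) = k"
proof (rule antisym)
  show "bitlen (2 ^ k - 1) \<le> k"
    by (simp add: bitlen_le_iff)
  show "k \<le> bitlen (2 ^ k - 1)"
    using less_power_bitlen[of "2 ^ k - 1"] power_increasing_iff[of "2::nat" k "bitlen (2 ^ k - 1)"]
    by (metis Suc_pred' less_eq_Suc_le one_less_numeral_iff power_increasing_iff semiring_norm(76) zero_less_numeral zero_less_power One_nat_def)
qed

lemma bitwise_sum_eq:
  assumes nullary: "\<And>a. a \<in> set (rel_arities \<sigma>) \<Longrightarrow> a = 0" "\<And>a. a \<in> set as \<Longrightarrow> a = 0"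
    and qf: "quantifier_free \<phi>" and wf: "wf_fm \<sigma> as \<phi>" and fv: "free_vars \<phi> \<subseteq> {..<l}" and LE: "builtins \<sigma> = {LE}"
    and f: "\<And>\<A>. \<A> \<in> structures \<sigma> \<Longrightarrow> enc \<sigma> \<A> \<noteq> [] \<Longrightarrow> f (enc \<sigma> \<A>) = count_sat as l \<phi> \<A>"
      "\<And>w. w \<noteq> [] \<Longrightarrow> w \<notin> enc \<sigma> ` structures \<sigma> \<Longrightarrow> f w = 0"
    and w: "length w > length (rel_arities \<sigma>)"
  shows "f w = bitwise_sum l (length (rel_arities \<sigma>)) (nconsts \<sigma>) as \<phi> w"
proof -
  let ?r = "length (rel_arities \<sigma>)" and ?c = "nconsts \<sigma>"
  let ?d = "l + ?c"
  have ne: "w \<noteq> []"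
    using w by auto
  have ar: "rel_arities \<sigma> ! i = 0" if "i < ?r" for i
    using nullary(1) that by simp
  have len: "enc_len \<sigma> n = ?r + ?c * bitlen (n - 1)" for n
    by (simp add: enc_len_def const_offset_def rel_offset_def ar)
  show ?thesis
  proof (cases "\<exists>k. length w = ?r + ?c * Suc k")
    case False
    then have "bitwise_sum l ?r ?c as \<phi> w = 0"
      by (simp add: bitwise_sum_def)
    moreover have "w \<notin> enc \<sigma> ` structures \<sigma>"
    proof
      assume "w \<in> enc \<sigma> ` structures \<sigma>"
      then obtain \<A> where "\<A> \<in> structures \<sigma>" "w = enc \<sigma> \<A>" by auto
      then have "length w = ?r + ?c * bitlen (size_of \<A> - 1)"
        using length_enc[of \<A> \<sigma> "size_of \<A>"] len by simp
      then show False
        using False w by (cases "bitlen (size_of \<A> - 1)") auto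
    qed
    ultimately show ?thesis
      using f(2)[OF ne] by simp
  next
    case True
    then obtain k where k: "length w = ?r + ?c * Suc k" by blast
    have c: "?c > 0"
      using w k by (cases ?c) auto
    have uniq: "length w = ?r + ?c * Suc k' \<longleftrightarrow> k' = k" for k'
      using k c by auto
    have "Suc k \<le> ?c * Suc k"
      using c mult_le_mono1[of 1 ?c "Suc k"] by simp
    then have "Suc k \<le> length w"
      unfolding k by (rule le_trans[OF _ le_add2])
    then have kN: "k < length w"
      by simp
    \<comment> \<open>The encoding does not distinguish the sizes with the same number of bits, so
      the most convenient one may be used: for a power of two every bit pattern is an element, and
      every string of this length is an encoding.\<close>
    define n where "n = (2::nat) ^ Suc k"
    have n: "n \<ge> 1" "bitlen (n - 1) = Suc k"
      unfolding n_def by (simp_all only: bitlen_power_minus_1 one_le_power one_le_numeral)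
    have "\<forall>j. \<exists>u. u < 2 ^ Suc k \<and> (\<forall>i. bit (u::nat) i \<longleftrightarrow> i < Suc k \<and> w ! (?r + j * Suc k + (k - i)))"
    proof
      fix j
      show "\<exists>u. u < 2 ^ Suc k \<and> (\<forall>i. bit (u::nat) i \<longleftrightarrow> i < Suc k \<and> w ! (?r + j * Suc k + (k - i)))"
        by (rule ex_word[of "Suc k" "\<lambda>i. w ! (?r + j * Suc k + (k - i))"])
    qed
    from choice[OF this] obtain U where U: "\<forall>j. U j < 2 ^ Suc k \<and> (\<forall>i. bit (U j :: nat) i \<longleftrightarrow> i < Suc k \<and> w ! (?r + j * Suc k + (k - i)))" ..
    define cv where "cv = map U [0..<?c]"
    have cv: "cv \<in> tuples n ?c"
      using U by (auto simp: cv_def tuples_def n_def)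
    define \<A> where "\<A> = decode \<sigma> n w cv"
    have A: "\<A> \<in> structures \<sigma>"
      unfolding \<A>_def by (rule decode_in_structures[OF n(1) cv])
    have match: "consts_match \<sigma> n w cv"
      unfolding consts_match_def n(2)
    proof (intro allI impI)
      fix j q assume "j < ?c" "q < Suc k"
      moreover have "const_offset \<sigma> n = ?r"
        by (simp add: const_offset_def rel_offset_def ar)
      ultimately show "w ! (const_offset \<sigma> n + j * Suc k + q) = bit (cv ! j) (Suc k - Suc q)"
        using U by (auto simp: cv_def simp del: mult_Suc_right)
    qed
    have enc: "enc \<sigma> \<A> = w"
      unfolding \<A>_def by (rule enc_decode[OF n(1) cv _ match]) (simp only: k len n(2))
    define \<rho> where "\<rho> = {i. i < ?r \<and> w ! i}"
    have \<rho>: "\<rho> = {i. i < length (rel_arities \<sigma>) \<and> [] \<in> rels \<A> ! i}"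
      by (auto simp: \<rho>_def \<A>_def decode_def rel_offset_def ar)
    have rt: "relation_tuples n as = relation_tuples 1 as"
    proof -
      have "tuples n (as ! i) = tuples 1 (as ! i)" if "i < length as" for i
        using nullary(2)[OF nth_mem[OF that]] by simp
      then show ?thesis
        unfolding relation_tuples_def by auto
    qed
    let ?C = "const_bits l ?r ?c w k"
    have "f w = count_sat as l \<phi> \<A>"
      using f(1)[OF A] enc ne by simp
    also have "\<dots> = (\<Sum>cs\<in>tuples n l. \<Sum>Ss\<in>relation_tuples 1 as. of_bool (sat \<A> Ss (\<lambda>j. cs ! j) \<phi>))"
      unfolding count_sat_eq by (simp add: \<A>_def decode_def rt Collect_conj_eq)
    also have "\<dots> = (\<Sum>Ss\<in>relation_tuples 1 as. \<Sum>cs\<in>tuples n l. of_bool (sat \<A> Ss (\<lambda>j. cs ! j) \<phi>))"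
      by (rule sum.swap)
    also have "\<dots> = (\<Sum>Ss\<in>relation_tuples 1 as. count_runs (accepts l \<phi> \<rho> Ss) l ?d ?C {} (Suc k))"
    proof (intro sum.cong refl)
      fix Ss
      have "count_runs (accepts l \<phi> \<rho> Ss) l ?d ?C {} (Suc k) =
        (\<Sum>cs\<in>tuples n l. of_bool (accepts l \<phi> \<rho> Ss (refine {} (less_pairs ?d (\<lambda>i. joint_value l cs cv i mod n)))))"
        unfolding n_def
      proof (rule count_runs_eq)
        fix i assume "i < Suc k"
        then show "?C i = {l + j |j. j < ?c \<and> bit (cv ! j) i}"
          using U by (auto simp: const_bits_def cv_def)
      qed
      also have "\<dots> = (\<Sum>cs\<in>tuples n l. of_bool (sat \<A> Ss (\<lambda>j. cs ! j) \<phi>))"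
      proof (intro sum.cong refl)
        fix cs assume cs: "cs \<in> tuples n l"
        have "joint_value l cs cv i < n" if "i < ?d" for i
          using that tuples_nth[OF cs, of i] tuples_nth[OF cv, of "i - l"] by (auto simp: joint_value_def)
        then have "refine {} (less_pairs ?d (\<lambda>i. joint_value l cs cv i mod n)) = less_pairs ?d (joint_value l cs cv)"
          by (auto simp: refine_def less_pairs_def)
        moreover have "cv = const_vals \<A>"
          by (simp add: \<A>_def decode_def)
        ultimately show "of_bool (accepts l \<phi> \<rho> Ss (refine {} (less_pairs ?d (\<lambda>i. joint_value l cs cv i mod n)))) =
          (of_bool (sat \<A> Ss (\<lambda>j. cs ! j) \<phi>) :: nat)"
          using sat_iff_accepts[OF A nullary qf wf fv LE \<rho>] by simp
      qed
      finally show "(\<Sum>cs\<in>tuples n l. of_bool (sat \<A> Ss (\<lambda>j. cs ! j) \<phi>)) =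
        count_runs (accepts l \<phi> \<rho> Ss) l ?d ?C {} (Suc k)" by simp
    qed
    also have "\<dots> = (\<Sum>Ss\<in>relation_tuples 1 as. \<Sum>s\<in>Pow ({..<?d} \<times> {..<?d}).
        moves_sum l ?r ?c ?d w k {} s k * count_runs (accepts l \<phi> \<rho> Ss) l ?d ?C s k)"
      by (simp only: count_runs_Suc_moves[OF empty_subsetI] moves_sum_eq[OF refl k order_refl kN])
    finally have fw: "f w = \<dots>" .
    define G where "G \<rho>' = (\<Sum>Ss\<in>relation_tuples 1 as. \<Sum>s\<in>Pow ({..<?d} \<times> {..<?d}).
        moves_sum l ?r ?c ?d w k {} s k * count_runs (accepts l \<phi> \<rho>' Ss) l ?d ?C s k)" for \<rho>'
    have "(\<Prod>i<?r. \<Sum>p<length w. if p = i then of_bool (w ! p = (i \<in> \<rho>')) else 0) = (of_bool (\<rho>' = \<rho>) :: nat)"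
      if "\<rho>' \<subseteq> {..<?r}" for \<rho>'
    proof -
      have "(\<Prod>i<?r. \<Sum>p<length w. if p = i then of_bool (w ! p = (i \<in> \<rho>')) else 0) = (\<Prod>i<?r. of_bool (w ! i = (i \<in> \<rho>')) :: nat)"
        using w by (intro prod.cong refl) simp
      also have "\<dots> = of_bool (\<forall>i\<in>{..<?r}. w ! i = (i \<in> \<rho>'))"
        by (rule prod_of_bool) simp
      also have "(\<forall>i\<in>{..<?r}. w ! i = (i \<in> \<rho>')) \<longleftrightarrow> \<rho>' = \<rho>"
        using that by (auto simp: \<rho>_def)
      finally show ?thesis .
    qed
    then have "(\<Sum>\<rho>'\<in>Pow {..<?r}. (\<Prod>i<?r. \<Sum>p<length w. if p = i then of_bool (w ! p = (i \<in> \<rho>')) else 0) * G \<rho>') =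
      (\<Sum>\<rho>'\<in>Pow {..<?r}. of_bool (\<rho>' = \<rho>) * G \<rho>')"
      by (intro sum.cong refl) simp
    also have "\<dots> = (\<Sum>\<rho>'\<in>{\<rho>}. of_bool (\<rho>' = \<rho>) * G \<rho>')"
      by (intro sum.mono_neutral_right) (auto simp: \<rho>_def)
    also have "\<dots> = f w"
      by (simp add: G_def fw)
    finally have "f w = (\<Sum>\<rho>'\<in>Pow {..<?r}. (\<Prod>i<?r. \<Sum>p<length w. if p = i then of_bool (w ! p = (i \<in> \<rho>')) else 0) * G \<rho>')"
      by (rule sym)
    also have "\<dots> = bitwise_sum l ?r ?c as \<phi> w"
      unfolding bitwise_sum_def uniq G_def using kN by simp
    finally show ?thesis .
  qed
qed

theorem sharp_Sigma0_subset: "sharp_rel (Sigma_fm 0) \<subseteq> FO_uniform_sharp_AC0"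
proof
  fix f assume "f \<in> sharp_rel (Sigma_fm 0)"
  then obtain \<sigma> as l \<phi> where LE: "builtins \<sigma> = {LE}" and qf: "quantifier_free \<phi>" and wf: "wf_fm \<sigma> as \<phi>"
    and fv: "free_vars \<phi> \<subseteq> {..<l}"
    and f0: "\<forall>\<A>\<in>structures \<sigma>. enc \<sigma> \<A> \<noteq> [] \<longrightarrow> f (enc \<sigma> \<A>) = count_sat as l \<phi> \<A>"
      "\<forall>w. w \<noteq> [] \<and> w \<notin> enc \<sigma> ` structures \<sigma> \<longrightarrow> f w = 0"
    unfolding sharp_rel_def by auto
  from f0 have f: "\<And>\<A>. \<A> \<in> structures \<sigma> \<Longrightarrow> enc \<sigma> \<A> \<noteq> [] \<Longrightarrow> f (enc \<sigma> \<A>) = count_sat as l \<phi> \<A>"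
      "\<And>w. w \<noteq> [] \<Longrightarrow> w \<notin> enc \<sigma> ` structures \<sigma> \<Longrightarrow> f w = 0"
    by simp_all
  show "f \<in> FO_uniform_sharp_AC0"
  proof (cases "\<exists>a\<in>set (rel_arities \<sigma>). a \<ge> 1")
    case True
    then obtain a where "a \<in> set (rel_arities \<sigma>)" "a \<ge> 1" by blast
    then show ?thesis
      by (rule sigma0_positive_arity[OF _ _ qf wf fv LE f])
  next
    case False
    then have null: "a = 0" if "a \<in> set (rel_arities \<sigma>)" for a
      using that by force
    show ?thesis
    proof (cases "\<exists>a\<in>set as. a \<ge> 1")
      case True
      then obtain i where i: "i < length as" "as ! i \<ge> 1"
        by (auto simp: in_set_conv_nth)
      show ?thesis
        by (rule K_imp_sharp_AC0[OF K_zero, of "enc_len \<sigma> (l + nconsts \<sigma> + 5)"])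
          (rule bounded_support[OF null qf wf fv LE f i])
    next
      case False
      then have null': "a = 0" if "a \<in> set as" for a
        using that by force
      show ?thesis
        by (rule K_imp_sharp_AC0[OF K_bitwise_sum]) (rule bitwise_sum_eq[OF null null' qf wf fv LE f])
    qed
  qed
qed

section \<open>A function in FO-uniform \<open>#AC\<^sup>0\<close> that is not in \<open>#\<Sigma>\<^sub>2\<close>\<close>

lemma sat_foldr_Ex_iff: "sat \<A> Ss e (foldr Ex xs \<psi>) \<longleftrightarrow> \<not> sat \<A> Ss e (foldr All xs (Neg \<psi>))"
  by (induction xs arbitrary: e) auto

lemma sat_foldr_Ex:
  "sat \<A> Ss e (foldr Ex ys \<chi>) \<longleftrightarrow>
    (\<exists>e'. (\<forall>x. x \<notin> set ys \<longrightarrow> e' x = e x) \<and> (\<forall>x\<in>set ys. e' x < size_of \<A>) \<and> sat \<A> Ss e' \<chi>)"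
proof (induction ys arbitrary: e)
  case Nil
  have "(\<forall>x. e' x = e x) \<longleftrightarrow> e' = e" for e'
    by auto
  then show ?case by simp
next
  case (Cons y ys)
  show ?case
  proof
    assume "sat \<A> Ss e (foldr Ex (y # ys) \<chi>)"
    then obtain a e' where "a < size_of \<A>" "\<forall>x. x \<notin> set ys \<longrightarrow> e' x = (e(y := a)) x"
      "\<forall>x\<in>set ys. e' x < size_of \<A>" "sat \<A> Ss e' \<chi>"
      using Cons.IH by auto
    then show "\<exists>e'. (\<forall>x. x \<notin> set (y # ys) \<longrightarrow> e' x = e x) \<and> (\<forall>x\<in>set (y # ys). e' x < size_of \<A>) \<and> sat \<A> Ss e' \<chi>"
      by (intro exI[of _ e']) (cases "y \<in> set ys"; auto)
  next
    assume "\<exists>e'. (\<forall>x. x \<notin> set (y # ys) \<longrightarrow> e' x = e x) \<and> (\<forall>x\<in>set (y # ys). e' x < size_of \<A>) \<and> sat \<A> Ss e' \<chi>"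
    then obtain e' where e': "\<forall>x. x \<notin> set (y # ys) \<longrightarrow> e' x = e x" "\<forall>x\<in>set (y # ys). e' x < size_of \<A>" "sat \<A> Ss e' \<chi>"
      by blast
    then have "sat \<A> Ss (e(y := e' y)) (foldr Ex ys \<chi>)"
      unfolding Cons.IH by (intro exI[of _ e']) auto
    then show "sat \<A> Ss e (foldr Ex (y # ys) \<chi>)"
      using e'(2) by auto
  qed
qed

lemma sat_foldr_All:
  "sat \<A> Ss e (foldr All ys \<chi>) \<longleftrightarrow>
    (\<forall>e'. (\<forall>x. x \<notin> set ys \<longrightarrow> e' x = e x) \<and> (\<forall>x\<in>set ys. e' x < size_of \<A>) \<longrightarrow> sat \<A> Ss e' \<chi>)"
proof -
  have "sat \<A> Ss e (foldr All ys \<chi>) \<longleftrightarrow> \<not> sat \<A> Ss e (foldr Ex ys (Neg \<chi>))" for e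
    by (induction ys arbitrary: e) auto
  then show ?thesis
    unfolding sat_foldr_Ex by auto
qed

lemma wf_foldr_Ex [simp]: "wf_fm \<sigma> as (foldr Ex ys \<chi>) \<longleftrightarrow> wf_fm \<sigma> as \<chi>"
  by (induction ys) auto

lemma wf_foldr_All [simp]: "wf_fm \<sigma> as (foldr All ys \<chi>) \<longleftrightarrow> wf_fm \<sigma> as \<chi>"
  by (induction ys) auto

text \<open>The existential witnesses are kept in the substructure, and a universal statement is
  inherited by substructures.\<close>

lemma pull_sat_Ex_All:
  assumes A: "\<A> \<in> structures \<sigma>" and h: "strict_mono_on {..<n} h" "h ` {..<n} \<subseteq> {..<size_of \<A>}"
    and cimg: "set (const_vals \<A>) \<subseteq> h ` {..<n}" and LE: "builtins \<sigma> = {LE}"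
    and qf: "quantifier_free \<psi>" and wf: "wf_fm \<sigma> as \<psi>"
    and e': "\<And>x. e' x < n" "\<And>x. x \<notin> set ys \<Longrightarrow> e' x = e x"
    and sat: "sat \<A> Ss (\<lambda>x. h (e' x)) (foldr All zs \<psi>)"
  shows "sat (pull \<sigma> h n \<A>) (pull_rels as h n Ss) e (foldr Ex ys (foldr All zs \<psi>))"
  unfolding sat_foldr_Ex
proof (intro exI[of _ e'] conjI)
  show "sat (pull \<sigma> h n \<A>) (pull_rels as h n Ss) e' (foldr All zs \<psi>)"
    unfolding sat_foldr_All
  proof (intro allI impI)
    fix e'' assume e'': "(\<forall>x. x \<notin> set zs \<longrightarrow> e'' x = e' x) \<and> (\<forall>x\<in>set zs. e'' x < size_of (pull \<sigma> h n \<A>))"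
    then have less: "e'' x < n" for x
      using e'(1)[of x] by (cases "x \<in> set zs") (auto simp: pull_def)
    then have "h (e'' x) < size_of \<A>" for x
      using h(2) by auto
    then have "sat \<A> Ss (\<lambda>x. h (e'' x)) \<psi>"
      using sat e'' unfolding sat_foldr_All by auto
    then show "sat (pull \<sigma> h n \<A>) (pull_rels as h n Ss) e'' \<psi>"
      using pull_sat[OF A h cimg LE less qf wf] by simp
  qed
qed (use e' in \<open>auto simp: pull_def\<close>)

text \<open>The bound on \<open>n\<close> leaves room for everything that must be retained: the
  element 0, the constants, the elements and the existential witnesses of both solutions, and a
  tuple that tells them apart.\<close>

lemma two_solutions_restrict:
  assumes A: "\<A> \<in> structures \<sigma>" and LE: "builtins \<sigma> = {LE}"
    and qf: "quantifier_free \<psi>" and wf: "wf_fm \<sigma> as \<psi>" and \<phi>: "\<phi> = foldr Ex ys (foldr All zs \<psi>)"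
    and fv: "free_vars \<phi> \<subseteq> {..<l}"
    and n: "1 + nconsts \<sigma> + 2 * l + 2 * length ys + sum_list as \<le> n" "n \<le> size_of \<A>"
    and two: "count_sat as l \<phi> \<A> \<ge> 2"
  shows "\<exists>\<B>\<in>structures \<sigma>. size_of \<B> = n \<and> count_sat as l \<phi> \<B> \<ge> 2"
proof -
  define N where "N = size_of \<A>"
  define sol where "sol \<C> = {(Ss, cs). Ss \<in> relation_tuples (size_of \<C>) as \<and> cs \<in> tuples (size_of \<C>) l \<and>
       sat \<C> Ss (\<lambda>j. cs ! j) \<phi>}" for \<C>
  have fin: "finite (sol \<C>)" for \<C>
    unfolding sol_def by (rule finite_subset[of _ "relation_tuples (size_of \<C>) as \<times> tuples (size_of \<C>) l"]) auto
  have cnt: "count_sat as l \<phi> \<C> = card (sol \<C>)" for \<C>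
    by (simp add: count_sat_def sol_def)
  have N: "0 < N"
    using n by (simp add: N_def)
  obtain p1 p2 where "p1 \<in> sol \<A>" "p2 \<in> sol \<A>" "p1 \<noteq> p2"
    using two fin[of \<A>] card_le_Suc0_iff_eq[of "sol \<A>"] unfolding cnt by (metis not_less_eq_eq numeral_2_eq_2)
  then obtain S1 c1 S2 c2 where s1: "S1 \<in> relation_tuples N as" "c1 \<in> tuples N l" "sat \<A> S1 (\<lambda>j. c1 ! j) \<phi>"
    and s2: "S2 \<in> relation_tuples N as" "c2 \<in> tuples N l" "sat \<A> S2 (\<lambda>j. c2 ! j) \<phi>"
    and diff: "(S1, c1) \<noteq> (S2, c2)"
    unfolding sol_def N_def by (cases p1, cases p2) auto
  define env where "env c = (\<lambda>j. if j < l then c ! j else (0::nat))" for c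
  have env_sat: "sat \<C> S (\<lambda>j. c ! j) \<phi> \<longleftrightarrow> sat \<C> S (env c) \<phi>" for \<C> S c
    by (rule sat_cong) (use fv in \<open>auto simp: env_def\<close>)
  have witness: "\<exists>e'. (\<forall>x. x \<notin> set ys \<longrightarrow> e' x = env c x) \<and> (\<forall>x\<in>set ys. e' x < N) \<and> sat \<A> S e' (foldr All zs \<psi>)"
    if "sat \<A> S (\<lambda>j. c ! j) \<phi>" for S c
    using that[unfolded env_sat] unfolding \<phi> sat_foldr_Ex N_def .
  obtain e1 where e1: "\<forall>x. x \<notin> set ys \<longrightarrow> e1 x = env c1 x" "\<forall>x\<in>set ys. e1 x < N" "sat \<A> S1 e1 (foldr All zs \<psi>)"
    using witness[OF s1(3)] by blast
  obtain e2 where e2: "\<forall>x. x \<notin> set ys \<longrightarrow> e2 x = env c2 x" "\<forall>x\<in>set ys. e2 x < N" "sat \<A> S2 e2 (foldr All zs \<psi>)"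
    using witness[OF s2(3)] by blast
  \<comment> \<open>If the relations of the two solutions differ, they differ at some tuple;
    retaining its entries keeps the restricted solutions distinct.\<close>
  obtain t where t: "set t \<subseteq> {..<N}" "length t \<le> sum_list as"
    "S1 \<noteq> S2 \<Longrightarrow> \<exists>i<length as. length t = as ! i \<and> (t \<in> S1 ! i) \<noteq> (t \<in> S2 ! i)"
  proof (cases "S1 = S2")
    case True
    then show ?thesis using that[of "[]"] by simp
  next
    case False
    then obtain i where i: "i < length as" "S1 ! i \<noteq> S2 ! i"
      using s1(1) s2(1) by (auto simp: relation_tuples_def list_eq_iff_nth_eq)
    then obtain t where t: "(t \<in> S1 ! i) \<noteq> (t \<in> S2 ! i)"
      by blast
    then have "t \<in> tuples N (as ! i)"
      using s1(1) s2(1) i(1) by (auto simp: relation_tuples_def)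
    moreover have "as ! i \<le> sum_list as"
      using i(1) by (rule elem_le_sum_list)
    ultimately show ?thesis
      using that[of t] t i(1) by (auto simp: tuples_def)
  qed
  define V where "V = insert 0 (set (const_vals \<A> @ c1 @ c2 @ map e1 ys @ map e2 ys @ t))"
  have cA: "const_vals \<A> \<in> tuples N (nconsts \<sigma>)"
    using structure_unfold(4)[OF A] by (simp add: N_def)
  have "V \<subseteq> {..<N}"
    using N cA s1(2) s2(2) e1(2) e2(2) t(1) by (auto simp: V_def tuples_def)
  moreover have "card V \<le> n"
  proof -
    have "card V \<le> Suc (length (const_vals \<A> @ c1 @ c2 @ map e1 ys @ map e2 ys @ t))"
      unfolding V_def using card_length[of "const_vals \<A> @ c1 @ c2 @ map e1 ys @ map e2 ys @ t"]
      by (simp add: card_insert_if del: set_append)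
    also have "\<dots> \<le> n"
      using n(1) t(2) cA s1(2) s2(2) by (simp add: tuples_def)
    finally show ?thesis .
  qed
  ultimately obtain h where h: "strict_mono_on {..<n} h" "h ` {..<n} \<subseteq> {..<N}" "V \<subseteq> h ` {..<n}"
    using ex_order_embedding[of V N n] n(2) by (auto simp: N_def)
  define g where "g = inv_into {..<n} h"
  have g: "g v < n" "h (g v) = v" if "v \<in> V" for v
    using h(3) that inv_into_into[of v h "{..<n}"] f_inv_into_f[of v h "{..<n}"] by (auto simp: g_def)
  have h': "h ` {..<n} \<subseteq> {..<size_of \<A>}"
    using h(2) by (simp add: N_def)
  have cimg: "set (const_vals \<A>) \<subseteq> h ` {..<n}"
    using h(3) by (auto simp: V_def)
  have inj: "inj_on h {..<n}"
    using h(1) by (rule strict_mono_on_imp_inj_on)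
  define \<B> where "\<B> = pull \<sigma> h n \<A>"
  have B: "\<B> \<in> structures \<sigma>" "size_of \<B> = n"
    using pull_in_structures[OF A h(1) h' cimg LE] n(1) by (simp_all add: \<B>_def pull_def)
  have pulled: "(pull_rels as h n S, map g c) \<in> sol \<B>"
    if c: "c \<in> tuples N l" "set c \<subseteq> V" and e: "\<forall>x. x \<notin> set ys \<longrightarrow> e x = env c x" "e ` set ys \<subseteq> V"
      and sat: "sat \<A> S e (foldr All zs \<psi>)" for S c e
  proof -
    have V0: "0 \<in> V"
      by (simp add: V_def)
    have len: "length c = l"
      using c(1) by (simp add: tuples_def)
    have envV: "env c x \<in> V" for x
      using c(2) V0 len by (auto simp: env_def)
    have eV: "e x \<in> V" for x
      using e envV by (cases "x \<in> set ys") auto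
    have "sat \<B> (pull_rels as h n S) (\<lambda>x. g (env c x)) \<phi>"
      unfolding \<B>_def \<phi>
    proof (rule pull_sat_Ex_All[OF A h(1) h' cimg LE qf wf])
      show "sat \<A> S (\<lambda>x. h (g (e x))) (foldr All zs \<psi>)"
        using sat g(2)[OF eV] by simp
    qed (use g(1)[OF eV] e(1) in auto)
    moreover have "sat \<B> (pull_rels as h n S) (\<lambda>x. g (env c x)) \<phi> \<longleftrightarrow> sat \<B> (pull_rels as h n S) (\<lambda>j. map g c ! j) \<phi>"
      by (rule sat_cong) (use fv len in \<open>auto simp: env_def\<close>)
    moreover have "map g c \<in> tuples n l"
      using c(2) g(1) len by (auto simp: tuples_def)
    ultimately show ?thesis
      using pull_rels_in by (simp add: sol_def B(2))
  qed
  have 1: "(pull_rels as h n S1, map g c1) \<in> sol \<B>"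
    by (rule pulled[OF s1(2) _ e1(1) _ e1(3)]) (auto simp: V_def)
  have 2: "(pull_rels as h n S2, map g c2) \<in> sol \<B>"
    by (rule pulled[OF s2(2) _ e2(1) _ e2(3)]) (auto simp: V_def)
  have "(pull_rels as h n S1, map g c1) \<noteq> (pull_rels as h n S2, map g c2)"
  proof (cases "c1 = c2")
    case False
    have "map h (map g c1) = c1" "map h (map g c2) = c2"
      using g(2) by (auto simp: V_def intro!: map_idI)
    then show ?thesis using False by (metis Pair_inject)
  next
    case True
    then have "S1 \<noteq> S2"
      using diff by simp
    then obtain i where i: "i < length as" "length t = as ! i" "(t \<in> S1 ! i) \<noteq> (t \<in> S2 ! i)"
      using t(3) by blast
    have "map h (map g t) = t" "map g t \<in> tuples n (as ! i)"
      using g i(2) by (auto simp: V_def tuples_def intro!: map_idI)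
    then have "(map g t \<in> pull_rels as h n S1 ! i) \<noteq> (map g t \<in> pull_rels as h n S2 ! i)"
      using i by (simp add: pull_rels_def)
    then show ?thesis by auto
  qed
  then have "card (sol \<B>) \<ge> 2"
    using 1 2 card_mono[OF fin[of \<B>], of "{(pull_rels as h n S1, map g c1), (pull_rels as h n S2, map g c2)}"] by auto
  then show ?thesis
    using B cnt by auto
qed

lemma odd_length_in_AC0: "(\<lambda>w. if odd (length w) then 2 else 1) \<in> FO_uniform_sharp_AC0"
proof (rule K_imp_sharp_AC0)
  \<comment> \<open>A length is odd iff the last position is even, that is, has its bit 0
    unset.\<close>
  have "FO (\<lambda>w e. \<exists>y<length w. y = length w - Suc 0 \<and> (\<exists>z<length w. z = 0 \<and> \<not> bit y z))"
    by (intro FO_intros)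
  then have "FO (\<lambda>w e. odd (length w))"
    by (rule FO_cong) (auto dest!: ok_lengthD simp: bit_0)
  then have "NUM (\<lambda>w e. odd (length w))"
    by (rule NUM_I) simp
  then show "K (\<lambda>w e. if odd (length w) then 2 else 1)"
    by (intro K_if K_const)
qed simp

text \<open>The function never takes the value 0 reserved for strings that encode nothing, so every
  positive length is the length of an encoding. In particular arbitrarily large structures with
  encodings of odd length exist, as do such with encodings of even length.\<close>

lemma odd_length_not_Sigma2: "(\<lambda>w. if odd (length w) then 2 else 1) \<notin> sharp_rel (Sigma_fm 2)"
proof
  let ?f = "\<lambda>w :: bool list. if odd (length w) then 2 else (1 :: nat)"
  assume "?f \<in> sharp_rel (Sigma_fm 2)"
  then obtain \<sigma> as l \<phi> where LE: "builtins \<sigma> = {LE}" and \<phi>: "\<phi> \<in> Sigma_fm 2" and wf: "wf_fm \<sigma> as \<phi>"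
    and fv: "free_vars \<phi> \<subseteq> {..<l}"
    and f: "\<forall>\<A>\<in>structures \<sigma>. enc \<sigma> \<A> \<noteq> [] \<longrightarrow> ?f (enc \<sigma> \<A>) = count_sat as l \<phi> \<A>"
      "\<forall>w. w \<noteq> [] \<and> w \<notin> enc \<sigma> ` structures \<sigma> \<longrightarrow> ?f w = 0"
    unfolding sharp_rel_def by blast
  obtain ys zs \<psi> where \<psi>: "\<phi> = foldr Ex ys (foldr All zs \<psi>)" "quantifier_free \<psi>"
    using \<phi> by (auto simp: numeral_2_eq_2)
  have wf\<psi>: "wf_fm \<sigma> as \<psi>"
    using wf by (simp add: \<psi>(1))
  let ?L = "enc_len \<sigma>"
  have surj: "\<exists>n. ?L n = N" if "N \<ge> 1" for N
  proof -
    have "replicate N True \<in> enc \<sigma> ` structures \<sigma>"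
    proof (rule ccontr)
      assume "replicate N True \<notin> enc \<sigma> ` structures \<sigma>"
      moreover have "replicate N True \<noteq> []"
        using that by (cases N) auto
      ultimately have "?f (replicate N True) = 0"
        using f(2) by blast
      then show False
        by (simp split: if_splits)
    qed
    then show ?thesis
      using length_enc by (metis imageE length_replicate)
  qed
  have count_value: "count_sat as l \<phi> \<A> = (if odd (?L (size_of \<A>)) then 2 else 1)"
    if "\<A> \<in> structures \<sigma>" "?L (size_of \<A>) \<ge> 1" for \<A>
  proof -
    have len: "length (enc \<sigma> \<A>) = ?L (size_of \<A>)"
      by (rule length_enc[OF that(1) refl])
    then have "enc \<sigma> \<A> \<noteq> []"
      using that(2) by auto
    then have "?f (enc \<sigma> \<A>) = count_sat as l \<phi> \<A>"
      using f(1) that(1) by blast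
    then show ?thesis
      unfolding len by (rule sym)
  qed
  define n0 where "n0 = 1 + nconsts \<sigma> + 2 * l + 2 * length ys + sum_list as"
  have bound: "?L k < Suc (\<Sum>k\<le>n. ?L k)" if "k \<le> n" for k n
    using member_le_sum[of k "{..n}" ?L] that by (simp add: less_Suc_eq_le)
  have odd: "odd (?L n')" if n': "n0 \<le> n'" "?L n' \<ge> 1" for n'
  proof -
    \<comment> \<open>An odd length that exceeds those of all structures of size at most
      \<open>n'\<close>, and so belongs to a larger structure.\<close>
    define N where "N = Suc (2 * (\<Sum>k\<le>n'. ?L k))"
    obtain n where n: "?L n = N"
      using surj[of N] by (auto simp: N_def)
    have "n' < n"
    proof (rule ccontr)
      assume "\<not> n' < n"
      then show False
        using bound[of n n'] n by (simp add: N_def)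
    qed
    \<comment> \<open>Any structure of this size will do; its relations are whatever the unspecified
      entries of the empty list yield.\<close>
    define \<A> where "\<A> = decode \<sigma> n [] (replicate (nconsts \<sigma>) 0)"
    have A: "\<A> \<in> structures \<sigma>" "size_of \<A> = n"
    proof -
      have "replicate (nconsts \<sigma>) 0 \<in> tuples n (nconsts \<sigma>)"
        using \<open>n' < n\<close> by (auto simp: tuples_def)
      then show "\<A> \<in> structures \<sigma>"
        unfolding \<A>_def using \<open>n' < n\<close> by (intro decode_in_structures) auto
      show "size_of \<A> = n"
        by (simp add: \<A>_def decode_def)
    qed
    have "count_sat as l \<phi> \<A> = 2"
      using count_value[OF A(1)] A(2) n by (simp add: N_def)
    then obtain \<B> where B: "\<B> \<in> structures \<sigma>" "size_of \<B> = n'" "count_sat as l \<phi> \<B> \<ge> 2"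
      using two_solutions_restrict[OF A(1) LE \<psi>(2) wf\<psi> \<psi>(1) fv, of n'] n'(1) \<open>n' < n\<close> A(2) unfolding n0_def by auto
    then show ?thesis
      using count_value[OF B(1)] n'(2) by (auto split: if_splits)
  qed
  \<comment> \<open>An even length beyond those of all structures of size at most \<open>n0\<close>;
    the size that realizes it contradicts the oddness just proved.\<close>
  define N where "N = 2 * Suc (\<Sum>k\<le>n0. ?L k)"
  obtain n where n: "?L n = N"
    using surj[of N] by (auto simp: N_def)
  have "n0 < n"
  proof (rule ccontr)
    assume "\<not> n0 < n"
    then show False
      using bound[of n n0] n by (simp add: N_def)
  qed
  then have "odd N"
    using odd[of n] n by (simp add: N_def)
  then show False
    by (simp add: N_def)
qed

section \<open>Parities of proof trees and polynomials of low degree\<close>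

text \<open>A polynomial over the two-element field is represented by its set of monomials.\<close>

definition pdeg :: "nat \<Rightarrow> nat \<Rightarrow> (nat set \<Rightarrow> bool) \<Rightarrow> bool" where
  "pdeg n k f \<longleftrightarrow> (\<exists>M\<subseteq>{m. m \<subseteq> {..<n} \<and> card m \<le> k}. \<forall>X\<subseteq>{..<n}. f X \<longleftrightarrow> odd (card {m \<in> M. m \<subseteq> X}))"

lemma finite_monomials: "finite {m. m \<subseteq> {..<n::nat} \<and> card m \<le> k}"
  by (rule finite_subset[of _ "Pow {..<n}"]) auto

lemma pdeg_cong: "pdeg n k f \<Longrightarrow> (\<And>X. X \<subseteq> {..<n} \<Longrightarrow> f X = g X) \<Longrightarrow> pdeg n k g"
  unfolding pdeg_def by auto

lemma pdeg_mono: "pdeg n k f \<Longrightarrow> k \<le> k' \<Longrightarrow> pdeg n k' f"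
  unfolding pdeg_def by (erule exE) (rule_tac x = M in exI, auto)

lemma pdeg_monomial:
  assumes "m \<subseteq> {..<n}" "card m \<le> k"
  shows "pdeg n k (\<lambda>X. m \<subseteq> X)"
proof -
  have "odd (card {m' \<in> {m}. m' \<subseteq> X}) \<longleftrightarrow> m \<subseteq> X" for X
  proof (cases "m \<subseteq> X")
    case True
    then have "{m' \<in> {m}. m' \<subseteq> X} = {m}" by auto
    then show ?thesis using True by simp
  next
    case False
    then have "{m' \<in> {m}. m' \<subseteq> X} = {}" by auto
    then show ?thesis using False by (metis card.empty even_zero)
  qed
  then show ?thesis
    unfolding pdeg_def using assms by (intro exI[of _ "{m}"]) auto
qed

lemma pdeg_True: "pdeg n k (\<lambda>X. True)"
  using pdeg_monomial[of "{}" n k] by simp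

lemma pdeg_False: "pdeg n k (\<lambda>X. False)"
  unfolding pdeg_def by (intro exI[of _ "{}"]) auto

lemma odd_card_sym_diff:
  assumes "finite A" "finite B"
  shows "odd (card (A - B \<union> (B - A))) \<longleftrightarrow> (odd (card A) \<noteq> odd (card B))"
proof -
  have "card (A - B \<union> (B - A)) = card (A - B) + card (B - A)"
    using assms by (intro card_Un_disjoint) auto
  moreover have "card A = card (A - B) + card (A \<inter> B)" "card B = card (B - A) + card (A \<inter> B)"
    using assms card_Un_disjoint[of "A - B" "A \<inter> B"] card_Un_disjoint[of "B - A" "A \<inter> B"]
    by (simp_all add: Un_Diff_Int Int_commute Diff_Int_distrib disjoint_iff)
      (metis Int_commute Un_Diff_Int)+
  ultimately show ?thesis by presburger
qed

lemma pdeg_xor: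
  assumes "pdeg n k f" "pdeg n k g"
  shows "pdeg n k (\<lambda>X. f X \<noteq> g X)"
proof -
  obtain M where M: "M \<subseteq> {m. m \<subseteq> {..<n} \<and> card m \<le> k}" "\<forall>X\<subseteq>{..<n}. f X \<longleftrightarrow> odd (card {m \<in> M. m \<subseteq> X})"
    using assms(1) unfolding pdeg_def by blast
  obtain M' where M': "M' \<subseteq> {m. m \<subseteq> {..<n} \<and> card m \<le> k}" "\<forall>X\<subseteq>{..<n}. g X \<longleftrightarrow> odd (card {m \<in> M'. m \<subseteq> X})"
    using assms(2) unfolding pdeg_def by blast
  have fin: "finite M" "finite M'"
    using M(1) M'(1) finite_subset[OF _ finite_monomials] by blast+
  have "{m \<in> M - M' \<union> (M' - M). m \<subseteq> X} =
    {m \<in> M. m \<subseteq> X} - {m \<in> M'. m \<subseteq> X} \<union> ({m \<in> M'. m \<subseteq> X} - {m \<in> M. m \<subseteq> X})" for X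
    by auto
  then have "odd (card {m \<in> M - M' \<union> (M' - M). m \<subseteq> X}) \<longleftrightarrow>
    (odd (card {m \<in> M. m \<subseteq> X}) \<noteq> odd (card {m \<in> M'. m \<subseteq> X}))" for X
    using odd_card_sym_diff[of "{m \<in> M. m \<subseteq> X}" "{m \<in> M'. m \<subseteq> X}"] fin by simp
  then show ?thesis
    unfolding pdeg_def using M M' by (intro exI[of _ "M - M' \<union> (M' - M)"]) auto
qed

lemma pdeg_not: "pdeg n k f \<Longrightarrow> pdeg n k (\<lambda>X. \<not> f X)"
  using pdeg_xor[OF _ pdeg_True, of n k f] by simp

lemma pdeg_xor_sum:
  assumes "finite I" "\<And>i. i \<in> I \<Longrightarrow> pdeg n k (F i)"
  shows "pdeg n k (\<lambda>X. odd (card {i \<in> I. F i X}))"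
  using assms
proof (induction I)
  case (insert x I)
  have "odd (card {i \<in> insert x I. F i X}) \<longleftrightarrow> (F x X \<noteq> odd (card {i \<in> I. F i X}))" for X
  proof (cases "F x X")
    case True
    then have "{i \<in> insert x I. F i X} = insert x {i \<in> I. F i X}" by auto
    then show ?thesis using True insert.hyps by simp
  next
    case False
    then have "{i \<in> insert x I. F i X} = {i \<in> I. F i X}" by auto
    then show ?thesis using False by simp
  qed
  then show ?case
    using pdeg_xor[of n k "F x" "\<lambda>X. odd (card {i \<in> I. F i X})"] insert by simp
qed (simp add: pdeg_False)

text \<open>The product is expanded over pairs of monomials. Pairs with the same union are counted
  separately, and \<open>pdeg_xor_sum\<close> takes care of their cancellation.\<close>

lemma pdeg_and:
  assumes "pdeg n k f" "pdeg n k' g"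
  shows "pdeg n (k + k') (\<lambda>X. f X \<and> g X)"
proof -
  obtain M where M: "M \<subseteq> {m. m \<subseteq> {..<n} \<and> card m \<le> k}" "\<forall>X\<subseteq>{..<n}. f X \<longleftrightarrow> odd (card {m \<in> M. m \<subseteq> X})"
    using assms(1) unfolding pdeg_def by blast
  obtain M' where M': "M' \<subseteq> {m. m \<subseteq> {..<n} \<and> card m \<le> k'}" "\<forall>X\<subseteq>{..<n}. g X \<longleftrightarrow> odd (card {m \<in> M'. m \<subseteq> X})"
    using assms(2) unfolding pdeg_def by blast
  have fin: "finite M" "finite M'"
    using M(1) M'(1) finite_subset[OF _ finite_monomials] by blast+
  have "pdeg n (k + k') (\<lambda>X. odd (card {p \<in> M \<times> M'. fst p \<union> snd p \<subseteq> X}))"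
  proof (rule pdeg_xor_sum)
    fix p assume "p \<in> M \<times> M'"
    then have "fst p \<in> {m. m \<subseteq> {..<n} \<and> card m \<le> k}" "snd p \<in> {m. m \<subseteq> {..<n} \<and> card m \<le> k'}"
      using M(1) M'(1) by (metis mem_Times_iff subsetD)+
    then have "fst p \<union> snd p \<subseteq> {..<n}" "card (fst p) \<le> k" "card (snd p) \<le> k'"
      by simp_all
    then show "pdeg n (k + k') (\<lambda>X. fst p \<union> snd p \<subseteq> X)"
      using card_Un_le[of "fst p" "snd p"] by (intro pdeg_monomial) auto
  qed (use fin in simp)
  then show ?thesis
  proof (rule pdeg_cong)
    fix X assume X: "X \<subseteq> {..<n}"
    have "{p \<in> M \<times> M'. fst p \<union> snd p \<subseteq> X} = {m \<in> M. m \<subseteq> X} \<times> {m \<in> M'. m \<subseteq> X}"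
      by auto
    then show "odd (card {p \<in> M \<times> M'. fst p \<union> snd p \<subseteq> X}) = (f X \<and> g X)"
      using M(2) M'(2) X by (simp add: card_cartesian_product)
  qed
qed

lemma pdeg_and_less:
  assumes "\<And>j. j < t \<Longrightarrow> pdeg n k (G j)"
  shows "pdeg n (t * k) (\<lambda>X. \<forall>j<t. G j X)"
  using assms
proof (induction t)
  case (Suc t)
  have "pdeg n (k + t * k) (\<lambda>X. G t X \<and> (\<forall>j<t. G j X))"
    using Suc by (intro pdeg_and) auto
  then show ?case
    unfolding mult_Suc by (rule pdeg_cong) (auto simp: less_Suc_eq)
qed (simp add: pdeg_True)

section \<open>Approximating conjunctions by parities\<close>

lemma card_even_intersection:
  assumes "finite Y" "Z \<subseteq> Y" "Z \<noteq> {}"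
  shows "2 * card {R \<in> Pow Y. even (card (R \<inter> Z))} = 2 ^ card Y"
proof -
  obtain z where z: "z \<in> Z"
    using assms(3) by blast
  let ?E = "{R \<in> Pow Y. even (card (R \<inter> Z))}" and ?O = "{R \<in> Pow Y. odd (card (R \<inter> Z))}"
  \<comment> \<open>Toggling a point of \<open>Z\<close> is an involution that exchanges even and
    odd intersections.\<close>
  let ?t = "\<lambda>R. R - {z} \<union> ({z} - R)"
  have finR: "finite R" if "R \<subseteq> Y" for R
    using that assms(1) finite_subset by blast
  have par: "odd (card (?t R \<inter> Z)) \<longleftrightarrow> even (card (R \<inter> Z))" if "R \<subseteq> Y" for R
  proof -
    have "?t R \<inter> Z = R \<inter> Z - {z} \<union> ({z} - R \<inter> Z)"
      using z by auto
    then show ?thesis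
      using odd_card_sym_diff[of "R \<inter> Z" "{z}"] finR[OF that] by simp
  qed
  have "bij_betw ?t ?E ?O"
    by (rule bij_betw_byWitness[where f' = ?t]) (use par z assms(2) in auto)
  then have "card ?E = card ?O"
    by (rule bij_betw_same_card)
  moreover have "card ?E + card ?O = card (Pow Y)"
  proof -
    have "card (?E \<union> ?O) = card ?E + card ?O"
      using assms(1) by (intro card_Un_disjoint) auto
    moreover have "?E \<union> ?O = Pow Y" by auto
    ultimately show ?thesis by simp
  qed
  ultimately show ?thesis
    using assms(1) by (simp add: card_Pow)
qed

text \<open>Averaging: for each \<open>X\<close> exactly half of all \<open>R\<close> meet
  \<open>Z X\<close> evenly, so some \<open>R\<close> does so for at most half of the
  \<open>X\<close>.\<close>

lemma ex_halving_set:
  assumes "finite Y" "finite B" "\<And>X. X \<in> B \<Longrightarrow> Z X \<subseteq> Y \<and> Z X \<noteq> {}"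
  shows "\<exists>R\<subseteq>Y. 2 * card {X \<in> B. even (card (R \<inter> Z X))} \<le> card B"
proof (rule ccontr)
  assume "\<not> ?thesis"
  then have *: "card B < 2 * card {X \<in> B. even (card (R \<inter> Z X))}" if "R \<in> Pow Y" for R
    using that by (meson PowD not_le)
  have "(\<Sum>R\<in>Pow Y. card B) < (\<Sum>R\<in>Pow Y. 2 * card {X \<in> B. even (card (R \<inter> Z X))})"
    using assms(1) * by (intro sum_strict_mono) auto
  also have "\<dots> = (\<Sum>R\<in>Pow Y. \<Sum>X\<in>B. 2 * of_bool (even (card (R \<inter> Z X))))"
    using assms(2) by (intro sum.cong refl) (simp add: sum_distrib_left[symmetric] Collect_conj_eq)
  also have "\<dots> = (\<Sum>X\<in>B. \<Sum>R\<in>Pow Y. 2 * of_bool (even (card (R \<inter> Z X))))"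
    by (rule sum.swap)
  also have "\<dots> = (\<Sum>X\<in>B. 2 ^ card Y)"
  proof (intro sum.cong refl)
    fix X assume "X \<in> B"
    then have "2 * card {R \<in> Pow Y. even (card (R \<inter> Z X))} = 2 ^ card Y"
      using assms card_even_intersection by blast
    then show "(\<Sum>R\<in>Pow Y. 2 * of_bool (even (card (R \<inter> Z X)))) = (2 :: nat) ^ card Y"
      using assms(1) by (simp add: sum_distrib_left[symmetric] Collect_conj_eq Pow_def)
  qed
  finally show False
    using assms(1) by (simp add: card_Pow)
qed

text \<open>If some child is false, a suitable set of children contains an odd number of false ones
  for at least half of the inputs not yet detected. After \<open>t\<close> such sets at most a
  fraction of \<open>2 ^ (-t)\<close> escapes; inputs for which all children are true are never
  misjudged.\<close>

lemma ex_and_approximation: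
  assumes "finite Y" "finite B"
  shows "\<exists>R. (\<forall>j<t. R j \<subseteq> Y) \<and>
    card {X \<in> B. \<not> (\<forall>y\<in>Y. q y X) \<and> (\<forall>j<t. even (card {y \<in> R j. \<not> q y X}))} * 2 ^ t \<le> card B"
proof (induction t)
  case 0
  then show ?case
    using assms(2) by (auto intro!: card_mono)
next
  case (Suc t)
  then obtain R where R: "\<forall>j<t. R j \<subseteq> Y"
    "card {X \<in> B. \<not> (\<forall>y\<in>Y. q y X) \<and> (\<forall>j<t. even (card {y \<in> R j. \<not> q y X}))} * 2 ^ t \<le> card B"
    by blast
  let ?B = "{X \<in> B. \<not> (\<forall>y\<in>Y. q y X) \<and> (\<forall>j<t. even (card {y \<in> R j. \<not> q y X}))}"
  obtain S where S: "S \<subseteq> Y" "2 * card {X \<in> ?B. even (card (S \<inter> {y \<in> Y. \<not> q y X}))} \<le> card ?B"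
    using ex_halving_set[OF assms(1), of ?B "\<lambda>X. {y \<in> Y. \<not> q y X}"] assms(2) by auto
  define R' where "R' = R(t := S)"
  have "{X \<in> B. \<not> (\<forall>y\<in>Y. q y X) \<and> (\<forall>j<Suc t. even (card {y \<in> R' j. \<not> q y X}))} =
    {X \<in> ?B. even (card (S \<inter> {y \<in> Y. \<not> q y X}))}"
  proof -
    have "S \<inter> {y \<in> Y. \<not> q y X} = {y \<in> S. \<not> q y X}" for X
      using S(1) by auto
    then show ?thesis
      by (auto simp: R'_def less_Suc_eq)
  qed
  then have "card {X \<in> B. \<not> (\<forall>y\<in>Y. q y X) \<and> (\<forall>j<Suc t. even (card {y \<in> R' j. \<not> q y X}))} * 2 ^ Suc t \<le> card ?B * 2 ^ t"
    using S(2) by simp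
  from this R(2) have "card {X \<in> B. \<not> (\<forall>y\<in>Y. q y X) \<and> (\<forall>j<Suc t. even (card {y \<in> R' j. \<not> q y X}))} * 2 ^ Suc t \<le> card B"
    by (rule le_trans)
  moreover have "\<forall>j<Suc t. R' j \<subseteq> Y"
    using R(1) S(1) by (simp add: R'_def less_Suc_eq)
  ultimately show ?case by blast
qed

text \<open>The counting recursion modulo 2: the sum at a disjunction becomes a parity, the product
  at a conjunction a conjunction.\<close>

definition local_parity :: "'g circuit \<Rightarrow> bool list \<Rightarrow> 'g \<Rightarrow> ('g \<Rightarrow> bool) \<Rightarrow> bool" where
  "local_parity C w g v = (case label C g of
      And_gate \<Rightarrow> \<forall>y\<in>child_gates C g. v y
    | Or_gate \<Rightarrow> odd (card {y \<in> child_gates C g. v y})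
    | lab \<Rightarrow> true_label w lab)"

lemma finite_child_gates: "is_circuit n C \<Longrightarrow> finite (child_gates C g)"
  unfolding is_circuit_def child_gates_def by (rule finite_subset[of _ "gates C"]) auto

lemma odd_sum_iff: "finite A \<Longrightarrow> odd (\<Sum>a\<in>A. f a :: nat) \<longleftrightarrow> odd (card {a \<in> A. odd (f a)})"
  using even_sum_iff[of A f] by simp

lemma parity_trees_at:
  assumes "is_circuit n C" "g \<in> gates C"
  shows "odd (card (trees_at C w g)) \<longleftrightarrow> local_parity C w g (\<lambda>y. odd (card (trees_at C w y)))"
  using card_trees_at[OF assms, of w] finite_child_gates[OF assms(1), of g]
  by (cases "label C g") (simp_all add: local_parity_def even_prod_iff odd_sum_iff)

text \<open>Only conjunctions cost accuracy and degree: they are replaced by a conjunction of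
  \<open>t\<close> negated parities of negated children. Parities and literals are represented
  exactly.\<close>

lemma gate_approximation:
  assumes C: "is_circuit N C" and g: "g \<in> gates C" and w: "\<And>i. i < N \<Longrightarrow> pdeg n 1 (\<lambda>X. w X ! i)"
    and p: "\<And>y. y \<in> child_gates C g \<Longrightarrow> pdeg n k (p y)" and "1 \<le> k" "1 \<le> t"
  shows "\<exists>q. pdeg n (t * k) q \<and>
    card {X \<in> Pow {..<n}. q X \<noteq> local_parity C (w X) g (\<lambda>y. p y X)} * 2 ^ t \<le> 2 ^ n"
proof -
  let ?Y = "child_gates C g"
  have fin: "finite ?Y"
    using finite_child_gates[OF C] .
  have tk: "k \<le> t * k" "1 \<le> t * k"
    using assms(5,6) by simp_all
  have exact: ?thesis if "pdeg n (t * k) q" "\<And>X. X \<subseteq> {..<n} \<Longrightarrow> q X = local_parity C (w X) g (\<lambda>y. p y X)" for q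
  proof -
    have "{X \<in> Pow {..<n}. q X \<noteq> local_parity C (w X) g (\<lambda>y. p y X)} = {}"
      using that(2) by auto
    then have "card {X \<in> Pow {..<n}. q X \<noteq> local_parity C (w X) g (\<lambda>y. p y X)} * 2 ^ t \<le> 2 ^ n"
      by (simp only: card.empty mult_0 le0)
    then show ?thesis using that(1) by blast
  qed
  show ?thesis
  proof (cases "label C g")
    case And_gate
    obtain R where R: "\<forall>j<t. R j \<subseteq> ?Y"
      "card {X \<in> Pow {..<n}. \<not> (\<forall>y\<in>?Y. p y X) \<and> (\<forall>j<t. even (card {y \<in> R j. \<not> p y X}))} * 2 ^ t \<le> card (Pow {..<n})"
      using ex_and_approximation[OF fin, of "Pow {..<n}" t p] by auto
    define q where "q = (\<lambda>X. \<forall>j<t. \<not> odd (card {y \<in> R j. \<not> p y X}))"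
    have "pdeg n (t * k) q"
      unfolding q_def
    proof (rule pdeg_and_less)
      fix j assume j: "j < t"
      have "finite (R j)"
        using R(1) j fin finite_subset by blast
      then have "pdeg n k (\<lambda>X. odd (card {y \<in> R j. \<not> p y X}))"
        by (rule pdeg_xor_sum) (use R(1) j p pdeg_not in blast)
      then show "pdeg n k (\<lambda>X. \<not> odd (card {y \<in> R j. \<not> p y X}))"
        by (rule pdeg_not)
    qed
    moreover have "{X \<in> Pow {..<n}. q X \<noteq> local_parity C (w X) g (\<lambda>y. p y X)} =
      {X \<in> Pow {..<n}. \<not> (\<forall>y\<in>?Y. p y X) \<and> (\<forall>j<t. even (card {y \<in> R j. \<not> p y X}))}"
    proof -
      have "q X" if "\<forall>y\<in>?Y. p y X" for X
      proof -
        have "{y \<in> R j. \<not> p y X} = {}" if "j < t" for j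
          using R(1) \<open>\<forall>y\<in>?Y. p y X\<close> that by auto
        then have "even (card {y \<in> R j. \<not> p y X})" if "j < t" for j
          using that by (metis card.empty even_zero)
        then show ?thesis
          by (simp add: q_def)
      qed
      moreover have "local_parity C (w X) g (\<lambda>y. p y X) \<longleftrightarrow> (\<forall>y\<in>?Y. p y X)" for X
        by (simp add: local_parity_def And_gate)
      ultimately show ?thesis
        unfolding q_def by auto
    qed
    ultimately show ?thesis
      using R(2) by (intro exI[of _ q]) (simp add: card_Pow)
  next
    case Or_gate
    show ?thesis
      by (rule exact[of "\<lambda>X. odd (card {y \<in> ?Y. p y X})"])
        (use pdeg_mono[OF pdeg_xor_sum[OF fin p] tk(1)] Or_gate in \<open>simp_all add: local_parity_def\<close>)
  next
    case (Const b)
    show ?thesis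
      by (rule exact[of "\<lambda>X. b"])
        (use pdeg_True pdeg_False Const in \<open>cases b; simp_all add: local_parity_def\<close>)+
  next
    case (Input i)
    then have "i < N"
      using C g by (auto simp: is_circuit_def)
    then show ?thesis
      by (intro exact[of "\<lambda>X. w X ! i"]) (use pdeg_mono[OF w tk(2)] Input in \<open>simp_all add: local_parity_def\<close>)
  next
    case (Neg_input i)
    then have "i < N"
      using C g by (auto simp: is_circuit_def)
    then show ?thesis
      by (intro exact[of "\<lambda>X. \<not> w X ! i"]) (use pdeg_mono[OF pdeg_not[OF w] tk(2)] Neg_input in \<open>simp_all add: local_parity_def\<close>)
  qed
qed

text \<open>Each level multiplies the degree by \<open>t\<close>. The errors do not propagate,
  because the error of a gate is counted relative to the polynomials of its children; the factor
  \<open>card (gates C)\<close> is a union bound over the gates.\<close>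

theorem circuit_approximation:
  assumes C: "is_circuit N C" and d: "depth_le C d" and w: "\<And>i. i < N \<Longrightarrow> pdeg n 1 (\<lambda>X. w X ! i)" and t: "1 \<le> t"
  shows "\<exists>p. pdeg n (t ^ Suc d) p \<and>
    card {X \<in> Pow {..<n}. p X \<noteq> odd (num_proof_trees C (w X))} * 2 ^ t \<le> card (gates C) * 2 ^ n"
proof -
  \<comment> \<open>The gates of height at most \<open>h\<close>.\<close>
  define G where "G h = {g \<in> gates C. \<forall>p\<in>paths C. hd p = g \<longrightarrow> length p \<le> Suc h}" for h
  \<comment> \<open>The comparison is with the polynomials of the children, not with the true
    values: an input on which every gate is locally right has the right value at the output.\<close>
  define good where "good h p g \<longleftrightarrow> pdeg n (t ^ Suc h) (p g) \<and>
    card {X \<in> Pow {..<n}. p g X \<noteq> local_parity C (w X) g (\<lambda>y. p y X)} * 2 ^ t \<le> 2 ^ n" for h and p :: "'a \<Rightarrow> nat set \<Rightarrow> bool" and g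
  have child: "y \<in> gates C \<and> (\<forall>p\<in>paths C. hd p = y \<longrightarrow> g # p \<in> paths C)" if "g \<in> gates C" "y \<in> child_gates C g" for g y
    using that C paths_Cons[of _ g C] unfolding child_gates_def is_circuit_def by (auto simp: paths_def)
  have child_G: "y \<in> G h" if "g \<in> G (Suc h)" "y \<in> child_gates C g" for g y h
    using child[of g y] that unfolding G_def by fastforce
  have child_0: "child_gates C g = {}" if "g \<in> G 0" for g
  proof (rule ccontr)
    assume "child_gates C g \<noteq> {}"
    then obtain y where y: "y \<in> child_gates C g" by blast
    have "[y] \<in> paths C"
      using child[of g y] y that by (auto simp: G_def paths_def)
    then have "g # [y] \<in> paths C"
      using child[of g y] y that by (auto simp: G_def)
    then show False
      using that by (fastforce simp: G_def)
  qed
  have ex: "\<exists>p. \<forall>g\<in>G h. good h p g" for h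
  proof (induction h)
    case 0
    have "\<forall>g\<in>G 0. \<exists>q. pdeg n (t * 1) q \<and>
      card {X \<in> Pow {..<n}. q X \<noteq> local_parity C (w X) g (\<lambda>y. False)} * 2 ^ t \<le> 2 ^ n"
    proof
      fix g assume g: "g \<in> G 0"
      show "\<exists>q. pdeg n (t * 1) q \<and>
      card {X \<in> Pow {..<n}. q X \<noteq> local_parity C (w X) g (\<lambda>y. False)} * 2 ^ t \<le> 2 ^ n"
        by (rule gate_approximation[OF C _ w _ order_refl t]) (use g child_0[OF g] in \<open>auto simp: G_def\<close>)
    qed
    then obtain q where q: "\<forall>g\<in>G 0. pdeg n (t * 1) (q g) \<and>
      card {X \<in> Pow {..<n}. q g X \<noteq> local_parity C (w X) g (\<lambda>y. False)} * 2 ^ t \<le> 2 ^ n"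
      by (rule bchoice[THEN exE])
    have "local_parity C (w X) g (\<lambda>y. q y X) = local_parity C (w X) g (\<lambda>y. False)" if "g \<in> G 0" for g X
      using child_0[OF that] by (auto simp: local_parity_def split: gate_label.splits)
    then show ?case
      using q by (intro exI[of _ q]) (simp add: good_def)
  next
    case (Suc h)
    then obtain p where p: "\<forall>g\<in>G h. good h p g" by blast
    have "\<forall>g\<in>G (Suc h). \<exists>q. pdeg n (t * t ^ Suc h) q \<and>
      card {X \<in> Pow {..<n}. q X \<noteq> local_parity C (w X) g (\<lambda>y. p y X)} * 2 ^ t \<le> 2 ^ n"
    proof
      fix g assume g: "g \<in> G (Suc h)"
      show "\<exists>q. pdeg n (t * t ^ Suc h) q \<and>
      card {X \<in> Pow {..<n}. q X \<noteq> local_parity C (w X) g (\<lambda>y. p y X)} * 2 ^ t \<le> 2 ^ n"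
      proof (rule gate_approximation[OF C _ w _ _ t])
        show "pdeg n (t ^ Suc h) (p y)" if "y \<in> child_gates C g" for y
          using p child_G[OF g that] by (simp add: good_def)
      qed (use g t in \<open>auto simp: G_def simp del: power_Suc\<close>)
    qed
    then obtain q where q: "\<forall>g\<in>G (Suc h). pdeg n (t * t ^ Suc h) (q g) \<and>
      card {X \<in> Pow {..<n}. q g X \<noteq> local_parity C (w X) g (\<lambda>y. p y X)} * 2 ^ t \<le> 2 ^ n"
      by (rule bchoice[THEN exE])
    define p' where "p' g = (if g \<in> G h then p g else q g)" for g
    have loc: "local_parity C (w X) g (\<lambda>y. p' y X) = local_parity C (w X) g (\<lambda>y. p y X)" if "g \<in> G (Suc h)" for g X
    proof -
      have "p' y X = p y X" if "y \<in> child_gates C g" for y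
        using child_G[OF \<open>g \<in> G (Suc h)\<close> that] by (simp add: p'_def)
      then show ?thesis
        unfolding local_parity_def by (auto cong: conj_cong split: gate_label.splits intro!: arg_cong[of _ _ card])
    qed
    have "good (Suc h) p' g" if g: "g \<in> G (Suc h)" for g
    proof (cases "g \<in> G h")
      case True
      then have "pdeg n (t ^ Suc h) (p g)" "card {X \<in> Pow {..<n}. p g X \<noteq> local_parity C (w X) g (\<lambda>y. p y X)} * 2 ^ t \<le> 2 ^ n"
        using p by (simp_all add: good_def)
      moreover have "t ^ Suc h \<le> t ^ Suc (Suc h)"
        using t by (intro power_increasing) auto
      ultimately show ?thesis
        unfolding good_def loc[OF g] using True pdeg_mono by (auto simp: p'_def simp del: power_Suc)
    next
      case False
      then show ?thesis
        unfolding good_def loc[OF g] using q g by (simp add: p'_def)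
    qed
    then show ?case by blast
  qed
  obtain p where p: "\<forall>g\<in>G d. good d p g"
    using ex by blast
  have Gd: "G d = gates C"
    using d by (auto simp: G_def depth_le_def)
  have finG: "finite (gates C)"
    using C by (simp add: is_circuit_def)
  define bad where "bad g = {X \<in> Pow {..<n}. p g X \<noteq> local_parity C (w X) g (\<lambda>y. p y X)}" for g
  have correct: "p g X \<longleftrightarrow> odd (card (trees_at C (w X) g))"
    if X: "X \<subseteq> {..<n}" "\<And>g. g \<in> gates C \<Longrightarrow> X \<notin> bad g" and g: "g \<in> gates C" for X g
  proof -
    have "finite (children C)"
      using C finite_subset unfolding is_circuit_def by blast
    then have "wf ((children C)\<inverse>)"
      using C unfolding is_circuit_def by (intro finite_acyclic_wf_converse) auto
    then show ?thesis
      using g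
    proof (induction g rule: wf_induct_rule)
      case (less g)
      have IH: "p y X \<longleftrightarrow> odd (card (trees_at C (w X) y))" if "y \<in> child_gates C g" for y
        using less.IH[of y] that child[OF less.prems that] by (simp add: child_gates_def)
      have "p g X = local_parity C (w X) g (\<lambda>y. p y X)"
        using X(2)[OF less.prems] X(1) by (auto simp: bad_def)
      also have "\<dots> = local_parity C (w X) g (\<lambda>y. odd (card (trees_at C (w X) y)))"
        unfolding local_parity_def using IH
        by (auto cong: conj_cong split: gate_label.splits intro!: arg_cong[of _ _ card])
      also have "\<dots> \<longleftrightarrow> odd (card (trees_at C (w X) g))"
        using parity_trees_at[OF C less.prems] by simp
      finally show ?case .
    qed
  qed
  let ?o = "out_gate C"
  have o: "?o \<in> gates C"
    using C by (simp add: is_circuit_def)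
  have "{X \<in> Pow {..<n}. p ?o X \<noteq> odd (num_proof_trees C (w X))} \<subseteq> (\<Union>g\<in>gates C. bad g)"
    using correct[OF _ _ o] unfolding num_proof_trees_eq by blast
  then have "card {X \<in> Pow {..<n}. p ?o X \<noteq> odd (num_proof_trees C (w X))} \<le> card (\<Union>g\<in>gates C. bad g)"
    using finG by (intro card_mono) (auto simp: bad_def)
  also have "\<dots> \<le> (\<Sum>g\<in>gates C. card (bad g))"
    using finG by (rule card_UN_le)
  finally have "card {X \<in> Pow {..<n}. p ?o X \<noteq> odd (num_proof_trees C (w X))} * 2 ^ t \<le> (\<Sum>g\<in>gates C. card (bad g) * 2 ^ t)"
    by (simp add: sum_distrib_right[symmetric])
  also have "\<dots> \<le> (\<Sum>g\<in>gates C. 2 ^ n)"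
    using p unfolding Gd by (intro sum_mono) (simp add: good_def bad_def)
  finally show ?thesis
    using p o unfolding Gd good_def by (intro exI[of _ "p ?o"]) simp
qed

section \<open>Majority is not the parity of the number of proof trees\<close>

text \<open>Values are corrected level by level. A monomial of size \<open>Suc k\<close> affects,
  among the sets of size at most \<open>Suc k\<close>, only the set equal to itself, and so none of
  the values already right.\<close>

lemma pdeg_interpolation: "\<exists>g. pdeg n k g \<and> (\<forall>X\<subseteq>{..<n}. card X \<le> k \<longrightarrow> g X = \<phi> X)"
proof (induction k)
  case 0
  have "pdeg n 0 (\<lambda>X. \<phi> {})"
    using pdeg_True[of n 0] pdeg_False[of n 0] by (cases "\<phi> {}") simp_all
  moreover have "X = {}" if "X \<subseteq> {..<n}" "card X \<le> 0" for X
    using that finite_subset by fastforce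
  ultimately show ?case
    by (intro exI[of _ "\<lambda>X. \<phi> {}"]) auto
next
  case (Suc k)
  then obtain g where g: "pdeg n k g" "\<forall>X\<subseteq>{..<n}. card X \<le> k \<longrightarrow> g X = \<phi> X" by blast
  define M where "M = {m. m \<subseteq> {..<n} \<and> card m = Suc k \<and> g m \<noteq> \<phi> m}"
  have fin: "finite M"
    by (rule finite_subset[of _ "Pow {..<n}"]) (auto simp: M_def)
  define g' where "g' = (\<lambda>X. g X \<noteq> odd (card {m \<in> M. m \<subseteq> X}))"
  have "pdeg n (Suc k) g'"
    unfolding g'_def
    by (intro pdeg_xor pdeg_xor_sum fin pdeg_monomial pdeg_mono[OF g(1)]) (auto simp: M_def)
  moreover have "g' X = \<phi> X" if X: "X \<subseteq> {..<n}" "card X \<le> Suc k" for X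
  proof -
    have finX: "finite X"
      using X(1) finite_subset by blast
    have sub: "m = X \<and> card X = Suc k" if "m \<in> M" "m \<subseteq> X" for m
    proof -
      have "card m = Suc k"
        using that(1) by (simp add: M_def)
      then show ?thesis
        using card_subset_eq[OF finX that(2)] card_mono[OF finX that(2)] X(2) by simp
    qed
    show ?thesis
    proof (cases "X \<in> M")
      case True
      then have "{m \<in> M. m \<subseteq> X} = {X}"
        using sub by blast
      then show ?thesis
        using True unfolding g'_def M_def by simp
    next
      case False
      then have "{m \<in> M. m \<subseteq> X} = {}"
        using sub by blast
      then have "g' X = g X"
        unfolding g'_def by (metis card.empty even_zero)
      moreover have "g X = \<phi> X"
        using False X g(2) by (cases "card X = Suc k") (auto simp: M_def)
      ultimately show ?thesis by simp
    qed
  qed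
  ultimately show ?case by blast
qed

text \<open>Complementing the set replaces every variable by its negation, which has degree
  1.\<close>

lemma pdeg_complement:
  assumes "pdeg n k f"
  shows "pdeg n k (\<lambda>X. f ({..<n} - X))"
proof -
  obtain M where M: "M \<subseteq> {m. m \<subseteq> {..<n} \<and> card m \<le> k}" "\<forall>X\<subseteq>{..<n}. f X \<longleftrightarrow> odd (card {m \<in> M. m \<subseteq> X})"
    using assms unfolding pdeg_def by blast
  have avoid: "pdeg n (card m) (\<lambda>X. \<forall>i\<in>m. i \<notin> X)" if "finite m" "m \<subseteq> {..<n}" for m
    using that
  proof (induction m)
    case (insert x m)
    have "pdeg n 1 (\<lambda>X. x \<in> X)"
      using pdeg_monomial[of "{x}" n 1] insert.prems by simp
    from pdeg_and[OF pdeg_not[OF this] insert.IH] show ?case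
      using insert by simp
  qed (simp add: pdeg_True)
  have fin: "finite M"
    using M(1) finite_subset[OF _ finite_monomials] by blast
  have "pdeg n k (\<lambda>X. odd (card {m \<in> M. \<forall>i\<in>m. i \<notin> X}))"
  proof (rule pdeg_xor_sum[OF fin])
    fix m assume "m \<in> M"
    then have m: "m \<subseteq> {..<n}" "card m \<le> k"
      using M(1) by auto
    then show "pdeg n k (\<lambda>X. \<forall>i\<in>m. i \<notin> X)"
      using avoid[OF finite_subset[OF m(1)] m(1)] pdeg_mono by blast
  qed
  then show ?thesis
  proof (rule pdeg_cong)
    fix X assume "X \<subseteq> {..<n}"
    have "m \<subseteq> {..<n} - X \<longleftrightarrow> (\<forall>i\<in>m. i \<notin> X)" if "m \<in> M" for m
      using M(1) that by auto
    then have "{m \<in> M. \<forall>i\<in>m. i \<notin> X} = {m \<in> M. m \<subseteq> {..<n} - X}"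
      by auto
    then show "odd (card {m \<in> M. \<forall>i\<in>m. i \<notin> X}) = f ({..<n} - X)"
      using M(2) by simp
  qed
qed

text \<open>Where majority agrees with a polynomial of degree \<open>D\<close>, every function has degree at most \<open>h + D\<close>:
  it is interpolated by polynomials of degree \<open>h\<close> on the small and on the large sets.\<close>

lemma agreement_bound:
  assumes n: "n = 2 * h + 1" and q: "pdeg n D q" and A: "A \<subseteq> Pow {..<n}" "\<And>X. X \<in> A \<Longrightarrow> q X \<longleftrightarrow> h < card X"
  shows "card A \<le> card {m. m \<subseteq> {..<n} \<and> card m \<le> D + h}"
proof -
  let ?M = "{m. m \<subseteq> {..<n} \<and> card m \<le> D + h}"
  have finA: "finite A"
    using A(1) finite_subset by blast
  have low: "\<exists>f. pdeg n (D + h) f \<and> (\<forall>X\<in>A. f X = \<phi> X)" for \<phi>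
  proof -
    obtain g1 where g1: "pdeg n h g1" "\<forall>X\<subseteq>{..<n}. card X \<le> h \<longrightarrow> g1 X = \<phi> X"
      using pdeg_interpolation by blast
    obtain g where g: "pdeg n h g" "\<forall>X\<subseteq>{..<n}. card X \<le> h \<longrightarrow> g X = \<phi> ({..<n} - X)"
      using pdeg_interpolation[of n h "\<lambda>X. \<phi> ({..<n} - X)"] by blast
    define g2 where "g2 = (\<lambda>X. g ({..<n} - X))"
    have g2: "pdeg n h g2"
      unfolding g2_def by (rule pdeg_complement[OF g(1)])
    \<comment> \<open>The polynomial \<open>q\<close> selects between the two interpolations; on
      \<open>A\<close> it says whether \<open>X\<close> is large.\<close>
    define f where "f = (\<lambda>X. (q X \<and> g2 X) \<noteq> (\<not> q X \<and> g1 X))"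
    have "pdeg n (D + h) f"
      unfolding f_def by (intro pdeg_xor pdeg_and q pdeg_not g1(1) g2)
    moreover have "f X = \<phi> X" if X: "X \<in> A" for X
    proof (cases "h < card X")
      case True
      have sub: "X \<subseteq> {..<n}"
        using A(1) X by blast
      then have "card ({..<n} - X) = n - card X"
        using finite_subset[OF sub] by (simp add: card_Diff_subset)
      then have "card ({..<n} - X) \<le> h"
        using True n by simp
      then have "g2 X = \<phi> ({..<n} - ({..<n} - X))"
        unfolding g2_def using g(2) by simp
      then show ?thesis
        using A(2)[OF X] True sub by (simp add: f_def double_diff)
    next
      case False
      then show ?thesis
        using A(2)[OF X] g1(2) A(1) X by (auto simp: f_def)
    qed
    ultimately show ?thesis by blast
  qed
  \<comment> \<open>Every subset of \<open>A\<close> is cut out by some set of monomials of size at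
    most \<open>D + h\<close>, so there are at least as many such sets of monomials as subsets of
    \<open>A\<close>.\<close>
  have "Pow A \<subseteq> (\<lambda>M. {X \<in> A. odd (card {m \<in> M. m \<subseteq> X})}) ` Pow ?M"
  proof
    fix S assume S: "S \<in> Pow A"
    obtain f where f: "pdeg n (D + h) f" "\<forall>X\<in>A. f X = (X \<in> S)"
      using low[of "\<lambda>X. X \<in> S"] by (elim exE conjE) (rule that; assumption)
    obtain M where M: "M \<subseteq> ?M" "\<forall>X\<subseteq>{..<n}. f X \<longleftrightarrow> odd (card {m \<in> M. m \<subseteq> X})"
      using f(1) unfolding pdeg_def by blast
    have "X \<in> S \<longleftrightarrow> odd (card {m \<in> M. m \<subseteq> X})" if "X \<in> A" for X
      using f(2) M(2) A(1) that by (metis PowD subsetD)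
    then have "S = {X \<in> A. odd (card {m \<in> M. m \<subseteq> X})}"
      using S by (intro set_eqI) (metis (mono_tags) CollectD CollectI PowD subsetD)
    then show "S \<in> (\<lambda>M. {X \<in> A. odd (card {m \<in> M. m \<subseteq> X})}) ` Pow ?M"
      using M(1) by blast
  qed
  then have "card (Pow A) \<le> card (Pow ?M)"
    using finite_monomials by (meson card_image_le card_mono finite_Pow_iff finite_imageI le_trans)
  then show ?thesis
    using finA finite_monomials[of n "D + h"] by (simp add: card_Pow)
qed

section \<open>Numerical estimates\<close>

lemma card_monomials: "card {m. m \<subseteq> {..<n::nat} \<and> card m \<le> k} = (\<Sum>i\<le>k. n choose i)"
proof -
  have "{m. m \<subseteq> {..<n} \<and> card m \<le> k} = (\<Union>i\<le>k. {m. m \<subseteq> {..<n} \<and> card m = i})"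
    by auto
  also have "card \<dots> = (\<Sum>i\<le>k. card {m. m \<subseteq> {..<n} \<and> card m = i})"
    by (rule card_UN_disjoint) (auto intro: finite_subset[of _ "Pow {..<n}"])
  finally show ?thesis
    by (simp add: n_subsets)
qed

text \<open>The squared form of the bound \<open>4 ^ k / sqrt (2 * k + 1)\<close>. Passing to
  \<open>Suc k\<close> multiplies the left side by
  \<open>4 * (2 * k + 1) * (2 * k + 3) / (Suc k)\<^sup>2\<close>, which is at most 16.\<close>

lemma central_binomial_square: "(2 * k choose k)\<^sup>2 * (2 * k + 1) \<le> 16 ^ k"
proof (induction k)
  case (Suc k)
  let ?c = "2 * k choose k" and ?c' = "2 * Suc k choose Suc k"
  have 1: "Suc k * ?c' = (2 * Suc k) * (Suc (2 * k) choose k)"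
    using Suc_times_binomial[of k "Suc (2 * k)"] by simp
  have 2: "Suc k * (Suc (2 * k) choose k) = Suc (2 * k) * ?c"
    using binomial_absorb_comp[of "Suc (2 * k)" k] by simp
  have "Suc k * (Suc k * ?c') = Suc k * (2 * (2 * k + 1) * ?c)"
    unfolding 1 using 2 by (metis (no_types, lifting) Suc_eq_plus1 mult.assoc mult.left_commute)
  then have c': "Suc k * ?c' = 2 * (2 * k + 1) * ?c"
    by (simp only: mult_cancel1) simp
  have "(Suc k)\<^sup>2 * (?c'\<^sup>2 * (2 * Suc k + 1)) = (Suc k * ?c')\<^sup>2 * (2 * k + 3)"
    by (simp add: power2_eq_square algebra_simps)
  also have "\<dots> = 4 * ((2 * k + 1) * (2 * k + 3)) * (?c\<^sup>2 * (2 * k + 1))"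
    unfolding c' by (simp add: power2_eq_square algebra_simps)
  also have "\<dots> \<le> 4 * (4 * (Suc k)\<^sup>2) * 16 ^ k"
  proof (rule mult_le_mono[OF mult_le_mono2 Suc.IH])
    show "(2 * k + 1) * (2 * k + 3) \<le> 4 * (Suc k)\<^sup>2"
      by (simp add: power2_eq_square add_mult_distrib add_mult_distrib2)
  qed
  also have "\<dots> = (Suc k)\<^sup>2 * 16 ^ Suc k"
    by simp
  finally show ?case
    by (simp only: mult_le_cancel1) simp
qed simp

text \<open>The coefficient is half of a central one. Taking \<open>2 * h + 2\<close> to be a power
  of 4 makes its square root the integer \<open>2 ^ j\<close>.\<close>

lemma binomial_middle_bound:
  assumes "2 * h + 2 = 4 ^ j"
  shows "(2 * h + 1 choose h) * 2 ^ j \<le> 2 ^ (2 * h + 1)"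
proof -
  let ?c = "2 * h + 1 choose h"
  have "2 * Suc h choose Suc h = (2 * h + 1 choose h) + (2 * h + 1 choose Suc h)"
    by simp
  also have "(2 * h + 1 choose Suc h) = ?c"
    using binomial_symmetric[of h "2 * h + 1"] by simp
  finally have "(2 * ?c)\<^sup>2 * (2 * Suc h + 1) \<le> 16 ^ Suc h"
    using central_binomial_square[of "Suc h"] by (simp only: mult_2)
  then have "4 * (?c\<^sup>2 * (2 * h + 3)) \<le> 4 * (4 * 16 ^ h)"
    by (simp add: power2_eq_square algebra_simps)
  then have "?c\<^sup>2 * (2 * h + 3) \<le> 4 * 16 ^ h"
    by linarith
  moreover have "?c\<^sup>2 * 4 ^ j \<le> ?c\<^sup>2 * (2 * h + 3)"
    using assms by (intro mult_le_mono2) simp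
  ultimately have "?c\<^sup>2 * 4 ^ j \<le> 4 * 16 ^ h"
    by linarith
  moreover have "(?c * 2 ^ j)\<^sup>2 = ?c\<^sup>2 * 4 ^ j"
    by (simp add: power_mult_distrib power2_eq_square flip: power_mult_distrib)
  moreover have "(2 ^ (2 * h + 1))\<^sup>2 = (4 * 16 ^ h :: nat)"
    by (simp add: power_mult_distrib power_mult flip: power_mult_distrib) (simp add: power2_eq_square power_mult flip: power_mult_distrib)
  ultimately have "(?c * 2 ^ j)\<^sup>2 \<le> (2 ^ (2 * h + 1))\<^sup>2"
    by (simp only:)
  then show ?thesis
    by (rule power2_le_imp_le) simp
qed

text \<open>The witness is \<open>j = 2 ^ i\<close>: the logarithm of the left side is then bounded
  by a linear function of \<open>i\<close>, that of the right side is \<open>2 ^ i\<close>.\<close>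

lemma ex_power_beats_polynomial: "\<exists>j\<ge>2. 4 * (a * j + b) ^ k \<le> (2::nat) ^ j"
proof -
  define A where "A = (a + b) * k + 2"
  define m where "m = A + k + 1"
  define i where "i = 2 * m"
  have "2 * m \<le> 2 ^ m"
    unfolding m_def Suc_eq_plus1[symmetric] power_Suc by (intro mult_le_mono2 Suc_leI less_exp)
  then have "(2 * m) * (2 * m) \<le> 2 ^ m * 2 ^ m"
    by (intro mult_le_mono)
  also have "\<dots> = (2::nat) ^ i"
    by (simp add: i_def mult_2 power_add)
  finally have "4 * (m * m) \<le> 2 ^ i"
    by simp
  moreover have "A + i * k \<le> 4 * (m * m)"
  proof -
    have "A * 1 \<le> m * m" "k * m \<le> m * m"
      by (intro mult_le_mono; simp add: m_def)+
    moreover have "i * k = 2 * (k * m)"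
      by (simp add: i_def)
    ultimately show ?thesis by linarith
  qed
  ultimately have i: "A + i * k \<le> 2 ^ i"
    by (rule le_trans[rotated])
  have "a * 2 ^ i + b \<le> (a + b) * 2 ^ i"
    by (simp add: algebra_simps)
  also have "\<dots> \<le> 2 ^ (a + b) * 2 ^ i"
    by (intro mult_le_mono1 less_imp_le less_exp)
  also have "\<dots> = 2 ^ (a + b + i)"
    by (simp add: power_add)
  finally have "(a * 2 ^ i + b) ^ k \<le> (2 ^ (a + b + i)) ^ k"
    by (intro power_mono) auto
  then have "4 * (a * 2 ^ i + b) ^ k \<le> 2 ^ 2 * 2 ^ ((a + b + i) * k)"
    by (simp add: power_mult)
  also have "\<dots> = 2 ^ (A + i * k)"
    by (simp add: A_def power_add algebra_simps)
  also have "\<dots> \<le> 2 ^ (2 ^ i)"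
    using i by (intro power_increasing) auto
  finally have "4 * (a * 2 ^ i + b) ^ k \<le> (2::nat) ^ (2 ^ i)" .
  moreover have "(2::nat) \<le> 2 ^ i"
    using power_increasing[of 1 i "2::nat"] by (simp add: i_def m_def)
  ultimately show ?thesis by blast
qed

text \<open>On the one hand the polynomial for the circuit agrees with majority on at least
  \<open>7 / 8\<close> of the sets. On the other hand \<open>agreement_bound\<close> allows one half
  of them plus \<open>t ^ Suc d\<close> middle binomial coefficients, which amounts to at most
  \<open>3 / 4\<close>.\<close>

theorem majority_parity_not_AC0:
  assumes W: "\<And>j h X. 2 \<le> j \<Longrightarrow> 2 * h + 2 = 4 ^ j \<Longrightarrow> X \<subseteq> {..<2 * h + 1} \<Longrightarrow>
      length (W h X) = (2 * h + 2)\<^sup>2 \<and> (odd (f (W h X)) \<longleftrightarrow> h < card X)"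
    and bits: "\<And>j h i. 2 \<le> j \<Longrightarrow> 2 * h + 2 = 4 ^ j \<Longrightarrow> i < (2 * h + 2)\<^sup>2 \<Longrightarrow> pdeg (2 * h + 1) 1 (\<lambda>X. W h X ! i)"
  shows "f \<notin> FO_uniform_sharp_AC0"
proof
  assume "f \<in> FO_uniform_sharp_AC0"
  then obtain C :: "nat \<Rightarrow> nat list circuit" and d c where "\<forall>n\<ge>1. is_circuit n (C n)" "\<forall>n\<ge>1. depth_le (C n) d"
    "\<forall>n\<ge>1. card (gates (C n)) \<le> n ^ c + c" "\<forall>w. w \<noteq> [] \<longrightarrow> f w = num_proof_trees (C (length w)) w"
    unfolding FO_uniform_sharp_AC0_def by blast
  note C = this[rule_format]
  obtain j where j: "2 \<le> j" "4 * ((4 * c) * j + (c + 3)) ^ Suc d \<le> (2::nat) ^ j"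
    using ex_power_beats_polynomial by blast
  define h where "h = (4 ^ j - 2) div (2::nat)"
  have "even ((4::nat) ^ j)" "2 \<le> (4::nat) ^ j"
    using j(1) power_increasing[of 1 j "4::nat"] by auto
  then have h: "2 * h + 2 = 4 ^ j"
    unfolding h_def by simp
  define n where "n = 2 * h + 1"
  define N where "N = (2 * h + 2)\<^sup>2"
  \<comment> \<open>Makes \<open>2 ^ t\<close> at least 8 times the number of gates: the inputs have
    length \<open>2 ^ (4 * j)\<close>, so there are at most \<open>2 ^ (4 * c * j) + c\<close>
    gates.\<close>
  define t where "t = (4 * c) * j + (c + 3)"
  define s where "s = card (gates (C N))"
  have N: "N = 2 ^ (4 * j)"
    unfolding N_def h by (simp add: power2_eq_square power_mult flip: power_mult_distrib)
  then have N1: "N \<ge> 1"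
    by simp
  have s: "s * 8 \<le> 2 ^ t"
  proof -
    have "s \<le> N ^ c + c"
      unfolding s_def by (rule C(3)[OF N1])
    also have "N ^ c = 2 ^ (4 * c * j)"
      unfolding N by (simp add: mult.commute mult.left_commute flip: power_mult)
    also have "2 ^ (4 * c * j) + c \<le> 2 ^ (4 * c * j) * 2 ^ c"
    proof -
      have "1 + c \<le> 2 ^ c"
        unfolding plus_1_eq_Suc by (intro Suc_leI less_exp)
      then have "2 ^ (4 * c * j) * (1 + c) \<le> 2 ^ (4 * c * j) * 2 ^ c"
        by (intro mult_le_mono2)
      moreover have "1 * c \<le> 2 ^ (4 * c * j) * c"
        by (intro mult_le_mono1) simp
      ultimately show ?thesis
        unfolding distrib_left mult_1 mult_1_right by linarith
    qed
    finally have "s * 8 \<le> 2 ^ (4 * c * j) * 2 ^ c * 2 ^ 3"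
      by simp
    also have "\<dots> = 2 ^ t"
      unfolding t_def by (simp add: power_add)
    finally show ?thesis .
  qed
  have "pdeg n 1 (\<lambda>X. W h X ! i)" if "i < N" for i
    using bits[OF j(1) h] that unfolding n_def N_def by blast
  then obtain p where p: "pdeg n (t ^ Suc d) p"
    "card {X \<in> Pow {..<n}. p X \<noteq> odd (num_proof_trees (C N) (W h X))} * 2 ^ t \<le> card (gates (C N)) * 2 ^ n"
    using circuit_approximation[OF C(1)[OF N1] C(2)[OF N1], of n "W h" t] by (auto simp: t_def)
  define A where "A = {X \<in> Pow {..<n}. p X \<longleftrightarrow> h < card X}"
  have bad: "{X \<in> Pow {..<n}. p X \<noteq> odd (num_proof_trees (C N) (W h X))} = Pow {..<n} - A"
  proof -
    have "odd (num_proof_trees (C N) (W h X)) \<longleftrightarrow> h < card X" if "X \<subseteq> {..<n}" for X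
    proof -
      have WX: "length (W h X) = N" "odd (f (W h X)) \<longleftrightarrow> h < card X"
        using W[OF j(1) h] that unfolding n_def N_def by blast+
      then have "W h X \<noteq> []"
        using N1 by auto
      then show ?thesis
        using C(4)[of "W h X"] WX by simp
    qed
    then show ?thesis
      unfolding A_def by auto
  qed
  have finA: "finite A" "A \<subseteq> Pow {..<n}"
    by (auto simp: A_def)
  have "card (Pow {..<n} - A) * 2 ^ t \<le> s * 2 ^ n"
    using p(2) unfolding bad s_def .
  then have "card (Pow {..<n} - A) * 2 ^ t * 8 \<le> (s * 8) * 2 ^ n"
    by simp
  also have "\<dots> \<le> 2 ^ t * 2 ^ n"
    using s by (intro mult_le_mono1)
  finally have "2 ^ t * (card (Pow {..<n} - A) * 8) \<le> 2 ^ t * 2 ^ n"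
    by (simp add: mult.commute mult.left_commute)
  then have small: "card (Pow {..<n} - A) * 8 \<le> 2 ^ n"
    by (simp only: mult_le_cancel1) simp
  have "card (Pow {..<n} - A) = 2 ^ n - card A" "card A \<le> 2 ^ n"
    using finA card_mono[OF _ finA(2)] by (simp_all add: card_Diff_subset card_Pow)
  then have big: "7 * 2 ^ n \<le> 8 * card A"
    using small by simp
  have "card A \<le> card {m. m \<subseteq> {..<n} \<and> card m \<le> t ^ Suc d + h}"
    by (rule agreement_bound[OF n_def p(1) finA(2)]) (simp add: A_def)
  also have "\<dots> = (\<Sum>i\<le>t ^ Suc d + h. n choose i)"
    by (rule card_monomials)
  also have "\<dots> = (\<Sum>i\<le>h. n choose i) + (\<Sum>i\<in>{Suc h..t ^ Suc d + h}. n choose i)"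
  proof -
    have "{..t ^ Suc d + h} = {..h} \<union> {Suc h..t ^ Suc d + h}"
      by auto
    then show ?thesis
      by (simp only:) (subst sum.union_disjoint, auto)
  qed
  also have "(\<Sum>i\<le>h. n choose i) = 2 ^ (2 * h)"
    unfolding n_def by (rule binomial_r_part_sum)
  also have "(\<Sum>i\<in>{Suc h..t ^ Suc d + h}. n choose i) \<le> t ^ Suc d * (n choose h)"
  proof -
    have "(\<Sum>i\<in>{Suc h..t ^ Suc d + h}. n choose i) \<le> (\<Sum>i\<in>{Suc h..t ^ Suc d + h}. n choose h)"
      using binomial_maximum[of n] by (intro sum_mono) (simp add: n_def)
    then show ?thesis by simp
  qed
  finally have "4 * card A \<le> 4 * 2 ^ (2 * h) + 4 * t ^ Suc d * (n choose h)"
    by simp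
  also have "4 * t ^ Suc d * (n choose h) \<le> 2 ^ j * (n choose h)"
    using j(2) unfolding t_def by (intro mult_le_mono1)
  also have "\<dots> \<le> 2 ^ n"
    using binomial_middle_bound[OF h] by (simp add: n_def mult.commute)
  finally have "4 * card A \<le> 3 * 2 ^ n"
    by (simp add: n_def)
  moreover have "(2::nat) ^ n > 0"
    by simp
  ultimately show False
    using big by linarith
qed

section \<open>A first-order definable majority\<close>

lemma inj_on_enc:
  assumes "nconsts \<sigma> = 0" "a \<in> set (rel_arities \<sigma>)" "1 \<le> a"
  shows "inj_on (enc \<sigma>) (structures \<sigma>)"
proof (rule inj_onI)
  fix \<A> \<B> assume A: "\<A> \<in> structures \<sigma>" and B: "\<B> \<in> structures \<sigma>" and eq: "enc \<sigma> \<A> = enc \<sigma> \<B>"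
  have "enc_len \<sigma> (size_of \<A>) = enc_len \<sigma> (size_of \<B>)"
    using length_enc[OF A refl] length_enc[OF B refl] eq by simp
  then have "size_of \<A> = size_of \<B>"
    using enc_len_eq_iff assms(2,3) by blast
  moreover have "const_vals \<A> = []" "const_vals \<B> = []"
    using structure_unfold(4)[OF A] structure_unfold(4)[OF B] assms(1) by (simp_all add: tuples_def)
  ultimately show "\<A> = \<B>"
    using decode_enc(2)[OF A] decode_enc(2)[OF B] eq by metis
qed

text \<open>In general different structures may share an encoding; injectivity guarantees that the
  count is a function of the string.\<close>

lemma ex_sharp_rel:
  assumes "inj_on (enc \<sigma>) (structures \<sigma>)" "builtins \<sigma> = {LE}" "\<phi> \<in> \<Phi>" "wf_fm \<sigma> as \<phi>" "free_vars \<phi> \<subseteq> {..<l}"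
  shows "\<exists>f\<in>sharp_rel \<Phi>. \<forall>\<A>\<in>structures \<sigma>. f (enc \<sigma> \<A>) = count_sat as l \<phi> \<A>"
proof -
  define f where "f w = (if w \<in> enc \<sigma> ` structures \<sigma> then count_sat as l \<phi> (inv_into (structures \<sigma>) (enc \<sigma>) w) else 0)" for w
  have f: "f (enc \<sigma> \<A>) = count_sat as l \<phi> \<A>" if "\<A> \<in> structures \<sigma>" for \<A>
    using that assms(1) by (simp add: f_def)
  have "f w = 0" if "w \<notin> enc \<sigma> ` structures \<sigma>" for w
    using that by (simp add: f_def)
  then have "f \<in> sharp_rel \<Phi>"
    unfolding sharp_rel_def mem_Collect_eq using assms(2-5) f
    by (intro exI[of _ \<sigma>] exI[of _ as] exI[of _ l] exI[of _ \<phi>]) simp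
  then show ?thesis
    using f by (intro bexI[of _ f]) auto
qed

text \<open>On the universe \<open>{..2 * h + 1}\<close>, the set \<open>X\<close> is given by the edges from \<open>Suc i\<close> to \<open>i\<close>. The
  other edges make the successor relation, the least element and the threshold \<open>h + 1\<close> accessible
  without quantifiers: the loop is the only one, and the last edge is the only descending edge
  that does not reverse an ascending one.\<close>

definition set_edges :: "nat \<Rightarrow> nat set \<Rightarrow> nat list set" where
  "set_edges h X = {[i, Suc i] | i. i < 2 * h + 1} \<union> {[Suc i, i] | i. i \<in> X} \<union> {[0, 0], [2 * h + 1, h + 1]}"

definition set_struc :: "nat \<Rightarrow> nat set \<Rightarrow> struc" where
  "set_struc h X = \<lparr>size_of = 2 * h + 2, rels = [set_edges h X], const_vals = []\<rparr>"

definition digraph_vocab :: vocab where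
  "digraph_vocab = \<lparr>builtins = {LE}, rel_arities = [2], nconsts = 0\<rparr>"

text \<open>The relation variable \<open>T(i, j)\<close> is forced to mean that \<open>X\<close> has at least \<open>j\<close> elements below \<open>i\<close>;
  \<open>wrong_count\<close> says that one of the constraints fails at the variables \<open>i = 0\<close>, \<open>i' = 1\<close>, \<open>j = 2\<close>, \<open>j' = 3\<close>, \<open>z = 4\<close>.\<close>

definition wrong_count :: fm where
  "wrong_count =
    (let E = \<lambda>x y. Rel 0 [Var x, Var y]; T = \<lambda>x y. RVar 0 [Var x, Var y];
         L = \<lambda>x y. Neg (Builtin LE (Var y) (Var x));
         step = Disj (T 0 3) (Conj (E 1 0) (T 0 2))
     in Disj (Conj (Conj (Conj (L 0 1) (E 0 1)) (Conj (L 2 3) (E 2 3)))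
           (Disj (Conj (T 1 3) (Neg step)) (Conj (Neg (T 1 3)) step)))
       (Disj (Conj (E 4 4) (Disj (Neg (T 0 4)) (Conj (Neg (Eq (Var 2) (Var 4))) (T 4 2))))
         (Conj (Conj (E 0 2) (L 2 0)) (Conj (Neg (E 2 0)) (Neg (T 0 2))))))"

lemma sat_wrong_count:
  "sat \<A> [T] e (foldr All [0, 1, 2, 3, 4] (Neg wrong_count)) \<longleftrightarrow>
    (\<forall>i<size_of \<A>. \<forall>i'<size_of \<A>. \<forall>j<size_of \<A>. \<forall>j'<size_of \<A>. \<forall>z<size_of \<A>.
      (i < i' \<and> [i, i'] \<in> rels \<A> ! 0 \<and> j < j' \<and> [j, j'] \<in> rels \<A> ! 0 \<longrightarrow>
        ([i', j'] \<in> T \<longleftrightarrow> [i, j'] \<in> T \<or> [i', i] \<in> rels \<A> ! 0 \<and> [i, j] \<in> T)) \<and>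
      ([z, z] \<in> rels \<A> ! 0 \<longrightarrow> [i, z] \<in> T \<and> (j \<noteq> z \<longrightarrow> [z, j] \<notin> T)) \<and>
      ([i, j] \<in> rels \<A> ! 0 \<and> j < i \<and> [j, i] \<notin> rels \<A> ! 0 \<longrightarrow> [i, j] \<in> T))"
  (is "_ \<longleftrightarrow> ?R")
proof -
  have "sat \<A> [T] e (foldr All [0, 1, 2, 3, 4] (Neg wrong_count)) \<longleftrightarrow>
    (\<forall>i<size_of \<A>. \<forall>i'<size_of \<A>. \<forall>j<size_of \<A>. \<forall>j'<size_of \<A>. \<forall>z<size_of \<A>.
      \<not> sat \<A> [T] (e(0 := i, 1 := i', 2 := j, 3 := j', 4 := z)) wrong_count)"
    by simp
  also have "\<dots> \<longleftrightarrow> ?R"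
    by (intro all_cong arg_cong2[of _ _ _ _ "(\<longrightarrow>)"] refl) (auto simp: wrong_count_def Let_def)
  finally show ?thesis .
qed

lemma set_edges_iff:
  "[a, b] \<in> set_edges h X \<longleftrightarrow> (b = Suc a \<and> a < 2 * h + 1) \<or> (a = Suc b \<and> b \<in> X) \<or> (a = 0 \<and> b = 0) \<or> (a = 2 * h + 1 \<and> b = h + 1)"
  by (auto simp: set_edges_def)

lemma set_struc_in_structures:
  assumes "X \<subseteq> {..<2 * h + 1}"
  shows "set_struc h X \<in> structures digraph_vocab"
proof -
  have "i < 2 * h + 1" if "i \<in> X" for i
    using assms that by blast
  then have "set_edges h X \<subseteq> tuples (2 * h + 2) 2"
    by (fastforce simp: set_edges_def tuples_def)
  then show ?thesis
    by (simp add: structures_def set_struc_def digraph_vocab_def relation_tuples_def tuples_def)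
qed

lemma card_below_Suc:
  "card (X \<inter> {..<Suc i}) = card (X \<inter> {..<i}) + (if i \<in> X then 1 else 0)"
  by (simp add: lessThan_Suc Int_insert_right)

text \<open>The constraints fix row 0 and column 0 of \<open>T\<close> and then each further row by
  the one above it, so there is only one candidate. The last edge demands
  \<open>[2 * h + 1, h + 1] \<in> T\<close>, which for the candidate says that \<open>X\<close> has
  more than \<open>h\<close> elements.\<close>

lemma sat_set_struc:
  assumes X: "X \<subseteq> {..<2 * h + 1}" and h: "2 \<le> h" and T: "T \<subseteq> tuples (2 * h + 2) 2"
  shows "sat (set_struc h X) [T] e (foldr All [0, 1, 2, 3, 4] (Neg wrong_count)) \<longleftrightarrow>
    h < card X \<and> T = {[i, j] | i j. i < 2 * h + 2 \<and> j < 2 * h + 2 \<and> j \<le> card (X \<inter> {..<i})}"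
    (is "?sat \<longleftrightarrow> _ \<and> T = ?U")
proof
  let ?m = "2 * h + 2" and ?c = "\<lambda>i. card (X \<inter> {..<i})"
  assume sat: ?sat
  have step: "[Suc i, Suc j] \<in> T \<longleftrightarrow> [i, Suc j] \<in> T \<or> i \<in> X \<and> [i, j] \<in> T" if "Suc i < ?m" "Suc j < ?m" for i j
  proof -
    \<comment> \<open>From \<open>h \<ge> 2\<close> on, the last edge is neither a loop nor of the
      form \<open>[Suc i, i]\<close>, so it cannot be mistaken for an edge that codes membership in
      \<open>X\<close>.\<close>
    have "[Suc i, i] \<in> set_edges h X \<longleftrightarrow> i \<in> X"
      using that h X by (auto simp: set_edges_iff)
    moreover have "[i, Suc i] \<in> set_edges h X" "[j, Suc j] \<in> set_edges h X"
      using that by (auto simp: set_edges_iff)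
    ultimately show ?thesis
      using sat[unfolded sat_wrong_count, rule_format, of i "Suc i" j "Suc j" 0] that by (auto simp: set_struc_def)
  qed
  have zero: "[i, 0] \<in> T" "j \<noteq> 0 \<Longrightarrow> [0, j] \<notin> T" if "i < ?m" "j < ?m" for i j
    using sat[unfolded sat_wrong_count, rule_format, of i 0 j 0 0] that by (auto simp: set_struc_def set_edges_iff)
  have T_iff: "[i, j] \<in> T \<longleftrightarrow> j \<le> ?c i" if "i < ?m" "j < ?m" for i j
    using that
  proof (induction i arbitrary: j)
    case 0
    then show ?case
      using zero[of 0 j] by auto
  next
    case (Suc i)
    show ?case
    proof (cases j)
      case 0
      then show ?thesis
        using zero[of "Suc i" 0] Suc.prems by simp
    next
      case (Suc j')
      then show ?thesis
        using step[of i j'] Suc.IH[of j] Suc.IH[of j'] Suc.prems by (auto simp: card_below_Suc)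
    qed
  qed
  have "[2 * h + 1, h + 1] \<in> T"
    using sat[unfolded sat_wrong_count, rule_format, of "2 * h + 1" 0 "h + 1" 0 0] h
    by (auto simp: set_struc_def set_edges_iff)
  then have "h < ?c (2 * h + 1)"
    using T_iff[of "2 * h + 1" "h + 1"] by simp
  moreover have "X \<inter> {..<2 * h + 1} = X"
    using X by blast
  moreover have "T = ?U"
  proof (rule set_eqI)
    fix t
    have pair: "t \<in> T \<Longrightarrow> \<exists>i j. t = [i, j] \<and> i < ?m \<and> j < ?m"
      using T by (auto simp: tuples_def length_Suc_conv numeral_2_eq_2)
    show "t \<in> T \<longleftrightarrow> t \<in> ?U"
      using pair T_iff by auto
  qed
  ultimately show "h < card X \<and> T = ?U"
    by simp
next
  let ?m = "2 * h + 2" and ?c = "\<lambda>i. card (X \<inter> {..<i})"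
  assume *: "h < card X \<and> T = ?U"
  have T_iff: "[i, j] \<in> T \<longleftrightarrow> j \<le> ?c i" if "i < ?m" "j < ?m" for i j
    using * that by simp
  have "X \<inter> {..<2 * h + 1} = X"
    using X by blast
  then have last: "h < ?c (2 * h + 1)"
    using * by simp
  show ?sat
    unfolding sat_wrong_count
  proof (intro allI impI conjI)
    fix i i' j j' z assume less: "i < size_of (set_struc h X)" "i' < size_of (set_struc h X)" "j < size_of (set_struc h X)"
      "j' < size_of (set_struc h X)" "z < size_of (set_struc h X)"
    note m = less[unfolded set_struc_def struc.simps]
    {
      assume "i < i' \<and> [i, i'] \<in> rels (set_struc h X) ! 0 \<and> j < j' \<and> [j, j'] \<in> rels (set_struc h X) ! 0"
      then have "i' = Suc i" "j' = Suc j"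
        by (auto simp: set_struc_def set_edges_iff)
      moreover have "[Suc i, i] \<in> set_edges h X \<longleftrightarrow> i \<in> X"
        using h by (auto simp: set_edges_iff)
      ultimately show "[i', j'] \<in> T \<longleftrightarrow> [i, j'] \<in> T \<or> [i', i] \<in> rels (set_struc h X) ! 0 \<and> [i, j] \<in> T"
        using m by (auto simp: T_iff card_below_Suc set_struc_def)
    next
      assume "[z, z] \<in> rels (set_struc h X) ! 0"
      then have "z = 0"
        using h by (auto simp: set_struc_def set_edges_iff)
      then show "[i, z] \<in> T"
        using m by (simp add: T_iff)
    next
      assume "[z, z] \<in> rels (set_struc h X) ! 0" "j \<noteq> z"
      then have "z = 0" "j \<noteq> 0"
        using h by (auto simp: set_struc_def set_edges_iff)
      then show "[z, j] \<notin> T"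
        using m by (simp add: T_iff)
    next
      assume "[i, j] \<in> rels (set_struc h X) ! 0 \<and> j < i \<and> [j, i] \<notin> rels (set_struc h X) ! 0"
      then have "i = 2 * h + 1" "j = h + 1"
        using X by (auto simp: set_struc_def set_edges_iff)
      then show "[i, j] \<in> T"
        using m last by (simp add: T_iff)
    }
  qed
qed

lemma count_sat_one_relation:
  "count_sat [a] 0 \<phi> \<A> = card {T. T \<subseteq> tuples (size_of \<A>) a \<and> sat \<A> [T] (\<lambda>j. [] ! j) \<phi>}"
proof -
  have "{(Ss, cs). Ss \<in> relation_tuples (size_of \<A>) [a] \<and> cs \<in> tuples (size_of \<A>) 0 \<and> sat \<A> Ss (\<lambda>j. cs ! j) \<phi>} =
    (\<lambda>T. ([T], [])) ` {T. T \<subseteq> tuples (size_of \<A>) a \<and> sat \<A> [T] (\<lambda>j. [] ! j) \<phi>}"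
    by (auto simp: relation_tuples_def tuples_def length_Suc_conv)
  then show ?thesis
    unfolding count_sat_def by (simp add: card_image inj_on_def)
qed

text \<open>The number of satisfying relations is 1 or 0. The existential formula is satisfied by
  the complementary set of relations, which has the same parity because the number of all relations
  is even.\<close>

lemma parity_count_sat:
  assumes X: "X \<subseteq> {..<2 * h + 1}" and h: "2 \<le> h"
  shows "odd (count_sat [2] 0 (foldr All [0, 1, 2, 3, 4] (Neg wrong_count)) (set_struc h X)) \<longleftrightarrow> h < card X"
    and "odd (count_sat [2] 0 (foldr Ex [0, 1, 2, 3, 4] wrong_count) (set_struc h X)) \<longleftrightarrow> h < card X"
proof -
  define P where "P = Pow (tuples (2 * h + 2) 2)"
  define G where "G = {T \<in> P. sat (set_struc h X) [T] (\<lambda>j. [] ! j) (foldr All [0, 1, 2, 3, 4] (Neg wrong_count))}"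
  have fin: "finite P" "G \<subseteq> P"
    by (auto simp: P_def G_def)
  \<comment> \<open>The number of relations is 2 to the number of pairs; one pair is enough to make
    it even.\<close>
  have "[0, 0] \<in> tuples (2 * h + 2) 2"
    by (simp add: tuples_def)
  then have "0 < card (tuples (2 * h + 2) 2)"
    by (metis card_gt_0_iff empty_iff finite_tuples)
  then have evenP: "even (card P)"
    by (simp add: P_def card_Pow)
  define U where "U = {[i, j] | i j. i < 2 * h + 2 \<and> j < 2 * h + 2 \<and> j \<le> card (X \<inter> {..<i})}"
  have "U \<in> P"
    by (auto simp: P_def U_def tuples_def)
  moreover have "T \<in> G \<longleftrightarrow> T \<in> P \<and> h < card X \<and> T = U" for T
    using sat_set_struc[OF X h, of T] by (auto simp: G_def P_def U_def)
  ultimately have "G = (if h < card X then {U} else {})"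
    by auto
  then have oddG: "odd (card G) \<longleftrightarrow> h < card X"
    by simp
  show "odd (count_sat [2] 0 (foldr All [0, 1, 2, 3, 4] (Neg wrong_count)) (set_struc h X)) \<longleftrightarrow> h < card X"
    using oddG by (simp add: count_sat_one_relation G_def P_def set_struc_def)
  have "{T. T \<subseteq> tuples (2 * h + 2) 2 \<and> sat (set_struc h X) [T] (\<lambda>j. [] ! j) (foldr Ex [0, 1, 2, 3, 4] wrong_count)} = P - G"
    unfolding sat_foldr_Ex_iff by (auto simp: P_def G_def simp del: foldr.simps)
  moreover have "size_of (set_struc h X) = 2 * h + 2"
    by (simp add: set_struc_def)
  ultimately have "count_sat [2] 0 (foldr Ex [0, 1, 2, 3, 4] wrong_count) (set_struc h X) = card (P - G)"
    unfolding count_sat_one_relation by simp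
  also have "\<dots> = card P - card G"
    using fin finite_subset by (intro card_Diff_subset) auto
  finally show "odd (count_sat [2] 0 (foldr Ex [0, 1, 2, 3, 4] wrong_count) (set_struc h X)) \<longleftrightarrow> h < card X"
    using oddG evenP card_mono[OF fin] by simp
qed

text \<open>Each bit of the encoding is a constant or tells whether one particular number belongs to
  \<open>X\<close>, so it is a polynomial of degree at most 1.\<close>

lemma set_struc_bit_pdeg:
  assumes "i < (2 * h + 2)\<^sup>2"
  shows "pdeg (2 * h + 1) 1 (\<lambda>X. enc digraph_vocab (set_struc h X) ! i)"
proof -
  let ?m = "2 * h + 2"
  have "i < enc_len digraph_vocab ?m"
    using assms by (simp add: enc_len_def const_offset_def rel_offset_def digraph_vocab_def)
  from enc_position[OF this] obtain t where t: "t \<in> tuples ?m 2" "i = rel_offset digraph_vocab ?m 0 + lex_index ?m t"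
    by (auto simp: digraph_vocab_def)
  obtain a b where ab: "t = [a, b]" "a < ?m" "b < ?m"
    using t(1) by (auto simp: tuples_def length_Suc_conv numeral_2_eq_2)
  have "pdeg (2 * h + 1) 1 (\<lambda>X. [a, b] \<in> set_edges h X)"
  proof (cases "[a, b] \<in> set_edges h {}")
    case True
    then have "[a, b] \<in> set_edges h X" for X
      by (auto simp: set_edges_iff)
    then show ?thesis
      by (simp add: pdeg_True)
  next
    case False
    then have edge: "[a, b] \<in> set_edges h X \<longleftrightarrow> a = Suc b \<and> {b} \<subseteq> X" for X
      by (auto simp: set_edges_iff)
    show ?thesis
    proof (cases "a = Suc b")
      case True
      then show ?thesis
        unfolding edge using pdeg_monomial[of "{b}" "2 * h + 1" 1] ab(2) by simp
    next
      case False
      then show ?thesis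
        unfolding edge by (simp add: pdeg_False)
    qed
  qed
  then show ?thesis
  proof (rule pdeg_cong)
    fix X assume "X \<subseteq> {..<2 * h + 1}"
    then have "set_struc h X \<in> structures digraph_vocab"
      by (rule set_struc_in_structures)
    moreover have "?m = size_of (set_struc h X)"
      by (simp add: set_struc_def)
    ultimately have "\<And>j t. j < length (rel_arities digraph_vocab) \<Longrightarrow> t \<in> tuples ?m (rel_arities digraph_vocab ! j) \<Longrightarrow>
      enc digraph_vocab (set_struc h X) ! (rel_offset digraph_vocab ?m j + lex_index ?m t) = (t \<in> rels (set_struc h X) ! j)"
      using enc_rel_nth by blast
    from this[of 0 t] show "([a, b] \<in> set_edges h X) = enc digraph_vocab (set_struc h X) ! i"
      using t ab(1) by (simp add: digraph_vocab_def set_struc_def)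
  qed
qed

lemma counting_majority_not_AC0:
  assumes \<phi>: "\<phi> \<in> \<Phi>" "wf_fm digraph_vocab [2] \<phi>" "free_vars \<phi> = {}"
    and parity: "\<And>h X. X \<subseteq> {..<2 * h + 1} \<Longrightarrow> 2 \<le> h \<Longrightarrow> odd (count_sat [2] 0 \<phi> (set_struc h X)) \<longleftrightarrow> h < card X"
  shows "\<not> sharp_rel \<Phi> \<subseteq> FO_uniform_sharp_AC0"
proof -
  have "inj_on (enc digraph_vocab) (structures digraph_vocab)"
    by (rule inj_on_enc[of _ 2]) (simp_all add: digraph_vocab_def)
  then obtain f where f: "f \<in> sharp_rel \<Phi>"
    "\<forall>\<A>\<in>structures digraph_vocab. f (enc digraph_vocab \<A>) = count_sat [2] 0 \<phi> \<A>"
    using ex_sharp_rel[of digraph_vocab \<phi> \<Phi> "[2]" 0] \<phi> by (auto simp: digraph_vocab_def)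
  have "f \<notin> FO_uniform_sharp_AC0"
  proof (rule majority_parity_not_AC0[where W = "\<lambda>h X. enc digraph_vocab (set_struc h X)"])
    fix j h :: nat and X assume j: "2 \<le> j" "2 * h + 2 = 4 ^ j" and X: "X \<subseteq> {..<2 * h + 1}"
    have "(4::nat) ^ 2 \<le> 4 ^ j"
      using j(1) by (intro power_increasing) auto
    then have "2 \<le> h"
      using j(2) by simp
    moreover have A: "set_struc h X \<in> structures digraph_vocab" "2 * h + 2 = size_of (set_struc h X)"
      using set_struc_in_structures[OF X] by (auto simp: set_struc_def)
    moreover have "enc_len digraph_vocab (2 * h + 2) = (2 * h + 2)\<^sup>2"
      by (simp add: enc_len_def const_offset_def rel_offset_def digraph_vocab_def)
    ultimately show "length (enc digraph_vocab (set_struc h X)) = (2 * h + 2)\<^sup>2 \<and>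
        (odd (f (enc digraph_vocab (set_struc h X))) \<longleftrightarrow> h < card X)"
      using length_enc[OF A] f(2) parity[OF X] by simp
  qed (rule set_struc_bit_pdeg)
  then show ?thesis
    using f(1) by blast
qed

lemma wrong_count_fm:
  "quantifier_free wrong_count" "wf_fm digraph_vocab [2] wrong_count" "free_vars wrong_count = {0, 1, 2, 3, 4}"
  by (auto simp: wrong_count_def Let_def digraph_vocab_def)

lemma sharp_Sigma1_not_AC0: "\<not> sharp_rel (Sigma_fm 1) \<subseteq> FO_uniform_sharp_AC0"
proof (rule counting_majority_not_AC0)
  show "foldr Ex [0, 1, 2, 3, 4] wrong_count \<in> Sigma_fm 1"
    unfolding One_nat_def Sigma_fm.simps mem_Collect_eq
    using wrong_count_fm(1) by (intro exI[of _ "[0, 1, 2, 3, 4]"] exI[of _ wrong_count]) simp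
  show "free_vars (foldr Ex [0, 1, 2, 3, 4] wrong_count) = {}"
    using wrong_count_fm(3) by auto
qed (use wrong_count_fm(2) parity_count_sat(2) in \<open>simp_all del: foldr.simps\<close>)

lemma sharp_Pi1_not_AC0: "\<not> sharp_rel (Pi_fm 1) \<subseteq> FO_uniform_sharp_AC0"
proof (rule counting_majority_not_AC0)
  show "foldr All [0, 1, 2, 3, 4] (Neg wrong_count) \<in> Pi_fm 1"
    unfolding One_nat_def Pi_fm.simps mem_Collect_eq
    using wrong_count_fm(1) by (intro exI[of _ "[0, 1, 2, 3, 4]"] exI[of _ "Neg wrong_count"]) simp
  show "free_vars (foldr All [0, 1, 2, 3, 4] (Neg wrong_count)) = {}"
    using wrong_count_fm(3) by auto
qed (use wrong_count_fm(2) parity_count_sat(1) in \<open>simp_all del: foldr.simps\<close>)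

section \<open>Comparison of the classes\<close>

lemma sharp_rel_mono: "\<Phi> \<subseteq> \<Psi> \<Longrightarrow> sharp_rel \<Phi> \<subseteq> sharp_rel \<Psi>"
  unfolding sharp_rel_def by blast

lemma Sigma_Pi_mono: "Sigma_fm k \<subseteq> Sigma_fm (Suc k) \<and> Pi_fm k \<subseteq> Pi_fm (Suc k)"
proof (induction k)
  case 0
  show ?case
    by (auto intro!: exI[of _ "[]"])
next
  case (Suc k)
  have "Sigma_fm (Suc k) \<subseteq> Sigma_fm (Suc (Suc k))"
    unfolding Sigma_fm.simps(2)[of k] Sigma_fm.simps(2)[of "Suc k"] using Suc.IH by blast
  moreover have "Pi_fm (Suc k) \<subseteq> Pi_fm (Suc (Suc k))"
    unfolding Pi_fm.simps(2)[of k] Pi_fm.simps(2)[of "Suc k"] using Suc.IH by blast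
  ultimately show ?case ..
qed

lemma Pi_subset_Sigma_Suc: "Pi_fm k \<subseteq> Sigma_fm (Suc k)"
  by (auto intro!: exI[of _ "[]"])

theorem theorem8:
  shows "sharp_rel (Sigma_fm 0) \<subset> FO_uniform_sharp_AC0 \<and>
    (\<forall>\<C>\<in>{sharp_rel (Sigma_fm 1), sharp_rel (Pi_fm 1), sharp_rel (Sigma_fm 2)}.
      \<not> FO_uniform_sharp_AC0 \<subseteq> \<C> \<and> \<not> \<C> \<subseteq> FO_uniform_sharp_AC0)"
proof -
  have "Sigma_fm 0 \<subseteq> Sigma_fm 1" "Sigma_fm 1 \<subseteq> Sigma_fm 2" "Pi_fm 1 \<subseteq> Sigma_fm 2"
    using Sigma_Pi_mono[of 0] Sigma_Pi_mono[of 1] Pi_subset_Sigma_Suc[of 1]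
    unfolding One_nat_def numeral_2_eq_2 by blast+
  note mono = this[THEN sharp_rel_mono]
  show ?thesis
    using mono odd_length_in_AC0 odd_length_not_Sigma2 sharp_Sigma0_subset sharp_Sigma1_not_AC0 sharp_Pi1_not_AC0
    by blast
qed

end
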